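(* Let $d\in[1,+\infty]$, let $(D_t)_{t\ge0}=(\mathbb A_{r(t)})_{t\ge0}$ be a canonical domain system of order $d$, and let $\mathcal D:=\{(z,t):t\ge0,\ z\in D_t\}$. The following two assertions hold. (A) For any evolution family $(\varphi_{s,t})_{0\le s\le t<+\infty}$ of order $d$ over $(D_t)$ there exist an essentially unique semicomplete weak holomorphic vector field $G:\mathcal D\to\mathbb C$ of order $d$ and a null-set $N\subset[0,+\infty)$ such that for all $s\ge0$: (i) the mapping $[s,+\infty)\ni t\mapsto\varphi_{s,t}\in\mathrm{Hol}(D_s,\mathbb C)$ is locally absolutely continuous; (ii) the mapping $[s,+\infty)\ni t\mapsto\varphi_{s,t}\in\mathrm{Hol}(D_s,\mathbb C)$ is differentiable at all $t\in[s,+\infty)\setminus N$; (iii) $d\varphi_{s,t}/dt=G(\cdot,t)\circ\varphi_{s,t}$ for all $t\in[s,+\infty)\setminus N$. Here "essentially unique" means that for any two such vector fields $G_1,G_2$ corresponding to the same evolution family, $G_1(\cdot,t)=G_2(\cdot,t)$ for a.e. $t\ge0$. (B) For any semicomplete weak holomorphic vector field $G:\mathcal D\to\mathbb C$ of order $d$, the formula $\varphi_{s,t}(z):=w^*_s(z,t)$, $t\ge s\ge0$, $z\in D_s$, where $w^*_s(z,\cdot)$ is the unique non-extendable solution to the initial value problem $\dot w=G(w,t)$, $w(s)=z$, defines an evolution family of order $d$ over $(D_t)$.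
   Context: Notation: $\mathbb A_\rho:=\{z\in\mathbb C:\rho<|z|<1\}$ for $\rho\in[0,1)$. $AC^d(X,Y)$ is the class of locally absolutely continuous functions $f:X\to Y$, $X\subset\mathbb R$ an interval, with $f'\in L^d_{\rm loc}(X)$. $\omega(\rho):=-\pi/\log \rho$ for $\rho\in(0,1)$ and $\omega(0):=0$. Canonical domain system of order $d$: a family $(D_t)_{t\ge0}$ of annuli $D_t=\mathbb A_{r(t)}$, with $r:[0,+\infty)\to[0,1)$, such that $t\mapsto\omega(r(t))$ belongs to $AC^d([0,+\infty),[0,+\infty))$ and is non-increasing. Evolution family of order $d$ over $(D_t)$: a family $(\varphi_{s,t})_{0\le s\le t<+\infty}$ of holomorphic maps $\varphi_{s,t}:D_s\to D_t$ such that: (EF1) $\varphi_{s,s}=\mathsf{id}_{D_s}$; (EF2) $\varphi_{s,t}=\varphi_{u,t}\circ\varphi_{s,u}$ whenever $0\le s\le u\le t<+\infty$; (EF3) for any closed interval $I=[S,T]\subset[0,+\infty)$ and any $z\in D_S$ there is a non-negative $k_{z,I}\in L^d([S,T],\mathbb R)$ with $|\varphi_{s,u}(z)-\varphi_{s,t}(z)|\le\int_u^t k_{z,I}(\xi)\,d\xi$ whenever $S\le s\le u\le t\le T$. Weak holomorphic vector field of order $d$ in $\mathcal D$: a function $G:\mathcal D\to\mathbb C$ such that (WHVF1) for each $z\in\mathbb C$ the function $G(z,\cdot)$ is (Lebesgue) measurable in $E_z:=\{t:(z,t)\in\mathcal D\}$; (WHVF2) for each $t\ge0$ the function $G(\cdot,t)$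 is holomorphic in $D_t$; (WHVF3) for each compact $K\subset\mathcal D$ there is a non-negative $k_K\in L^d(\mathrm{pr}_{\mathbb R}(K),\mathbb R)$, where $\mathrm{pr}_{\mathbb R}(K):=\{t:\exists z\ (z,t)\in K\}$, with $|G(z,t)|\le k_K(t)$ for all $(z,t)\in K$. A solution of $\dot w=G(w,t)$, $w(s)=z$ (with $(z,s)\in\mathcal D$) is a locally absolutely continuous function $w$ on an interval $J\subset[0,+\infty)$, $s\in J$, with $(w(t),t)\in\mathcal D$ for $t\in J$, $w(s)=z$, satisfying the equation for a.e. $t\in J$. For a weak holomorphic vector field there is a unique non-extendable solution $w^*_s(z,\cdot)$, defined on an interval $J_*(z,s)$, of which any other solution is a restriction. $G$ is called semicomplete if $J_*(z,s)\supset[s,+\infty)$ for every $(z,s)\in\mathcal D$. For a domain $U$ and an interval $I$, a mapping $\varphi:I\to\mathrm{Hol}(U,\mathbb C)$ is absolutely continuous on $I$ if for any $\varepsilon>0$ and compact $K\subset U$ there is $\delta>0$ such that for any finite set of pairwise disjoint intervals $(a_j,b_j)$, $a_j,b_j\in I$, $\sum_j(b_j-a_j)<\delta$ implies $\sum_j\|\varphi(b_j)-\varphi(a_j)\|_K<\varepsilon$, where $\|f\|_K:=\sup_K|f|$; it is locally absolutely continuous if it is absolutely continuous on each compact interval $J\subset I$. It is differentiable at $t_0\in I$ with derivative $g\in\mathrm{Hol}(U,\mathbb C)$ if $\|g-(\varphi(t)-\varphi(t_0))/(t-t_0)\|_K\to0$ as $t\to t_0$, $t\in I\setminus\{t_0\}$,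 for every compact $K\subset U$. *)

theory Defs
  imports "HOL-Analysis.Analysis"
begin

definition annulus :: "real \<Rightarrow> complex set" where
  "annulus \<rho> = {z. \<rho> < norm z \<and> norm z < 1}"

definition \<omega> :: "real \<Rightarrow> real" where
  "\<omega> \<rho> = (if \<rho> = 0 then 0 else - pi / ln \<rho>)"

definition Ld :: "ennreal \<Rightarrow> real set \<Rightarrow> (real \<Rightarrow> 'a::euclidean_space) \<Rightarrow> bool" where
  "Ld d X k \<longleftrightarrow> k \<in> borel_measurable (lebesgue_on X) \<and>
     (if d = \<infinity> then \<exists>C. AE x in lebesgue_on X. norm (k x) \<le> C
      else integrable (lebesgue_on X) (\<lambda>x. norm (k x) powr enn2real d))"

definition Ld_loc :: "ennreal \<Rightarrow> real set \<Rightarrow> (real \<Rightarrow> 'a::euclidean_space) \<Rightarrow> bool" where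
  "Ld_loc d X k \<longleftrightarrow> (\<forall>a b. {a..b} \<subseteq> X \<longrightarrow> Ld d {a..b} k)"

text \<open>A finite family of pairwise disjoint intervals with end points in a set is
  represented by the finite set of the pairs of their end points.\<close>

definition disjoint_intervals :: "real set \<Rightarrow> (real \<times> real) set \<Rightarrow> bool" where
  "disjoint_intervals I P \<longleftrightarrow> finite P \<and>
     (\<forall>(a, b)\<in>P. a \<in> I \<and> b \<in> I \<and> a < b) \<and>
     disjoint_family_on (\<lambda>(a, b). {a<..<b}) P"

definition abs_cont_on :: "real set \<Rightarrow> (real \<Rightarrow> 'a::real_normed_vector) \<Rightarrow> bool" where
  "abs_cont_on I f \<longleftrightarrow>
     (\<forall>\<epsilon>>0. \<exists>\<delta>>0. \<forall>P. disjoint_intervals I P \<and> (\<Sum>(a, b)\<in>P. b - a) < \<delta> \<longrightarrow>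
        (\<Sum>(a, b)\<in>P. norm (f b - f a)) < \<epsilon>)"

definition loc_abs_cont_on :: "real set \<Rightarrow> (real \<Rightarrow> 'a::real_normed_vector) \<Rightarrow> bool" where
  "loc_abs_cont_on I f \<longleftrightarrow> (\<forall>a b. {a..b} \<subseteq> I \<longrightarrow> abs_cont_on {a..b} f)"

text \<open>The derivative of a locally absolutely continuous function is only defined almost
  everywhere; \<open>g\<close> is any representative of it.\<close>

definition ACd :: "ennreal \<Rightarrow> real set \<Rightarrow> (real \<Rightarrow> 'a::euclidean_space) \<Rightarrow> bool" where
  "ACd d X f \<longleftrightarrow> loc_abs_cont_on X f \<and>
     (\<exists>g. (AE t in lebesgue. t \<in> X \<longrightarrow> (f has_vector_derivative g t) (at t within X)) \<and>
          Ld_loc d X g)"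

definition canonical_domain_system :: "ennreal \<Rightarrow> (real \<Rightarrow> complex set) \<Rightarrow> bool" where
  "canonical_domain_system d D \<longleftrightarrow>
     (\<exists>r::real \<Rightarrow> real. (\<forall>t\<ge>0. 0 \<le> r t \<and> r t < 1 \<and> D t = annulus (r t)) \<and>
        ACd d {0..} (\<lambda>t. \<omega> (r t)) \<and> antimono_on {0..} (\<lambda>t. \<omega> (r t)))"

definition total_domain :: "(real \<Rightarrow> complex set) \<Rightarrow> (complex \<times> real) set" where
  "total_domain D = {(z, t). 0 \<le> t \<and> z \<in> D t}"

text \<open>Here \<open>\<phi> s t z\<close> stands for $\varphi_{s,t}(z)$; only its values for $0 \le s \le t$ and
  $z \in D_s$ are relevant.\<close>

definition evolution_family ::
    "ennreal \<Rightarrow> (real \<Rightarrow> complex set) \<Rightarrow> (real \<Rightarrow> real \<Rightarrow> complex \<Rightarrow> complex) \<Rightarrow> bool" where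
  "evolution_family d D \<phi> \<longleftrightarrow>
     (\<forall>s t. 0 \<le> s \<and> s \<le> t \<longrightarrow> \<phi> s t holomorphic_on D s \<and> \<phi> s t ` D s \<subseteq> D t) \<and>
     (\<forall>s\<ge>0. \<forall>z\<in>D s. \<phi> s s z = z) \<and>
     (\<forall>s u t. 0 \<le> s \<and> s \<le> u \<and> u \<le> t \<longrightarrow> (\<forall>z\<in>D s. \<phi> s t z = \<phi> u t (\<phi> s u z))) \<and>
     (\<forall>S T z. 0 \<le> S \<and> S \<le> T \<and> z \<in> D S \<longrightarrow>
        (\<exists>k::real \<Rightarrow> real. (\<forall>\<xi>\<in>{S..T}. 0 \<le> k \<xi>) \<and> Ld d {S..T} k \<and>
           (\<forall>s u t. S \<le> s \<and> s \<le> u \<and> u \<le> t \<and> t \<le> T \<longrightarrow>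
              norm (\<phi> s u z - \<phi> s t z) \<le> (LINT \<xi>:{u..t}|lebesgue. k \<xi>))))"

definition weak_hol_vector_field ::
    "ennreal \<Rightarrow> (real \<Rightarrow> complex set) \<Rightarrow> (complex \<Rightarrow> real \<Rightarrow> complex) \<Rightarrow> bool" where
  "weak_hol_vector_field d D G \<longleftrightarrow>
     (\<forall>z. G z \<in> borel_measurable (lebesgue_on {t. (z, t) \<in> total_domain D})) \<and>
     (\<forall>t\<ge>0. (\<lambda>z. G z t) holomorphic_on D t) \<and>
     (\<forall>K. compact K \<and> K \<subseteq> total_domain D \<longrightarrow>
        (\<exists>k::real \<Rightarrow> real. (\<forall>t\<in>snd ` K. 0 \<le> k t) \<and> Ld d (snd ` K) k \<and>
           (\<forall>(z, t)\<in>K. norm (G z t) \<le> k t)))"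

definition is_solution ::
    "(real \<Rightarrow> complex set) \<Rightarrow> (complex \<Rightarrow> real \<Rightarrow> complex) \<Rightarrow> real \<Rightarrow> complex \<Rightarrow>
     real set \<Rightarrow> (real \<Rightarrow> complex) \<Rightarrow> bool" where
  "is_solution D G s z J w \<longleftrightarrow>
     is_interval J \<and> J \<subseteq> {0..} \<and> s \<in> J \<and> loc_abs_cont_on J w \<and>
     (\<forall>t\<in>J. (w t, t) \<in> total_domain D) \<and> w s = z \<and>
     (AE t in lebesgue. t \<in> J \<longrightarrow> (w has_vector_derivative G (w t) t) (at t within J))"

definition nonextendable_solution ::
    "(real \<Rightarrow> complex set) \<Rightarrow> (complex \<Rightarrow> real \<Rightarrow> complex) \<Rightarrow> real \<Rightarrow> complex \<Rightarrow>
     real set \<Rightarrow> (real \<Rightarrow> complex) \<Rightarrow> bool" where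
  "nonextendable_solution D G s z J w \<longleftrightarrow> is_solution D G s z J w \<and>
     (\<forall>J' v. is_solution D G s z J' v \<and> J \<subseteq> J' \<and> (\<forall>t\<in>J. v t = w t) \<longrightarrow> J' = J)"

text \<open>For a weak holomorphic vector field, the non-extendable solution of an initial value
  problem exists and is unique up to its (irrelevant) values outside of its interval of
  definition; so both descriptions below are proper, the second one for \<open>t\<close> in
  \<open>max_interval D G s z\<close>.\<close>

definition max_interval ::
    "(real \<Rightarrow> complex set) \<Rightarrow> (complex \<Rightarrow> real \<Rightarrow> complex) \<Rightarrow> real \<Rightarrow> complex \<Rightarrow> real set" where
  "max_interval D G s z = (THE J. \<exists>w. nonextendable_solution D G s z J w)"

definition max_solution ::
    "(real \<Rightarrow> complex set) \<Rightarrow> (complex \<Rightarrow> real \<Rightarrow> complex) \<Rightarrow> real \<Rightarrow> complex \<Rightarrow> real \<Rightarrow> complex"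
    where
  "max_solution D G s z t = (THE y. \<exists>J w. nonextendable_solution D G s z J w \<and> t \<in> J \<and> w t = y)"

definition semicomplete ::
    "(real \<Rightarrow> complex set) \<Rightarrow> (complex \<Rightarrow> real \<Rightarrow> complex) \<Rightarrow> bool" where
  "semicomplete D G \<longleftrightarrow> (\<forall>(z, s)\<in>total_domain D. {s..} \<subseteq> max_interval D G s z)"

text \<open>The case distinction makes the supremum over the empty set equal to zero.\<close>

definition sup_norm :: "complex set \<Rightarrow> (complex \<Rightarrow> complex) \<Rightarrow> real" where
  "sup_norm K f = (if K = {} then 0 else SUP z\<in>K. norm (f z))"

definition hol_abs_cont_on ::
    "complex set \<Rightarrow> real set \<Rightarrow> (real \<Rightarrow> complex \<Rightarrow> complex) \<Rightarrow> bool" where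
  "hol_abs_cont_on U I \<phi> \<longleftrightarrow>
     (\<forall>\<epsilon>>0. \<forall>K. compact K \<and> K \<subseteq> U \<longrightarrow>
        (\<exists>\<delta>>0. \<forall>P. disjoint_intervals I P \<and> (\<Sum>(a, b)\<in>P. b - a) < \<delta> \<longrightarrow>
           (\<Sum>(a, b)\<in>P. sup_norm K (\<lambda>z. \<phi> b z - \<phi> a z)) < \<epsilon>))"

definition hol_loc_abs_cont_on ::
    "complex set \<Rightarrow> real set \<Rightarrow> (real \<Rightarrow> complex \<Rightarrow> complex) \<Rightarrow> bool" where
  "hol_loc_abs_cont_on U I \<phi> \<longleftrightarrow> (\<forall>a b. {a..b} \<subseteq> I \<longrightarrow> hol_abs_cont_on U {a..b} \<phi>)"

definition has_hol_derivative ::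
    "complex set \<Rightarrow> real set \<Rightarrow> (real \<Rightarrow> complex \<Rightarrow> complex) \<Rightarrow> (complex \<Rightarrow> complex) \<Rightarrow>
     real \<Rightarrow> bool" where
  "has_hol_derivative U I \<phi> g t0 \<longleftrightarrow> g holomorphic_on U \<and>
     (\<forall>K. compact K \<and> K \<subseteq> U \<longrightarrow>
        ((\<lambda>t. sup_norm K (\<lambda>z. g z - (\<phi> t z - \<phi> t0 z) / of_real (t - t0))) \<longlongrightarrow> 0)
          (at t0 within I))"

definition hol_differentiable ::
    "complex set \<Rightarrow> real set \<Rightarrow> (real \<Rightarrow> complex \<Rightarrow> complex) \<Rightarrow> real \<Rightarrow> bool" where
  "hol_differentiable U I \<phi> t0 \<longleftrightarrow> (\<exists>g. has_hol_derivative U I \<phi> g t0)"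

definition corresponding_vector_field ::
    "ennreal \<Rightarrow> (real \<Rightarrow> complex set) \<Rightarrow> (real \<Rightarrow> real \<Rightarrow> complex \<Rightarrow> complex) \<Rightarrow>
     (complex \<Rightarrow> real \<Rightarrow> complex) \<Rightarrow> real set \<Rightarrow> bool" where
  "corresponding_vector_field d D \<phi> G N \<longleftrightarrow>
     weak_hol_vector_field d D G \<and> semicomplete D G \<and> N \<subseteq> {0..} \<and> N \<in> null_sets lebesgue \<and>
     (\<forall>s\<ge>0. hol_loc_abs_cont_on (D s) {s..} (\<phi> s) \<and>
        (\<forall>t\<in>{s..} - N. hol_differentiable (D s) {s..} (\<phi> s) t) \<and>
        (\<forall>t\<in>{s..} - N. has_hol_derivative (D s) {s..} (\<phi> s) (\<lambda>z. G (\<phi> s t z) t) t))"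

end

theory Submission
  imports Defs "HOL-Complex_Analysis.Complex_Analysis"
begin

text \<open>
  Two trajectories \<open>v\<close>, \<open>w\<close> of a weak holomorphic vector field \<open>G\<close> satisfy the scalar linear equation
  \<open>(v - w)' = A (v - w)\<close> with \<open>A = (G v - G w) / (v - w)\<close>, which Cauchy's inequality bounds by an
  integrable function. So \<open>v - w\<close> is \<open>v a - w a\<close> times the exponential of \<open>\<integral> A\<close>; uniqueness, continuous
  dependence and holomorphy of the flow in the initial value can all be read off this formula.

  For the converse, write \<open>\<phi> u t z = z exp (q z)\<close> on the annulus \<open>D u\<close>. As \<open>\<phi> u t\<close> maps \<open>D u\<close> into \<open>D t\<close>,
  the real part of \<open>q\<close> is at most zero on the outer boundary circle and bounded below on the inner one,
  so positivity controls all Laurent coefficients of \<open>q\<close> by its mean, the value of \<open>q\<close> at one point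
  and \<open>\<omega> (r u) - \<omega> (r t)\<close>. Hence the increments of \<open>\<phi>\<close> are bounded, uniformly on
  compact sets, by the integral of one function of class \<open>L\<^sup>d\<close>. At almost every time this makes the
  difference quotients locally bounded, and pointwise differentiability on a countable dense set
  upgrades to locally uniform convergence.
\<close>

section \<open>Absolutely continuous functions on the line\<close>

text \<open>In (A), (EF3) supplies a density for each point separately, whereas (WHVF3) asks for one
  density per compact set. Positivity closes this gap, but a bound on \<open>Re q\<close> says
  nothing about the mean of \<open>Im q\<close>, which is a rotation; this is why the value of
  \<open>q\<close> at one point has to enter. Moreover \<open>r t\<close> may reach zero, where
  \<open>ln (r t)\<close> blows up while \<open>\<omega> (r t)\<close> does not. The Laurent
  coefficients of negative index carry an additional factor \<open>\<rho>\<close>, and it is this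
  factor that lets \<open>\<omega>\<close> absorb the logarithm. A single null set of times has to
  serve uncountably many initial times. It is built from rational ones only; every other initial
  time is reduced to these by the composition law, except \<open>s = t\<close>, where a preimage
  under an earlier map is needed. In (B) the density in (EF3) must serve all initial times
  \<open>s\<close> in \<open>{S..T}\<close> at once, so the trajectories started at one point at all
  these times have to be kept in one compact subset of the total domain.\<close>

lemma sum_integral_disjoint_intervals_le:
  fixes k :: "real \<Rightarrow> real"
  assumes P: "disjoint_intervals I P" and k: "integrable lebesgue k" and nn: "\<And>x. 0 \<le> k x"
  shows "(\<Sum>(a, b)\<in>P. integral {a..b} k) \<le> (LINT x|lebesgue. k x)"
proof -
  have fin: "finite P" and dis: "disjoint_family_on (\<lambda>(a, b). {a<..<b}) P"
    using P unfolding disjoint_intervals_def by auto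
  have int: "set_integrable lebesgue {a<..<b} k" for a b
    using k unfolding set_integrable_def by (intro integrable_mult_indicator) auto
  have eq: "integral {a..b} k = (LINT x|lebesgue. indicator {a<..<b} x * k x)" for a b
  proof -
    have "integral {a..b} k = integral {a<..<b} k"
      by (simp add: integral_open_interval_real)
    also have "\<dots> = (LINT x:{a<..<b}|lebesgue. k x)"
      by (simp add: set_lebesgue_integral_eq_integral(2)[OF int])
    finally show ?thesis by (simp add: set_lebesgue_integral_def)
  qed
  have "(\<Sum>(a, b)\<in>P. integral {a..b} k) = (\<Sum>p\<in>P. LINT x|lebesgue. indicator {fst p<..<snd p} x * k x)"
    by (intro sum.cong) (auto simp: eq)
  also have "\<dots> = (LINT x|lebesgue. (\<Sum>p\<in>P. indicator {fst p<..<snd p} x * k x))"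
    using int by (subst Bochner_Integration.integral_sum) (auto simp: set_integrable_def)
  also have "\<dots> \<le> (LINT x|lebesgue. k x)"
  proof (rule integral_mono)
    show "integrable lebesgue (\<lambda>x. \<Sum>p\<in>P. indicator {fst p<..<snd p} x * k x)"
      using int by (intro Bochner_Integration.integrable_sum) (auto simp: set_integrable_def)
    fix x
    have "(\<Sum>p\<in>P. indicator {fst p<..<snd p} x * k x) = (\<Sum>p\<in>P. indicator {fst p<..<snd p} x) * k x"
      by (simp add: sum_distrib_right)
    \<comment> \<open>Disjointness: at each point at most one of the open intervals contributes, so
      the indicators add up to an indicator.\<close>
    also have "(\<Sum>p\<in>P. indicator {fst p<..<snd p} x) = (indicator (\<Union>p\<in>P. {fst p<..<snd p}) x :: real)"
      using dis fin by (subst indicator_UN_disjoint) (auto simp: case_prod_beta')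
    also have "\<dots> * k x \<le> k x"
      using nn by (auto simp: indicator_def)
    finally show "(\<Sum>p\<in>P. indicator {fst p<..<snd p} x * k x) \<le> k x" .
  qed (use k in auto)
  finally show ?thesis .
qed

text \<open>Meant for an open set \<open>U\<close> of small measure around an exceptional null set:
  cells that are tagged in the null set and lie in \<open>U\<close> have small total length.\<close>

lemma sum_length_disjoint_intervals_le:
  assumes P: "disjoint_intervals I P" and U: "U \<in> lmeasurable"
    and sub: "\<And>a b. (a, b) \<in> P \<Longrightarrow> {a<..<b} \<subseteq> U"
  shows "(\<Sum>(a, b)\<in>P. b - a) \<le> measure lebesgue U"
proof -
  have lt: "a < b" if "(a, b) \<in> P" for a b
    using P that unfolding disjoint_intervals_def by auto
  have "integral {a..b} (indicator U) = b - a" if "(a, b) \<in> P" for a b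
  proof -
    have "integral {a..b} (indicator U :: real \<Rightarrow> real) = integral {a<..<b} (indicator U)"
      by (simp add: integral_open_interval_real)
    also have "\<dots> = integral {a<..<b} (\<lambda>x. 1 :: real)"
      using sub[OF that] by (intro integral_cong) (auto simp: indicator_def)
    also have "\<dots> = integral {a..b} (\<lambda>x. 1 :: real)"
      by (rule integral_open_interval_real[symmetric])
    finally show ?thesis using lt[OF that] by simp
  qed
  then have "(\<Sum>(a, b)\<in>P. b - a) = (\<Sum>(a, b)\<in>P. integral {a..b} (indicator U))"
    by (intro sum.cong) auto
  also have "\<dots> \<le> (LINT x|lebesgue. indicator U x)"
    using U by (intro sum_integral_disjoint_intervals_le[OF P])
      (auto simp: fmeasurable_def integrable_indicator_iff)
  finally show ?thesis by simp
qed

lemma disjoint_intervals_mono: "disjoint_intervals I P \<Longrightarrow> I \<subseteq> J \<Longrightarrow> disjoint_intervals J P"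
  unfolding disjoint_intervals_def by blast

lemma abs_cont_on_subset: "abs_cont_on I f \<Longrightarrow> J \<subseteq> I \<Longrightarrow> abs_cont_on J f"
  unfolding abs_cont_on_def using disjoint_intervals_mono by meson

lemma loc_abs_cont_on_subset: "loc_abs_cont_on I f \<Longrightarrow> J \<subseteq> I \<Longrightarrow> loc_abs_cont_on J f"
  unfolding loc_abs_cont_on_def by (meson order_trans)

text \<open>Gauge proof: tags in the exceptional set carry little total length, which absolute
  continuity turns into little total variation.\<close>

lemma abs_cont_fundamental:
  fixes f :: "real \<Rightarrow> 'a::banach"
  assumes ab: "a \<le> b" and ac: "abs_cont_on {a..b} f" and N: "negligible N"
    and der: "\<And>t. t \<in> {a..b} - N \<Longrightarrow> (f has_vector_derivative g t) (at t within {a..b})"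
  shows "(g has_integral (f b - f a)) {a..b}"
proof -
  \<comment> \<open>With the integrand set to zero on \<open>N\<close>, a cell tagged in
    \<open>N\<close> contributes only the increment of \<open>f\<close> over it.\<close>
  define g0 where "g0 t = (if t \<in> N then 0 else g t)" for t
  have "(g0 has_integral (f b - f a)) {a..b}"
    unfolding has_integral_real
  proof (intro allI impI)
    fix e :: real assume e: "e > 0"
    define e' where "e' = e / (2 * (b - a) + 1) / 2"
    have e': "e' > 0" "e' * (b - a) < e / 2"
      using e ab by (auto simp: e'_def divide_simps)
    obtain \<delta> where \<delta>: "\<delta> > 0" and AC: "\<And>P. disjoint_intervals {a..b} P \<Longrightarrow>
        (\<Sum>(a, b)\<in>P. b - a) < \<delta> \<Longrightarrow> (\<Sum>(a, b)\<in>P. norm (f b - f a)) < e / 2"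
      using ac e unfolding abs_cont_on_def by (meson half_gt_zero)
    have N0: "N \<in> null_sets lebesgue" using N by (simp add: negligible_iff_null_sets)
    obtain U where U: "open U" "N \<subseteq> U" "U - N \<in> lmeasurable" "emeasure lebesgue (U - N) < ennreal \<delta>"
      using sets_lebesgue_outer_open[of N \<delta>] N0 \<delta> by blast
    have eU: "emeasure lebesgue U = emeasure lebesgue (U - N)"
      using N0 U(1) by (metis borel_open emeasure_Diff_null_set sets_completionI_sets sets_lborel)
    have U3: "U \<in> lmeasurable"
      using U(1,3) eU by (auto simp: fmeasurable_def borel_open)
    have mU: "measure lebesgue U < \<delta>"
      using U(4) \<delta> emeasure_eq_measure2[OF U3] unfolding eU[symmetric]
      by (simp add: ennreal_less_iff)
    have "\<exists>d>0. \<forall>y\<in>{a..b}. norm (y - t) < d \<longrightarrow> norm (f y - f t - (y - t) *\<^sub>R g t) \<le> e' * norm (y - t)"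
      if "t \<in> {a..b} - N" for t
      using der[OF that] e'(1) unfolding has_vector_derivative_def has_derivative_within_alt by blast
    then obtain d where d: "\<And>t. t \<in> {a..b} - N \<Longrightarrow> d t > 0"
      and dd: "\<And>t y. t \<in> {a..b} - N \<Longrightarrow> y \<in> {a..b} \<Longrightarrow> norm (y - t) < d t \<Longrightarrow>
         norm (f y - f t - (y - t) *\<^sub>R g t) \<le> e' * norm (y - t)"
      by metis
    \<comment> \<open>A tag in \<open>N\<close> gets all of \<open>U\<close> as its neighbourhood,
      so its cell lies in \<open>U\<close>; any other tag in \<open>{a..b}\<close> gets a ball on
      which \<open>f\<close> is linear up to the slope error \<open>e'\<close>.\<close>
    define \<gamma> where "\<gamma> t = (if t \<in> N then U else if t \<in> {a..b} then ball t (d t) else ball t 1)" for t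
    have "gauge \<gamma>"
      unfolding gauge_def using U(1,2) d by (auto simp: \<gamma>_def)
    moreover have "norm ((\<Sum>(x, K)\<in>p. Sigma_Algebra.measure lborel K *\<^sub>R g0 x) - (f b - f a)) < e"
      if p: "p tagged_division_of {a..b}" and fine: "\<gamma> fine p" for p
    proof -
      have finp: "finite p" using p by auto
      have K: "\<exists>u v. K = {u..v} \<and> u \<le> x \<and> x \<le> v \<and> a \<le> u \<and> v \<le> b" if xK: "(x, K) \<in> p" for x K
      proof -
        obtain u v where uv: "K = cbox u v" using tagged_division_ofD(4)[OF p xK] by blast
        with tagged_division_ofD(2,3)[OF p xK] show ?thesis by fastforce
      qed
      define p1 where "p1 = {(x, K)\<in>p. x \<in> N}"
      define p2 where "p2 = {(x, K)\<in>p. x \<notin> N}"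
      have pp: "p = p1 \<union> p2" "p1 \<inter> p2 = {}" "finite p1" "finite p2"
        using finp by (auto simp: p1_def p2_def intro: finite_subset[OF _ finp])
      define E where "E = (\<lambda>(x, K). Sigma_Algebra.measure lborel K *\<^sub>R g0 x - (f (Sup K) - f (Inf K)))"
      have "(\<Sum>(x, K)\<in>p. Sigma_Algebra.measure lborel K *\<^sub>R g0 x) - (f b - f a) = sum E p"
        unfolding additive_tagged_division_1[OF ab p, of f, symmetric] E_def
        by (simp add: sum_subtractf case_prod_beta')
      also have "\<dots> = sum E p1 + sum E p2"
        using pp sum.union_disjoint by metis
      also have "norm \<dots> \<le> norm (sum E p1) + norm (sum E p2)" by (rule norm_triangle_ineq)
      also have "norm (sum E p2) \<le> e' * (b - a)"
      proof -
        have "norm (sum E p2) \<le> (\<Sum>(x, K)\<in>p2. e' * Sigma_Algebra.measure lborel K)"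
        proof (rule sum_norm_le, clarify)
          fix x K assume xK: "(x, K) \<in> p2"
          then have xK': "(x, K) \<in> p" "x \<notin> N" by (auto simp: p2_def)
          obtain u v where uv: "K = {u..v}" "u \<le> x" "x \<le> v" "a \<le> u" "v \<le> b"
            using K[OF xK'(1)] by blast
          then have x: "x \<in> {a..b} - N" using xK' by auto
          have sub: "K \<subseteq> ball x (d x)"
            using fineD[OF fine xK'(1)] x by (auto simp: \<gamma>_def)
          have "u \<in> K" "v \<in> K" using uv by auto
          then have "norm (u - x) < d x" "norm (v - x) < d x"
            using sub by (auto simp: dist_norm norm_minus_commute subset_iff)
          then have 1: "norm (f u - f x - (u - x) *\<^sub>R g x) \<le> e' * (x - u)"
              "norm (f v - f x - (v - x) *\<^sub>R g x) \<le> e' * (v - x)"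
            using dd[OF x, of u] dd[OF x, of v] uv by auto
          have "E (x, K) = (f u - f x - (u - x) *\<^sub>R g x) - (f v - f x - (v - x) *\<^sub>R g x)"
            using uv xK' by (simp add: E_def g0_def algebra_simps)
          also have "norm \<dots> \<le> e' * (x - u) + e' * (v - x)"
            using 1 norm_triangle_ineq4 by (smt (verit, best))
          also have "\<dots> = e' * Sigma_Algebra.measure lborel K" using uv by (simp add: algebra_simps)
          finally show "norm (E (x, K)) \<le> e' * Sigma_Algebra.measure lborel K" .
        qed
        also have "\<dots> \<le> (\<Sum>(x, K)\<in>p. e' * Sigma_Algebra.measure lborel K)"
          using finp e' by (intro sum_mono2) (auto simp: p2_def)
        also have "\<dots> = e' * (b - a)"
          using additive_content_tagged_division[of p a b] p ab
          by (simp add: sum_distrib_left[symmetric] case_prod_beta')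
        finally show ?thesis .
      qed
      also have "norm (sum E p1) < e / 2"
      proof -
        \<comment> \<open>Degenerate cells are dropped, since \<open>disjoint_intervals\<close>
          demands \<open>a < b\<close>; their terms are zero.\<close>
        define p3 where "p3 = {(x, K)\<in>p1. Inf K < Sup K}"
        define h where "h = (\<lambda>(x::real, K::real set). (Inf K, Sup K))"
        have fin3: "finite p3" using pp(3) by (rule finite_subset[rotated]) (auto simp: p3_def)
        have K3: "\<exists>u v. K = {u..v} \<and> u < v \<and> u \<le> x \<and> x \<le> v \<and> a \<le> u \<and> v \<le> b \<and> x \<in> N \<and> (x, K) \<in> p \<and> h (x, K) = (u, v)"
          if xK: "(x, K) \<in> p3" for x K
          using xK K[of x K] unfolding p3_def p1_def h_def by fastforce
        have dis: "{fst (h y)<..<snd (h y)} \<inter> {fst (h y')<..<snd (h y')} = {}"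
          if yy: "y \<in> p3" "y' \<in> p3" "y \<noteq> y'" for y y'
        proof -
          obtain x K x' K' where y: "y = (x, K)" "y' = (x', K')" by fastforce
          obtain u v where "K = {u..v}" "(x, K) \<in> p" "h (x, K) = (u, v)"
            using K3[of x K] yy(1) unfolding y by blast
          moreover obtain u' v' where "K' = {u'..v'}" "(x', K') \<in> p" "h (x', K') = (u', v')"
            using K3[of x' K'] yy(2) unfolding y by blast
          ultimately show ?thesis
            using tagged_division_ofD(5)[OF p, of x K x' K'] yy(3) unfolding y by simp
        qed
        \<comment> \<open>Two different cells with the same end points would have disjoint but equal
          interiors, hence empty ones.\<close>
        have inj: "inj_on h p3"
        proof (rule inj_onI, rule ccontr)
          fix y y' assume H: "y \<in> p3" "y' \<in> p3" "h y = h y'" "y \<noteq> y'"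
          then have "{fst (h y)<..<snd (h y)} = {}" using dis[of y y'] by auto
          then show False using K3 H(1) by (cases y) fastforce
        qed
        have P: "disjoint_intervals {a..b} (h ` p3)"
          unfolding disjoint_intervals_def disjoint_family_on_def
        proof (intro conjI ballI impI)
          show "finite (h ` p3)" using fin3 by simp
        next
          fix q assume "q \<in> h ` p3"
          then show "case q of (u, v) \<Rightarrow> u \<in> {a..b} \<and> v \<in> {a..b} \<and> u < v"
            using K3 by fastforce
        next
          fix q q' assume "q \<in> h ` p3" "q' \<in> h ` p3" "q \<noteq> q'"
          then show "(case q of (a, b) \<Rightarrow> {a<..<b}) \<inter> (case q' of (a, b) \<Rightarrow> {a<..<b}) = {}"
            using dis by (auto simp: case_prod_beta')
        qed
        have "{u<..<v} \<subseteq> U" if uv: "(u, v) \<in> h ` p3" for u v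
        proof -
          obtain x K where xK: "(x, K) \<in> p3" "(u, v) = h (x, K)"
            using uv by (metis imageE surj_pair)
          then have "K = {u..v}" "x \<in> N" "(x, K) \<in> p" using K3[OF xK(1)] by auto
          then show ?thesis using fineD[OF fine, of x K] by (auto simp: \<gamma>_def subset_iff)
        qed
        then have "(\<Sum>(u, v)\<in>h ` p3. v - u) \<le> measure lebesgue U"
          by (intro sum_length_disjoint_intervals_le[OF P U3])
        then have *: "(\<Sum>(u, v)\<in>h ` p3. norm (f v - f u)) < e / 2"
          using AC[OF P] mU by simp
        have "sum E p1 = sum E p3"
        proof (rule sum.mono_neutral_right)
          show "\<forall>i\<in>p1 - p3. E i = 0"
          proof
            fix i assume i: "i \<in> p1 - p3"
            obtain x K where xK: "i = (x, K)" by fastforce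
            then have "(x, K) \<in> p" "x \<in> N" "\<not> Inf K < Sup K" using i by (auto simp: p1_def p3_def)
            moreover obtain u v where uv: "K = {u..v}" "u \<le> x" "x \<le> v" using K \<open>(x, K) \<in> p\<close> by blast
            moreover have "u = v" using uv \<open>\<not> Inf K < Sup K\<close> by simp
            ultimately show "E i = 0" unfolding xK E_def g0_def by simp
          qed
        qed (use pp in \<open>auto simp: p3_def\<close>)
        also have "norm \<dots> \<le> (\<Sum>y\<in>p3. norm (f (snd (h y)) - f (fst (h y))))"
        proof (rule sum_norm_le, clarify)
          fix x K assume "(x, K) \<in> p3"
          then have "x \<in> N" by (auto simp: p3_def p1_def)
          then show "norm (E (x, K)) \<le> norm (f (snd (h (x, K))) - f (fst (h (x, K))))"
            by (simp add: E_def g0_def h_def norm_minus_commute)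
        qed
        also have "\<dots> = (\<Sum>(u, v)\<in>h ` p3. norm (f v - f u))"
          by (simp add: sum.reindex[OF inj] case_prod_beta')
        finally show ?thesis using * by linarith
      qed
      finally show ?thesis using e' by linarith
    qed
    ultimately show "\<exists>\<gamma>. gauge \<gamma> \<and> (\<forall>\<D>. \<D> tagged_division_of {a..b} \<and> \<gamma> fine \<D> \<longrightarrow>
        norm ((\<Sum>(x, K)\<in>\<D>. Sigma_Algebra.measure lborel K *\<^sub>R g0 x) - (f b - f a)) < e)"
      by (intro exI[of _ \<gamma>]) simp
  qed
  then show ?thesis
    by (rule has_integral_spike[OF N, rotated]) (auto simp: g0_def)
qed

section \<open>Differentiation of indefinite integrals almost everywhere\<close>

lemma negligible_uminus_image:
  fixes N :: "real set"
  assumes "negligible N"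
  shows "negligible (uminus ` N)"
    by (rule negligible_differentiable_image_negligible[OF _ assms])
    (auto simp: differentiable_on_def intro!: derivative_intros)

text \<open>Merges the limits of the forward and the backward difference quotients; for indefinite
  integrals these two come from different applications of the differentiation theorem.\<close>

lemma has_vector_derivative_split_real:
  assumes "a < x" "x < b"
    and r: "\<And>e. e > 0 \<Longrightarrow> \<exists>d>0. \<forall>h. 0 < h \<and> h < d \<longrightarrow> norm ((F (x + h) - F x) /\<^sub>R h - l) < e"
    and l: "\<And>e. e > 0 \<Longrightarrow> \<exists>d>0. \<forall>h. 0 < h \<and> h < d \<longrightarrow> norm ((F x - F (x - h)) /\<^sub>R h - l) < e"
  shows "(F has_vector_derivative l) (at x)"
  unfolding has_vector_derivative_def has_derivative_at_alt
proof (intro conjI allI impI)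
  show "bounded_linear (\<lambda>h. h *\<^sub>R l)" by (rule bounded_linear_scaleR_left)
  fix e :: real assume e: "0 < e"
  obtain d1 where d1: "d1 > 0" "\<And>h. 0 < h \<Longrightarrow> h < d1 \<Longrightarrow> norm ((F (x + h) - F x) /\<^sub>R h - l) < e" using r[OF e] by blast
  obtain d2 where d2: "d2 > 0" "\<And>h. 0 < h \<Longrightarrow> h < d2 \<Longrightarrow> norm ((F x - F (x - h)) /\<^sub>R h - l) < e" using l[OF e] by blast
  have "norm (F y - F x - (y - x) *\<^sub>R l) \<le> e * norm (y - x)" if y: "norm (y - x) < min d1 d2" for y
  proof -
    consider "y = x" | "y > x" | "y < x" by linarith
    then show ?thesis
    proof cases
      case 2
      then have "norm ((F y - F x) /\<^sub>R (y - x) - l) < e" using d1(2)[of "y - x"] y by auto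
      moreover have "F y - F x - (y - x) *\<^sub>R l = (y - x) *\<^sub>R ((F y - F x) /\<^sub>R (y - x) - l)"
        using 2 by (simp add: scaleR_diff_right)
      ultimately show ?thesis using 2 by (simp add: mult.commute)
    next
      case 3
      then have "norm ((F x - F y) /\<^sub>R (x - y) - l) < e" using d2(2)[of "x - y"] y by auto
      moreover have "F y - F x - (y - x) *\<^sub>R l = (y - x) *\<^sub>R ((F x - F y) /\<^sub>R (x - y) - l)"
      proof -
        have "(x - y) *\<^sub>R ((F x - F y) /\<^sub>R (x - y)) = F x - F y" using 3 by simp
        then have "F y - F x = (y - x) *\<^sub>R ((F x - F y) /\<^sub>R (x - y))"
          by (metis minus_diff_eq scaleR_minus_left)
        then show ?thesis by (simp add: scaleR_diff_right)
      qed
      ultimately show ?thesis using 3 by (simp add: mult.commute)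
    qed simp
  qed
  then show "\<exists>d>0. \<forall>y. norm (y - x) < d \<longrightarrow> norm (F y - F x - (y - x) *\<^sub>R l) \<le> e * norm (y - x)"
    using d1(1) d2(1) by (intro exI[of _ "min d1 d2"]) auto
qed

text \<open>The differentiation theorem controls averages over intervals to the right of a point.
  Applied to \<open>k0\<close> and to its reflection \<open>k1\<close> it covers both sides, with
  the union of one null set and a reflected one as the exceptional set.\<close>

lemma indefinite_integral_has_vector_derivative_ae:
  fixes k :: "real \<Rightarrow> 'a::euclidean_space"
  assumes k: "k integrable_on {a..b}"
  obtains N where "negligible N"
    "\<And>x. x \<in> {a<..<b} - N \<Longrightarrow> ((\<lambda>t. integral {a..t} k) has_vector_derivative k x) (at x)"
proof -
  define k0 where "k0 x = (if x \<in> {a..b} then k x else 0)" for x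
  define k1 where "k1 x = k0 (- x)" for x
  have "k0 integrable_on UNIV"
    using k unfolding k0_def by (rule integrable_restrict_UNIV[THEN iffD2])
  then have i0: "k0 integrable_on cbox u v" for u v
    by (rule integrable_on_subcbox) auto
  have i1: "k1 integrable_on cbox u v" for u v
    unfolding k1_def[abs_def] using i0[of "- v" "- u"] Henstock_Kurzweil_Integration.integrable_reflect_real[where f = k0 and a = "- v" and b = "- u"]
    by simp
  obtain N0 where N0: "negligible N0" "\<And>x e. \<lbrakk>x \<notin> N0; 0 < e\<rbrakk> \<Longrightarrow>
      \<exists>d>0. \<forall>h. 0 < h \<and> h < d \<longrightarrow> norm(integral (cbox x (x + h *\<^sub>R One)) k0 /\<^sub>R h ^ DIM(real) - k0 x) < e"
    using integrable_ccontinuous_explicit[of k0] i0 by metis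
  obtain N1 where N1: "negligible N1" "\<And>x e. \<lbrakk>x \<notin> N1; 0 < e\<rbrakk> \<Longrightarrow>
      \<exists>d>0. \<forall>h. 0 < h \<and> h < d \<longrightarrow> norm(integral (cbox x (x + h *\<^sub>R One)) k1 /\<^sub>R h ^ DIM(real) - k1 x) < e"
    using integrable_ccontinuous_explicit[of k1] i1 by metis
  define F where "F t = integral {a..t} k" for t
  have F: "F v - F u = integral {u..v} k0" if "a \<le> u" "u \<le> v" "v \<le> b" for u v
  proof -
    have "k integrable_on {a..v}" using k by (rule integrable_on_subinterval) (use that in auto)
    then have "F v = F u + integral {u..v} k"
      using Henstock_Kurzweil_Integration.integral_combine[of a u v k] that by (simp add: F_def)
    moreover have "integral {u..v} k = integral {u..v} k0"
      using that by (intro integral_cong) (auto simp: k0_def)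
    ultimately show ?thesis by simp
  qed
  show thesis
  proof
    show "negligible (N0 \<union> uminus ` N1)" using N0(1) N1(1) negligible_uminus_image by auto
    fix x assume x: "x \<in> {a<..<b} - (N0 \<union> uminus ` N1)"
    then have xx: "x \<notin> N0" "- x \<notin> N1" "a < x" "x < b" by force+
    have "(F has_vector_derivative k0 x) (at x)"
    proof (rule has_vector_derivative_split_real[OF xx(3,4)])
      fix e :: real assume e: "e > 0"
      obtain d where d: "d > 0" "\<And>h. 0 < h \<Longrightarrow> h < d \<Longrightarrow> norm (integral {x..x+h} k0 /\<^sub>R h - k0 x) < e"
        using N0(2)[OF xx(1) e] by auto
      show "\<exists>d>0. \<forall>h. 0 < h \<and> h < d \<longrightarrow> norm ((F (x + h) - F x) /\<^sub>R h - k0 x) < e"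
        using d xx F by (intro exI[of _ "min d (b - x)"]) auto
    next
      fix e :: real assume e: "e > 0"
      obtain d where d: "d > 0" "\<And>h. 0 < h \<Longrightarrow> h < d \<Longrightarrow> norm (integral {-x..-x+h} k1 /\<^sub>R h - k1 (-x)) < e"
        using N1(2)[OF xx(2) e] by auto
      have "integral {-x..-x+h} k1 = integral {x-h..x} k0" for h
        using Henstock_Kurzweil_Integration.integral_reflect_real[of x "x - h" k0] by (simp add: k1_def[abs_def])
      then show "\<exists>d>0. \<forall>h. 0 < h \<and> h < d \<longrightarrow> norm ((F x - F (x - h)) /\<^sub>R h - k0 x) < e"
        using d xx F by (intro exI[of _ "min d (x - a)"]) (auto simp: k1_def)
    qed
    then show "((\<lambda>t. integral {a..t} k) has_vector_derivative k x) (at x)"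
      using xx by (simp add: F_def[abs_def] k0_def)
  qed
qed

section \<open>Absolute continuity of the integral\<close>

lemma integrable_truncation:
  fixes k :: "real \<Rightarrow> real"
  assumes k: "integrable lebesgue k" and nn: "\<And>x. 0 \<le> k x" and e: "e > 0"
  obtains c where "c > 0" "(LINT x|lebesgue. k x - min (k x) c) < e"
proof -
  have m: "k \<in> borel_measurable lebesgue" using k by auto
  have "(\<lambda>n. LINT x|lebesgue. k x - min (k x) (real n)) \<longlonglongrightarrow> (LINT x::real|lebesgue. 0)"
  proof (rule integral_dominated_convergence[where w = k])
    show "AE x in lebesgue. (\<lambda>n. k x - min (k x) (real n)) \<longlonglongrightarrow> 0"
    proof (rule AE_I2)
      fix x
      obtain m where "k x \<le> real m" using real_arch_simple by blast
      then have "\<forall>\<^sub>F n in sequentially. k x - min (k x) (real n) = 0"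
        unfolding eventually_sequentially by (intro exI[of _ m]) (auto simp: min_def)
      then show "(\<lambda>n. k x - min (k x) (real n)) \<longlonglongrightarrow> 0" by (rule tendsto_eventually)
    qed
  qed (use m k nn in auto)
  then have "(\<lambda>n. LINT x|lebesgue. k x - min (k x) (real n)) \<longlonglongrightarrow> 0" by simp
  then have "\<forall>\<^sub>F n in sequentially. (LINT x|lebesgue. k x - min (k x) (real n)) < e"
    using e by (rule order_tendstoD)
  then obtain n where n: "(LINT x|lebesgue. k x - min (k x) (real n)) < e" "n > 0"
    by (metis (mono_tags, lifting) eventually_conj eventually_gt_at_top eventually_happens' sequentially_bot)
  then show thesis using that[of "real n"] by simp
qed

text \<open>Split the density at a height \<open>c\<close>: the part below \<open>c\<close>
  contributes at most \<open>c\<close> times the total length, the part above has integral less than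
  \<open>e / 2\<close> whatever the intervals are. Hence the choice \<open>e / (2 * c)\<close> for
  the admissible length.\<close>

lemma disjoint_intervals_integral_small:
  fixes k :: "real \<Rightarrow> real"
  assumes k: "k absolutely_integrable_on {a..b}" and nn: "\<And>x. x \<in> {a..b} \<Longrightarrow> 0 \<le> k x" and e: "e > 0"
  obtains \<delta> where "\<delta> > 0" "\<And>P. disjoint_intervals {a..b} P \<Longrightarrow> (\<Sum>(a, b)\<in>P. b - a) < \<delta> \<Longrightarrow>
      (\<Sum>(a, b)\<in>P. integral {a..b} k) < e"
proof -
  define k0 where "k0 x = indicator {a..b} x * k x" for x
  have k0: "integrable lebesgue k0" using k by (simp add: set_integrable_def k0_def[abs_def])
  have nn0: "0 \<le> k0 x" for x using nn by (auto simp: k0_def indicator_def)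
  have "e / 2 > 0" using e by simp
  then obtain c where c: "c > 0" "(LINT x|lebesgue. k0 x - min (k0 x) c) < e / 2"
    using integrable_truncation[OF k0 nn0] by blast
  have m: "integrable lebesgue (\<lambda>x. min (k0 x) c)"
    by (rule Bochner_Integration.integrable_bound[OF k0]) (use k0 nn0 c in auto)
  have h: "integrable lebesgue (\<lambda>x. k0 x - min (k0 x) c)" using k0 m by auto
  show thesis
  proof
    show "e / (2 * c) > 0" using e c by simp
    fix P assume P: "disjoint_intervals {a..b} P" and len: "(\<Sum>(a, b)\<in>P. b - a) < e / (2 * c)"
    have "(\<Sum>(a, b)\<in>P. integral {a..b} k) \<le> (\<Sum>(a, b)\<in>P. c * (b - a) + integral {a..b} (\<lambda>x. k0 x - min (k0 x) c))"
    proof (rule sum_mono, clarify)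
      fix u v assume "(u, v) \<in> P"
      then have uv: "a \<le> u" "u < v" "v \<le> b" using P by (auto simp: disjoint_intervals_def)
      have i: "f integrable_on {u..v}" if "integrable lebesgue f" for f :: "real \<Rightarrow> real"
        using that integrable_on_lebesgue integrable_on_subcbox[of f UNIV u v] by auto
      have "integral {u..v} k = integral {u..v} k0"
        using uv by (intro integral_cong) (auto simp: k0_def)
      also have "\<dots> = integral {u..v} (\<lambda>x. min (k0 x) c) + integral {u..v} (\<lambda>x. k0 x - min (k0 x) c)"
        using integral_add[OF i[OF m] i[OF h]] by simp
      also have "integral {u..v} (\<lambda>x. min (k0 x) c) \<le> integral {u..v} (\<lambda>x. c)"
        by (rule integral_le[OF i[OF m]]) auto
      also have "\<dots> = c * (v - u)" using uv by simp
      finally show "integral {u..v} k \<le> c * (v - u) + integral {u..v} (\<lambda>x. k0 x - min (k0 x) c)" by simp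
    qed
    also have "\<dots> = c * (\<Sum>(a, b)\<in>P. b - a) + (\<Sum>(a, b)\<in>P. integral {a..b} (\<lambda>x. k0 x - min (k0 x) c))"
      by (simp add: case_prod_beta' sum.distrib sum_distrib_left)
    also have "\<dots> \<le> c * (\<Sum>(a, b)\<in>P. b - a) + (LINT x|lebesgue. k0 x - min (k0 x) c)"
      using sum_integral_disjoint_intervals_le[OF P h] by simp
    also have "\<dots> < c * (e / (2 * c)) + e / 2"
      using len c by (intro add_strict_mono mult_strict_left_mono) auto
    also have "\<dots> = e" using c by simp
    finally show "(\<Sum>(a, b)\<in>P. integral {a..b} k) < e" .
  qed
qed

text \<open>The criterion by which indefinite integrals, glued trajectories and the orbits of an
  evolution family are recognised as absolutely continuous.\<close>

lemma abs_cont_on_dominated: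
  fixes k :: "real \<Rightarrow> real"
  assumes k: "k absolutely_integrable_on {a..b}" and nn: "\<And>x. x \<in> {a..b} \<Longrightarrow> 0 \<le> k x"
    and dom: "\<And>u v. a \<le> u \<Longrightarrow> u \<le> v \<Longrightarrow> v \<le> b \<Longrightarrow> norm (f v - f u) \<le> integral {u..v} k"
  shows "abs_cont_on {a..b} f"
  unfolding abs_cont_on_def
proof (intro allI impI)
  fix e :: real assume "e > 0"
  then obtain d where d: "d > 0" "\<And>P. disjoint_intervals {a..b} P \<Longrightarrow> (\<Sum>(a, b)\<in>P. b - a) < d \<Longrightarrow>
      (\<Sum>(a, b)\<in>P. integral {a..b} k) < e"
    using disjoint_intervals_integral_small[OF k nn] by blast
  have "(\<Sum>(a, b)\<in>P. norm (f b - f a)) < e" if P: "disjoint_intervals {a..b} P" "(\<Sum>(a, b)\<in>P. b - a) < d" for P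
  proof -
    have "(\<Sum>(a, b)\<in>P. norm (f b - f a)) \<le> (\<Sum>(a, b)\<in>P. integral {a..b} k)"
    proof (rule sum_mono, clarify)
      fix u v assume "(u, v) \<in> P"
      then show "norm (f v - f u) \<le> integral {u..v} k"
        using P(1) by (intro dom) (auto simp: disjoint_intervals_def)
    qed
    then show ?thesis using d(2)[OF P] by linarith
  qed
  then show "\<exists>\<delta>>0. \<forall>P. disjoint_intervals {a..b} P \<and> (\<Sum>(a, b)\<in>P. b - a) < \<delta> \<longrightarrow> (\<Sum>(a, b)\<in>P. norm (f b - f a)) < e"
    using d(1) by blast
qed

lemma integral_diff_Icc:
  fixes k :: "real \<Rightarrow> 'a::banach"
  assumes "k integrable_on {a..b}" "a \<le> u" "u \<le> v" "v \<le> b"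
  shows "integral {a..v} k - integral {a..u} k = integral {u..v} k"
proof -
  have "k integrable_on {a..v}" using assms(1) by (rule integrable_on_subinterval) (use assms in auto)
  then show ?thesis using Henstock_Kurzweil_Integration.integral_combine[of a u v k] assms by (simp add: algebra_simps)
qed

lemma abs_cont_on_indefinite_integral:
  fixes k :: "real \<Rightarrow> 'a::euclidean_space"
  assumes k: "k absolutely_integrable_on {a..b}"
  shows "abs_cont_on {a..b} (\<lambda>t. integral {a..t} k)"
proof (rule abs_cont_on_dominated[where k = "\<lambda>x. norm (k x)"])
  show nk: "(\<lambda>x. norm (k x)) absolutely_integrable_on {a..b}" using absolutely_integrable_norm[OF k] by (simp add: o_def)
  fix u v assume uv: "a \<le> u" "u \<le> v" "v \<le> b"
  have ki: "k integrable_on {a..b}" "(\<lambda>x. norm (k x)) integrable_on {a..b}"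
    using k nk set_lebesgue_integral_eq_integral(1) by blast+
  have "integral {a..v} k - integral {a..u} k = integral {u..v} k"
    by (rule integral_diff_Icc[OF ki(1) uv])
  also have "norm \<dots> \<le> integral {u..v} (\<lambda>x. norm (k x))"
    using ki uv by (intro integral_norm_bound_integral) (auto intro: integrable_on_subinterval)
  finally show "norm (integral {a..v} k - integral {a..u} k) \<le> integral {u..v} (\<lambda>x. norm (k x))" .
qed auto

section \<open>Differentiability almost everywhere of functions with increments dominated by an
  integral\<close>

lemma emeasure_density_Ioc:
  fixes k :: "real \<Rightarrow> real"
  assumes [measurable]: "k \<in> borel_measurable lborel" and k: "integrable lborel k" and nn: "AE x in lborel. 0 \<le> k x"
  shows "emeasure (density lborel (\<lambda>x. ennreal (k x))) {u<..v} = ennreal (LINT x|lborel. indicator {u<..v} x * k x)"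
proof -
  have "emeasure (density lborel (\<lambda>x. ennreal (k x))) {u<..v} = (\<integral>\<^sup>+ x. ennreal (k x) * indicator {u<..v} x \<partial>lborel)"
    by (rule emeasure_density) auto
  also have "\<dots> = (\<integral>\<^sup>+ x. ennreal (indicator {u<..v} x * k x) \<partial>lborel)"
    by (intro nn_integral_cong) (auto simp: indicator_def)
  also have "\<dots> = ennreal (LINT x|lborel. indicator {u<..v} x * k x)"
  proof (rule nn_integral_eq_integral)
    show "integrable lborel (\<lambda>x. indicator {u<..v} x * k x)"
      using integrable_mult_indicator[of "{u<..v}" lborel k] k by simp
  qed (use nn in \<open>auto simp: indicator_def\<close>)
  finally show ?thesis .
qed

text \<open>If two nondecreasing functions add up to an absolutely continuous one, then both
  Lebesgue-Stieltjes measures are dominated by the one of the sum.\<close>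

lemma interval_measure_absolutely_continuous:
  fixes F G k :: "real \<Rightarrow> real"
  assumes F: "\<And>x y. x \<le> y \<Longrightarrow> F x \<le> F y" "\<And>x. continuous (at_right x) F"
    and G: "\<And>x y. x \<le> y \<Longrightarrow> G x \<le> G y" "\<And>x. continuous (at_right x) G"
    and k: "k \<in> borel_measurable lborel" "integrable lborel k" "AE x in lborel. 0 \<le> k x"
    and sum: "\<And>u v. u \<le> v \<Longrightarrow> F v - F u + (G v - G u) = (LINT x|lborel. indicator {u<..v} x * k x)"
  shows "absolutely_continuous lborel (interval_measure F)"
proof -
  define \<nu> where "\<nu> = interval_measure F"
  define \<mu> where "\<mu> = interval_measure G"
  define M where "M = measure_of UNIV (sets borel) (\<lambda>A. emeasure \<nu> A + emeasure \<mu> A)"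
  have sets: "sets \<nu> = sets borel" "sets \<mu> = sets borel" by (auto simp: \<nu>_def \<mu>_def)
  have sM: "sets M = sets borel" unfolding M_def
    by (metis sets.sets_measure_of_eq space_borel)
  have eM: "emeasure M A = emeasure \<nu> A + emeasure \<mu> A" if "A \<in> sets borel" for A
    unfolding M_def
  proof (rule emeasure_measure_of_sigma[OF _ _ _ that])
    show "sigma_algebra UNIV (sets (borel :: real measure))"
      by (metis sets.sigma_algebra_axioms space_borel)
    show "positive (sets borel) (\<lambda>A. emeasure \<nu> A + emeasure \<mu> A)" by (simp add: positive_def)
    show "countably_additive (sets borel) (\<lambda>A. emeasure \<nu> A + emeasure \<mu> A)"
    proof (rule countably_additiveI)
      fix A :: "nat \<Rightarrow> real set" assume A: "range A \<subseteq> sets borel" "disjoint_family A"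
      show "(\<Sum>i. emeasure \<nu> (A i) + emeasure \<mu> (A i)) = emeasure \<nu> (\<Union> (range A)) + emeasure \<mu> (\<Union> (range A))"
        using A sets by (subst suminf_add[symmetric]) (auto simp: suminf_emeasure)
    qed
  qed
  \<comment> \<open>By the assumption \<open>sum\<close> both measures agree on half-open intervals,
    which form an intersection-stable generator of the Borel sets.\<close>
  have "M = density lborel (\<lambda>x. ennreal (k x))"
  proof (rule measure_eqI_generator_eq)
    let ?E = "range (\<lambda>(a, b). {a <.. b::real})"
    show "Int_stable ?E" by (auto simp: Int_stable_def)
    show "sets M = sigma_sets UNIV ?E" "sets (density lborel (\<lambda>x. ennreal (k x))) = sigma_sets UNIV ?E"
      using sM by (simp_all add: borel_sigma_sets_Ioc)
    have eI: "emeasure M {u<..v} = ennreal (LINT x|lborel. indicator {u<..v} x * k x)" for u v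
    proof (cases "u \<le> v")
      case True
      then show ?thesis
        using eM[of "{u<..v}"] F G sum[OF True]
        by (simp add: \<nu>_def \<mu>_def emeasure_interval_measure_Ioc ennreal_plus[symmetric] del: ennreal_plus)
    qed (use eM in auto)
    show "emeasure M X = emeasure (density lborel (\<lambda>x. ennreal (k x))) X" if "X \<in> ?E" for X
      using that eI emeasure_density_Ioc[OF k] by auto
    show "range (\<lambda>n::nat. {- real n<..real n}) \<subseteq> ?E" by auto
    show "(\<Union>n::nat. {- real n<..real n}) = UNIV"
    proof (safe; simp)
      fix x :: real
      obtain n :: nat where "\<bar>x\<bar> < real n" using reals_Archimedean2 by blast
      then show "\<exists>n. - real n < x \<and> x \<le> real n" by (intro exI[of _ n]) auto
    qed
    show "emeasure M {- real n<..real n} \<noteq> \<infinity>" for n by (simp add: eI)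
  qed auto
  then have "absolutely_continuous lborel M"
    using absolutely_continuousI_density[of "\<lambda>x. ennreal (k x)" lborel] k(1) by simp
  then have ac: "null_sets lborel \<subseteq> null_sets M" by (simp add: absolutely_continuous_def)
  have "A \<in> null_sets \<nu>" if "A \<in> null_sets lborel" for A
  proof -
    have A: "A \<in> sets borel" using that by auto
    have "emeasure M A = 0" using that ac by auto
    then have "emeasure \<nu> A = 0" using eM[OF A] by simp
    then show ?thesis using A sets by auto
  qed
  then show ?thesis unfolding absolutely_continuous_def \<nu>_def by blast
qed

text \<open>With \<open>H\<close> the integral of \<open>k\<close>, both \<open>H + f\<close> and
  \<open>H - f\<close> are nondecreasing and they add up to \<open>2 * H\<close>. So the Stieltjes
  measure of \<open>H + f\<close> has a density by the Radon-Nikodym theorem, \<open>H + f\<close>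
  is an indefinite integral up to a constant, and \<open>f\<close> is a difference of functions that
  are differentiable almost everywhere.\<close>

lemma dominated_real_ae_differentiable:
  fixes f k :: "real \<Rightarrow> real"
  assumes ab: "a \<le> b" and k: "k absolutely_integrable_on {a..b}" and nn: "\<And>x. x \<in> {a..b} \<Longrightarrow> 0 \<le> k x"
    and dom: "\<And>u v. a \<le> u \<Longrightarrow> u \<le> v \<Longrightarrow> v \<le> b \<Longrightarrow> norm (f v - f u) \<le> integral {u..v} k"
  obtains N g where "negligible N"
    "\<And>x. x \<in> {a<..<b} - N \<Longrightarrow> (f has_vector_derivative g x) (at x)"
proof -
  \<comment> \<open>Clamping to \<open>{a..b}\<close> extends the functions by constants to the
    whole line, on which \<open>interval_measure\<close> is defined.\<close>
  define cl where "cl x = max a (min b x)" for x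
  have cl: "a \<le> cl x" "cl x \<le> b" for x using ab by (auto simp: cl_def)
  have clm: "cl x \<le> cl y" if "x \<le> y" for x y using that by (auto simp: cl_def)
  have clc: "continuous (at_right x) cl" for x unfolding cl_def
    by (intro continuous_intros)
  have ki: "k integrable_on {a..b}" using k set_lebesgue_integral_eq_integral(1) by blast
  define H where "H x = integral {a..x} k" for x
  have H: "H v - H u = integral {u..v} k" if "a \<le> u" "u \<le> v" "v \<le> b" for u v
    unfolding H_def by (rule integral_diff_Icc[OF ki that])
  have dom': "\<bar>f v - f u\<bar> \<le> H v - H u" if "a \<le> u" "u \<le> v" "v \<le> b" for u v
    using dom[OF that] H[OF that] by simp
  have Hc: "continuous_on {a..b} H" unfolding H_def by (rule indefinite_integral_continuous_1[OF ki])
  have fc: "continuous_on {a..b} f"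
    unfolding continuous_on_iff
  proof (intro ballI allI impI)
    fix x e assume x: "x \<in> {a..b}" and e: "(0::real) < e"
    obtain d where d: "d > 0" "\<And>y. y \<in> {a..b} \<Longrightarrow> dist y x < d \<Longrightarrow> dist (H y) (H x) < e"
      using Hc x e unfolding continuous_on_iff by metis
    have "dist (f y) (f x) < e" if "y \<in> {a..b}" "dist y x < d" for y
      using d(2)[OF that] dom'[of x y] dom'[of y x] x that(1) by (cases "x \<le> y") (auto simp: dist_real_def)
    then show "\<exists>d>0. \<forall>x'\<in>{a..b}. dist x' x < d \<longrightarrow> dist (f x') (f x) < e" using d(1) by blast
  qed
  have comp: "continuous (at_right x) (\<lambda>x. h (cl x))" if "continuous_on {a..b} h" for h :: "real \<Rightarrow> real" and x
  proof -
    have "continuous_on UNIV (\<lambda>x. h (cl x))"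
      by (rule continuous_on_compose2[OF that]) (auto simp: cl_def ab intro!: continuous_intros)
    then show ?thesis
      by (simp add: continuous_on_eq_continuous_at continuous_at_imp_continuous_at_within)
  qed
  define F where "F x = H (cl x) + f (cl x)" for x
  define G where "G x = H (cl x) - f (cl x)" for x
  have Fm: "F x \<le> F y" and Gm: "G x \<le> G y" if "x \<le> y" for x y
    using dom'[of "cl x" "cl y"] cl clm[OF that] by (auto simp: F_def G_def)
  have Fc: "continuous (at_right x) F" and Gc: "continuous (at_right x) G" for x
    unfolding F_def[abs_def] G_def[abs_def] by (intro continuous_intros comp Hc fc)+
  define k0 where "k0 x = 2 * (indicator {a..b} x * k x)" for x
  have k0: "integrable lebesgue k0" using k by (simp add: set_integrable_def k0_def[abs_def])
  \<comment> \<open>The Stieltjes measures are Borel measures, so the Lebesgue measurable density is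
    replaced by a Borel one that agrees with it almost everywhere.\<close>
  then obtain k1 where k1: "k1 \<in> borel_measurable lborel" "AE x in lborel. k0 x = k1 x"
    using completion_ex_borel_measurable_real[of k0 lborel] by auto
  have k1': "AE x in lebesgue. k0 x = k1 x" using k1(2) by (rule AE_completion)
  have k1m: "k1 \<in> borel_measurable lebesgue" using k1(1) by (simp add: measurable_completion)
  have ik1: "integrable lebesgue k1" using integrable_cong_AE_imp[OF k0 k1m] k1' by (auto simp: eq_commute)
  then have ik1': "integrable lborel k1" using k1(1) integrable_completion by metis
  have pos: "AE x in lborel. 0 \<le> k1 x" 
  proof -
    have "0 \<le> k0 x" for x using nn by (cases "x \<in> {a..b}") (auto simp: k0_def)
    with k1(2) show ?thesis by (auto elim!: eventually_mono) (metis)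
  qed
  have sum: "F v - F u + (G v - G u) = (LINT x|lborel. indicator {u<..v} x * k1 x)" if uv: "u \<le> v" for u v
  proof -
    have "(LINT x|lborel. indicator {u<..v} x * k1 x) = (LINT x|lebesgue. indicator {u<..v} x * k1 x)"
      using k1(1) by (subst integral_completion) auto
    also have "\<dots> = (LINT x|lebesgue. 2 * (indicator {cl u..cl v} x * k x))"
    proof (rule integral_cong_AE)
      show "AE x in lebesgue. indicator {u<..v} x * k1 x = 2 * (indicator {cl u..cl v} x * k x)"
      proof -
        have "AE x in lebesgue. x \<noteq> u \<and> x \<noteq> a \<and> x \<noteq> b"
          using AE_completion[OF AE_lborel_singleton[of u]] AE_completion[OF AE_lborel_singleton[of a]]
            AE_completion[OF AE_lborel_singleton[of b]] by auto
        then show ?thesis using k1'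
        proof eventually_elim
          case (elim x)
          then show ?case using uv ab
            by (cases "a \<le> x"; cases "x \<le> b") (auto simp: k0_def cl_def indicator_def split: if_splits)
        qed
      qed
      have "set_integrable lebesgue {cl u..cl v} k"
        using k by (rule set_integrable_subset) (use cl in auto)
      then show "(\<lambda>x. 2 * (indicator {cl u..cl v} x * k x)) \<in> borel_measurable lebesgue"
        by (auto simp: set_integrable_def)
      show "(\<lambda>x. indicator {u<..v} x * k1 x) \<in> borel_measurable lebesgue"
        by (intro borel_measurable_times borel_measurable_indicator k1m) simp
    qed
    also have "\<dots> = 2 * (LINT x:{cl u..cl v}|lebesgue. k x)" by (simp add: set_lebesgue_integral_def)
    also have "\<dots> = 2 * integral {cl u..cl v} k"
      by (subst set_lebesgue_integral_eq_integral(2)[OF set_integrable_subset[OF k]]) (use cl in auto)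
    also have "\<dots> = 2 * (H (cl v) - H (cl u))" using cl clm[OF uv] by (subst H) auto
    finally show ?thesis by (simp add: F_def G_def)
  qed
  have ac: "absolutely_continuous lborel (interval_measure F)"
    by (rule interval_measure_absolutely_continuous[OF Fm Fc Gm Gc k1(1) ik1' pos sum])
  then obtain h where h: "h \<in> borel_measurable lborel" "density lborel h = interval_measure F"
    using sigma_finite_measure.Radon_Nikodym[OF sigma_finite_lborel ac] by auto
  have hI: "(\<integral>\<^sup>+ x. h x * indicator {u<..v} x \<partial>lborel) = ennreal (F v - F u)" if "u \<le> v" for u v
  proof -
    have "(\<integral>\<^sup>+ x. h x * indicator {u<..v} x \<partial>lborel) = emeasure (density lborel h) {u<..v}"
      using h(1) by (subst emeasure_density) auto
    also have "\<dots> = ennreal (F v - F u)"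
      unfolding h(2) using emeasure_interval_measure_Ioc[OF that] Fm Fc by blast
    finally show ?thesis .
  qed
  define g where "g x = enn2real (h x * indicator {a<..b} x)" for x
  have gm: "g \<in> borel_measurable lborel" unfolding g_def using h(1) by measurable
  have fin: "AE x in lborel. h x * indicator {a<..b} x \<noteq> \<infinity>"
    by (rule nn_integral_PInf_AE) (use h(1) hI[OF ab] in auto)
  have gh: "AE x in lborel. ennreal (g x) = h x * indicator {a<..b} x"
    using fin by eventually_elim (auto simp: g_def less_top)
  have g: "has_bochner_integral lborel (\<lambda>x. indicator {u<..v} x * g x) (F v - F u)" if "a \<le> u" "u \<le> v" "v \<le> b" for u v
  proof (rule has_bochner_integral_nn_integral)
    have "(\<integral>\<^sup>+ x. ennreal (indicator {u<..v} x * g x) \<partial>lborel) = (\<integral>\<^sup>+ x. h x * indicator {u<..v} x \<partial>lborel)"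
    proof (rule nn_integral_cong_AE)
      show "AE x in lborel. ennreal (indicator {u<..v} x * g x) = h x * indicator {u<..v} x"
        using gh
      proof eventually_elim
        case (elim x)
        then show ?case using that by (cases "x \<in> {u<..v}") auto
      qed
    qed
    then show "(\<integral>\<^sup>+ x. ennreal (indicator {u<..v} x * g x) \<partial>lborel) = ennreal (F v - F u)"
      using hI[OF that(2)] by simp
    show "0 \<le> F v - F u" using Fm[OF that(2)] by simp
    show "(\<lambda>x. indicator {u<..v} x * g x) \<in> borel_measurable lborel"
      by (intro borel_measurable_times borel_measurable_indicator gm) simp
    show "AE x in lborel. 0 \<le> indicator {u<..v} x * g x" by (simp add: g_def)
  qed
  have gint: "(g has_integral (F v - F u)) {u..v}" if "a \<le> u" "u \<le> v" "v \<le> b" for u v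
  proof -
    have "((\<lambda>x. indicator {u<..v} x * g x) has_integral (F v - F u)) UNIV"
      using g[OF that] by (simp add: has_integral_integral_lborel has_bochner_integral_iff)
        (metis has_integral_integral_lborel)
    then have "((\<lambda>x. if x \<in> {u<..v} then g x else 0) has_integral (F v - F u)) UNIV"
      by (rule has_integral_eq[rotated]) (auto simp: indicator_def)
    then have "(g has_integral (F v - F u)) {u<..v}" by (rule has_integral_restrict_UNIV[THEN iffD1])
    then show ?thesis
      by (rule has_integral_spike_set_eq[THEN iffD1, rotated 2]) (auto intro: negligible_subset[of "{u}"])
  qed
  obtain N1 where N1: "negligible N1"
    "\<And>x. x \<in> {a<..<b} - N1 \<Longrightarrow> ((\<lambda>t. integral {a..t} g) has_vector_derivative g x) (at x)"
    using indefinite_integral_has_vector_derivative_ae[of g a b] gint[OF order_refl ab order_refl]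
    by (metis has_integral_integrable_integral)
  obtain N2 where N2: "negligible N2"
    "\<And>x. x \<in> {a<..<b} - N2 \<Longrightarrow> ((\<lambda>t. integral {a..t} k) has_vector_derivative k x) (at x)"
    using indefinite_integral_has_vector_derivative_ae[OF ki] by metis
  show thesis
  proof
    show "negligible (N1 \<union> N2)" using N1 N2 by simp
    fix x assume x: "x \<in> {a<..<b} - (N1 \<union> N2)"
    have "((\<lambda>t. integral {a..t} g - integral {a..t} k + f a) has_vector_derivative (g x - k x) + 0) (at x)"
      using x by (intro derivative_intros N1(2) N2(2)) auto
    then have "((\<lambda>t. integral {a..t} g - integral {a..t} k + f a) has_vector_derivative (g x - k x)) (at x)" by simp
    then show "(f has_vector_derivative (g x - k x)) (at x)"
    proof (rule has_vector_derivative_transform_within_open[of _ _ _ "{a<..<b}"])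
      fix t assume t: "t \<in> {a<..<b}"
      have "integral {a..t} g = F t - F a"
        using gint[of a t] t by (auto intro: integral_unique)
      moreover have "cl t = t" "cl a = a" using t ab by (auto simp: cl_def)
      moreover have "H a = 0" by (simp add: H_def)
      ultimately show "integral {a..t} g - integral {a..t} k + f a = f t"
        by (simp add: F_def H_def)
    qed (use x in auto)
  qed
qed

lemma dominated_complex_ae_differentiable:
  fixes f :: "real \<Rightarrow> complex" and k :: "real \<Rightarrow> real"
  assumes ab: "a \<le> b" and k: "k absolutely_integrable_on {a..b}" and nn: "\<And>x. x \<in> {a..b} \<Longrightarrow> 0 \<le> k x"
    and dom: "\<And>u v. a \<le> u \<Longrightarrow> u \<le> v \<Longrightarrow> v \<le> b \<Longrightarrow> norm (f v - f u) \<le> integral {u..v} k"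
  obtains N g where "negligible N"
    "\<And>x. x \<in> {a<..<b} - N \<Longrightarrow> (f has_vector_derivative g x) (at x)"
proof -
  have "norm (Re (f v) - Re (f u)) \<le> integral {u..v} k" "norm (Im (f v) - Im (f u)) \<le> integral {u..v} k"
    if "a \<le> u" "u \<le> v" "v \<le> b" for u v
    using dom[OF that] abs_Re_le_cmod[of "f v - f u"] abs_Im_le_cmod[of "f v - f u"] by auto
  then obtain N1 g1 N2 g2 where N: "negligible N1"
    "\<And>x. x \<in> {a<..<b} - N1 \<Longrightarrow> ((\<lambda>t. Re (f t)) has_vector_derivative g1 x) (at x)" "negligible N2"
    "\<And>x. x \<in> {a<..<b} - N2 \<Longrightarrow> ((\<lambda>t. Im (f t)) has_vector_derivative g2 x) (at x)"
    using dominated_real_ae_differentiable[OF ab k nn, of "\<lambda>t. Re (f t)"]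
      dominated_real_ae_differentiable[OF ab k nn, of "\<lambda>t. Im (f t)"] by metis
  show thesis
  proof
    show "negligible (N1 \<union> N2)" using N by simp
    fix x assume "x \<in> {a<..<b} - (N1 \<union> N2)"
    then show "(f has_vector_derivative Complex (g1 x) (g2 x)) (at x)"
      using N by (simp add: has_vector_derivative_complex_iff has_real_derivative_iff_has_vector_derivative)
  qed
qed

section \<open>Functions of class \<open>L\<^sup>d\<close>\<close>

lemma Ld_dominated:
  fixes h k :: "real \<Rightarrow> 'a::euclidean_space" 
  assumes "Ld d X k" "h \<in> borel_measurable (lebesgue_on X)" "AE x in lebesgue_on X. norm (h x) \<le> c * norm (k x)" "1 \<le> d"
  shows "Ld d X h"
proof (cases "d = \<infinity>")
  case True
  then obtain C where C: "AE x in lebesgue_on X. norm (k x) \<le> C" using assms(1) by (auto simp: Ld_def)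
  from assms(3) C have "AE x in lebesgue_on X. norm (h x) \<le> \<bar>c\<bar> * max C 0"
  proof eventually_elim
    case (elim x)
    have "c * norm (k x) \<le> \<bar>c\<bar> * max C 0" using elim by (intro mult_mono) auto
    then show ?case using elim by linarith
  qed
  then show ?thesis using True assms(2) by (auto simp: Ld_def)
next
  case False
  define p where "p = enn2real d"
  have p: "1 \<le> p" using assms(4) False unfolding p_def
    by (metis enn2real_mono enn2real_1 less_top infinity_ennreal_def)
  have i: "integrable (lebesgue_on X) (\<lambda>x. norm (k x) powr p)" using assms(1) False by (auto simp: Ld_def p_def)
  have "integrable (lebesgue_on X) (\<lambda>x. norm (h x) powr p)"
  proof (rule Bochner_Integration.integrable_bound)
    show "integrable (lebesgue_on X) (\<lambda>x. \<bar>c\<bar> powr p * norm (k x) powr p)" using i by simp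
    show "(\<lambda>x. norm (h x) powr p) \<in> borel_measurable (lebesgue_on X)" using assms(2) by measurable
    show "AE x in lebesgue_on X. norm (norm (h x) powr p) \<le> norm (\<bar>c\<bar> powr p * norm (k x) powr p)"
      using assms(3)
    proof eventually_elim
      case (elim x)
      have "norm (h x) \<le> \<bar>c\<bar> * norm (k x)"
        using elim by (meson abs_ge_self mult_right_mono norm_ge_zero order_trans)
      then have "norm (h x) powr p \<le> (\<bar>c\<bar> * norm (k x)) powr p" using p by (intro powr_mono2) auto
      then show ?case using powr_mult by (simp add: powr_mult)
    qed
  qed
  then show ?thesis using False assms(2) by (auto simp: Ld_def p_def)
qed

text \<open>For finite \<open>d\<close> the norm of the sum is at most twice the larger norm, and
  the power of a maximum is at most the sum of the powers.\<close>

lemma Ld_add: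
  fixes h k :: "real \<Rightarrow> 'a::euclidean_space" 
  assumes "Ld d X h" "Ld d X k" "1 \<le> d"
  shows "Ld d X (\<lambda>x. h x + k x)"
proof -
  have m: "h \<in> borel_measurable (lebesgue_on X)" "k \<in> borel_measurable (lebesgue_on X)"
    using assms by (auto simp: Ld_def)
  show ?thesis
  proof (cases "d = \<infinity>")
    case True
    obtain C1 C2 where "AE x in lebesgue_on X. norm (h x) \<le> C1" "AE x in lebesgue_on X. norm (k x) \<le> C2"
      using True assms(1,2) by (auto simp: Ld_def)
    then have "AE x in lebesgue_on X. norm (h x + k x) \<le> C1 + C2"
      by eventually_elim (rule norm_triangle_mono)
    then show ?thesis using True m by (auto simp: Ld_def)
  next
    case False
    define p where "p = enn2real d"
    have p: "1 \<le> p" using assms(3) False unfolding p_def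
      by (metis enn2real_mono enn2real_1 less_top infinity_ennreal_def)
    have i: "integrable (lebesgue_on X) (\<lambda>x. norm (h x) powr p)" "integrable (lebesgue_on X) (\<lambda>x. norm (k x) powr p)"
      using assms(1,2) False by (auto simp: Ld_def p_def)
    have "integrable (lebesgue_on X) (\<lambda>x. norm (h x + k x) powr p)"
    proof (rule Bochner_Integration.integrable_bound)
      show "integrable (lebesgue_on X) (\<lambda>x. 2 powr p * (norm (h x) powr p + norm (k x) powr p))" using i by simp
      show "(\<lambda>x. norm (h x + k x) powr p) \<in> borel_measurable (lebesgue_on X)" using m by measurable
      show "AE x in lebesgue_on X. norm (norm (h x + k x) powr p) \<le> norm (2 powr p * (norm (h x) powr p + norm (k x) powr p))"
      proof (rule AE_I2)
        fix x
        have "norm (h x + k x) \<le> 2 * max (norm (h x)) (norm (k x))"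
          using norm_triangle_ineq[of "h x" "k x"] by linarith
        then have "norm (h x + k x) powr p \<le> (2 * max (norm (h x)) (norm (k x))) powr p"
          using p by (intro powr_mono2) auto
        also have "\<dots> = 2 powr p * (max (norm (h x)) (norm (k x)) powr p)"
          by (subst powr_mult) (auto simp: le_max_iff_disj)
        also have "\<dots> \<le> 2 powr p * (norm (h x) powr p + norm (k x) powr p)"
          by (intro mult_left_mono) (auto simp: max_def)
        finally show "norm (norm (h x + k x) powr p) \<le> norm (2 powr p * (norm (h x) powr p + norm (k x) powr p))"
          by simp
      qed
    qed
    then show ?thesis using False m by (auto simp: Ld_def p_def)
  qed
qed

lemma Ld_scale:
  fixes k :: "real \<Rightarrow> real" 
  assumes "Ld d X k" "1 \<le> d"
  shows "Ld d X (\<lambda>x. c * k x)"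
  using assms(1) by (rule Ld_dominated[where c = "\<bar>c\<bar>"]) (use assms in \<open>auto simp: Ld_def abs_mult\<close>)

lemma Ld_abs:
  fixes k :: "real \<Rightarrow> real" 
  assumes "Ld d X k" "1 \<le> d"
  shows "Ld d X (\<lambda>x. \<bar>k x\<bar>)"
  using assms(1) by (rule Ld_dominated[where c = 1]) (use assms in \<open>auto simp: Ld_def\<close>)

lemma Ld_zero: "Ld d X (\<lambda>x. 0 :: real)"
  by (auto simp: Ld_def)

text \<open>Extension by zero: it turns a density on a short time interval into one on every
  \<open>{0..T}\<close>, so that densities of different origin can be added.\<close>

lemma Ld_restrict:
  fixes k :: "real \<Rightarrow> real"
  assumes k: "Ld d X k" and X: "X \<in> sets lebesgue" and Y: "Y \<in> sets lebesgue" and d: "1 \<le> d"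
  shows "Ld d Y (\<lambda>x. indicator X x * k x)"
proof -
  have m0: "(\<lambda>x. indicator X x * k x) \<in> borel_measurable lebesgue"
    using k X by (simp add: Ld_def borel_measurable_restrict_space_iff[of X lebesgue k] mult.commute)
  then have m: "(\<lambda>x. indicator X x * k x) \<in> borel_measurable (lebesgue_on Y)"
    by (rule measurable_restrict_space1)
  show ?thesis
  proof (cases "d = \<infinity>")
    case True
    obtain C where "AE x in lebesgue_on X. norm (k x) \<le> C" using True k by (auto simp: Ld_def)
    then have "AE x in lebesgue. x \<in> X \<longrightarrow> norm (k x) \<le> C" using X by (simp add: AE_restrict_space_iff)
    then have "AE x in lebesgue. x \<in> Y \<longrightarrow> norm (indicator X x * k x) \<le> max C 0"
      by eventually_elim (auto simp: indicator_def)
    then have "AE x in lebesgue_on Y. norm (indicator X x * k x) \<le> max C 0" using Y by (simp add: AE_restrict_space_iff)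
    then show ?thesis using True m unfolding Ld_def by auto
  next
    case False
    define p where "p = enn2real d"
    have "integrable (lebesgue_on X) (\<lambda>x. norm (k x) powr p)" using k False by (auto simp: Ld_def p_def)
    then have "integrable lebesgue (\<lambda>x. indicator X x *\<^sub>R (norm (k x) powr p))"
      using X by (simp add: integrable_restrict_space)
    also have "(\<lambda>x. indicator X x *\<^sub>R (norm (k x) powr p)) = (\<lambda>x. norm (indicator X x * k x) powr p)"
      by (auto simp: indicator_def fun_eq_iff)
    finally have "set_integrable lebesgue UNIV (\<lambda>x. norm (indicator X x * k x) powr p)" by (simp add: set_integrable_def)
    then have "set_integrable lebesgue Y (\<lambda>x. norm (indicator X x * k x) powr p)"
      by (rule set_integrable_subset) (use Y in auto)
    then have "integrable (lebesgue_on Y) (\<lambda>x. norm (indicator X x * k x) powr p)"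
      using Y by (simp add: set_integrable_def integrable_restrict_space)
    then show ?thesis using False m by (auto simp: Ld_def p_def)
  qed
qed

lemma Ld_cong: "(\<And>x. x \<in> X \<Longrightarrow> h x = k x) \<Longrightarrow> X \<in> sets lebesgue \<Longrightarrow> Ld d X h \<longleftrightarrow> Ld d X k"
proof -
  assume h: "\<And>x. x \<in> X \<Longrightarrow> h x = k x" and X: "X \<in> sets lebesgue"
  have 1: "h \<in> borel_measurable (lebesgue_on X) \<longleftrightarrow> k \<in> borel_measurable (lebesgue_on X)"
    using h by (intro measurable_cong) auto
  have 2: "(AE x in lebesgue_on X. norm (h x) \<le> C) \<longleftrightarrow> (AE x in lebesgue_on X. norm (k x) \<le> C)" for C
    using h by (intro AE_cong) auto
  have 3: "integrable (lebesgue_on X) (\<lambda>x. norm (h x) powr p) \<longleftrightarrow> integrable (lebesgue_on X) (\<lambda>x. norm (k x) powr p)" for p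
    using h by (intro Bochner_Integration.integrable_cong) auto
  show ?thesis unfolding Ld_def 1 2 3 ..
qed

lemma Ld_subset:
  fixes k :: "real \<Rightarrow> real"
  assumes k: "Ld d X k" and X: "X \<in> sets lebesgue" and Y: "Y \<in> sets lebesgue" "Y \<subseteq> X" and d: "1 \<le> d"
  shows "Ld d Y k"
proof -
  have "Ld d Y (\<lambda>x. indicator X x * k x) \<longleftrightarrow> Ld d Y k"
    using Y by (intro Ld_cong) (auto simp: indicator_def)
  with Ld_restrict[OF k X Y(1) d] show ?thesis by simp
qed

text \<open>On a set of finite measure everything reduces to
  \<open>norm y \<le> 1 + norm y powr p\<close> for \<open>p \<ge> 1\<close>.\<close>

lemma Ld_imp_absolutely_integrable:
  fixes k :: "real \<Rightarrow> 'a::euclidean_space"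
  assumes k: "Ld d X k" and X: "X \<in> lmeasurable" and d: "1 \<le> d"
  shows "k absolutely_integrable_on X"
proof -
  have X': "X \<in> sets lebesgue" using X by auto
  have m: "k \<in> borel_measurable (lebesgue_on X)" using k by (simp add: Ld_def)
  have fin: "integrable (lebesgue_on X) (\<lambda>x. c :: real)" for c
    using X X' by (simp add: integrable_restrict_space integrable_indicator_iff fmeasurable_def)
  have "integrable (lebesgue_on X) k"
  proof (cases "d = \<infinity>")
    case True
    obtain C where C: "AE x in lebesgue_on X. norm (k x) \<le> C" using True k by (auto simp: Ld_def)
    show ?thesis
      by (rule Bochner_Integration.integrable_bound[OF fin[of C] m]) (use C in \<open>auto elim!: eventually_mono\<close>)
  next
    case False
    define p where "p = enn2real d"
    have p: "1 \<le> p" using d False unfolding p_def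
      by (metis enn2real_mono enn2real_1 less_top infinity_ennreal_def)
    have i: "integrable (lebesgue_on X) (\<lambda>x. norm (k x) powr p)" using k False by (auto simp: Ld_def p_def)
    have "norm y \<le> 1 + norm y powr p" for y :: 'a
    proof (cases "norm y \<le> 1")
      case False
      then have "norm y powr 1 \<le> norm y powr p" using p by (intro powr_mono) auto
      then show ?thesis using False by simp
    qed (simp add: add_increasing2)
    then show ?thesis
      by (intro Bochner_Integration.integrable_bound[OF Bochner_Integration.integrable_add[OF fin[of 1] i] m])
        (auto intro!: AE_I2)
  qed
  then show ?thesis using X' by (simp add: set_integrable_def integrable_restrict_space)
qed

lemma LINT_Icc_eq_integral:
  fixes k :: "real \<Rightarrow> real"
  assumes "k absolutely_integrable_on {a..b}" "a \<le> u" "v \<le> b"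
  shows "(LINT x:{u..v}|lebesgue. k x) = integral {u..v} k"
  using assms by (intro set_lebesgue_integral_eq_integral(2)) (auto intro: set_integrable_subset)

section \<open>Linear differential equations with integrable coefficient\<close>

lemma abs_cont_on_continuous:
  assumes "abs_cont_on {a..b} f"
  shows "continuous_on {a..b} f"
  unfolding continuous_on_iff
proof (intro ballI allI impI)
  fix x e assume x: "x \<in> {a..b}" and e: "(0::real) < e"
  obtain d where d: "d > 0" "\<And>P. disjoint_intervals {a..b} P \<Longrightarrow> (\<Sum>(a, b)\<in>P. b - a) < d \<Longrightarrow>
      (\<Sum>(a, b)\<in>P. norm (f b - f a)) < e"
    using assms e unfolding abs_cont_on_def by metis
  have "dist (f y) (f x) < e" if y: "y \<in> {a..b}" "dist y x < d" for y
  proof -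
    have *: "norm (f v - f u) < e" if "u \<in> {a..b}" "v \<in> {a..b}" "u < v" "v - u < d" for u v
      using d(2)[of "{(u, v)}"] that by (auto simp: disjoint_intervals_def disjoint_family_on_def)
    show ?thesis using *[of x y] *[of y x] x y e
      by (cases x y rule: linorder_cases) (auto simp: dist_norm norm_minus_commute)
  qed
  then show "\<exists>d>0. \<forall>x'\<in>{a..b}. dist x' x < d \<longrightarrow> dist (f x') (f x) < e" using d(1) by blast
qed

text \<open>One device for sums, for products of bounded functions and for compositions with locally
  Lipschitz functions; the integrating factor below needs all of these at once.\<close>

lemma abs_cont_on_bound2:
  fixes f :: "real \<Rightarrow> 'a::real_normed_vector" and g :: "real \<Rightarrow> 'b::real_normed_vector"
    and h :: "real \<Rightarrow> 'c::real_normed_vector"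
  assumes f: "abs_cont_on I f" and g: "abs_cont_on I g"
    and h: "\<And>u v. u \<in> I \<Longrightarrow> v \<in> I \<Longrightarrow> norm (h v - h u) \<le> C * (norm (f v - f u) + norm (g v - g u))"
  shows "abs_cont_on I h"
  unfolding abs_cont_on_def
proof (intro allI impI)
  fix e :: real assume e: "e > 0"
  define e' where "e' = e / (2 * (\<bar>C\<bar> + 1))"
  have e': "e' > 0" using e by (simp add: e'_def)
  obtain d1 where d1: "d1 > 0" "\<And>P. disjoint_intervals I P \<Longrightarrow> (\<Sum>(a, b)\<in>P. b - a) < d1 \<Longrightarrow>
      (\<Sum>(a, b)\<in>P. norm (f b - f a)) < e'"
    using f e' unfolding abs_cont_on_def by metis
  obtain d2 where d2: "d2 > 0" "\<And>P. disjoint_intervals I P \<Longrightarrow> (\<Sum>(a, b)\<in>P. b - a) < d2 \<Longrightarrow>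
      (\<Sum>(a, b)\<in>P. norm (g b - g a)) < e'"
    using g e' unfolding abs_cont_on_def by metis
  have "(\<Sum>(a, b)\<in>P. norm (h b - h a)) < e"
    if P: "disjoint_intervals I P" "(\<Sum>(a, b)\<in>P. b - a) < min d1 d2" for P
  proof -
    have "(\<Sum>(a, b)\<in>P. norm (h b - h a)) \<le> (\<Sum>(a, b)\<in>P. (\<bar>C\<bar> + 1) * (norm (f b - f a) + norm (g b - g a)))"
    proof (rule sum_mono, clarify)
      fix u v assume "(u, v) \<in> P"
      then have "norm (h v - h u) \<le> C * (norm (f v - f u) + norm (g v - g u))"
        using P(1) by (intro h) (auto simp: disjoint_intervals_def)
      also have "\<dots> \<le> (\<bar>C\<bar> + 1) * (norm (f v - f u) + norm (g v - g u))"
        by (intro mult_right_mono) auto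
      finally show "norm (h v - h u) \<le> (\<bar>C\<bar> + 1) * (norm (f v - f u) + norm (g v - g u))" .
    qed
    also have "\<dots> = (\<bar>C\<bar> + 1) * ((\<Sum>(a, b)\<in>P. norm (f b - f a)) + (\<Sum>(a, b)\<in>P. norm (g b - g a)))"
      by (simp add: sum_distrib_left sum.distrib[symmetric] case_prod_beta')
    also have "\<dots> < (\<bar>C\<bar> + 1) * (e' + e')"
      using d1(2)[OF P(1)] d2(2)[OF P(1)] P(2) by (intro mult_strict_left_mono add_strict_mono) auto
    also have "\<dots> = e" 
    proof -
      have "c * (e / (2 * c) + e / (2 * c)) = e" if "c > 0" for c using that by (simp add: field_simps)
      from this[of "\<bar>C\<bar> + 1"] show ?thesis unfolding e'_def by simp
    qed
    finally show ?thesis .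
  qed
  then show "\<exists>\<delta>>0. \<forall>P. disjoint_intervals I P \<and> (\<Sum>(a, b)\<in>P. b - a) < \<delta> \<longrightarrow> (\<Sum>(a, b)\<in>P. norm (h b - h a)) < e"
    using d1(1) d2(1) by (intro exI[of _ "min d1 d2"]) auto
qed

lemma abs_cont_on_diff:
  assumes "abs_cont_on I f" "abs_cont_on I g"
  shows "abs_cont_on I (\<lambda>x. f x - g x)"
  using assms
proof (rule abs_cont_on_bound2[where C = 1])
  fix u v
  have "f v - g v - (f u - g u) = (f v - f u) - (g v - g u)" by simp
  then show "norm (f v - g v - (f u - g u)) \<le> 1 * (norm (f v - f u) + norm (g v - g u))"
    using norm_triangle_ineq4[of "f v - f u" "g v - g u"] by (metis mult_1)
qed

lemma norm_exp_diff_le: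
  fixes z w :: complex
  assumes "norm z \<le> M" "norm w \<le> M"
  shows "norm (exp z - exp w) \<le> exp M * norm (z - w)"
proof (rule field_differentiable_bound[of "cball 0 M" exp exp])
  fix x :: complex assume "x \<in> cball 0 M"
  then show "norm (exp x) \<le> exp M" using norm_exp[of x] by (auto intro: order_trans)
qed (use assms in \<open>auto intro!: derivative_eq_intros\<close>)

text \<open>Integrating factor: \<open>y t * exp (- F t)\<close> is absolutely continuous with
  derivative zero almost everywhere, hence constant by the fundamental theorem.\<close>

lemma linear_ode_solution:
  fixes y A :: "real \<Rightarrow> complex"
  assumes ac: "abs_cont_on {a..b} y" and A: "A absolutely_integrable_on {a..b}" and N: "negligible N"
    and der: "\<And>t. t \<in> {a..b} - N \<Longrightarrow> (y has_vector_derivative A t * y t) (at t within {a..b})"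
    and t: "t \<in> {a..b}"
  shows "y t = y a * exp (integral {a..t} A)"
proof -
  define F where "F t = integral {a..t} A" for t
  define u where "u t = y t * exp (- F t)" for t
  have Ai: "A integrable_on {a..b}" using A set_lebesgue_integral_eq_integral(1) by blast
  have F: "abs_cont_on {a..b} F" unfolding F_def by (rule abs_cont_on_indefinite_integral[OF A])
  obtain N1 where N1: "negligible N1" "\<And>x. x \<in> {a<..<b} - N1 \<Longrightarrow> (F has_vector_derivative A x) (at x)"
    using indefinite_integral_has_vector_derivative_ae[OF Ai] unfolding F_def by metis
  obtain M1 where M1: "\<And>x. x \<in> {a..b} \<Longrightarrow> norm (y x) \<le> M1"
    using compact_imp_bounded[OF compact_continuous_image[OF abs_cont_on_continuous[OF ac] compact_Icc]]
    unfolding bounded_iff by (metis imageI)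
  obtain M2 where M2: "\<And>x. x \<in> {a..b} \<Longrightarrow> norm (F x) \<le> M2"
    using compact_imp_bounded[OF compact_continuous_image[OF abs_cont_on_continuous[OF F] compact_Icc]]
    unfolding bounded_iff by (metis imageI)
  have "abs_cont_on {a..b} u"
  proof (rule abs_cont_on_bound2[OF ac F])
    fix x x' assume x: "x \<in> {a..b}" "x' \<in> {a..b}"
    have M: "0 \<le> M1" using M1[OF x(1)] by (meson norm_ge_zero order_trans)
    have "norm (exp (- F x')) \<le> exp (norm (- F x'))" by (rule norm_exp)
    also have "\<dots> \<le> exp M2" using M2[OF x(2)] by simp
    finally have E: "norm (exp (- F x')) \<le> exp M2" .
    have "u x' - u x = (y x' - y x) * exp (- F x') + y x * (exp (- F x') - exp (- F x))"
      by (simp add: u_def algebra_simps)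
    also have "norm \<dots> \<le> norm (y x' - y x) * norm (exp (- F x')) + norm (y x) * norm (exp (- F x') - exp (- F x))"
      using norm_triangle_ineq norm_mult by metis
    also have "\<dots> \<le> norm (y x' - y x) * exp M2 + M1 * (exp M2 * norm (- F x' - - F x))"
      using M1 M2 x M by (intro add_mono mult_mono norm_exp_diff_le E) auto
    also have "norm (- F x' - - F x) = norm (F x' - F x)"
      by (metis minus_diff_eq minus_diff_minus norm_minus_cancel)
    also have "norm (y x' - y x) * exp M2 + M1 * (exp M2 * norm (F x' - F x)) \<le>
        (exp M2 * (1 + M1)) * (norm (y x' - y x) + norm (F x' - F x))"
      using M by (simp add: algebra_simps)
    finally show "norm (u x' - u x) \<le> (exp M2 * (1 + M1)) * (norm (y x' - y x) + norm (F x' - F x))" .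
  qed
  then have acu: "abs_cont_on {a..t} u" by (rule abs_cont_on_subset) (use t in auto)
  have "((\<lambda>_. 0) has_integral (u t - u a)) {a..t}"
  proof (rule abs_cont_fundamental[OF _ acu])
    \<comment> \<open>The end points join the exceptional set so that the derivative within
      \<open>{a..b}\<close> is a two-sided one elsewhere.\<close>
    show "negligible (N \<union> N1 \<union> {a, b})" using N N1 by (simp add: negligible_Un)
    fix x assume x: "x \<in> {a..t} - (N \<union> N1 \<union> {a, b})"
    then have xi: "x \<in> {a<..<b}" using t by auto
    then have "at x within {a..b} = at x" by (simp add: at_within_Icc_at)
    then have dy: "(y has_vector_derivative A x * y x) (at x)" using der[of x] x xi by auto
    have dF: "(F has_vector_derivative A x) (at x)" using N1(2) x xi by auto
    have de: "((\<lambda>t. exp (- F t)) has_vector_derivative - A x * exp (- F x)) (at x)"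
      using field_vector_diff_chain_at[of "\<lambda>t. - F t" "- A x" x exp "exp (- F x)"] dF
      by (auto simp: o_def intro!: derivative_eq_intros)
    have "(u has_vector_derivative (y x * (- A x * exp (- F x)) + A x * y x * exp (- F x))) (at x)"
      unfolding u_def by (rule has_vector_derivative_mult[OF dy de])
    then have "(u has_vector_derivative 0) (at x)" by (simp add: algebra_simps)
    then show "(u has_vector_derivative 0) (at x within {a..t})"
      by (rule has_vector_derivative_at_within)
  qed (use t in auto)
  then have "u t = u a" using has_integral_unique[OF has_integral_0] by fastforce
  then show ?thesis by (simp add: u_def F_def exp_minus field_simps)
qed

text \<open>For continuation arguments: an estimate valid as long as \<open>f\<close> stays at most
  \<open>e\<close> holds up to the first time at which \<open>f\<close> equals \<open>e\<close>, and
  is then contradicted there.\<close>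

lemma first_hit:
  fixes f :: "real \<Rightarrow> real"
  assumes c: "continuous_on {a..b} f" and a: "f a < e" and t: "t \<in> {a..b}" "e \<le> f t"
  obtains t1 where "a < t1" "t1 \<le> t" "f t1 = e" "\<And>x. x \<in> {a..t1} \<Longrightarrow> f x \<le> e"
proof -
  define S where "S = {x \<in> {a..t}. f x = e}"
  have ct: "continuous_on {a..t} f" using c by (rule continuous_on_subset) (use t in auto)
  have ivt: "\<exists>x\<in>{a..y}. f x = e" if "y \<in> {a..t}" "e \<le> f y" for y
    using IVT'[of f a e y] a that continuous_on_subset[OF ct, of "{a..y}"] by auto
  have "\<exists>x\<in>{a..t}. f x = e" using ivt[of t] t by auto
  then obtain x0 where "x0 \<in> S" unfolding S_def by blast
  moreover have "closed S"
    unfolding S_def by (rule continuous_closed_preimage_constant[OF ct closed_atLeastAtMost])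
  moreover have "bounded S" by (rule bounded_subset[of "{a..t}"]) (auto simp: S_def)
  ultimately obtain t1 where t1: "t1 \<in> S" "\<And>x. x \<in> S \<Longrightarrow> t1 \<le> x"
    using compact_attains_inf[of S] by (auto simp: compact_eq_bounded_closed)
  show thesis
  proof
    show "a < t1" using t1(1) a by (cases "t1 = a") (auto simp: S_def)
    show "t1 \<le> t" "f t1 = e" using t1(1) by (auto simp: S_def)
    fix x assume x: "x \<in> {a..t1}"
    show "f x \<le> e"
    proof (rule ccontr)
      assume "\<not> f x \<le> e"
      then obtain y where "y \<in> {a..x}" "f y = e" using ivt[of x] x t1(1) by (auto simp: S_def)
      then have "y \<in> S" using x t1(1) by (auto simp: S_def)
      then have "t1 \<le> y" by (rule t1(2))
      then have "y = x" using \<open>y \<in> {a..x}\<close> x by auto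
      then show False using \<open>f y = e\<close> \<open>\<not> f x \<le> e\<close> by simp
    qed
  qed
qed

section \<open>Trajectories of a weak holomorphic vector field\<close>

text \<open>Cauchy's inequality on circles of radius \<open>e\<close> centred in
  \<open>cball c e\<close>, which stay inside \<open>cball c (2 * e)\<close>, bounds the derivative
  by \<open>B / e\<close>.\<close>

lemma holomorphic_Lipschitz_cball:
  assumes f: "f holomorphic_on S" and S: "open S" and sub: "cball c (2 * e) \<subseteq> S" and e: "e > 0"
    and B: "\<And>z. z \<in> cball c (2 * e) \<Longrightarrow> norm (f z) \<le> B"
    and xy: "x \<in> cball c e" "y \<in> cball c e"
  shows "norm (f x - f y) \<le> B / e * norm (x - y)"
proof (rule field_differentiable_bound[of "cball c e" f "deriv f"])
  fix z assume z: "z \<in> cball c e"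
  then have sub': "cball z e \<subseteq> cball c (2 * e)" by (auto simp: cball_subset_cball_iff dist_commute)
  have zS: "z \<in> S" using z sub e by (auto simp: subset_iff)
  show "(f has_field_derivative deriv f z) (at z within cball c e)"
    using holomorphic_derivI[OF f S zS] by (rule has_field_derivative_at_within)
  have "norm ((deriv ^^ 1) f z) \<le> fact 1 * B / e ^ 1"
  proof (rule Cauchy_inequality)
    show "f holomorphic_on ball z e" using f by (rule holomorphic_on_subset) (use sub' sub in force)
    show "continuous_on (cball z e) f"
      using holomorphic_on_imp_continuous_on[OF f] by (rule continuous_on_subset) (use sub' sub in force)
    show "norm (f x) \<le> B" if "norm (z - x) = e" for x
      using that sub' by (intro B) (auto simp: subset_iff dist_norm)
  qed (use e in auto)
  then show "norm (deriv f z) \<le> B / e" by simp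
qed (use xy in auto)

lemma AE_negligible_iff:
  "(AE t in lebesgue. t \<in> J \<longrightarrow> P t) \<longleftrightarrow> (\<exists>N. negligible N \<and> (\<forall>t\<in>J - N. P t))"
proof
  assume "AE t in lebesgue. t \<in> J \<longrightarrow> P t"
  then obtain N where "N \<in> null_sets lebesgue" "{t. \<not> (t \<in> J \<longrightarrow> P t)} \<subseteq> N"
    by (auto simp: eventually_ae_filter)
  then show "\<exists>N. negligible N \<and> (\<forall>t\<in>J - N. P t)"
    by (intro exI[of _ N]) (auto simp: negligible_iff_null_sets)
next
  assume "\<exists>N. negligible N \<and> (\<forall>t\<in>J - N. P t)"
  then obtain N where "negligible N" "\<forall>t\<in>J - N. P t" by blast
  then show "AE t in lebesgue. t \<in> J \<longrightarrow> P t"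
    by (intro AE_I'[of N]) (auto simp: negligible_iff_null_sets)
qed

section \<open>Growing annuli and solutions on compact time intervals\<close>

locale annular_domains =
  fixes D :: "real \<Rightarrow> complex set" and r :: "real \<Rightarrow> real"
  assumes r_nonneg: "\<And>t. 0 \<le> t \<Longrightarrow> 0 \<le> r t" and r_less_1: "\<And>t. 0 \<le> t \<Longrightarrow> r t < 1"
    and D_eq: "\<And>t. 0 \<le> t \<Longrightarrow> D t = annulus (r t)"
    and r_antimono: "\<And>s t. 0 \<le> s \<Longrightarrow> s \<le> t \<Longrightarrow> r t \<le> r s"
    and r_cont: "continuous_on {0..} r"
begin

lemma mem_D: "0 \<le> t \<Longrightarrow> z \<in> D t \<longleftrightarrow> r t < norm z \<and> norm z < 1"
  by (simp add: D_eq annulus_def)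

lemma mem_total_domain: "(z, t) \<in> total_domain D \<longleftrightarrow> 0 \<le> t \<and> z \<in> D t"
  by (simp add: total_domain_def)

lemma D_mono: "0 \<le> s \<Longrightarrow> s \<le> t \<Longrightarrow> D s \<subseteq> D t"
  using r_antimono[of s t] by (auto simp: mem_D)

lemma open_D: "0 \<le> t \<Longrightarrow> open (D t)"
  unfolding D_eq annulus_def by (intro open_Collect_conj open_Collect_less continuous_intros)

text \<open>The distances from \<open>w t\<close> to the two boundary circles depend continuously on
  \<open>t\<close>, so they have a common positive lower bound; half of it leaves a compact tube
  inside the total domain.\<close>

lemma tube:
  assumes a: "0 \<le> a" "a \<le> b" and w: "continuous_on {a..b} w" and D: "\<And>t. t \<in> {a..b} \<Longrightarrow> w t \<in> D t"
  obtains e where "e > 0" "\<And>t. t \<in> {a..b} \<Longrightarrow> cball (w t) e \<subseteq> D t"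
    "compact ((\<lambda>(x, t). (w t + x, t)) ` (cball 0 e \<times> {a..b}))"
proof -
  define f where "f t = min (norm (w t) - r t) (1 - norm (w t))" for t
  have "continuous_on {a..b} r" using r_cont by (rule continuous_on_subset) (use a in auto)
  then have "continuous_on {a..b} f" unfolding f_def by (intro continuous_intros w)
  moreover have "{a..b} \<noteq> {}" using a by simp
  ultimately obtain t0 where t0: "t0 \<in> {a..b}" "\<And>t. t \<in> {a..b} \<Longrightarrow> f t0 \<le> f t"
    using continuous_attains_inf[of "{a..b}" f] by auto
  have pos: "f t0 > 0" using D[OF t0(1)] a t0(1) by (auto simp: f_def mem_D)
  show thesis
  proof
    show "f t0 / 2 > 0" using pos by simp
    fix t assume t: "t \<in> {a..b}"
    show "cball (w t) (f t0 / 2) \<subseteq> D t"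
    proof
      fix z assume "z \<in> cball (w t) (f t0 / 2)"
      then have "norm (w t - z) < f t" using t0(2)[OF t] pos by (auto simp: dist_norm)
      then show "z \<in> D t" using t a norm_triangle_ineq2[of "w t" z] norm_triangle_ineq2[of z "w t"]
        by (auto simp: mem_D f_def norm_minus_commute)
    qed
  next
    have "continuous_on (cball 0 (f t0 / 2) \<times> {a..b}) (\<lambda>p. w (snd p))"
      by (rule continuous_on_compose2[OF w continuous_on_snd]) (auto intro: continuous_intros)
    then show "compact ((\<lambda>(x, t). (w t + x, t)) ` (cball 0 (f t0 / 2) \<times> {a..b}))"
      unfolding case_prod_beta'
      by (intro compact_continuous_image compact_Times continuous_intros) auto
  qed
qed

end

locale vector_field = annular_domains +
  fixes G :: "complex \<Rightarrow> real \<Rightarrow> complex" and d :: ennreal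
  assumes d: "1 \<le> d" and G: "weak_hol_vector_field d D G"
begin

lemma G_holomorphic: "0 \<le> t \<Longrightarrow> (\<lambda>z. G z t) holomorphic_on D t"
  using G by (simp add: weak_hol_vector_field_def)

lemma compact_bound:
  assumes K: "compact K" "K \<subseteq> total_domain D"
  obtains k :: "real \<Rightarrow> real" where "\<And>t. t \<in> snd ` K \<Longrightarrow> 0 \<le> k t" "Ld d (snd ` K) k"
    "k absolutely_integrable_on snd ` K" "\<And>z t. (z, t) \<in> K \<Longrightarrow> norm (G z t) \<le> k t"
proof -
  obtain k :: "real \<Rightarrow> real" where k: "\<forall>t\<in>snd ` K. 0 \<le> k t" "Ld d (snd ` K) k" "\<forall>(z, t)\<in>K. norm (G z t) \<le> k t"
    using G K unfolding weak_hol_vector_field_def by blast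
  have "compact (snd ` K)" by (intro compact_continuous_image K continuous_intros)
  then have "k absolutely_integrable_on snd ` K"
    by (intro Ld_imp_absolutely_integrable[OF k(2) _ d] lmeasurable_compact)
  then show thesis using that[of k] k by fastforce
qed

text \<open>Solutions on a compact interval without reference to an initial value, so that they can
  be cut, glued and compared. The exceptional set is a negligible one, as the gauge integral wants
  it.\<close>

definition traj :: "real \<Rightarrow> real \<Rightarrow> (real \<Rightarrow> complex) \<Rightarrow> bool" where
  "traj a b w \<longleftrightarrow> 0 \<le> a \<and> a \<le> b \<and> abs_cont_on {a..b} w \<and> (\<forall>t\<in>{a..b}. w t \<in> D t) \<and>
    (\<exists>N. negligible N \<and> (\<forall>t\<in>{a..b} - N. (w has_vector_derivative G (w t) t) (at t within {a..b})))"

lemma traj_subinterval: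
  assumes "traj a b w" "a \<le> a'" "a' \<le> b'" "b' \<le> b"
  shows "traj a' b' w"
proof -
  obtain N where N: "negligible N" "\<And>t. t \<in> {a..b} - N \<Longrightarrow> (w has_vector_derivative G (w t) t) (at t within {a..b})"
    using assms(1) unfolding traj_def by blast
  have sub: "{a'..b'} \<subseteq> {a..b}" using assms by auto
  have "(w has_vector_derivative G (w t) t) (at t within {a'..b'})" if "t \<in> {a'..b'} - N" for t
    using that sub by (intro has_vector_derivative_within_subset[OF N(2) sub]) auto
  moreover have "abs_cont_on {a'..b'} w"
    using assms(1) sub by (auto simp: traj_def intro: abs_cont_on_subset)
  ultimately show ?thesis using assms N(1) unfolding traj_def by auto
qed

lemma traj_cong:
  assumes "traj a b w" "\<And>t. t \<in> {a..b} \<Longrightarrow> v t = w t"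
  shows "traj a b v"
proof -
  obtain N where N: "negligible N" "\<And>t. t \<in> {a..b} - N \<Longrightarrow> (w has_vector_derivative G (w t) t) (at t within {a..b})"
    using assms(1) unfolding traj_def by blast
  have "(v has_vector_derivative G (v t) t) (at t within {a..b})" if "t \<in> {a..b} - N" for t
    using N(2)[OF that] assms(2) that
    by (metis DiffD1 has_vector_derivative_transform)
  moreover have "abs_cont_on {a..b} v"
    using assms(1) by (auto simp: traj_def assms(2) intro: abs_cont_on_bound2[where C = 1 and f = w and g = w])
  ultimately show ?thesis using assms N(1) unfolding traj_def by auto
qed

lemma traj_cont: "traj a b w \<Longrightarrow> continuous_on {a..b} w"
  by (simp add: traj_def abs_cont_on_continuous)

text \<open>Also the source of the measurability of \<open>G (w t) t\<close> in \<open>t\<close>: a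
  vector field is only assumed measurable in time for a fixed point, but this function is a
  derivative almost everywhere and therefore integrable.\<close>

lemma traj_integral:
  assumes "traj a b w" "t \<in> {a..b}"
  shows "((\<lambda>t. G (w t) t) has_integral (w t - w a)) {a..t}"
proof -
  have "traj a t w" using traj_subinterval[OF assms(1), of a t] assms by (auto simp: traj_def)
  then have *: "a \<le> t" "abs_cont_on {a..t} w"
    "\<exists>N. negligible N \<and> (\<forall>x\<in>{a..t} - N. (w has_vector_derivative G (w x) x) (at x within {a..t}))"
    by (auto simp: traj_def)
  then obtain N where N: "negligible N"
    "\<And>x. x \<in> {a..t} - N \<Longrightarrow> (w has_vector_derivative G (w x) x) (at x within {a..t})"
    by blast
  show ?thesis by (rule abs_cont_fundamental[OF *(1,2) N])
qed

text \<open>At times where \<open>v\<close> and \<open>w\<close> meet the quotient is zero by the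
  convention on division, and the linear equation persists there because both of its sides
  vanish.\<close>

lemma traj_diff:
  assumes v: "traj a b v" and w: "traj a b w" and k: "k absolutely_integrable_on {a..b}"
    and A: "\<And>t. t \<in> {a..b} \<Longrightarrow> norm ((G (v t) t - G (w t) t) / (v t - w t)) \<le> k t"
  shows "(\<lambda>t. (G (v t) t - G (w t) t) / (v t - w t)) absolutely_integrable_on {a..b}" (is ?A)
    and "\<And>t. t \<in> {a..b} \<Longrightarrow>
      v t - w t = (v a - w a) * exp (integral {a..t} (\<lambda>t. (G (v t) t - G (w t) t) / (v t - w t)))"
proof -
  have ab: "a \<le> b" using v by (simp add: traj_def)
  have m: "(\<lambda>t. G (w t) t) \<in> borel_measurable (lebesgue_on {a..b})" if "traj a b w" for w
    
  proof -
    have "b \<in> {a..b}" using ab by simp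
    from traj_integral[OF that this] have "(\<lambda>t. G (w t) t) integrable_on {a..b}" by (rule has_integral_integrable)
    then show ?thesis by (rule integrable_imp_measurable)
  qed
  have mc: "w \<in> borel_measurable (lebesgue_on {a..b})" if "traj a b w" for w
    using traj_cont[OF that] by (intro continuous_imp_measurable_on_sets_lebesgue) auto
  show A1: ?A
  proof (rule measurable_bounded_by_integrable_imp_absolutely_integrable)
    show "(\<lambda>t. (G (v t) t - G (w t) t) / (v t - w t)) \<in> borel_measurable (lebesgue_on {a..b})"
      by (intro borel_measurable_divide borel_measurable_diff m mc v w)
    show "k integrable_on {a..b}" using k set_lebesgue_integral_eq_integral(1) by blast
  qed (use A in auto)
  obtain N1 where N1: "negligible N1" "\<And>t. t \<in> {a..b} - N1 \<Longrightarrow> (w has_vector_derivative G (w t) t) (at t within {a..b})"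
    using w unfolding traj_def by blast
  obtain N2 where N2: "negligible N2" "\<And>t. t \<in> {a..b} - N2 \<Longrightarrow> (v has_vector_derivative G (v t) t) (at t within {a..b})"
    using v unfolding traj_def by blast
  show "v t - w t = (v a - w a) * exp (integral {a..t} (\<lambda>t. (G (v t) t - G (w t) t) / (v t - w t)))"
    if "t \<in> {a..b}" for t
  proof (rule linear_ode_solution[of a b "\<lambda>t. v t - w t", OF _ A1 _ _ that])
    show "abs_cont_on {a..b} (\<lambda>t. v t - w t)" using v w by (auto simp: traj_def intro: abs_cont_on_diff)
    show "negligible (N1 \<union> N2)" using N1 N2 by simp
    fix x assume "x \<in> {a..b} - (N1 \<union> N2)"
    then have "((\<lambda>t. v t - w t) has_vector_derivative G (v x) x - G (w x) x) (at x within {a..b})"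
      by (intro has_vector_derivative_diff N1(2) N2(2)) auto
    moreover have "G (v x) x - G (w x) x = (G (v x) x - G (w x) x) / (v x - w x) * (v x - w x)" by simp
    ultimately show "((\<lambda>t. v t - w t) has_vector_derivative (G (v x) x - G (w x) x) / (v x - w x) * (v x - w x)) (at x within {a..b})"
      by simp
  qed
qed

text \<open>The tube is compact, so (WHVF3) bounds \<open>G\<close> on it by one density
  \<open>k\<close>; halving its radius turns this bound into the Lipschitz constant
  \<open>k t / e\<close>.\<close>

lemma traj_tube:
  assumes w: "traj a b w"
  obtains e k where "e > 0" "k absolutely_integrable_on {a..b}" "\<And>t. t \<in> {a..b} \<Longrightarrow> 0 \<le> k t"
    "\<And>t. t \<in> {a..b} \<Longrightarrow> cball (w t) (2 * e) \<subseteq> D t"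
    "\<And>t z. t \<in> {a..b} \<Longrightarrow> z \<in> cball (w t) (2 * e) \<Longrightarrow> norm (G z t) \<le> k t"
    "\<And>t x y. t \<in> {a..b} \<Longrightarrow> x \<in> cball (w t) e \<Longrightarrow> y \<in> cball (w t) e \<Longrightarrow>
      norm (G x t - G y t) \<le> k t / e * norm (x - y)"
    "compact ((\<lambda>(x, t). (w t + x, t)) ` (cball 0 (2 * e) \<times> {a..b}))"
proof -
  have ab: "0 \<le> a" "a \<le> b" "\<And>t. t \<in> {a..b} \<Longrightarrow> w t \<in> D t" using w by (auto simp: traj_def)
  obtain e0 where e0: "e0 > 0" "\<And>t. t \<in> {a..b} \<Longrightarrow> cball (w t) e0 \<subseteq> D t"
    "compact ((\<lambda>(x, t). (w t + x, t)) ` (cball 0 e0 \<times> {a..b}))"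
    using tube[OF ab(1,2) traj_cont[OF w] ab(3)] by blast
  define K where "K = (\<lambda>(x, t). (w t + x, t)) ` (cball 0 e0 \<times> {a..b})"
  have Kmem: "(z, t) \<in> K \<longleftrightarrow> t \<in> {a..b} \<and> z \<in> cball (w t) e0" for z t
    unfolding K_def by (auto simp: image_iff dist_norm norm_minus_commute intro!: bexI[of _ "z - w t"])
  have "K \<subseteq> total_domain D"
  proof clarify
    fix z t assume "(z, t) \<in> K"
    then have "t \<in> {a..b}" "z \<in> cball (w t) e0" by (auto simp: Kmem)
    then show "(z, t) \<in> total_domain D" using e0(2)[of t] ab by (auto simp: mem_total_domain)
  qed
  moreover have "compact K" unfolding K_def by (rule e0(3))
  ultimately obtain k where k: "\<And>t. t \<in> snd ` K \<Longrightarrow> 0 \<le> k t" 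
    "k absolutely_integrable_on snd ` K" "\<And>z t. (z, t) \<in> K \<Longrightarrow> norm (G z t) \<le> k t"
    using compact_bound by metis
  have sndK: "snd ` K = {a..b}"
  proof safe
    fix t assume "t \<in> {a..b}" then have "(w t, t) \<in> K" using e0(1) by (auto simp: Kmem)
    then show "t \<in> snd ` K" by force
  qed (auto simp: K_def)
  show thesis
  proof
    show "e0 / 2 > 0" using e0(1) by simp
    show "k absolutely_integrable_on {a..b}" using k(2) sndK by simp
    show "0 \<le> k t" if "t \<in> {a..b}" for t using k(1) sndK that by auto
    show "cball (w t) (2 * (e0 / 2)) \<subseteq> D t" if "t \<in> {a..b}" for t using e0(2)[OF that] by simp
    show *: "norm (G z t) \<le> k t" if "t \<in> {a..b}" "z \<in> cball (w t) (2 * (e0 / 2))" for t z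
      using that by (intro k(3)) (auto simp: Kmem)
    show "norm (G x t - G y t) \<le> k t / (e0 / 2) * norm (x - y)"
      if "t \<in> {a..b}" "x \<in> cball (w t) (e0 / 2)" "y \<in> cball (w t) (e0 / 2)" for t x y
      using that ab e0 by (intro holomorphic_Lipschitz_cball[OF G_holomorphic open_D _ _ *, of t]) auto
    show "compact ((\<lambda>(x, t). (w t + x, t)) ` (cball 0 (2 * (e0 / 2)) \<times> {a..b}))" using e0(3) by simp
  qed
qed

text \<open>Where the trajectories are \<open>e\<close>-close the Lipschitz bound controls the
  quotient; elsewhere its denominator exceeds \<open>e\<close>, and the bounds of \<open>G\<close>
  along both trajectories do.\<close>

lemma traj_diff_exp:
  assumes v: "traj a b v" and w: "traj a b w"
  obtains A where "\<And>t. t \<in> {a..b} \<Longrightarrow> v t - w t = (v a - w a) * exp (A t)"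
proof -
  obtain e k where e: "e > 0" "k absolutely_integrable_on {a..b}" "\<And>t. t \<in> {a..b} \<Longrightarrow> 0 \<le> k t"
    "\<And>t. t \<in> {a..b} \<Longrightarrow> cball (w t) (2 * e) \<subseteq> D t"
    "\<And>t z. t \<in> {a..b} \<Longrightarrow> z \<in> cball (w t) (2 * e) \<Longrightarrow> norm (G z t) \<le> k t"
    "\<And>t x y. t \<in> {a..b} \<Longrightarrow> x \<in> cball (w t) e \<Longrightarrow> y \<in> cball (w t) e \<Longrightarrow>
      norm (G x t - G y t) \<le> k t / e * norm (x - y)"
    "compact ((\<lambda>(x, t). (w t + x, t)) ` (cball 0 (2 * e) \<times> {a..b}))"
    by (rule traj_tube[OF w]) (rule that)
  obtain e' k' where e': "e' > 0" "k' absolutely_integrable_on {a..b}" "\<And>t. t \<in> {a..b} \<Longrightarrow> 0 \<le> k' t"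
    "\<And>t. t \<in> {a..b} \<Longrightarrow> cball (v t) (2 * e') \<subseteq> D t"
    "\<And>t z. t \<in> {a..b} \<Longrightarrow> z \<in> cball (v t) (2 * e') \<Longrightarrow> norm (G z t) \<le> k' t"
    "\<And>t x y. t \<in> {a..b} \<Longrightarrow> x \<in> cball (v t) e' \<Longrightarrow> y \<in> cball (v t) e' \<Longrightarrow>
      norm (G x t - G y t) \<le> k' t / e' * norm (x - y)"
    "compact ((\<lambda>(x, t). (v t + x, t)) ` (cball 0 (2 * e') \<times> {a..b}))"
    by (rule traj_tube[OF v]) (rule that)
  have ai: "(\<lambda>t. (k t + k' t) / e) absolutely_integrable_on {a..b}"
    using e(2) e'(2) by (intro set_integrable_divide set_integral_add) auto
  have bd: "norm ((G (v t) t - G (w t) t) / (v t - w t)) \<le> (k t + k' t) / e" if t: "t \<in> {a..b}" for t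
  proof (cases "norm (v t - w t) \<le> e")
    case True
    have "norm (G (v t) t - G (w t) t) \<le> k t / e * norm (v t - w t)"
      using True e(1) by (intro e(6)[OF t]) (auto simp: dist_norm norm_minus_commute)
    then have "norm ((G (v t) t - G (w t) t) / (v t - w t)) \<le> k t / e"
      using e(1,3) t by (cases "v t = w t") (auto simp: norm_divide divide_simps)
    also have "\<dots> \<le> (k t + k' t) / e" using e(1) e'(3)[OF t] by (intro divide_right_mono) auto
    finally show ?thesis .
  next
    case False
    have "norm (G (v t) t - G (w t) t) \<le> k' t + k t"
      using e(1) e'(1) by (intro norm_triangle_le_diff add_mono e(5)[OF t] e'(5)[OF t]) auto
    then have "norm (G (v t) t - G (w t) t) / norm (v t - w t) \<le> (k' t + k t) / e"
      using False e(1) e(3)[OF t] e'(3)[OF t] by (intro frac_le) auto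
    then show ?thesis by (simp add: norm_divide add.commute)
  qed
  show thesis by (rule that) (rule traj_diff(2)[OF v w ai bd])
qed

text \<open>The exponential has no zeros, so a common value at any one time, not only the initial
  one, forces the initial values to agree and then all others.\<close>

lemma traj_unique:
  assumes "traj a b v" "traj a b w" "t0 \<in> {a..b}" "v t0 = w t0" "t \<in> {a..b}"
  shows "v t = w t"
proof -
  obtain A where A: "\<And>t. t \<in> {a..b} \<Longrightarrow> v t - w t = (v a - w a) * exp (A t)"
    using traj_diff_exp[OF assms(1,2)] by blast
  have "v a = w a" using A[OF assms(3)] assms(4) by simp
  then show ?thesis using A[OF assms(5)] by simp
qed

text \<open>Continuation argument: while \<open>v\<close> stays in the tube the exponential formula
  bounds \<open>v - w\<close>, and \<open>close\<close> makes this bound less than \<open>e\<close>,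
  so \<open>v\<close> cannot reach the boundary of the tube. The constant is taken over the fixed
  interval \<open>{a..b}\<close> and thus is uniform in the later starting time
  \<open>a'\<close>.\<close>

lemma traj_stay:
  assumes w: "traj a b w" and e: "e > 0" and k: "k absolutely_integrable_on {a..b}" "\<And>t. t \<in> {a..b} \<Longrightarrow> 0 \<le> k t"
    and lip: "\<And>t x y. t \<in> {a..b} \<Longrightarrow> x \<in> cball (w t) e \<Longrightarrow> y \<in> cball (w t) e \<Longrightarrow>
      norm (G x t - G y t) \<le> k t / e * norm (x - y)"
    and a': "a' \<in> {a..b}" and v: "traj a' b v"
    and close: "norm (v a' - w a') * exp (integral {a..b} (\<lambda>t. k t / e)) < e"
    and t: "t \<in> {a'..b}"
  shows "norm (v t - w t) \<le> norm (v a' - w a') * exp (integral {a..b} (\<lambda>t. k t / e))"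
    and "norm (v t - w t) < e"
proof -
  define M where "M = exp (integral {a..b} (\<lambda>t. k t / e))"
  have ki: "(\<lambda>t. k t / e) absolutely_integrable_on {a..b}" using k(1) by auto
  have wi: "traj a' b w" using w a' by (auto intro: traj_subinterval)
  have bd: "norm (v x - w x) \<le> norm (v a' - w a') * M"
    if x: "x \<in> {a'..b}" and le: "\<And>y. y \<in> {a'..x} \<Longrightarrow> norm (v y - w y) \<le> e" for x
  proof -
    have vx: "traj a' x v" "traj a' x w" using v wi x by (auto intro: traj_subinterval)
    have kx: "(\<lambda>t. k t / e) absolutely_integrable_on {a'..x}"
      using ki by (rule set_integrable_subset) (use a' x in auto)
    have A: "norm ((G (v t) t - G (w t) t) / (v t - w t)) \<le> k t / e" if t: "t \<in> {a'..x}" for t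
    proof -
      have t': "t \<in> {a..b}" using t a' x by auto
      have "norm (G (v t) t - G (w t) t) \<le> k t / e * norm (v t - w t)"
        using le[OF t] e by (intro lip[OF t']) (auto simp: dist_norm norm_minus_commute)
      then show ?thesis
        using e k(2)[OF t'] by (cases "v t = w t") (auto simp: norm_divide divide_simps)
    qed
    let ?A = "\<lambda>t. (G (v t) t - G (w t) t) / (v t - w t)"
    have "norm (v x - w x) = norm (v a' - w a') * norm (exp (integral {a'..x} ?A))"
      using traj_diff(2)[OF vx kx A, of x] x by (simp add: norm_mult)
    also have "norm (exp (integral {a'..x} ?A)) \<le> exp (norm (integral {a'..x} ?A))" by (rule norm_exp)
    also have "norm (integral {a'..x} ?A) \<le> integral {a'..x} (\<lambda>t. k t / e)"
    proof (rule integral_norm_bound_integral)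
      show "?A integrable_on {a'..x}"
        by (rule set_lebesgue_integral_eq_integral(1)[OF traj_diff(1)[OF vx kx A]])
      show "(\<lambda>t. k t / e) integrable_on {a'..x}" by (rule set_lebesgue_integral_eq_integral(1)[OF kx])
    qed (rule A)
    also have "\<dots> \<le> integral {a..b} (\<lambda>t. k t / e)"
      using kx ki set_lebesgue_integral_eq_integral(1) a' x e k(2)
      by (intro integral_subset_le) auto
    finally show ?thesis by (simp add: M_def mult_left_mono)
  qed
  have all: "norm (v t - w t) < e" if t: "t \<in> {a'..b}" for t
  proof (rule ccontr)
    assume "\<not> norm (v t - w t) < e"
    then have "e \<le> norm (v t - w t)" by simp
    moreover have "continuous_on {a'..b} (\<lambda>t. norm (v t - w t))"
      by (intro continuous_intros traj_cont v wi)
    moreover have "norm (v a' - w a') < e"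
    proof -
      have "norm (v a' - w a') * 1 \<le> norm (v a' - w a') * M"
      proof (rule mult_left_mono)
        have "0 \<le> integral {a..b} (\<lambda>t. k t / e)"
          by (rule integral_nonneg[OF set_lebesgue_integral_eq_integral(1)[OF ki]]) (use k(2) e in auto)
        then show "1 \<le> M" by (simp add: M_def)
      qed simp
      then show ?thesis using close by (simp add: M_def)
    qed
    ultimately obtain t1 where t1: "a' < t1" "t1 \<le> t" "norm (v t1 - w t1) = e"
        "\<And>x. x \<in> {a'..t1} \<Longrightarrow> norm (v x - w x) \<le> e"
      using first_hit[of a' b "\<lambda>t. norm (v t - w t)" e t] t by metis
    have "e \<le> norm (v a' - w a') * M" using bd[of t1] t1 t by auto
    then show False using close by (simp add: M_def)
  qed
  show "norm (v t - w t) < e" using all t by blast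
  show "norm (v t - w t) \<le> norm (v a' - w a') * exp (integral {a..b} (\<lambda>t. k t / e))"
    using bd[OF t] all t unfolding M_def by (meson atLeastAtMost_iff less_imp_le order_trans)
qed

end

context vector_field
begin

lemma traj_norm_le:
  assumes w: "traj a b w" and k: "k absolutely_integrable_on {a..b}"
    and bd: "\<And>t. t \<in> {a..b} \<Longrightarrow> norm (G (w t) t) \<le> k t" and uv: "a \<le> u" "u \<le> v" "v \<le> b"
  shows "norm (w v - w u) \<le> integral {u..v} k"
proof -
  have tr: "traj u v w" using traj_subinterval[OF w uv] .
  have v: "v \<in> {u..v}" using uv by simp
  have hi: "((\<lambda>t. G (w t) t) has_integral (w v - w u)) {u..v}" by (rule traj_integral[OF tr v])
  have ki: "k integrable_on {u..v}"
    using set_lebesgue_integral_eq_integral(1)[OF k] by (rule integrable_on_subinterval) (use uv in auto)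
  have "norm (integral {u..v} (\<lambda>t. G (w t) t)) \<le> integral {u..v} k"
    by (rule integral_norm_bound_integral[OF has_integral_integrable[OF hi] ki]) (use bd uv in auto)
  then show ?thesis using integral_unique[OF hi] by simp
qed

text \<open>An interval of a disjoint family may straddle \<open>c\<close>, so absolute continuity
  is obtained from a common integrable density for both pieces, whose integrals add up across
  \<open>c\<close>.\<close>

lemma traj_combine:
  assumes 1: "traj a c w" and 2: "traj c b w"
  shows "traj a b w"
proof -
  have ac: "0 \<le> a" "a \<le> c" "c \<le> b" using 1 2 by (auto simp: traj_def)
  have D: "w t \<in> D t" if "t \<in> {a..b}" for t
    using 1 2 that by (cases "t \<le> c") (auto simp: traj_def)
  have bnd: "\<exists>k. k absolutely_integrable_on {a..b} \<and> (\<forall>t. 0 \<le> k t) \<and> (\<forall>t\<in>{a..b}. norm (G (w t) t) \<le> k t)"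
    if tr: "traj a b w" for a b
  proof -
    obtain e k where e: "e > 0" "k absolutely_integrable_on {a..b}" "\<And>t. t \<in> {a..b} \<Longrightarrow> 0 \<le> k t"
      "\<And>t z. t \<in> {a..b} \<Longrightarrow> z \<in> cball (w t) (2 * e) \<Longrightarrow> norm (G z t) \<le> k t"
      by (rule traj_tube[OF tr]) (rule that)
    have "(\<lambda>t. \<bar>k t\<bar>) absolutely_integrable_on {a..b}"
      using absolutely_integrable_norm[OF e(2)] by (simp add: o_def)
    moreover have "norm (G (w t) t) \<le> \<bar>k t\<bar>" if "t \<in> {a..b}" for t
      using e(4)[OF that, of "w t"] e(1) by simp
    ultimately show ?thesis by (intro exI[of _ "\<lambda>t. \<bar>k t\<bar>"]) auto
  qed
  obtain k1 where k1: "k1 absolutely_integrable_on {a..c}" "\<And>t. 0 \<le> k1 t" "\<And>t. t \<in> {a..c} \<Longrightarrow> norm (G (w t) t) \<le> k1 t"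
    using bnd[OF 1] by blast
  obtain k2 where k2: "k2 absolutely_integrable_on {c..b}" "\<And>t. 0 \<le> k2 t" "\<And>t. t \<in> {c..b} \<Longrightarrow> norm (G (w t) t) \<le> k2 t"
    using bnd[OF 2] by blast
  define k where "k t = indicator {a..c} t * k1 t + indicator {c..b} t * k2 t" for t
  have "integrable lebesgue k" using k1(1) k2(1) by (auto simp: k_def[abs_def] set_integrable_def)
  then have k: "k absolutely_integrable_on {a..b}"
    by (metis UNIV_I absolutely_integrable_on_def integrable_on_lebesgue set_integrable_subset
        lebesgue_on_UNIV_eq integrable_restrict_space set_integrable_def sets.top subset_UNIV
        integrable_mult_indicator lmeasurable_interval(1) fmeasurableD)
  have knn: "0 \<le> k t" for t using k1 k2 by (simp add: k_def)
  have kb1: "norm (G (w t) t) \<le> k t" if "t \<in> {a..c}" for t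
    using k1(3)[OF that] k2(2)[of t] that by (auto simp: k_def indicator_def)
  have kb2: "norm (G (w t) t) \<le> k t" if "t \<in> {c..b}" for t
    using k2(3)[OF that] k1(2)[of t] that by (auto simp: k_def indicator_def)
  have kac: "k absolutely_integrable_on {a..c}" "k absolutely_integrable_on {c..b}"
    using k ac by (auto intro: set_integrable_subset)
  have "abs_cont_on {a..b} w"
  proof (rule abs_cont_on_dominated[OF k knn])
    fix u v assume uv: "a \<le> u" "u \<le> v" "v \<le> b"
    consider "v \<le> c" | "c \<le> u" | "u \<le> c" "c \<le> v" by linarith
    then show "norm (w v - w u) \<le> integral {u..v} k"
    proof cases
      case 3
      have "norm (w v - w u) \<le> norm (w v - w c) + norm (w c - w u)"
        using norm_triangle_ineq[of "w v - w c" "w c - w u"] by simp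
      also have "\<dots> \<le> integral {c..v} k + integral {u..c} k"
        using 3 uv by (intro add_mono traj_norm_le[OF 1 kac(1) kb1] traj_norm_le[OF 2 kac(2) kb2]) auto
      also have "\<dots> = integral {u..v} k"
        using Henstock_Kurzweil_Integration.integral_combine[of u c v k] 3
          integrable_on_subinterval[OF set_lebesgue_integral_eq_integral(1)[OF k], of u v] uv by auto
      finally show ?thesis .
    qed (use uv in \<open>auto intro: traj_norm_le[OF 1 kac(1) kb1] traj_norm_le[OF 2 kac(2) kb2]\<close>)
  qed
  moreover obtain N1 where N1: "negligible N1" "\<And>t. t \<in> {a..c} - N1 \<Longrightarrow> (w has_vector_derivative G (w t) t) (at t within {a..c})"
    using 1 unfolding traj_def by blast
  obtain N2 where N2: "negligible N2" "\<And>t. t \<in> {c..b} - N2 \<Longrightarrow> (w has_vector_derivative G (w t) t) (at t within {c..b})"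
    using 2 unfolding traj_def by blast
  have "(w has_vector_derivative G (w t) t) (at t within {a..b})" if "t \<in> {a..b} - (N1 \<union> N2 \<union> {a, b, c})" for t
  proof -
    have "(w has_vector_derivative G (w t) t) (at t)"
    proof (cases "t < c")
      case True
      then have "at t within {a..c} = at t" using that by (intro at_within_Icc_at) auto
      with N1(2)[of t] True that show ?thesis by auto
    next
      case False
      then have "at t within {c..b} = at t" using that by (intro at_within_Icc_at) auto
      with N2(2)[of t] False that show ?thesis by auto
    qed
    then show ?thesis by (rule has_vector_derivative_at_within)
  qed
  moreover have "negligible (N1 \<union> N2 \<union> {a, b, c})" using N1(1) N2(1) by (simp add: negligible_Un)
  ultimately show ?thesis using ac D unfolding traj_def
    by (metis order_trans)
qed

section \<open>Existence and uniqueness of the non-extendable solution\<close>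

lemma solution_traj:
  assumes "is_solution D G s z J w" "{a..b} \<subseteq> J" "a \<le> b"
  shows "traj a b w"
proof -
  obtain N where N: "negligible N" "\<And>t. t \<in> J - N \<Longrightarrow> (w has_vector_derivative G (w t) t) (at t within J)"
    using assms(1) unfolding is_solution_def AE_negligible_iff by blast
  have "(w has_vector_derivative G (w t) t) (at t within {a..b})" if "t \<in> {a..b} - N" for t
    using assms(2) that by (intro has_vector_derivative_within_subset[OF N(2) assms(2)]) auto
  then show ?thesis using assms N(1)
    by (auto simp: is_solution_def traj_def loc_abs_cont_on_def mem_total_domain subset_iff)
qed

lemma solution_unique:
  assumes v: "is_solution D G s z J v" and w: "is_solution D G s z J' w" and t: "t \<in> J" "t \<in> J'"
  shows "v t = w t"
proof -
  have i: "is_interval J" "s \<in> J" "v s = z" "is_interval J'" "s \<in> J'" "w s = z"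
    using v w by (auto simp: is_solution_def)
  have sub: "{min s t..max s t} \<subseteq> J" "{min s t..max s t} \<subseteq> J'"
    using i t mem_is_interval_1_I[of J "min s t" "max s t"] mem_is_interval_1_I[of J' "min s t" "max s t"]
    by (auto simp: min_def max_def split: if_splits)
  show ?thesis
    by (rule traj_unique[OF solution_traj[OF v sub(1)] solution_traj[OF w sub(2)], of s t]) (use i in auto)
qed

lemma solution_subset:
  assumes "is_solution D G s z J w" "J' \<subseteq> J" "is_interval J'" "s \<in> J'"
  shows "is_solution D G s z J' w"
proof -
  obtain N where N: "negligible N" "\<And>t. t \<in> J - N \<Longrightarrow> (w has_vector_derivative G (w t) t) (at t within J)"
    using assms(1) unfolding is_solution_def AE_negligible_iff by blast
  have "\<forall>t\<in>J' - N. (w has_vector_derivative G (w t) t) (at t within J')"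
    using assms(2) by (auto intro!: has_vector_derivative_within_subset[OF N(2) assms(2)])
  then have "AE t in lebesgue. t \<in> J' \<longrightarrow> (w has_vector_derivative G (w t) t) (at t within J')"
    unfolding AE_negligible_iff using N(1) by blast
  then show ?thesis
    using assms unfolding is_solution_def by (blast intro: loc_abs_cont_on_subset)
qed

text \<open>The null set may vary with the compact interval. Intervals with rational end points are
  countable and surround every interior point of \<open>J\<close>; what remains is the frontier of
  \<open>J\<close>, which is negligible.\<close>

lemma solutionI_traj:
  assumes J: "is_interval J" "J \<subseteq> {0..}" "s \<in> J" "w s = z"
    and tr: "\<And>a b. {a..b} \<subseteq> J \<Longrightarrow> a \<le> b \<Longrightarrow> traj a b w"
  shows "is_solution D G s z J w"
proof -
  have "abs_cont_on {a..b} w" if "{a..b} \<subseteq> J" for a b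
  proof (cases "a \<le> b")
    case False
    then have "P = {}" if "disjoint_intervals {a..b} P" for P
      using that by (auto simp: disjoint_intervals_def)
    then show ?thesis unfolding abs_cont_on_def by (metis sum.empty zero_less_one)
  qed (use tr[OF that] in \<open>auto simp: traj_def\<close>)
  moreover have "(w t, t) \<in> total_domain D" if "t \<in> J" for t
    using tr[of t t] that by (auto simp: traj_def mem_total_domain)
  moreover have "\<exists>N. negligible N \<and> (\<forall>t\<in>J - N. (w has_vector_derivative G (w t) t) (at t within J))"
  proof -
    define Q where "Q = {(a, b). a \<in> \<rat> \<and> b \<in> \<rat> \<and> a \<le> b \<and> {a..b} \<subseteq> J}"
    have "\<exists>N. negligible N \<and> (\<forall>t\<in>{fst p..snd p} - N. (w has_vector_derivative G (w t) t) (at t within {fst p..snd p}))"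
      if "p \<in> Q" for p
      using tr[of "fst p" "snd p"] that unfolding Q_def traj_def by auto
    then obtain N where N: "\<And>p. p \<in> Q \<Longrightarrow> negligible (N p)"
      "\<And>p t. p \<in> Q \<Longrightarrow> t \<in> {fst p..snd p} - N p \<Longrightarrow> (w has_vector_derivative G (w t) t) (at t within {fst p..snd p})"
      by metis
    have "countable Q" by (rule countable_subset[of _ "\<rat> \<times> \<rat>"]) (auto simp: Q_def countable_rat)
    then have neg: "negligible (\<Union>p\<in>Q. N p)"
      by (intro negligible_countable_Union) (use N(1) in auto)
    have "(w has_vector_derivative G (w t) t) (at t within J)" if t: "t \<in> J - ((\<Union>p\<in>Q. N p) \<union> frontier J)" for t
    proof -
      have "t \<in> interior J" using t by (metis DiffD1 DiffD2 DiffI UnI2 closure_subset frontier_def subsetD)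
      then obtain e where e: "e > 0" "ball t e \<subseteq> J" by (metis mem_interior)
      obtain a where a: "a \<in> \<rat>" "t - e < a" "a < t" using Rats_dense_in_real[of "t - e" t] e by auto
      obtain b where b: "b \<in> \<rat>" "t < b" "b < t + e" using Rats_dense_in_real[of t "t + e"] e by auto
      have "{a..b} \<subseteq> J" using a b e(2) by (force simp: dist_real_def)
      then have p: "(a, b) \<in> Q" using a b by (auto simp: Q_def)
      have "at t within {a..b} = at t" using a b by (intro at_within_Icc_at) auto
      then have "(w has_vector_derivative G (w t) t) (at t)" using N(2)[OF p, of t] t p a b by auto
      then show ?thesis by (rule has_vector_derivative_at_within)
    qed
    moreover have "negligible (frontier J)"
      using J(1) by (simp add: is_interval_convex_1 negligible_convex_frontier)
    ultimately show ?thesis using neg by (intro exI[of _ "(\<Union>p\<in>Q. N p) \<union> frontier J"]) auto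
  qed
  ultimately show ?thesis using J unfolding is_solution_def loc_abs_cont_on_def AE_negligible_iff by blast
qed

lemma trivial_solution:
  assumes "(z, s) \<in> total_domain D"
  shows "is_solution D G s z {s} (\<lambda>_. z)"
proof (rule solutionI_traj)
  fix a b assume ab: "{a..b} \<subseteq> {s}" "a \<le> b"
  then have "a = s" "b = s" by auto
  then show "traj a b (\<lambda>_. z)"
    using assms by (auto simp: traj_def mem_total_domain abs_cont_on_def intro!: exI[of _ 1] exI[of _ "{s}"])
qed (use assms in \<open>auto simp: mem_total_domain is_interval_1\<close>)

text \<open>By uniqueness all solutions of the initial value problem agree where they overlap, so
  they glue to a solution on the union of their intervals. This gives a greatest solution and not
  only a maximal one.\<close>

lemma max_solution_exists:
  assumes zs: "(z, s) \<in> total_domain D"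
  obtains J w where "is_solution D G s z J w" "\<forall>J' v. is_solution D G s z J' v \<longrightarrow> J' \<subseteq> J"
proof -
  define S where "S = {J. \<exists>w. is_solution D G s z J w}"
  define w where "w t = (SOME y. \<exists>J v. is_solution D G s z J v \<and> t \<in> J \<and> v t = y)" for t
  have w: "w t = v t" if sol: "is_solution D G s z J v" "t \<in> J" for J v t
  proof -
    have "\<exists>J v'. is_solution D G s z J v' \<and> t \<in> J \<and> v' t = w t"
      unfolding w_def by (rule someI[of _ "v t"]) (use sol in blast)
    then obtain J' v' where "is_solution D G s z J' v'" "t \<in> J'" "v' t = w t" by blast
    then show ?thesis using solution_unique[OF sol(1) _ sol(2)] by metis
  qed
  have S: "is_interval J \<and> J \<subseteq> {0..} \<and> s \<in> J" if "J \<in> S" for J using that by (auto simp: S_def is_solution_def)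
  \<comment> \<open>Every time of the union is joined to \<open>s\<close> inside the interval of one
    single solution; other intervals are then composed at \<open>s\<close>.\<close>
  have tr: "traj (min s t) (max s t) w" if t: "t \<in> \<Union>S" for t
  proof -
    obtain J v where J: "is_solution D G s z J v" "t \<in> J" using t by (auto simp: S_def)
    then have "{min s t..max s t} \<subseteq> J"
      using mem_is_interval_1_I[of J "min s t" "max s t"]
      by (auto simp: is_solution_def min_def max_def split: if_splits)
    then have "traj (min s t) (max s t) v" by (intro solution_traj[OF J(1)]) auto
    then show ?thesis by (rule traj_cong) (use w[OF J(1)] \<open>{min s t..max s t} \<subseteq> J\<close> in blast)
  qed
  have triv: "{s} \<in> S" using trivial_solution[OF zs] by (auto simp: S_def)
  have "is_solution D G s z (\<Union>S) w"
  proof (rule solutionI_traj)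
    show "is_interval (\<Union>S)" unfolding is_interval_connected_1
      by (rule connected_Union) (use S in \<open>auto simp: is_interval_connected_1\<close>)
    show "\<Union>S \<subseteq> {0..}" using S by blast
    show "s \<in> \<Union>S" using triv by blast
    show "w s = z" using w[OF trivial_solution[OF zs]] by simp
    fix a b assume ab: "{a..b} \<subseteq> \<Union>S" "a \<le> b"
    then have abS: "a \<in> \<Union>S" "b \<in> \<Union>S" by auto
    consider "b \<le> s" | "s \<le> a" | "a \<le> s" "s \<le> b" by linarith
    then show "traj a b w"
    proof cases
      case 1
      then have "traj a s w" using tr[OF abS(1)] ab(2) by (cases "a = s") (simp_all add: min_def max_def)
      then show ?thesis by (rule traj_subinterval) (use 1 ab in auto)
    next
      case 2
      then have "traj s b w" using tr[OF abS(2)] ab(2) by (cases "b = s") (simp_all add: min_def max_def)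
      then show ?thesis by (rule traj_subinterval) (use 2 ab in auto)
    next
      case 3
      then have "traj a s w" "traj s b w"
        using tr[OF abS(1)] tr[OF abS(2)] by (cases "a = s"; cases "b = s"; simp add: min_def max_def)+
      then show ?thesis by (rule traj_combine)
    qed
  qed
  then show thesis by (rule that) (auto simp: S_def)
qed

lemma nonextendable_unique:
  assumes "is_solution D G s z J w" and max: "\<forall>J' v. is_solution D G s z J' v \<longrightarrow> J' \<subseteq> J"
  shows "nonextendable_solution D G s z J w"
    and "nonextendable_solution D G s z J' v \<Longrightarrow> J' = J \<and> (\<forall>t\<in>J. v t = w t)"
proof -
  show "nonextendable_solution D G s z J w"
    using assms unfolding nonextendable_solution_def by blast
  assume v: "nonextendable_solution D G s z J' v"
  then have "is_solution D G s z J' v" by (simp add: nonextendable_solution_def)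
  then have "J' \<subseteq> J" "\<forall>t\<in>J'. w t = v t" using max solution_unique[OF assms(1)] by blast+
  then have "J' = J" using v assms(1) unfolding nonextendable_solution_def by metis
  then show "J' = J \<and> (\<forall>t\<in>J. v t = w t)" using \<open>\<forall>t\<in>J'. w t = v t\<close> by auto
qed

lemma
  assumes sol: "is_solution D G s z J w"
  shows solution_subset_max_interval: "J \<subseteq> max_interval D G s z"
    and max_solution_eq: "t \<in> J \<Longrightarrow> max_solution D G s z t = w t"
proof -
  have "(z, s) \<in> total_domain D" using sol by (auto simp: is_solution_def)
  then obtain J0 w0 where m: "is_solution D G s z J0 w0" "\<forall>J' v. is_solution D G s z J' v \<longrightarrow> J' \<subseteq> J0"
    by (rule max_solution_exists) blast
  note ne = nonextendable_unique[OF m]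
  have "max_interval D G s z = J0"
    unfolding max_interval_def using ne by (intro the_equality) (metis, metis)
  then show "J \<subseteq> max_interval D G s z" using m(2) sol by blast
  assume t: "t \<in> J"
  then have t0: "t \<in> J0" using m(2) sol by blast
  have "max_solution D G s z t = w0 t"
    unfolding max_solution_def by (rule the_equality) (use ne t0 in blast)+
  also have "\<dots> = w t" by (rule solution_unique[OF m(1) sol t0 t])
  finally show "max_solution D G s z t = w t" .
qed

lemma semicomplete_solution:
  assumes "semicomplete D G" "(z, s) \<in> total_domain D"
  obtains w where "is_solution D G s z {s..} w"
proof -
  obtain J0 w0 where m: "is_solution D G s z J0 w0" "\<forall>J' v. is_solution D G s z J' v \<longrightarrow> J' \<subseteq> J0"
    by (rule max_solution_exists[OF assms(2)]) blast
  note ne = nonextendable_unique[OF m]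
  have "max_interval D G s z = J0"
    unfolding max_interval_def using ne by (intro the_equality) (metis, metis)
  then have "{s..} \<subseteq> J0" using assms by (auto simp: semicomplete_def)
  then have "is_solution D G s z {s..} w0"
    by (intro solution_subset[OF m(1)]) (auto simp: is_interval_ci)
  then show thesis by (rule that)
qed

end

section \<open>The flow of a semicomplete vector field\<close>

text \<open>Isolates what the proof of (B) uses of \<open>max_solution\<close>: its orbits are
  trajectories with the right initial value.\<close>

locale trajectory_flow = vector_field +
  fixes \<phi> :: "real \<Rightarrow> real \<Rightarrow> complex \<Rightarrow> complex"
  assumes flow: "\<And>s t z. 0 \<le> s \<Longrightarrow> s \<le> t \<Longrightarrow> z \<in> D s \<Longrightarrow> traj s t (\<lambda>u. \<phi> s u z)"
    and flow_init: "\<And>s z. 0 \<le> s \<Longrightarrow> z \<in> D s \<Longrightarrow> \<phi> s s z = z"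
begin

lemma flow_in: "0 \<le> s \<Longrightarrow> s \<le> t \<Longrightarrow> z \<in> D s \<Longrightarrow> \<phi> s t z \<in> D t"
  using flow[of s t z] by (auto simp: traj_def)

lemma flow_comp:
  assumes "0 \<le> s" "s \<le> u" "u \<le> t" "z \<in> D s"
  shows "\<phi> s t z = \<phi> u t (\<phi> s u z)"
proof (rule traj_unique[of u t "\<lambda>x. \<phi> s x z" "\<lambda>x. \<phi> u x (\<phi> s u z)" u])
  show "traj u t (\<lambda>x. \<phi> s x z)"
    by (rule traj_subinterval[OF flow[of s t z]]) (use assms in auto)
  show "traj u t (\<lambda>x. \<phi> u x (\<phi> s u z))" using assms by (intro flow flow_in) auto
  show "\<phi> s u z = \<phi> u u (\<phi> s u z)" using assms flow_init[of u "\<phi> s u z"] flow_in[of s u z] by simp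
qed (use assms in auto)

text \<open>The difference quotient of the flow in the initial value is the exponential of an
  integral, so dominated convergence applies.\<close>

lemma flow_holomorphic:
  assumes st: "0 \<le> s" "s \<le> t"
  shows "\<phi> s t holomorphic_on D s"
proof -
  have "\<exists>L. (\<phi> s t has_field_derivative L) (at z)" if z: "z \<in> D s" for z
  proof -
    define w where "w x = \<phi> s x z" for x
    have w: "traj s t w" unfolding w_def by (rule flow[OF st z])
    have ws: "w s = z" using flow_init[OF st(1) z] by (simp add: w_def)
    obtain e k where e: "e > 0" and k: "k absolutely_integrable_on {s..t}" "\<And>x. x \<in> {s..t} \<Longrightarrow> 0 \<le> k x"
      and cb: "\<And>x. x \<in> {s..t} \<Longrightarrow> cball (w x) (2 * e) \<subseteq> D x"
      and bd: "\<And>x z. x \<in> {s..t} \<Longrightarrow> z \<in> cball (w x) (2 * e) \<Longrightarrow> norm (G z x) \<le> k x"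
      and lip: "\<And>x a b. x \<in> {s..t} \<Longrightarrow> a \<in> cball (w x) e \<Longrightarrow> b \<in> cball (w x) e \<Longrightarrow>
        norm (G a x - G b x) \<le> k x / e * norm (a - b)"
      and cp: "compact ((\<lambda>(x, t). (w t + x, t)) ` (cball 0 (2 * e) \<times> {s..t}))"
      by (rule traj_tube[OF w]) (rule that)
    define M where "M = exp (integral {s..t} (\<lambda>x. k x / e))"
    \<comment> \<open>\<open>M\<close> bounds the growth of distances in \<open>traj_stay\<close>:
      the first \<open>e\<close> keeps the initial value in \<open>D s\<close>, the quotient keeps
      the whole trajectory in the tube.\<close>
    define \<eta> where "\<eta> = min e (e / M)"
    have M: "M > 0" by (simp add: M_def)
    have \<eta>: "\<eta> > 0" using e M by (simp add: \<eta>_def)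
    have ke: "(\<lambda>x. k x / e) absolutely_integrable_on {s..t}" using k(1) by auto
    have near: "y \<in> D s" "norm (y - z) * M < e" if "y \<in> ball z \<eta>" for y
    proof -
      have "y \<in> cball (w s) (2 * e)" using that e by (auto simp: ws \<eta>_def)
      then show "y \<in> D s" using cb[of s] st by auto
      have "norm (y - z) < e / M" using that by (auto simp: dist_norm norm_minus_commute \<eta>_def)
      then show "norm (y - z) * M < e" using M by (simp add: field_simps)
    qed
    have stay: "norm (\<phi> s x y - w x) \<le> norm (y - z) * M" "norm (\<phi> s x y - w x) < e"
      if y: "y \<in> ball z \<eta>" and x: "x \<in> {s..t}" for x y
    proof -
      have v: "traj s t (\<lambda>x. \<phi> s x y)" using near(1)[OF y] st by (intro flow)
      have vs: "\<phi> s s y = y" using near(1)[OF y] st by (intro flow_init)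
      have cl: "norm (\<phi> s s y - w s) * exp (integral {s..t} (\<lambda>x. k x / e)) < e"
        using near(2)[OF y] by (simp add: vs ws M_def)
      have s: "s \<in> {s..t}" using st by simp
      show "norm (\<phi> s x y - w x) \<le> norm (y - z) * M"
        using traj_stay(1)[OF w e k lip s v cl x] by (simp add: vs ws M_def)
      show "norm (\<phi> s x y - w x) < e"
        using traj_stay(2)[OF w e k lip s v cl x] .
    qed
    define A where "A y x = (G (\<phi> s x y) x - G (w x) x) / (\<phi> s x y - w x)" for y x
    have A: "norm (A y x) \<le> k x / e" if y: "y \<in> ball z \<eta>" and x: "x \<in> {s..t}" for x y
    proof -
      have "norm (G (\<phi> s x y) x - G (w x) x) \<le> k x / e * norm (\<phi> s x y - w x)"
        using stay(2)[OF y x] e by (intro lip[OF x]) (auto simp: dist_norm norm_minus_commute)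
      then show ?thesis
        using e k(2)[OF x] by (cases "\<phi> s x y = w x") (auto simp: A_def norm_divide divide_simps)
    qed
    have dif: "A y absolutely_integrable_on {s..t} \<and>
        (\<forall>x\<in>{s..t}. \<phi> s x y - w x = (y - z) * exp (integral {s..x} (A y)))" if y: "y \<in> ball z \<eta>" for y
    proof -
      have v: "traj s t (\<lambda>x. \<phi> s x y)" using near(1)[OF y] st by (intro flow)
      have vs: "\<phi> s s y = y" using near(1)[OF y] st by (intro flow_init)
      show ?thesis
        using traj_diff[OF v w ke A[OF y, unfolded A_def]] by (auto simp: A_def[abs_def] vs ws)
    qed
    \<comment> \<open>The solution at time \<open>t\<close> of the equation linearised along
      \<open>w\<close>, with initial value one.\<close>
    define L where "L = exp (integral {s..t} (\<lambda>x. deriv (\<lambda>u. G u x) (w x)))"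
    have "((\<lambda>y. (\<phi> s t y - \<phi> s t z) / (y - z)) \<longlongrightarrow> L) (at z within ball z \<eta>)"
      unfolding tendsto_at_iff_sequentially
    proof (intro allI impI)
      fix X :: "nat \<Rightarrow> complex" assume X: "\<forall>i. X i \<in> ball z \<eta> - {z}" and Xz: "X \<longlonglongrightarrow> z"
      have lim: "(\<lambda>n. A (X n) x) \<longlonglongrightarrow> deriv (\<lambda>u. G u x) (w x)" if x: "x \<in> {s..t}" for x
      proof -
        have wx: "w x \<in> D x" using w x by (auto simp: traj_def)
        have x0: "0 \<le> x" using x st by auto
        have "((\<lambda>u. G u x) has_field_derivative deriv (\<lambda>u. G u x) (w x)) (at (w x))"
          by (rule holomorphic_derivI[OF G_holomorphic[OF x0] open_D[OF x0] wx])
        then have d: "((\<lambda>u. (G u x - G (w x) x) / (u - w x)) \<longlongrightarrow> deriv (\<lambda>u. G u x) (w x)) (at (w x))"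
          by (simp add: has_field_derivative_iff)
        have "(\<lambda>n. \<phi> s x (X n) - w x) \<longlonglongrightarrow> 0"
        proof (rule Lim_null_comparison)
          show "\<forall>\<^sub>F n in sequentially. norm (\<phi> s x (X n) - w x) \<le> norm (X n - z) * M"
            using stay(1)[OF _ x] X by auto
          show "(\<lambda>n. norm (X n - z) * M) \<longlonglongrightarrow> 0"
            using Xz by (auto intro!: tendsto_eq_intros tendsto_norm_zero LIM_zero)
        qed
        then have "(\<lambda>n. \<phi> s x (X n)) \<longlonglongrightarrow> w x" by (rule LIM_zero_cancel)
        \<comment> \<open>Trajectories with different initial values never meet, so
          \<open>A (X n) x\<close> is a genuine difference quotient and not the default value
          zero.\<close>
        moreover have "\<phi> s x (X n) \<noteq> w x" for n
        proof -
          have "X n \<in> ball z \<eta>" "X n \<noteq> z" using X by auto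
          then show ?thesis using dif[of "X n"] x by fastforce
        qed
        ultimately have "filterlim (\<lambda>n. \<phi> s x (X n)) (at (w x)) sequentially"
          by (simp add: filterlim_at)
        from filterlim_compose[OF d this] show ?thesis by (simp add: A_def)
      qed
      have "(\<lambda>n. integral {s..t} (A (X n))) \<longlonglongrightarrow> integral {s..t} (\<lambda>x. deriv (\<lambda>u. G u x) (w x))"
      proof (rule dominated_convergence(2))
        show "A (X n) integrable_on {s..t}" for n
        proof -
          have "X n \<in> ball z \<eta>" using X by auto
          then have "A (X n) absolutely_integrable_on {s..t}" using dif by blast
          then show ?thesis by (rule set_lebesgue_integral_eq_integral(1))
        qed
        show "(\<lambda>x. k x / e) integrable_on {s..t}" using ke set_lebesgue_integral_eq_integral(1) by blast
        show "norm (A (X n) x) \<le> k x / e" if "x \<in> {s..t}" for n x using A[of "X n" x] that X by blast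
      qed (rule lim)
      then have "(\<lambda>n. exp (integral {s..t} (A (X n)))) \<longlonglongrightarrow> L"
        unfolding L_def by (rule tendsto_exp)
      moreover have "(\<phi> s t (X n) - \<phi> s t z) / (X n - z) = exp (integral {s..t} (A (X n)))" for n
      proof -
        have "X n \<in> ball z \<eta>" "X n \<noteq> z" using X by auto
        then show ?thesis using dif[of "X n"] st by (simp add: w_def)
      qed
      ultimately show "((\<lambda>y. (\<phi> s t y - \<phi> s t z) / (y - z)) \<circ> X) \<longlonglongrightarrow> L" by (simp add: o_def)
    qed
    moreover have "at z within ball z \<eta> = at z" by (rule at_within_open) (use \<eta> in auto)
    ultimately have "(\<phi> s t has_field_derivative L) (at z)"
      unfolding has_field_derivative_iff by (simp only:)
    then show ?thesis by blast
  qed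
  then show ?thesis
    using open_D[OF st(1)] by (simp add: holomorphic_on_open)
qed

text \<open>Inside the ball the speed is at most \<open>k\<close>, so a first arrival at its
  boundary would require the integral of \<open>k\<close> to be at least \<open>e\<close>.\<close>

lemma flow_stays_near_start:
  assumes S: "0 \<le> S" and e: "e > 0" and k: "k absolutely_integrable_on {S..T}" "\<And>t. t \<in> {S..T} \<Longrightarrow> 0 \<le> k t"
    and sub: "\<And>t x. t \<in> {S..T} \<Longrightarrow> x \<in> cball z e \<Longrightarrow> x \<in> D t \<and> norm (G x t) \<le> k t"
    and st: "S \<le> s" "s \<le> t" "t \<le> T" and small: "integral {s..t} k < e" and x: "x \<in> {s..t}"
  shows "norm (\<phi> s x z - z) < e"
proof (rule ccontr)
  assume "\<not> norm (\<phi> s x z - z) < e"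
  then have H: "e \<le> norm (\<phi> s x z - z)" by simp
  have zs: "z \<in> D s" using sub[of s z] st e by auto
  have tr: "traj s t (\<lambda>u. \<phi> s u z)" using S st zs by (intro flow) auto
  have i: "\<phi> s s z = z" using S st zs by (intro flow_init) auto
  have c: "continuous_on {s..t} (\<lambda>u. norm (\<phi> s u z - z))" by (intro continuous_intros traj_cont[OF tr])
  obtain t1 where t1: "s < t1" "t1 \<le> x" "norm (\<phi> s t1 z - z) = e"
      "\<And>u. u \<in> {s..t1} \<Longrightarrow> norm (\<phi> s u z - z) \<le> e"
    using first_hit[OF c _ x H] e i by auto
  have tr1: "traj s t1 (\<lambda>u. \<phi> s u z)" by (rule traj_subinterval[OF tr]) (use t1 x in auto)
  have k1: "k absolutely_integrable_on {s..t1}" "k absolutely_integrable_on {s..t}"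
    using st t1 x by (auto intro: set_integrable_subset[OF k(1)])
  have "norm (\<phi> s t1 z - \<phi> s s z) \<le> integral {s..t1} k"
  proof (rule traj_norm_le[OF tr1 k1(1)])
    fix u assume u: "u \<in> {s..t1}"
    then have "\<phi> s u z \<in> cball z e" using t1(4)[OF u] by (simp add: dist_norm norm_minus_commute)
    then show "norm (G (\<phi> s u z) u) \<le> k u" using sub[of u] u st t1 x by auto
  qed (use t1 in auto)
  also have "\<dots> \<le> integral {s..t} k"
    using k1 set_lebesgue_integral_eq_integral(1) k(2) st t1 x by (intro integral_subset_le) auto
  finally show False using small t1(3) i by simp
qed

text \<open>Local in the initial time: for \<open>s'\<close> near \<open>s\<close> the trajectory
  started at time \<open>s'\<close> in \<open>z\<close> follows the one started at time
  \<open>s\<close>. Finitely many such neighbourhoods cover \<open>{S..T}\<close>, and the union of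
  their compact sets serves all initial times.\<close>

lemma flow_graph_compact:
  assumes S: "0 \<le> S" "S \<le> T" and z: "z \<in> D S"
  obtains K where "compact K" "K \<subseteq> total_domain D" "snd ` K = {S..T}"
    "\<And>s t. S \<le> s \<Longrightarrow> s \<le> t \<Longrightarrow> t \<le> T \<Longrightarrow> (\<phi> s t z, t) \<in> K"
proof -
  have zt: "z \<in> D t" if "t \<in> {S..T}" for t using that z D_mono[of S] S by auto
  obtain e0 where e0: "e0 > 0" and cb0: "\<And>t. t \<in> {S..T} \<Longrightarrow> cball z e0 \<subseteq> D t"
    and cp0: "compact ((\<lambda>(x, t). (z + x, t)) ` (cball 0 e0 \<times> {S..T}))"
    by (rule tube[OF S continuous_on_const[where c = z] zt]) (assumption, rule that)
  \<comment> \<open>A ball about \<open>z\<close> fits into every \<open>D t\<close> with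
    \<open>t \<ge> S\<close>, since the annuli grow. \<open>B\<close> contains the short initial
    drifts and makes the projection of the compact set all of \<open>{S..T}\<close>.\<close>
  define B where "B = (\<lambda>(x, t). (z + x, t)) ` (cball 0 e0 \<times> {S..T})"
  have Bmem: "(x, t) \<in> B \<longleftrightarrow> t \<in> {S..T} \<and> x \<in> cball z e0" for x t
    unfolding B_def by (auto simp: image_iff dist_norm norm_minus_commute intro!: bexI[of _ "x - z"])
  have Bsub: "B \<subseteq> total_domain D"
  proof clarify
    fix x t assume "(x, t) \<in> B"
    then have "t \<in> {S..T}" "x \<in> cball z e0" by (auto simp: Bmem)
    then show "(x, t) \<in> total_domain D" using cb0[of t] S by (auto simp: mem_total_domain)
  qed
  have sndB: "snd ` B = {S..T}" 
  proof safe
    fix t assume "t \<in> {S..T}" then have "(z, t) \<in> B" using e0 by (auto simp: Bmem)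
    then show "t \<in> snd ` B" by force
  qed (auto simp: B_def)
  have cB: "compact B" using cp0 by (simp add: B_def)
  obtain k0 where k0: "\<And>t. t \<in> {S..T} \<Longrightarrow> 0 \<le> k0 t" "k0 absolutely_integrable_on {S..T}"
      "\<And>z t. (z, t) \<in> B \<Longrightarrow> norm (G z t) \<le> k0 t"
    using compact_bound[OF cB Bsub] sndB by metis
  have H: "\<exists>U K. open U \<and> s \<in> U \<and> compact K \<and> K \<subseteq> total_domain D \<and> snd ` K \<subseteq> {S..T} \<and>
      (\<forall>s'\<in>U \<inter> {S..T}. \<forall>t\<in>{s'..T}. (\<phi> s' t z, t) \<in> K)" if s: "s \<in> {S..T}" for s
  proof -
    define w where "w x = \<phi> s x z" for x
    have zs: "z \<in> D s" using cb0[OF s] e0 by auto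
    have w: "traj s T w" unfolding w_def using s S zs by (intro flow) auto
    have ws: "w s = z" unfolding w_def using s S zs by (intro flow_init) auto
    obtain e k where e: "e > 0" and k: "k absolutely_integrable_on {s..T}" "\<And>x. x \<in> {s..T} \<Longrightarrow> 0 \<le> k x"
      and cb: "\<And>x. x \<in> {s..T} \<Longrightarrow> cball (w x) (2 * e) \<subseteq> D x"
      and bd: "\<And>x z. x \<in> {s..T} \<Longrightarrow> z \<in> cball (w x) (2 * e) \<Longrightarrow> norm (G z x) \<le> k x"
      and lip: "\<And>x a b. x \<in> {s..T} \<Longrightarrow> a \<in> cball (w x) e \<Longrightarrow> b \<in> cball (w x) e \<Longrightarrow>
        norm (G a x - G b x) \<le> k x / e * norm (a - b)"
      and cp: "compact ((\<lambda>(x, t). (w t + x, t)) ` (cball 0 (2 * e) \<times> {s..T}))"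
      by (rule traj_tube[OF w]) (rule that)
    define M where "M = exp (integral {s..T} (\<lambda>x. k x / e))"
    have M: "M > 0" by (simp add: M_def)
    \<comment> \<open>Initial values within \<open>e1\<close> of \<open>w\<close> stay within
      \<open>e\<close> of it after growth by the factor \<open>M\<close>; the bound by
      \<open>e0\<close> places the drift about \<open>z\<close> inside \<open>B\<close>.\<close>
    define e1 where "e1 = min e0 (e / M)"
    have e1: "e1 > 0" "e1 \<le> e0" "e1 * M \<le> e" using e0 e M by (auto simp: e1_def min_def field_simps)
    define C where "C = (\<lambda>(x, t). (w t + x, t)) ` (cball 0 (2 * e) \<times> {s..T})"
    have Cmem: "(x, t) \<in> C \<longleftrightarrow> t \<in> {s..T} \<and> x \<in> cball (w t) (2 * e)" for x t
      unfolding C_def by (auto simp: image_iff dist_norm norm_minus_commute intro!: bexI[of _ "x - w t"])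
    have Csub: "C \<subseteq> total_domain D"
    proof clarify
      fix x t assume "(x, t) \<in> C"
      then have "t \<in> {s..T}" "x \<in> cball (w t) (2 * e)" by (auto simp: Cmem)
      then show "(x, t) \<in> total_domain D" using cb[of t] S s by (auto simp: mem_total_domain)
    qed
    have inC: "(\<phi> s' t y, t) \<in> C"
      if s': "s \<le> s'" "s' \<le> t" "t \<le> T" and y: "y \<in> D s'" "norm (y - w s') < e1" for s' t y
    proof -
      have s'': "s' \<in> {s..T}" using s' by auto
      have v: "traj s' T (\<lambda>u. \<phi> s' u y)" using S s s' y by (intro flow) auto
      have i: "\<phi> s' s' y = y" using S s s' y by (intro flow_init) auto
      have "norm (y - w s') * M < e1 * M" using y(2) M by (intro mult_strict_right_mono)
      then have "norm (y - w s') * M < e" using e1(3) by linarith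
      then have cl: "norm (\<phi> s' s' y - w s') * exp (integral {s..T} (\<lambda>x. k x / e)) < e"
        by (simp only: i M_def)
      have t': "t \<in> {s'..T}" using s' by auto
      have "norm (\<phi> s' t y - w t) < e" by (rule traj_stay(2)[OF w e k lip s'' v cl t'])
      then show ?thesis using s' e by (auto simp: Cmem dist_norm norm_minus_commute)
    qed
    have k0i: "k0 integrable_on {S..T}" using k0(2) set_lebesgue_integral_eq_integral(1) by blast
    have "continuous_on {S..T} (\<lambda>u. integral {S..u} k0)" by (rule indefinite_integral_continuous_1[OF k0i])
    then obtain d1 where d1: "d1 > 0" "\<And>u. u \<in> {S..T} \<Longrightarrow> dist u s < d1 \<Longrightarrow> dist (integral {S..u} k0) (integral {S..s} k0) < e1"
      using s e1(1) unfolding continuous_on_iff by metis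
    obtain d2 where d2: "d2 > 0" "\<And>u. u \<in> {s..T} \<Longrightarrow> dist u s < d2 \<Longrightarrow> dist (w u) (w s) < e1"
      using traj_cont[OF w] s e1(1) unfolding continuous_on_iff by fastforce
    have main: "(\<phi> s' t z, t) \<in> B \<union> C" if s': "s' \<in> ball s (min d1 d2) \<inter> {S..T}" and t: "t \<in> {s'..T}" for s' t
    proof (cases "s \<le> s'")
      case True
      have "norm (z - w s') < e1" using d2(2)[of s'] s' True by (auto simp: ws dist_norm norm_minus_commute)
      moreover have "z \<in> D s'" using cb0[of s'] e0 s' by auto
      ultimately show ?thesis using inC[of s' t z] True t by auto
    next
      case False
      have sm: "integral {s'..s} k0 < e1"
        \<comment> \<open>When \<open>s'\<close> precedes \<open>s\<close>, there is no trajectory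
          \<open>w\<close> to compare with until time \<open>s\<close>; the point drifts inside the
          ball about \<open>z\<close> up to then and enters the tube around \<open>w\<close> at time
          \<open>s\<close>.\<close>
        using d1(2)[of s'] integral_diff_Icc[OF k0i, of s' s] s' s False by (auto simp: dist_norm)
      have sb: "x \<in> D t \<and> norm (G x t) \<le> k0 t" if "t \<in> {S..T}" "x \<in> cball z e1" for t x
        using that cb0[OF that(1)] e1(2) k0(3)[of x t] by (auto simp: Bmem subset_iff)
      have near: "norm (\<phi> s' x z - z) < e1" if "x \<in> {s'..s}" for x
        by (rule flow_stays_near_start[OF S(1) e1(1) k0(2,1) sb _ _ _ sm that]) (use s' s False in auto)
      show ?thesis
      proof (cases "t \<le> s")
        case True
        then show ?thesis using near[of t] t s' e1(2) by (auto simp: Bmem dist_norm norm_minus_commute)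
      next
        case False': False
        have zs': "z \<in> D s'" using cb0[of s'] e0 s' by auto
        have "(\<phi> s t (\<phi> s' s z), t) \<in> C"
          using near[of s] False False' t s' S zs' by (intro inC flow_in) (auto simp: ws)
        moreover have "\<phi> s' t z = \<phi> s t (\<phi> s' s z)"
          using False False' s' S zs' by (intro flow_comp) auto
        ultimately show ?thesis by simp
      qed
    qed
    have "compact (B \<union> C)" using cB cp by (auto simp: C_def)
    moreover have "snd ` (B \<union> C) \<subseteq> {S..T}" using s by (auto simp: B_def C_def)
    ultimately show ?thesis
      using main Bsub Csub d1(1) d2(1)
      by (intro exI[of _ "ball s (min d1 d2)"] exI[of _ "B \<union> C"]) auto
  qed
  then obtain U K where UK: "\<And>s. s \<in> {S..T} \<Longrightarrow> open (U s) \<and> s \<in> U s \<and> compact (K s) \<and> K s \<subseteq> total_domain D \<and>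
      snd ` K s \<subseteq> {S..T} \<and> (\<forall>s'\<in>U s \<inter> {S..T}. \<forall>t\<in>{s'..T}. (\<phi> s' t z, t) \<in> K s)"
    by metis
  have "{S..T} \<subseteq> (\<Union>s\<in>{S..T}. U s)" using UK by blast
  then obtain F where F: "F \<subseteq> {S..T}" "finite F" "{S..T} \<subseteq> (\<Union>s\<in>F. U s)"
    using compactE_image[OF compact_Icc, of "{S..T}" U S T] UK by metis
  show thesis
  proof
    show "compact (B \<union> (\<Union>s\<in>F. K s))" using cB F UK by (intro compact_Un compact_UN) auto
    show "B \<union> (\<Union>s\<in>F. K s) \<subseteq> total_domain D" using Bsub F UK by blast
    have "snd ` K s \<subseteq> {S..T}" if "s \<in> F" for s using UK F that by blast
    then show "snd ` (B \<union> (\<Union>s\<in>F. K s)) = {S..T}" using sndB by (auto simp: image_Un image_UN)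
    fix s t assume st: "S \<le> s" "s \<le> t" "t \<le> T"
    have "s \<in> {S..T}" using st by simp
    then have "s \<in> (\<Union>s\<in>F. U s)" using F(3) by blast
    then obtain s0 where "s0 \<in> F" "s \<in> U s0" by blast
    then have "(\<phi> s t z, t) \<in> K s0" using UK[of s0] F(1) st by auto
    then show "(\<phi> s t z, t) \<in> B \<union> (\<Union>s\<in>F. K s)" using \<open>s0 \<in> F\<close> by blast
  qed
qed

lemma flow_evolution_family: "evolution_family d D \<phi>"
  unfolding evolution_family_def
proof (intro conjI allI impI ballI)
  show "\<phi> s t holomorphic_on D s" "\<phi> s t ` D s \<subseteq> D t" if "0 \<le> s \<and> s \<le> t" for s t
    using flow_holomorphic flow_in that by auto
  show "\<phi> s s z = z" if "0 \<le> s" "z \<in> D s" for s z using flow_init that .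
  show "\<phi> s t z = \<phi> u t (\<phi> s u z)" if "0 \<le> s \<and> s \<le> u \<and> u \<le> t" "z \<in> D s" for s u t z
    using flow_comp that by blast
  fix S T z assume STz: "0 \<le> S \<and> S \<le> T \<and> z \<in> D S"
  then obtain K where K: "compact K" "K \<subseteq> total_domain D" "snd ` K = {S..T}"
    "\<And>s t. S \<le> s \<Longrightarrow> s \<le> t \<Longrightarrow> t \<le> T \<Longrightarrow> (\<phi> s t z, t) \<in> K"
    using flow_graph_compact by metis
  obtain k where k: "\<And>t. t \<in> {S..T} \<Longrightarrow> 0 \<le> k t" "Ld d {S..T} k" "k absolutely_integrable_on {S..T}"
    "\<And>z t. (z, t) \<in> K \<Longrightarrow> norm (G z t) \<le> k t"
    using compact_bound[OF K(1,2)] unfolding K(3) by metis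
  have "norm (\<phi> s u z - \<phi> s t z) \<le> (LINT \<xi>:{u..t}|lebesgue. k \<xi>)"
    if "S \<le> s \<and> s \<le> u \<and> u \<le> t \<and> t \<le> T" for s u t
  proof -
    have zs: "z \<in> D s" using D_mono[of S s] STz that by auto
    have tr: "traj s t (\<lambda>x. \<phi> s x z)" using that STz zs by (intro flow) auto
    have ks: "k absolutely_integrable_on {s..t}" by (rule set_integrable_subset[OF k(3)]) (use that in auto)
    have "norm (\<phi> s t z - \<phi> s u z) \<le> integral {u..t} k"
      by (rule traj_norm_le[OF tr ks]) (use k(4) K(4) that in auto)
    then show ?thesis using that by (subst LINT_Icc_eq_integral[OF k(3)]) (auto simp: norm_minus_commute)
  qed
  then show "\<exists>k. (\<forall>\<xi>\<in>{S..T}. 0 \<le> k \<xi>) \<and> Ld d {S..T} k \<and>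
      (\<forall>s u t. S \<le> s \<and> s \<le> u \<and> u \<le> t \<and> t \<le> T \<longrightarrow> norm (\<phi> s u z - \<phi> s t z) \<le> (LINT \<xi>:{u..t}|lebesgue. k \<xi>))"
    using k(1,2) by (intro exI[of _ k]) auto
qed

end

lemma (in vector_field) semicomplete_evolution_family:
  assumes "semicomplete D G"
  shows "evolution_family d D (\<lambda>s t z. max_solution D G s z t)"
proof -
  interpret trajectory_flow D r G d "\<lambda>s t z. max_solution D G s z t"
  proof
    fix s t z assume st: "0 \<le> s" "s \<le> t" and z: "z \<in> D s"
    obtain w where w: "is_solution D G s z {s..} w"
      using semicomplete_solution[OF assms, of z s] st z by (auto simp: mem_total_domain)
    have "traj s t w" by (rule solution_traj[OF w]) (use st in auto)
    then show "traj s t (\<lambda>u. max_solution D G s z u)"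
      by (rule traj_cong) (use max_solution_eq[OF w] in auto)
  next
    fix s z assume s: "0 \<le> s" and z: "z \<in> D s"
    obtain w where w: "is_solution D G s z {s..} w"
      using semicomplete_solution[OF assms, of z s] s z by (auto simp: mem_total_domain)
    then have "w s = z" by (simp add: is_solution_def)
    then show "max_solution D G s z s = z" using max_solution_eq[OF w, of s] by simp
  qed
  show ?thesis by (rule flow_evolution_family)
qed

section \<open>Holomorphic functions on an annulus\<close>

lemma mem_annulus: "z \<in> annulus \<rho> \<longleftrightarrow> \<rho> < norm z \<and> norm z < 1"
  by (simp add: annulus_def)

lemma open_annulus: "open (annulus \<rho>)"
  unfolding annulus_def by (intro open_Collect_conj open_Collect_less continuous_intros)

text \<open>For \<open>0 \<le> \<rho> < 1\<close> the universal covering space of the annulus under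
  \<open>exp\<close>; a half-plane if \<open>\<rho> = 0\<close>. Its convexity provides primitives
  and logarithms.\<close>

definition strip :: "real \<Rightarrow> complex set" where
  "strip \<rho> = {\<zeta>. exp \<zeta> \<in> annulus \<rho>}"

lemma mem_strip: "\<zeta> \<in> strip \<rho> \<longleftrightarrow> \<rho> < exp (Re \<zeta>) \<and> Re \<zeta> < 0"
  by (simp add: strip_def mem_annulus norm_exp_eq_Re)

lemma convex_strip: "convex (strip \<rho>)"
proof (cases "\<rho> > 0")
  case True
  then have "\<rho> < exp x \<longleftrightarrow> ln \<rho> < x" for x by (metis exp_ln exp_less_cancel_iff)
  then have "strip \<rho> = {\<zeta>. Re \<zeta> > ln \<rho>} \<inter> {\<zeta>. Re \<zeta> < 0}"
    unfolding set_eq_iff Int_iff mem_Collect_eq mem_strip by blast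
  then show ?thesis by (simp add: convex_Int convex_halfspace_Re_gt convex_halfspace_Re_lt)
next
  case False
  then have "strip \<rho> = {\<zeta>. Re \<zeta> < 0}"
    by (auto simp: mem_strip) (metis exp_gt_zero order_le_less_trans not_less)
  then show ?thesis by (simp add: convex_halfspace_Re_lt)
qed

lemma open_strip: "open (strip \<rho>)"
  using open_vimage[OF open_annulus, of exp \<rho>] by (simp add: strip_def vimage_def continuous_on_exp)

lemma strip_shift: "Re w = 0 \<Longrightarrow> \<zeta> + w \<in> strip \<rho> \<longleftrightarrow> \<zeta> \<in> strip \<rho>"
  by (simp add: mem_strip)

section \<open>Means over circles and logarithms on an annulus\<close>

definition circle_mean :: "(complex \<Rightarrow> complex) \<Rightarrow> real \<Rightarrow> complex" where
  "circle_mean f R = integral {0..2*pi} (\<lambda>y. f (of_real R * cis y)) / (2 * pi)"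

text \<open>Cauchy's theorem read on the covering: the lift has a primitive \<open>g\<close>, whose
  increment over one period \<open>2 * pi * \<i>\<close> has derivative zero and is a constant
  \<open>c\<close>; each mean equals \<open>c / (2 * pi * \<i>)\<close>.\<close>

lemma circle_mean_holomorphic_const:
  assumes f: "f holomorphic_on annulus \<rho>" and R: "\<rho> < R" "0 < R" "R < 1" "\<rho> < R'" "0 < R'" "R' < 1"
  shows "circle_mean f R = circle_mean f R'"
proof -
  define F where "F \<zeta> = f (exp \<zeta>)" for \<zeta>
  have "F holomorphic_on strip \<rho>"
    unfolding F_def by (rule holomorphic_on_compose_gen[OF _ f, unfolded o_def])
      (auto simp: strip_def intro!: holomorphic_intros)
  then obtain g where g: "\<And>x. x \<in> strip \<rho> \<Longrightarrow> (g has_field_derivative F x) (at x within strip \<rho>)"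
    using holomorphic_convex_primitive'[OF convex_strip open_strip] by blast
  then have g: "(g has_field_derivative F x) (at x)" if "x \<in> strip \<rho>" for x
    using that by (simp add: at_within_open[OF _ open_strip])
  define P :: complex where "P = 2 * pi * \<i>"
  have P: "Re P = 0" "exp P = 1" by (simp_all add: P_def)
  define h where "h \<zeta> = g (\<zeta> + P) - g \<zeta>" for \<zeta>
  have h: "(h has_field_derivative 0) (at x within strip \<rho>)" if "x \<in> strip \<rho>" for x
  proof -
    have "(g has_field_derivative F (x + P)) (at (x + P))" using that P by (intro g) (simp add: strip_shift)
    then have "((\<lambda>\<zeta>. g (\<zeta> + P)) has_field_derivative F (x + P)) (at x)" by (simp add: DERIV_shift)
    moreover have "F (x + P) = F x" by (simp add: F_def exp_add P)
    ultimately have "(h has_field_derivative F x - F x) (at x)"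
      unfolding h_def using g[OF that] by (intro derivative_intros) auto
    then show ?thesis by (simp add: has_field_derivative_at_within)
  qed
  obtain c where c: "\<And>x. x \<in> strip \<rho> \<Longrightarrow> h x = c"
    using has_field_derivative_zero_constant[OF convex_strip h] by blast
  have "integral {0..2*pi} (\<lambda>y. f (of_real R * cis y)) = c / \<i>" if "\<rho> < R" "0 < R" "R < 1" for R
  proof -
    have st: "Complex (ln R) y \<in> strip \<rho>" for y using that by (simp add: mem_strip)
    have ex: "exp (Complex (ln R) y) = of_real R * cis y" for y
      using that by (simp add: exp_eq_polar exp_of_real[symmetric])
    have "((\<lambda>y. \<i> * f (of_real R * cis y)) has_integral (g (Complex (ln R) (2 * pi)) - g (Complex (ln R) 0))) {0..2*pi}"
    proof (rule fundamental_theorem_of_calculus)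
      fix y :: real assume "y \<in> {0..2 * pi}"
      have "((\<lambda>y. g (Complex (ln R) y)) has_vector_derivative \<i> * F (Complex (ln R) y)) (at y)"
      proof -
        have "((\<lambda>y. Complex (ln R) y) has_vector_derivative \<i>) (at y)"
          by (simp add: has_vector_derivative_complex_iff)
        from field_vector_diff_chain_at[OF this g[OF st]] show ?thesis by (simp add: o_def)
      qed
      then show "((\<lambda>y. g (Complex (ln R) y)) has_vector_derivative \<i> * f (of_real R * cis y)) (at y within {0..2 * pi})"
        unfolding F_def ex by (rule has_vector_derivative_at_within)
    qed simp
    from has_integral_mult_right[OF this, of "- \<i>"]
    have "((\<lambda>y. f (of_real R * cis y)) has_integral - \<i> * (g (Complex (ln R) (2 * pi)) - g (Complex (ln R) 0))) {0..2*pi}"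
      by simp
    moreover have "Complex (ln R) (2 * pi) = Complex (ln R) 0 + P" by (simp add: P_def complex_eq_iff)
    moreover have "g (Complex (ln R) 0 + P) - g (Complex (ln R) 0) = c" using c[OF st, of 0] by (simp add: h_def)
    ultimately show ?thesis by (simp add: integral_unique)
  qed
  then show ?thesis using R unfolding circle_mean_def by simp
qed

text \<open>The values lie in the discrete set of multiples of \<open>2 * pi * \<i>\<close>. Every
  comparison of two branches of a logarithm below is of this kind.\<close>

lemma exp_eq_1_constant:
  fixes f :: "'a::topological_space \<Rightarrow> complex"
  assumes S: "connected S" "continuous_on S f" "\<And>x. x \<in> S \<Longrightarrow> exp (f x) = 1" and "x \<in> S" "y \<in> S"
  shows "f x = f y"
proof -
  have "f constant_on S"
  proof (rule continuous_discrete_range_constant[OF S(1,2)])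
    fix x assume x: "x \<in> S"
    have "2 * pi \<le> norm (f y - f x)" if y: "y \<in> S" "f y \<noteq> f x" for y
    proof -
      have "exp (f y) = exp (f x)" using S(3) x y by simp
      then obtain n :: int where n: "f y = f x + (of_int (2 * n) * pi) * \<i>" by (auto simp: exp_eq)
      then have "n \<noteq> 0" using y by auto
      then have "1 \<le> \<bar>real_of_int n\<bar>" by linarith
      moreover have "norm (f y - f x) = 2 * \<bar>real_of_int n\<bar> * pi" using n by (simp add: norm_mult)
      ultimately show ?thesis by simp
    qed
    then show "\<exists>e>0. \<forall>y. y \<in> S \<and> f y \<noteq> f x \<longrightarrow> e \<le> norm (f y - f x)"
      by (intro exI[of _ "2 * pi"]) auto
  qed
  then show ?thesis using assms(4,5) by (auto simp: constant_on_def)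
qed

text \<open>Closeness to the identity on one circle forces winding number one there, so the logarithm
  of \<open>\<phi> z / z\<close> is single-valued on the whole annulus.\<close>

lemma annulus_logarithm:
  assumes \<rho>: "0 \<le> \<rho>" and f: "f holomorphic_on annulus \<rho>" and nz: "\<And>z. z \<in> annulus \<rho> \<Longrightarrow> f z \<noteq> 0"
    and R: "\<rho> < R" "R < 1" and near: "\<And>z. norm z = R \<Longrightarrow> norm (f z - z) < norm z"
  obtains q where "q holomorphic_on annulus \<rho>" "\<And>z. z \<in> annulus \<rho> \<Longrightarrow> f z = z * exp (q z)"
    "\<And>z. norm z = R \<Longrightarrow> q z = Ln (f z / z)"
proof -
  have R0: "R > 0" using R \<rho> by simp
  have "(\<lambda>\<zeta>. f (exp \<zeta>)) holomorphic_on strip \<rho>"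
    by (rule holomorphic_on_compose_gen[OF _ f, unfolded o_def])
      (auto simp: strip_def intro!: holomorphic_intros)
  then obtain L where L: "L holomorphic_on strip \<rho>" "\<And>\<zeta>. \<zeta> \<in> strip \<rho> \<Longrightarrow> exp (L \<zeta>) = f (exp \<zeta>)"
    using holomorphic_logarithm_exists[OF convex_strip open_strip, of "\<lambda>\<zeta>. f (exp \<zeta>)" \<rho>] nz
    by (auto simp: strip_def)
  define line where "line = {\<zeta>. Re \<zeta> = ln R}"
  have line: "line \<subseteq> strip \<rho>" using R R0 by (auto simp: line_def mem_strip)
  have cl: "connected line" 
  proof -
    have "line = {\<zeta>. Re \<zeta> \<le> ln R} \<inter> {\<zeta>. Re \<zeta> \<ge> ln R}" by (auto simp: line_def)
    then show ?thesis
      by (simp add: convex_connected convex_Int convex_halfspace_Re_le convex_halfspace_Re_ge)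
  qed
  have lnorm: "norm (exp \<zeta>) = R" if "\<zeta> \<in> line" for \<zeta> using that R0 by (simp add: line_def norm_exp_eq_Re)
  \<comment> \<open>The quotient has distance less than one from \<open>1\<close>, hence it avoids
    the branch cut of \<open>Ln\<close>.\<close>
  have pos: "f z / z \<notin> \<real>\<^sub>\<le>\<^sub>0" if "norm z = R" for z
  proof
    assume "f z / z \<in> \<real>\<^sub>\<le>\<^sub>0"
    then obtain x where x: "f z / z = of_real x" "x \<le> 0" by (rule nonpos_Reals_cases)
    have "norm (f z / z - 1) = \<bar>x - 1\<bar>" unfolding x(1) by (metis norm_of_real of_real_1 of_real_diff)
    then have "1 \<le> norm (f z / z - 1)" using x(2) by simp
    moreover have "norm (f z / z - 1) = norm (f z - z) / norm z"
      using that R0 by (metis diff_divide_distrib divide_self norm_divide norm_zero less_irrefl)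
    ultimately show False using near[OF that] that R0 by (simp add: field_simps)
  qed
  define \<zeta>0 where "\<zeta>0 = complex_of_real (ln R)"
  have \<zeta>0: "\<zeta>0 \<in> line" by (simp add: \<zeta>0_def line_def)
  \<comment> \<open>The multiple of \<open>2 * pi * \<i>\<close> by which the chosen logarithm of
    the lift misses the principal one; subtracting it makes \<open>P\<close> principal on the whole
    line over the circle of radius \<open>R\<close>.\<close>
  define k where "k = L \<zeta>0 - \<zeta>0 - Ln (f (exp \<zeta>0) / exp \<zeta>0)"
  have quot0: "f (exp \<zeta>) / exp \<zeta> \<noteq> 0" if "\<zeta> \<in> strip \<rho>" for \<zeta> using nz that by (simp add: strip_def)
  have expk: "exp k = 1"
    using L(2)[of \<zeta>0] \<zeta>0 line quot0[of \<zeta>0] unfolding k_def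
    by (simp add: exp_diff exp_Ln subset_iff)
  define P where "P \<zeta> = L \<zeta> - \<zeta> - k" for \<zeta>
  have Ph: "P holomorphic_on strip \<rho>" unfolding P_def by (intro holomorphic_intros L)
  have Pe: "exp (P \<zeta>) = f (exp \<zeta>) / exp \<zeta>" if "\<zeta> \<in> strip \<rho>" for \<zeta>
    using L(2)[OF that] expk by (simp add: P_def exp_diff)
  have Pl: "P \<zeta> = Ln (f (exp \<zeta>) / exp \<zeta>)" if \<zeta>: "\<zeta> \<in> line" for \<zeta>
  proof -
    have "P \<zeta> - Ln (f (exp \<zeta>) / exp \<zeta>) = P \<zeta>0 - Ln (f (exp \<zeta>0) / exp \<zeta>0)"
    proof (rule exp_eq_1_constant[OF cl _ _ \<zeta> \<zeta>0])
      have "continuous_on line (\<lambda>\<zeta>. f (exp \<zeta>) / exp \<zeta>)"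
        by (intro continuous_intros continuous_on_subset[OF holomorphic_on_imp_continuous_on[OF \<open>(\<lambda>\<zeta>. f (exp \<zeta>)) holomorphic_on strip \<rho>\<close>] line]) auto
      then show "continuous_on line (\<lambda>\<zeta>. P \<zeta> - Ln (f (exp \<zeta>) / exp \<zeta>))"
        by (intro continuous_on_diff continuous_on_Ln' pos lnorm continuous_on_subset[OF holomorphic_on_imp_continuous_on[OF Ph] line])
      show "exp (P x - Ln (f (exp x) / exp x)) = 1" if "x \<in> line" for x
        using Pe[of x] quot0[of x] that line by (auto simp: exp_diff exp_Ln)
    qed
    then show ?thesis by (simp add: P_def k_def)
  qed
  \<comment> \<open>The increment of \<open>P\<close> over a period is constant on the strip, and it
    vanishes on the line, where \<open>P\<close> is a function of
    \<open>exp \<zeta>\<close>.\<close>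
  have per: "P \<zeta> = P \<zeta>'" if \<zeta>: "\<zeta> \<in> strip \<rho>" "exp \<zeta>' = exp \<zeta>" for \<zeta> \<zeta>'
  proof -
    obtain n :: int where n: "\<zeta>' = \<zeta> + (of_int (2 * n) * pi) * \<i>" using \<zeta>(2) by (auto simp: exp_eq)
    define w where "w = (of_int (2 * n) * complex_of_real pi) * \<i>"
    have w: "Re w = 0" "exp w = 1" by (auto simp: w_def exp_eq_1)
    have "P (\<zeta> + w) - P \<zeta> = P (\<zeta>0 + w) - P \<zeta>0"
    proof (rule exp_eq_1_constant[where f = "\<lambda>\<zeta>. P (\<zeta> + w) - P \<zeta>", OF convex_connected[OF convex_strip] _ _ \<zeta>(1)])
      show "continuous_on (strip \<rho>) (\<lambda>\<zeta>. P (\<zeta> + w) - P \<zeta>)"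
        by (intro continuous_intros holomorphic_on_imp_continuous_on[OF Ph]
            continuous_on_compose2[OF holomorphic_on_imp_continuous_on[OF Ph]])
          (auto simp: strip_shift w)
      show "exp (P (x + w) - P x) = 1" if "x \<in> strip \<rho>" for x
        using Pe[of x] Pe[of "x + w"] that quot0[OF that] w by (simp add: exp_diff exp_add strip_shift)
      show "\<zeta>0 \<in> strip \<rho>" using \<zeta>0 line by blast
    qed
    also have "P (\<zeta>0 + w) = P \<zeta>0"
      using Pl[of \<zeta>0] Pl[of "\<zeta>0 + w"] \<zeta>0 w by (simp add: line_def exp_add)
    finally show ?thesis using n by (simp add: w_def)
  qed
  define q where "q z = P (Ln z)" for z
  have Ls: "Ln z \<in> strip \<rho>" "exp (Ln z) = z" if "z \<in> annulus \<rho>" for z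
  proof -
    have "z \<noteq> 0" using that \<rho> by (auto simp: mem_annulus)
    then show "exp (Ln z) = z" by simp
    then show "Ln z \<in> strip \<rho>" using that by (simp add: strip_def)
  qed
  show thesis
  proof
    show "f z = z * exp (q z)" if "z \<in> annulus \<rho>" for z
      using Pe[OF Ls(1)[OF that]] Ls(2)[OF that] that \<rho> by (auto simp: q_def mem_annulus)
    show "q z = Ln (f z / z)" if "norm z = R" for z
    proof -
      have z: "z \<noteq> 0" using that R0 by auto
      then have "Ln z \<in> line" using that by (simp add: line_def Re_Ln)
      from Pl[OF this] z show ?thesis by (simp add: q_def)
    qed
    show "q holomorphic_on annulus \<rho>"
    proof (subst holomorphic_on_open[OF open_annulus], intro ballI)
      fix z1 assume z1: "z1 \<in> annulus \<rho>"
      have z10: "z1 \<noteq> 0" using z1 \<rho> by (auto simp: mem_annulus)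
      \<comment> \<open>A branch of the logarithm that is holomorphic near \<open>z1\<close>, also
        when \<open>z1\<close> lies on the cut of \<open>Ln\<close>; periodicity of \<open>P\<close>
        makes the choice of branch irrelevant.\<close>
      define l where "l z = Ln (z / z1) + Ln z1" for z
      define U where "U = annulus \<rho> \<inter> {z. Re (z / z1) > 0}"
      have "open U" unfolding U_def
        by (intro open_Int open_annulus open_Collect_less continuous_intros) (use z10 in auto)
      have z1U: "z1 \<in> U" using z1 z10 by (simp add: U_def)
      have U0: "z / z1 \<notin> \<real>\<^sub>\<le>\<^sub>0" "z \<noteq> 0" "z \<in> annulus \<rho>" if "z \<in> U" for z
        using that \<rho> by (auto simp: U_def mem_annulus complex_nonpos_Reals_iff)
      have le: "exp (l z) = z" if "z \<in> U" for z using U0[OF that] z10 by (simp add: l_def exp_add)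
      have "(\<lambda>z. P (l z)) holomorphic_on U"
      proof (rule holomorphic_on_compose_gen[OF _ Ph, unfolded o_def])
        show "l holomorphic_on U" unfolding l_def by (intro holomorphic_intros) (use U0 z10 in auto)
        show "l ` U \<subseteq> strip \<rho>" using le U0 by (auto simp: strip_def)
      qed
      moreover have "P (l z) = q z" if "z \<in> U" for z
        using per[of "Ln z" "l z"] Ls[OF U0(3)[OF that]] le[OF that] by (simp add: q_def)
      ultimately have "q holomorphic_on U" using holomorphic_cong by (metis (no_types, lifting))
      then show "\<exists>f'. (q has_field_derivative f') (at z1)"
        using \<open>open U\<close> z1U holomorphic_on_open by blast
    qed
  qed
qed

text \<open>Coefficient estimates extend to the boundary radii although \<open>q\<close> itself need
  not: the coefficients are constants, and only explicit functions of the radius pass to the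
  limit.\<close>

lemma le_left_endpoint:
  fixes f g :: "real \<Rightarrow> real"
  assumes "a < b" "isCont f b" "isCont g b" "\<And>x. a < x \<Longrightarrow> x < b \<Longrightarrow> f x \<le> g x"
  shows "f b \<le> g b"
proof (rule tendsto_le)
  show "(g \<longlongrightarrow> g b) (at_left b)" "(f \<longlongrightarrow> f b) (at_left b)"
    using assms by (auto simp: isCont_def intro: tendsto_within_subset)
  show "\<forall>\<^sub>F x in at_left b. f x \<le> g x"
    using eventually_at_left_real[OF assms(1)] by eventually_elim (use assms in auto)
qed simp

lemma le_right_endpoint:
  fixes f g :: "real \<Rightarrow> real"
  assumes "a < b" "isCont f a" "isCont g a" "\<And>x. a < x \<Longrightarrow> x < b \<Longrightarrow> f x \<le> g x"
  shows "f a \<le> g a"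
proof (rule tendsto_le)
  show "(g \<longlongrightarrow> g a) (at_right a)" "(f \<longlongrightarrow> f a) (at_right a)"
    using assms by (auto simp: isCont_def intro: tendsto_within_subset)
  show "\<forall>\<^sub>F x in at_right a. f x \<le> g x"
    using eventually_at_right_real[OF assms(1)] by eventually_elim (use assms in auto)
qed simp

text \<open>Dominated convergence: all partial sums are bounded by the constant
  \<open>M / (1 - c)\<close>.\<close>

lemma integral_geometric_sums:
  fixes u t :: "real \<Rightarrow> complex"
  assumes u: "continuous_on {a..b} u" and t: "continuous_on {a..b} t"
    and c: "c < 1" "\<And>y. y \<in> {a..b} \<Longrightarrow> norm (t y) \<le> c"
  shows "(\<lambda>n. integral {a..b} (\<lambda>y. u y * t y ^ n)) sums integral {a..b} (\<lambda>y. u y / (1 - t y))"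
  unfolding sums_def
proof -
  obtain M where M: "\<And>y. y \<in> {a..b} \<Longrightarrow> norm (u y) \<le> M"
    using compact_imp_bounded[OF compact_continuous_image[OF u compact_Icc]]
    unfolding bounded_iff by (metis imageI)
  have int: "(\<lambda>y. u y * t y ^ n) integrable_on {a..b}" for n
    by (intro integrable_continuous_interval continuous_intros u t)
  have "(\<lambda>n. integral {a..b} (\<lambda>y. \<Sum>i<n. u y * t y ^ i)) \<longlonglongrightarrow> integral {a..b} (\<lambda>y. u y / (1 - t y))"
  proof (rule dominated_convergence(2))
    show "(\<lambda>y. \<Sum>i<n. u y * t y ^ i) integrable_on {a..b}" for n
      by (intro integrable_sum int) auto
    show "(\<lambda>y. M * (1 / (1 - c))) integrable_on {a..b}" by (rule integrable_const_ivl)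
    fix y assume y: "y \<in> {a..b}"
    have t1: "norm (t y) < 1" using c y by fastforce
    have c0: "0 \<le> c" using c(2)[OF y] norm_ge_zero order_trans by blast
    show "norm (\<Sum>i<n. u y * t y ^ i) \<le> M * (1 / (1 - c))" for n
    proof -
      have "norm (\<Sum>i<n. u y * t y ^ i) \<le> (\<Sum>i<n. M * c ^ i)"
      proof (rule sum_norm_le)
        fix i
        show "norm (u y * t y ^ i) \<le> M * c ^ i"
          unfolding norm_mult norm_power using M[OF y] c(2)[OF y] order_trans[OF norm_ge_zero M[OF y]]
          by (intro mult_mono power_mono) auto
      qed
      also have "\<dots> = M * (\<Sum>i<n. c ^ i)" by (simp add: sum_distrib_left)
      also have "(\<Sum>i<n. c ^ i) \<le> (\<Sum>i. c ^ i)" using c0 c(1) by (intro sum_le_suminf) (auto intro: summable_geometric)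
      also have "(\<Sum>i. c ^ i) = 1 / (1 - c)" using c0 c(1) by (intro suminf_geometric) auto
      finally show ?thesis using order_trans[OF norm_ge_zero M[OF y]] by (simp add: mult_left_mono)
    qed
    have "(\<lambda>i. u y * t y ^ i) sums (u y * (1 / (1 - t y)))"
      by (intro sums_mult geometric_sums t1)
    then show "(\<lambda>n. \<Sum>i<n. u y * t y ^ i) \<longlonglongrightarrow> u y / (1 - t y)" by (simp add: sums_def)
  qed
  moreover have "integral {a..b} (\<lambda>y. \<Sum>i<n. u y * t y ^ i) = (\<Sum>i<n. integral {a..b} (\<lambda>y. u y * t y ^ i))" for n
    by (rule integral_sum) (use int in auto)
  ultimately show "(\<lambda>n. \<Sum>i<n. integral {a..b} (\<lambda>y. u y * t y ^ i)) \<longlonglongrightarrow> integral {a..b} (\<lambda>y. u y / (1 - t y))"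
    by simp
qed

text \<open>The core of the positivity argument: the Fourier coefficients of a nonnegative function
  are dominated by its mean.\<close>

lemma norm_integral_le_positive:
  fixes V :: "real \<Rightarrow> real" and e :: "real \<Rightarrow> complex"
  assumes V: "continuous_on {a..b} V" "\<And>y. y \<in> {a..b} \<Longrightarrow> 0 \<le> V y"
    and e: "continuous_on {a..b} e" "\<And>y. y \<in> {a..b} \<Longrightarrow> norm (e y) \<le> 1"
  shows "norm (integral {a..b} (\<lambda>y. of_real (V y) * e y)) \<le> integral {a..b} V"
proof (rule integral_norm_bound_integral)
  show "norm (of_real (V y) * e y) \<le> V y" if "y \<in> {a..b}" for y
    using V(2)[OF that] e(2)[OF that] by (simp add: norm_mult mult_left_le)
qed (intro integrable_continuous_interval continuous_intros V e)+

text \<open>The mean of a power is homogeneous in \<open>R\<close> of nonzero degree, yet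
  independent of \<open>R\<close> in \<open>(0, 1)\<close>; comparing the radii \<open>1/2\<close>
  and \<open>1/4\<close> forces the constant factor to vanish.\<close>

lemma circle_mean_power:
  assumes "0 < R" "n > 0"
  shows "circle_mean (\<lambda>z. z ^ n) R = 0" "circle_mean (\<lambda>z. 1 / z ^ n) R = 0"
    "circle_mean (\<lambda>z. c) R = c"
proof -
  define I where "I = integral {0..2*pi} (\<lambda>y. cis y ^ n) / (2 * pi)"
  define J where "J = integral {0..2*pi} (\<lambda>y. 1 / cis y ^ n) / (2 * pi)"
  have I: "circle_mean (\<lambda>z. z ^ n) R = of_real (R ^ n) * I" for R
    by (simp add: circle_mean_def I_def power_mult_distrib)
  have J: "circle_mean (\<lambda>z. 1 / z ^ n) R = of_real (1 / R ^ n) * J" for R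
  proof -
    have "1 / (of_real R * cis y) ^ n = of_real (1 / R ^ n) * (1 / cis y ^ n)" for y
      by (simp add: power_mult_distrib)
    then show ?thesis unfolding circle_mean_def J_def
      by (metis (no_types, lifting) integral_cong integral_mult_right times_divide_eq_right)
  qed
  have "circle_mean (\<lambda>z. z ^ n) (1/2) = circle_mean (\<lambda>z. z ^ n) (1/4)"
    by (rule circle_mean_holomorphic_const[of _ 0]) (auto intro!: holomorphic_intros)
  then have "I = 0 \<or> ((1 / 2) ^ n :: real) = (1 / 4) ^ n" unfolding I
    by (metis mult_cancel_right of_real_eq_iff)
  moreover have ne: "((1 / 2) ^ n :: real) \<noteq> (1 / 4) ^ n"
    using assms(2) power_strict_mono[of "1/4" "1/2 :: real" n] by simp
  ultimately show "circle_mean (\<lambda>z. z ^ n) R = 0" unfolding I by simp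
  have "circle_mean (\<lambda>z. 1 / z ^ n) (1/2) = circle_mean (\<lambda>z. 1 / z ^ n) (1/4)"
    by (rule circle_mean_holomorphic_const[of _ 0]) (auto intro!: holomorphic_intros simp: mem_annulus)
  then have "J = 0 \<or> (1 / (1 / 2) ^ n :: real) = 1 / (1 / 4) ^ n" unfolding J
    by (metis mult_cancel_right of_real_eq_iff)
  then show "circle_mean (\<lambda>z. 1 / z ^ n) R = 0" unfolding J using ne by auto
  show "circle_mean (\<lambda>z. c) R = c" by (simp add: circle_mean_def scaleR_conv_of_real)
qed

section \<open>Laurent coefficients and the Laurent expansion\<close>

text \<open>For \<open>f z = z * exp (q z)\<close> the assumption \<open>upper\<close> says that
  \<open>norm (f z) \<le> 1\<close>.\<close>

locale annulus_function =
  fixes q :: "complex \<Rightarrow> complex" and \<rho> :: real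
  assumes q: "q holomorphic_on annulus \<rho>" and \<rho>: "0 \<le> \<rho>" "\<rho> < 1"
    and upper: "\<And>z. z \<in> annulus \<rho> \<Longrightarrow> Re (q z) \<le> - ln (norm z)"
begin

text \<open>The Laurent coefficients of \<open>q\<close> with index \<open>n\<close> and \<open>- n\<close>.\<close>

definition cp :: "nat \<Rightarrow> complex" where "cp n = circle_mean (\<lambda>z. q z / z ^ n) ((\<rho> + 1) / 2)"
definition cm :: "nat \<Rightarrow> complex" where "cm n = circle_mean (\<lambda>z. q z * z ^ n) ((\<rho> + 1) / 2)"

lemma cp_eq: "\<rho> < R \<Longrightarrow> R < 1 \<Longrightarrow> circle_mean (\<lambda>z. q z / z ^ n) R = cp n"
  unfolding cp_def by (rule circle_mean_holomorphic_const[of _ \<rho>])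
    (use \<rho> in \<open>auto intro!: holomorphic_intros q simp: mem_annulus\<close>)

lemma cm_eq: "\<rho> < R \<Longrightarrow> R < 1 \<Longrightarrow> circle_mean (\<lambda>z. q z * z ^ n) R = cm n"
  unfolding cm_def by (rule circle_mean_holomorphic_const[of _ \<rho>])
    (use \<rho> in \<open>auto intro!: holomorphic_intros q simp: mem_annulus\<close>)

lemma circle_in: "\<rho> < R \<Longrightarrow> R < 1 \<Longrightarrow> of_real R * cis y \<in> annulus \<rho>"
  using \<rho> by (simp add: mem_annulus norm_mult)

lemma q_circle_cont: "\<rho> < R \<Longrightarrow> R < 1 \<Longrightarrow> continuous_on X (\<lambda>y. q (of_real R * cis y))"
  by (rule continuous_on_compose2[OF holomorphic_on_imp_continuous_on[OF q]])
    (auto intro!: continuous_intros circle_in)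

text \<open>The function \<open>K + s * Re q\<close> is nonnegative on the circle and has mean
  \<open>K + s * Re (cp 0)\<close>. Its Fourier coefficient of index \<open>n > 0\<close> is
  \<open>s / 2\<close> times the expression on the left, because the constant \<open>K\<close> drops
  out and \<open>Re q\<close> mixes the Laurent coefficients of index \<open>n\<close> and
  \<open>- n\<close>.\<close>

lemma coefficient_bound:
  assumes R: "\<rho> < R" "R < 1" and n: "n > 0"
    and pos: "\<And>z. norm z = R \<Longrightarrow> 0 \<le> K + s * Re (q z)" and s: "s = 1 \<or> s = -1"
  shows "norm (of_real (R ^ n) * cp n + cnj (cm n) / of_real (R ^ n)) \<le> 2 * (K + s * Re (cp 0))"
proof -
  have R0: "R > 0" using R \<rho> by simp
  define Q where "Q y = q (of_real R * cis y)" for y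
  define I where "I f = integral {0..2*pi} f" for f :: "real \<Rightarrow> complex"
  have Q: "continuous_on {0..2*pi} Q" unfolding Q_def by (rule q_circle_cont[OF R])
  have cis_pow: "continuous_on {0..2*pi} (\<lambda>y. cis y ^ n)" "continuous_on {0..2*pi} (\<lambda>y. 1 / cis y ^ n)"
    by (intro continuous_intros; simp)+
  have e1: "I (\<lambda>y. Q y / cis y ^ n) = 2 * pi * (of_real (R ^ n) * cp n)"
  proof -
    have "Q y / cis y ^ n = of_real (R ^ n) * (q (of_real R * cis y) / (of_real R * cis y) ^ n)" for y
      using R0 by (simp add: Q_def power_mult_distrib)
    then have "I (\<lambda>y. Q y / cis y ^ n) = of_real (R ^ n) * I (\<lambda>y. q (of_real R * cis y) / (of_real R * cis y) ^ n)"
      by (simp only: I_def integral_mult_right)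
    also have "I (\<lambda>y. q (of_real R * cis y) / (of_real R * cis y) ^ n) = 2 * pi * cp n"
      using cp_eq[OF R, of n] by (simp add: circle_mean_def I_def field_simps)
    finally show ?thesis by simp
  qed
  have e2: "I (\<lambda>y. Q y * cis y ^ n) = 2 * pi * (cm n / of_real (R ^ n))"
  proof -
    have "Q y * cis y ^ n = (1 / of_real (R ^ n)) * (q (of_real R * cis y) * (of_real R * cis y) ^ n)" for y
      using R0 by (simp add: Q_def power_mult_distrib)
    then have "I (\<lambda>y. Q y * cis y ^ n) = (1 / of_real (R ^ n)) * I (\<lambda>y. q (of_real R * cis y) * (of_real R * cis y) ^ n)"
      by (simp only: I_def integral_mult_right)
    also have "I (\<lambda>y. q (of_real R * cis y) * (of_real R * cis y) ^ n) = 2 * pi * cm n"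
      using cm_eq[OF R, of n] by (simp add: circle_mean_def I_def field_simps)
    finally show ?thesis by simp
  qed
  have e3: "I (\<lambda>y. cnj (Q y) / cis y ^ n) = cnj (2 * pi * (cm n / of_real (R ^ n)))"
  proof -
    have "cnj (Q y) / cis y ^ n = cnj (Q y * cis y ^ n)" for y
    proof -
      have "cnj (cis y) = inverse (cis y)" by (simp add: cis_cnj)
      then show ?thesis by (simp only: divide_inverse power_inverse complex_cnj_mult complex_cnj_power)
    qed
    then have "I (\<lambda>y. cnj (Q y) / cis y ^ n) = cnj (I (\<lambda>y. Q y * cis y ^ n))"
      by (simp add: I_def integral_cnj del: complex_cnj_mult)
    then show ?thesis unfolding e2 .
  qed
  have e4: "I (\<lambda>y. 1 / cis y ^ n) = 0"
    using circle_mean_power(2)[of 1 n] n by (simp add: circle_mean_def I_def)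
  define V where "V y = K + s * Re (Q y)" for y
  have Vc: "continuous_on {0..2*pi} V" unfolding V_def by (intro continuous_intros Q)
  have V0: "0 \<le> V y" for y using R0 unfolding V_def Q_def by (intro pos) (simp add: norm_mult)
  have IV: "integral {0..2*pi} V = 2 * pi * (K + s * Re (cp 0))"
  proof -
    have "I Q = 2 * pi * cp 0"
      using cp_eq[OF R, of 0] by (simp add: circle_mean_def I_def Q_def[abs_def] field_simps)
    moreover have "(\<lambda>y. Re (Q y)) integrable_on {0..2*pi}" "Q integrable_on {0..2*pi}"
      by (intro integrable_continuous_interval continuous_intros Q)+
    moreover have "integral {0..2*pi} (\<lambda>y. Re (Q y)) = Re (I Q)"
      using integral_linear[OF calculation(3) bounded_linear_Re] by (simp add: I_def o_def)
    ultimately show ?thesis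
      unfolding V_def by (subst integral_add) (auto simp: algebra_simps intro: integrable_on_mult_right)
  qed
  have "I (\<lambda>y. of_real (V y) * (1 / cis y ^ n)) =
      s / 2 * (I (\<lambda>y. Q y / cis y ^ n) + I (\<lambda>y. cnj (Q y) / cis y ^ n)) + K * I (\<lambda>y. 1 / cis y ^ n)"
  proof -
    have i: "(\<lambda>y. Q y / cis y ^ n) integrable_on {0..2*pi}" "(\<lambda>y. cnj (Q y) / cis y ^ n) integrable_on {0..2*pi}"
      "(\<lambda>y. 1 / cis y ^ n) integrable_on {0..2*pi}"
      by (intro integrable_continuous_interval continuous_intros Q; simp)+
    have "of_real (V y) * (1 / cis y ^ n) =
        of_real (s / 2) * (Q y / cis y ^ n + cnj (Q y) / cis y ^ n) + of_real K * (1 / cis y ^ n)" for y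
    proof -
      have "of_real (Re (Q y)) = (Q y + cnj (Q y)) / 2" by (simp add: complex_add_cnj)
      then have "of_real (V y) = of_real (s / 2) * (Q y + cnj (Q y)) + of_real K" by (simp add: V_def field_simps)
      then show ?thesis by (simp add: algebra_simps add_divide_distrib)
    qed
    then have "I (\<lambda>y. of_real (V y) * (1 / cis y ^ n)) =
        I (\<lambda>y. of_real (s / 2) * (Q y / cis y ^ n + cnj (Q y) / cis y ^ n) + of_real K * (1 / cis y ^ n))" by simp
    also have "\<dots> = I (\<lambda>y. of_real (s / 2) * (Q y / cis y ^ n + cnj (Q y) / cis y ^ n)) + I (\<lambda>y. of_real K * (1 / cis y ^ n))"
      unfolding I_def using i by (intro integral_add integrable_on_mult_right integrable_add)
    also have "I (\<lambda>y. of_real (s / 2) * (Q y / cis y ^ n + cnj (Q y) / cis y ^ n)) =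
        of_real (s / 2) * (I (\<lambda>y. Q y / cis y ^ n) + I (\<lambda>y. cnj (Q y) / cis y ^ n))"
      unfolding I_def using i by (simp only: integral_mult_right integral_add)
    also have "I (\<lambda>y. of_real K * (1 / cis y ^ n)) = of_real K * I (\<lambda>y. 1 / cis y ^ n)"
      unfolding I_def by (simp only: integral_mult_right)
    finally show ?thesis by simp
  qed
  also have "\<dots> = of_real (s * pi) * (of_real (R ^ n) * cp n + cnj (cm n) / of_real (R ^ n))"
    unfolding e1 e3 e4 by (simp add: field_simps)
  finally have "norm (I (\<lambda>y. of_real (V y) * (1 / cis y ^ n))) = pi * norm (of_real (R ^ n) * cp n + cnj (cm n) / of_real (R ^ n))"
    using s by (auto simp: norm_mult)
  moreover have "norm (I (\<lambda>y. of_real (V y) * (1 / cis y ^ n))) \<le> integral {0..2*pi} V"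
    unfolding I_def by (rule norm_integral_le_positive[OF Vc V0 cis_pow(2)]) (simp add: norm_divide norm_power)
  ultimately have "pi * norm (of_real (R ^ n) * cp n + cnj (cm n) / of_real (R ^ n)) \<le> pi * (2 * (K + s * Re (cp 0)))"
    unfolding IV by (simp add: mult.assoc mult.left_commute)
  then show ?thesis using pi_gt_zero mult_le_cancel_left_pos by blast
qed

text \<open>The function \<open>w * (q w - q z) / (w - z)\<close>, with its singularity removed, has
  the same mean \<open>S\<close> over a circle outside and over one inside the circle through
  \<open>z\<close>. Expanding the kernel in powers of \<open>z / w\<close> on the former and of
  \<open>w / z\<close> on the latter yields the two halves of the Laurent series, in whose sum
  \<open>S\<close> cancels.\<close>

lemma series:
  assumes z: "z \<in> annulus \<rho>"
  obtains S where "(\<lambda>n. cp n * z ^ n) sums (q z + S)" "(\<lambda>n. cm (Suc n) / z ^ Suc n) sums (- S)"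
proof -
  have z0: "z \<noteq> 0" using z \<rho> by (auto simp: mem_annulus)
  define h where "h w = (if w = z then deriv q z else (q w - q z) / (w - z))" for w
  have h: "h holomorphic_on annulus \<rho>" unfolding h_def by (rule pole_lemma_open[OF q open_annulus])
  define g where "g w = h w * w" for w
  have g: "g holomorphic_on annulus \<rho>" unfolding g_def by (intro holomorphic_intros h)
  define R where "R = (norm z + 1) / 2"
  define R' where "R' = (norm z + \<rho>) / 2"
  have R: "\<rho> < R" "R < 1" "norm z < R" and R': "\<rho> < R'" "R' < 1" "R' < norm z"
    using z \<rho> by (auto simp: R_def R'_def mem_annulus)
  have R0: "R > 0" "R' > 0" using R(1) R'(1) \<rho> by linarith+
  have gg: "circle_mean g R = circle_mean g R'"
    by (rule circle_mean_holomorphic_const[OF g]) (use R R' R0 in auto)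
  define Q where "Q R y = q (of_real R * cis y)" for R y
  have Qc: "continuous_on X (Q R)" "continuous_on X (Q R')" for X
    unfolding Q_def using q_circle_cont R R' by auto
  have s1: "(\<lambda>n. integral {0..2*pi} (\<lambda>y. (Q R y - q z) * (z / (of_real R * cis y)) ^ n)) sums
      integral {0..2*pi} (\<lambda>y. (Q R y - q z) / (1 - z / (of_real R * cis y)))"
  proof (rule integral_geometric_sums)
    show "norm z / R < 1" using R(3) R0 by simp
  qed (use R0 in \<open>auto intro!: continuous_intros Qc simp: norm_divide norm_mult\<close>)
  have s2: "(\<lambda>n. integral {0..2*pi} (\<lambda>y. ((Q R' y - q z) * (of_real R' * cis y / z)) * ((of_real R' * cis y) / z) ^ n)) sums
      integral {0..2*pi} (\<lambda>y. ((Q R' y - q z) * (of_real R' * cis y / z)) / (1 - (of_real R' * cis y) / z))"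
  proof (rule integral_geometric_sums)
    show "R' / norm z < 1" using R'(3) z0 by simp
  qed (use R0 z0 in \<open>auto intro!: continuous_intros Qc simp: norm_divide norm_mult\<close>)
  have i: "(\<lambda>y. Q R y * f y) integrable_on {0..2*pi}" "(\<lambda>y. Q R' y * f y) integrable_on {0..2*pi}"
     "f integrable_on {0..2*pi}"
    if "continuous_on {0..2*pi} f" for f by (intro integrable_continuous_interval continuous_intros Qc that)+
  \<comment> \<open>The subtracted constant \<open>q z\<close> shows only for \<open>n = 0\<close>,
    all other powers having mean zero over a circle.\<close>
  have t1: "integral {0..2*pi} (\<lambda>y. (Q R y - q z) * (z / (of_real R * cis y)) ^ n) = 2 * pi * (cp n * z ^ n - (if n = 0 then q z else 0))" for n
  proof -
    have c: "continuous_on {0..2*pi} (\<lambda>y. 1 / (of_real R * cis y) ^ n)"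
      by (intro continuous_intros) (use R0 in auto)
    have "integral {0..2*pi} (\<lambda>y. (Q R y - q z) * (z / (of_real R * cis y)) ^ n) =
      integral {0..2*pi} (\<lambda>y. z ^ n * (Q R y * (1 / (of_real R * cis y) ^ n)) - (z ^ n * q z) * (1 / (of_real R * cis y) ^ n))"
      by (intro integral_cong) (simp add: power_divide algebra_simps diff_divide_distrib)
    also have "\<dots> = z ^ n * integral {0..2*pi} (\<lambda>y. Q R y * (1 / (of_real R * cis y) ^ n)) -
        (z ^ n * q z) * integral {0..2*pi} (\<lambda>y. 1 / (of_real R * cis y) ^ n)"
      using i[OF c] by (subst integral_diff) (auto intro: integrable_on_mult_right simp only: integral_mult_right)
    also have "integral {0..2*pi} (\<lambda>y. Q R y * (1 / (of_real R * cis y) ^ n)) = 2 * pi * cp n"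
      using cp_eq[OF R(1,2), of n] by (simp add: circle_mean_def Q_def field_simps)
    also have "integral {0..2*pi} (\<lambda>y. 1 / (of_real R * cis y) ^ n) = 2 * pi * circle_mean (\<lambda>z. 1 / z ^ n) R"
      by (simp add: circle_mean_def)
    also have "circle_mean (\<lambda>z. 1 / z ^ n) R = (if n = 0 then 1 else 0)"
      using circle_mean_power(2)[OF R0(1), of n] circle_mean_power(3)[OF R0(1), of 1 1] by auto
    finally show ?thesis by (auto simp: algebra_simps)
  qed
  have t2: "integral {0..2*pi} (\<lambda>y. ((Q R' y - q z) * (of_real R' * cis y / z)) * ((of_real R' * cis y) / z) ^ n) =
      2 * pi * (cm (Suc n) / z ^ Suc n)" for n
  proof -
    have c: "continuous_on {0..2*pi} (\<lambda>y. (of_real R' * cis y) ^ Suc n)"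
      by (intro continuous_intros)
    have "integral {0..2*pi} (\<lambda>y. ((Q R' y - q z) * (of_real R' * cis y / z)) * ((of_real R' * cis y) / z) ^ n) =
      integral {0..2*pi} (\<lambda>y. (1 / z ^ Suc n) * (Q R' y * (of_real R' * cis y) ^ Suc n) - (q z / z ^ Suc n) * (of_real R' * cis y) ^ Suc n)"
      by (intro integral_cong) (simp add: power_divide algebra_simps diff_divide_distrib)
    also have "\<dots> = (1 / z ^ Suc n) * integral {0..2*pi} (\<lambda>y. Q R' y * (of_real R' * cis y) ^ Suc n) -
        (q z / z ^ Suc n) * integral {0..2*pi} (\<lambda>y. (of_real R' * cis y) ^ Suc n)"
      using i[OF c] by (subst integral_diff) (auto intro: integrable_on_mult_right simp only: integral_mult_right)
    also have "integral {0..2*pi} (\<lambda>y. Q R' y * (of_real R' * cis y) ^ Suc n) = 2 * pi * cm (Suc n)"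
      using cm_eq[OF R'(1,2), of "Suc n"] by (simp add: circle_mean_def Q_def field_simps)
    also have "integral {0..2*pi} (\<lambda>y. (of_real R' * cis y) ^ Suc n) = 2 * pi * circle_mean (\<lambda>z. z ^ Suc n) R'"
      by (simp add: circle_mean_def)
    also have "circle_mean (\<lambda>z. z ^ Suc n) R' = 0" by (rule circle_mean_power(1)[OF R0(2)]) simp
    finally show ?thesis by simp
  qed
  define S where "S = circle_mean g R"
  have g1: "integral {0..2*pi} (\<lambda>y. (Q R y - q z) / (1 - z / (of_real R * cis y))) = 2 * pi * S"
  proof -
    have "(Q R y - q z) / (1 - z / (of_real R * cis y)) = g (of_real R * cis y)" for y
    proof -
      define w where "w = of_real R * cis y"
      have "norm w = R" using R0 by (simp add: w_def norm_mult)
      then have "w \<noteq> z" "w \<noteq> 0" using R R0 by auto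
      then show ?thesis unfolding Q_def w_def[symmetric] by (simp add: g_def h_def field_simps)
    qed
    then show ?thesis by (simp add: S_def circle_mean_def)
  qed
  have g2: "integral {0..2*pi} (\<lambda>y. ((Q R' y - q z) * (of_real R' * cis y / z)) / (1 - (of_real R' * cis y) / z)) = - (2 * pi * S)"
  proof -
    have "((Q R' y - q z) * (of_real R' * cis y / z)) / (1 - (of_real R' * cis y) / z) = - g (of_real R' * cis y)" for y
    proof -
      define w where "w = of_real R' * cis y"
      have "norm w = R'" using R0 by (simp add: w_def norm_mult)
      then have "w \<noteq> z" "w \<noteq> 0" using R' R0 by auto
      then have "(q w - q z) * (w / z) / (1 - w / z) = - ((q w - q z) / (w - z) * w)"
        using z0 by (simp add: divide_simps) (simp add: algebra_simps)
      then show ?thesis using \<open>w \<noteq> z\<close> unfolding Q_def w_def[symmetric] by (simp add: g_def h_def)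
    qed
    then show ?thesis unfolding S_def gg by (simp add: circle_mean_def)
  qed
  have "(\<lambda>n. 2 * pi * (cp n * z ^ n - (if n = 0 then q z else 0))) sums (2 * pi * S)"
    using s1 unfolding t1 g1 .
  then have "(\<lambda>n. cp n * z ^ n - (if n = 0 then q z else 0)) sums S"
    by (subst (asm) sums_mult_iff) auto
  from sums_add[OF this sums_single[of 0 "\<lambda>_. q z"]]
  have 1: "(\<lambda>n. cp n * z ^ n) sums (q z + S)" by (simp add: add.commute)
  have "(\<lambda>n. 2 * pi * (cm (Suc n) / z ^ Suc n)) sums (2 * pi * (- S))"
    using s2 unfolding t2 g2 by simp
  then have 2: "(\<lambda>n. cm (Suc n) / z ^ Suc n) sums (- S)"
    by (subst (asm) sums_mult_iff) auto
  show thesis by (rule that[OF 1 2])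
qed

end

section \<open>Estimates from positivity on the two boundary circles\<close>

context annulus_function
begin

text \<open>The mean of \<open>- Re q\<close> over any circle in the annulus, that is, the mean of
  \<open>ln (norm z / norm (f z))\<close>.\<close>

definition m :: real where "m = - Re (cp 0)"

lemma upper_bound:
  assumes "\<rho> < R" "R < 1" "n > 0"
  shows "norm (of_real (R ^ n) * cp n + cnj (cm n) / of_real (R ^ n)) \<le> 2 * (m - ln R)"
proof -
  have "norm (of_real (R ^ n) * cp n + cnj (cm n) / of_real (R ^ n)) \<le> 2 * (- ln R + (-1) * Re (cp 0))"
  proof (rule coefficient_bound[OF assms])
    fix z :: complex assume "norm z = R"
    then show "0 \<le> - ln R + - 1 * Re (q z)" using upper[of z] assms by (simp add: mem_annulus)
  qed simp
  then show ?thesis by (simp add: m_def)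
qed

text \<open>On the circle of radius \<open>R\<close> the mean of \<open>Re q\<close> is at most
  \<open>- ln R\<close>; it does not depend on \<open>R\<close>, which may tend to one.\<close>

lemma m_nonneg: "0 \<le> m"
proof -
  have "0 \<le> m - ln 1"
  proof (rule le_left_endpoint[OF \<rho>(2), where f = "\<lambda>R. 0" and g = "\<lambda>R. m - ln R"])
    show "0 \<le> m - ln R" if "\<rho> < R" "R < 1" for R
      using order_trans[OF norm_ge_zero upper_bound[OF that, of 1]] by simp
    show "isCont (\<lambda>R. m - ln R) 1" by (intro continuous_intros) auto
  qed simp
  then show ?thesis by simp
qed

lemma outer: 
  assumes "n > 0"
  shows "norm (cp n + cnj (cm n)) \<le> 2 * m"
proof -
  have "norm (of_real (1 ^ n) * cp n + cnj (cm n) / of_real (1 ^ n)) \<le> 2 * (m - ln 1)"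
  proof (rule le_left_endpoint[OF \<rho>(2), where f = "\<lambda>R. norm (of_real (R ^ n) * cp n + cnj (cm n) / of_real (R ^ n))" and g = "\<lambda>R. 2 * (m - ln R)"])
    show "isCont (\<lambda>R. 2 * (m - ln R)) 1" by (intro continuous_intros) auto
    show "isCont (\<lambda>R. norm (of_real (R ^ n) * cp n + cnj (cm n) / of_real (R ^ n))) 1" by (intro continuous_intros) auto
  qed (rule upper_bound[OF _ _ assms])
  then show ?thesis by simp
qed

lemma inner_upper:
  assumes "n > 0" "\<rho> > 0"
  shows "norm (of_real (\<rho> ^ n) * cp n + cnj (cm n) / of_real (\<rho> ^ n)) \<le> 2 * m + 2 * (- ln \<rho>)"
proof -
  have "norm (of_real (\<rho> ^ n) * cp n + cnj (cm n) / of_real (\<rho> ^ n)) \<le> 2 * (m - ln \<rho>)"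
  proof (rule le_right_endpoint[OF \<rho>(2), where f = "\<lambda>R. norm (of_real (R ^ n) * cp n + cnj (cm n) / of_real (R ^ n))" and g = "\<lambda>R. 2 * (m - ln R)"])
    show "isCont (\<lambda>R. 2 * (m - ln R)) \<rho>" by (intro continuous_intros) (use assms in auto)
    show "isCont (\<lambda>R. norm (of_real (R ^ n) * cp n + cnj (cm n) / of_real (R ^ n))) \<rho>"
      by (intro continuous_intros) (use assms in auto)
  qed (rule upper_bound[OF _ _ assms(1)])
  then show ?thesis by simp
qed

text \<open>The assumption \<open>low\<close> expresses \<open>\<sigma> \<le> norm (f z)\<close>.
  Positivity of \<open>Re q + ln R - ln \<sigma>\<close> gives a bound that contains
  \<open>- m\<close>: this yields the second claim, and weakening \<open>- m\<close> to
  \<open>m\<close> gives the first the same shape as \<open>inner_upper\<close>.\<close>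

lemma inner_lower:
  assumes "\<rho> > 0" and low: "\<And>z. z \<in> annulus \<rho> \<Longrightarrow> ln \<sigma> - ln (norm z) \<le> Re (q z)" and n: "n > 0"
  shows "norm (of_real (\<rho> ^ n) * cp n + cnj (cm n) / of_real (\<rho> ^ n)) \<le> 2 * m + 2 * (ln \<rho> - ln \<sigma>)"
    and "m \<le> ln \<rho> - ln \<sigma>"
proof -
  have *: "norm (of_real (\<rho> ^ n) * cp n + cnj (cm n) / of_real (\<rho> ^ n)) \<le> 2 * (ln \<rho> - ln \<sigma> - m)"
  proof (rule le_right_endpoint[OF \<rho>(2), where f = "\<lambda>R. norm (of_real (R ^ n) * cp n + cnj (cm n) / of_real (R ^ n))" and g = "\<lambda>R. 2 * (ln R - ln \<sigma> - m)"])
    show "isCont (\<lambda>R. 2 * (ln R - ln \<sigma> - m)) \<rho>" by (intro continuous_intros) (use assms in auto)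
    show "isCont (\<lambda>R. norm (of_real (R ^ n) * cp n + cnj (cm n) / of_real (R ^ n))) \<rho>"
      by (intro continuous_intros) (use assms in auto)
    fix R assume R: "\<rho> < R" "R < 1"
    have "norm (of_real (R ^ n) * cp n + cnj (cm n) / of_real (R ^ n)) \<le> 2 * ((ln R - ln \<sigma>) + 1 * Re (cp 0))"
    proof (rule coefficient_bound[OF R n])
      fix z :: complex assume "norm z = R"
      then show "0 \<le> (ln R - ln \<sigma>) + 1 * Re (q z)" using low[of z] R by (simp add: mem_annulus)
    qed simp
    then show "norm (of_real (R ^ n) * cp n + cnj (cm n) / of_real (R ^ n)) \<le> 2 * (ln R - ln \<sigma> - m)" by (simp add: m_def)
  qed
  then show "m \<le> ln \<rho> - ln \<sigma>" using order_trans[OF norm_ge_zero *] by simp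
  show "norm (of_real (\<rho> ^ n) * cp n + cnj (cm n) / of_real (\<rho> ^ n)) \<le> 2 * m + 2 * (ln \<rho> - ln \<sigma>)"
    using * m_nonneg by simp
qed

text \<open>A bound of \<open>Re q\<close> by \<open>- ln R\<close> grows too slowly for a singular
  part at the centre: multiply the coefficient bound by \<open>R ^ n\<close> and let
  \<open>R\<close> tend to zero.\<close>

lemma cm_punctured_disc:
  assumes "\<rho> = 0" "n > 0"
  shows "cm n = 0"
proof -
  \<comment> \<open>The right side is kept as the value at \<open>R = 0\<close> of a continuous
    majorant, where \<open>2 * sqrt R\<close> replaces \<open>- R * ln R\<close>.\<close>
  have "norm (of_real (0 ^ (2 * n)) * cp n + cnj (cm n)) \<le> 2 * (0 * m + 2 * sqrt 0)"
  proof (rule le_right_endpoint[of 0 1 "\<lambda>R. norm (of_real (R ^ (2 * n)) * cp n + cnj (cm n))" "\<lambda>R. 2 * (R * m + 2 * sqrt R)"])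
    fix R :: real assume R: "0 < R" "R < 1"
    have "norm (of_real (R ^ n) * cp n + cnj (cm n) / of_real (R ^ n)) \<le> 2 * (m - ln R)"
      by (rule upper_bound) (use R assms in auto)
    then have "R ^ n * norm (of_real (R ^ n) * cp n + cnj (cm n) / of_real (R ^ n)) \<le> R ^ n * (2 * (m - ln R))"
      using R by (intro mult_left_mono) auto
    also have "R ^ n * norm (of_real (R ^ n) * cp n + cnj (cm n) / of_real (R ^ n)) =
        norm (of_real (R ^ n) * (of_real (R ^ n) * cp n + cnj (cm n) / of_real (R ^ n)))"
      using R by (simp add: norm_mult norm_power)
    also have "of_real (R ^ n) * (of_real (R ^ n) * cp n + cnj (cm n) / of_real (R ^ n)) = of_real (R ^ (2 * n)) * cp n + cnj (cm n)"
    proof -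
      have "R ^ (2 * n) = R ^ n * R ^ n" by (simp add: mult_2 power_add)
      then show ?thesis using R by (simp add: distrib_left mult.assoc)
    qed
    also have "R ^ n * (2 * (m - ln R)) \<le> R * (2 * (m - ln R))"
    proof (rule mult_right_mono)
      show "R ^ n \<le> R" using R assms(2) power_decreasing[of 1 n R] by simp
      have "ln R < 0" using R by simp
      with m_nonneg have "0 \<le> m - ln R" by (metis diff_ge_0_iff_ge less_imp_le order_trans)
      then show "0 \<le> 2 * (m - ln R)" by (rule mult_nonneg_nonneg[OF zero_le_numeral])
    qed
    also have "\<dots> \<le> 2 * (R * m + 2 * sqrt R)"
    proof -
      have "ln (1 / sqrt R) \<le> 1 / sqrt R - 1" using R by (intro ln_le_minus_one) auto
      moreover have "ln (1 / sqrt R) = - (ln R / 2)" using R by (simp add: ln_div ln_sqrt)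
      ultimately have "- ln R \<le> 2 / sqrt R" by simp
      then have "R * (- ln R) \<le> R * (2 / sqrt R)" using R by (intro mult_left_mono) auto
      also have "R * (2 / sqrt R) = 2 * sqrt R" using R by (simp add: field_simps flip: real_sqrt_mult)
      finally show ?thesis by (simp add: algebra_simps)
    qed
    finally show "norm (of_real (R ^ (2 * n)) * cp n + cnj (cm n)) \<le> 2 * (R * m + 2 * sqrt R)" .
  next
    show "isCont (\<lambda>R. 2 * (R * m + 2 * sqrt R)) 0" by (intro continuous_intros)
    show "isCont (\<lambda>R. norm (of_real (R ^ (2 * n)) * cp n + cnj (cm n))) 0" by (intro continuous_intros)
  qed simp
  then show ?thesis using assms(2) by (simp add: power_0_left)
qed

text \<open>Eliminates \<open>cp n\<close> between the bounds on the outer and the inner circle. The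
  index starts at one, so a factor \<open>\<rho>\<close> can be split off; it meets
  \<open>\<kappa>\<close> in the product that \<open>\<omega>\<close> controls.\<close>

lemma cm_bound:
  assumes \<kappa>: "0 \<le> \<kappa>" and H: "\<And>n. n > 0 \<Longrightarrow> \<rho> > 0 \<Longrightarrow>
    norm (of_real (\<rho> ^ n) * cp n + cnj (cm n) / of_real (\<rho> ^ n)) \<le> 2 * m + 2 * \<kappa>"
  shows "norm (cm (Suc n)) \<le> (4 * m * \<rho> + 2 * (\<rho> * \<kappa>)) / (1 - \<rho>\<^sup>2) * \<rho> ^ n"
proof (cases "\<rho> = 0")
  case True
  then show ?thesis using cm_punctured_disc[OF True, of "Suc n"] by simp
next
  case False
  then have r: "0 < \<rho>" using \<rho> by simp
  define N where "N = Suc n"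
  have rN: "\<rho> ^ (2 * N) \<le> \<rho>\<^sup>2" unfolding N_def using r \<rho> by (intro power_decreasing) auto
  have r2: "\<rho>\<^sup>2 < 1" using r \<rho> by (simp add: power_less_one_iff)
  define E where "E = of_real (\<rho> ^ N) * cp N + cnj (cm N) / of_real (\<rho> ^ N)"
  define F where "F = cp N + cnj (cm N)"
  have "of_real (1 - \<rho> ^ (2 * N)) * cnj (cm N) = of_real (\<rho> ^ N) * (E - of_real (\<rho> ^ N) * F)"
  proof -
    have "\<rho> ^ (2 * N) = \<rho> ^ N * \<rho> ^ N" by (simp add: mult_2 power_add)
    then show ?thesis using r by (simp add: E_def F_def algebra_simps)
  qed
  then have "norm (of_real (1 - \<rho> ^ (2 * N)) * cnj (cm N)) = norm (of_real (\<rho> ^ N) * (E - of_real (\<rho> ^ N) * F))" by simp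
  also have "norm (of_real (1 - \<rho> ^ (2 * N)) * cnj (cm N)) = (1 - \<rho> ^ (2 * N)) * norm (cm N)"
    using rN r2 by (simp add: norm_mult del: of_real_diff)
  also have "norm (of_real (\<rho> ^ N) * (E - of_real (\<rho> ^ N) * F)) = \<rho> ^ N * norm (E - of_real (\<rho> ^ N) * F)"
    using r by (simp add: norm_mult norm_power)
  also have "\<dots> \<le> \<rho> ^ N * (4 * m + 2 * \<kappa>)"
  proof (rule mult_left_mono)
    have "norm (E - of_real (\<rho> ^ N) * F) \<le> norm E + norm (of_real (\<rho> ^ N) * F)" by (rule norm_triangle_ineq4)
    also have "norm E \<le> 2 * m + 2 * \<kappa>" unfolding E_def using r by (intro H) (auto simp: N_def)
    also have "norm (of_real (\<rho> ^ N) * F) \<le> 1 * (2 * m)"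
      unfolding norm_mult F_def using r \<rho> m_nonneg
    proof (intro mult_mono outer)
      have "\<rho> ^ N \<le> 1" by (rule power_le_one) (use r \<rho> in auto)
      then show "norm (complex_of_real (\<rho> ^ N)) \<le> 1" unfolding norm_of_real using r by simp
    qed (auto simp: N_def)
    finally show "norm (E - of_real (\<rho> ^ N) * F) \<le> 4 * m + 2 * \<kappa>" by simp
  qed (use r in auto)
  finally have "(1 - \<rho> ^ (2 * N)) * norm (cm N) \<le> \<rho> ^ N * (4 * m + 2 * \<kappa>)" .
  moreover have "(1 - \<rho>\<^sup>2) * norm (cm N) \<le> (1 - \<rho> ^ (2 * N)) * norm (cm N)"
    using rN by (intro mult_right_mono) auto
  ultimately have "(1 - \<rho>\<^sup>2) * norm (cm N) \<le> (4 * m * \<rho> + 2 * (\<rho> * \<kappa>)) * \<rho> ^ n"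
    by (simp add: N_def algebra_simps)
  then show ?thesis using r2 by (simp add: N_def pos_le_divide_eq mult.commute)
qed

text \<open>The Laurent series without its constant term, majorised by two geometric series: with
  ratio \<open>b\<close> for the positive and \<open>\<rho> / a\<close> for the negative
  indices.\<close>

lemma oscillation_bound:
  assumes \<kappa>: "0 \<le> \<kappa>" and H: "\<And>n. n > 0 \<Longrightarrow> \<rho> > 0 \<Longrightarrow>
    norm (of_real (\<rho> ^ n) * cp n + cnj (cm n) / of_real (\<rho> ^ n)) \<le> 2 * m + 2 * \<kappa>"
    and z: "a \<le> norm z" "norm z \<le> b" and ab: "\<rho> < a" "b < 1"
  shows "norm (q z - cp 0) \<le> 2 * m * (b / (1 - b)) +
    (4 * m * \<rho> + 2 * (\<rho> * \<kappa>)) / (1 - \<rho>\<^sup>2) * (b / (1 - b) + 1 / (a - \<rho>))"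
proof -
  define X where "X = (4 * m * \<rho> + 2 * (\<rho> * \<kappa>)) / (1 - \<rho>\<^sup>2)"
  have r2: "\<rho>\<^sup>2 < 1" using \<rho> by (simp add: power_less_one_iff abs_square_less_1)
  have X0: "0 \<le> X" unfolding X_def using \<rho> m_nonneg \<kappa> r2 by (intro divide_nonneg_pos add_nonneg_nonneg mult_nonneg_nonneg) auto
  have cm: "norm (cm (Suc n)) \<le> X * \<rho> ^ n" for n unfolding X_def by (rule cm_bound[OF \<kappa> H])
  have cp: "norm (cp (Suc n)) \<le> 2 * m + X" for n
  proof -
    have "norm (cp (Suc n)) \<le> norm (cp (Suc n) + cnj (cm (Suc n))) + norm (cm (Suc n))"
      using norm_triangle_ineq4[of "cp (Suc n) + cnj (cm (Suc n))" "cnj (cm (Suc n))"] by simp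
    also have "\<dots> \<le> 2 * m + X * 1"
      using order_trans[OF cm[of n] mult_left_mono[OF power_le_one[OF \<rho>(1)] X0]] \<rho>
      by (intro add_mono outer) auto
    finally show ?thesis by simp
  qed
  have za: "z \<in> annulus \<rho>" using z ab by (simp add: mem_annulus)
  have a0: "0 < a" using ab \<rho> by simp
  obtain S where S: "(\<lambda>n. cp n * z ^ n) sums (q z + S)" "(\<lambda>n. cm (Suc n) / z ^ Suc n) sums (- S)"
    using series[OF za] by blast
  have "(\<lambda>n. cp (Suc n) * z ^ Suc n) sums (q z + S - cp 0)"
    using S(1) by (subst sums_Suc_iff) simp
  from sums_add[OF this S(2)] have s: "(\<lambda>n. cp (Suc n) * z ^ Suc n + cm (Suc n) / z ^ Suc n) sums (q z - cp 0)"
    by simp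
  have g: "(\<lambda>n. (2 * m + X) * b * b ^ n + X / a * (\<rho> / a) ^ n) sums ((2 * m + X) * b * (1 / (1 - b)) + X / a * (1 / (1 - \<rho> / a)))"
    using z ab \<rho> a0 order_trans[OF norm_ge_zero z(2)] by (intro sums_add sums_mult geometric_sums) auto
  have "norm (q z - cp 0) \<le> (2 * m + X) * b * (1 / (1 - b)) + X / a * (1 / (1 - \<rho> / a))"
  proof (rule norm_sums_le[OF s g])
    fix n
    have "norm (cp (Suc n) * z ^ Suc n) \<le> (2 * m + X) * b ^ Suc n"
      unfolding norm_mult norm_power using cp[of n] z m_nonneg X0 by (intro mult_mono power_mono) auto
    moreover have "norm (cm (Suc n) / z ^ Suc n) \<le> X * \<rho> ^ n / a ^ Suc n"
      unfolding norm_divide norm_power using cm[of n] z a0 X0 \<rho> by (intro frac_le power_mono) auto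
    ultimately have "norm (cp (Suc n) * z ^ Suc n + cm (Suc n) / z ^ Suc n) \<le> (2 * m + X) * b ^ Suc n + X * \<rho> ^ n / a ^ Suc n"
      by (rule norm_triangle_mono)
    also have "\<dots> = (2 * m + X) * b * b ^ n + X / a * (\<rho> / a) ^ n" by (simp add: power_divide)
    finally show "norm (cp (Suc n) * z ^ Suc n + cm (Suc n) / z ^ Suc n) \<le> (2 * m + X) * b * b ^ n + X / a * (\<rho> / a) ^ n" .
  qed
  also have "X / a * (1 / (1 - \<rho> / a)) = X * (1 / (a - \<rho>))" using a0 ab by (simp add: field_simps)
  finally show ?thesis unfolding X_def[symmetric] by (simp add: algebra_simps)
qed

end

text \<open>For \<open>\<sigma>\<close> close to \<open>0\<close> the bound \<open>ln \<rho> - ln \<sigma>\<close> from below is useless; the upper bound on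
  \<open>Re q\<close> then still gives \<open>- ln \<rho>\<close> on the inner circle.\<close>

lemma inner_constant_exists:
  assumes \<rho>: "0 < \<rho>" "\<rho> < 1" and \<sigma>: "0 \<le> \<sigma>" "\<sigma> \<le> \<rho>"
  obtains \<kappa> where "0 \<le> \<kappa>" "\<rho> * \<kappa> \<le> 3 * (\<omega> \<rho> - \<omega> \<sigma>)" "\<kappa> = - ln \<rho> \<or> (0 < \<sigma> \<and> \<kappa> = ln \<rho> - ln \<sigma>)"
proof -
  define L where "L = - ln \<rho>"
  have L: "L > 0" using \<rho> by (simp add: L_def)
  have om: "\<omega> \<rho> = pi / L" using \<rho> by (simp add: \<omega>_def L_def)
  \<comment> \<open>From \<open>L / 2 \<le> exp (L / 2)\<close> by squaring, since
    \<open>exp L = 1 / \<rho>\<close>.\<close>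
  have rL: "\<rho> * L\<^sup>2 \<le> 4"
  proof -
    have "L / 2 \<le> exp (L / 2)" using exp_ge_add_one_self[of "L / 2"] by linarith
    then have "(L / 2)\<^sup>2 \<le> (exp (L / 2))\<^sup>2" using L by (intro power_mono) auto
    also have "(exp (L / 2))\<^sup>2 = exp L" by (simp add: power2_eq_square flip: exp_add)
    also have "exp L = 1 / \<rho>" using \<rho> by (simp add: L_def exp_minus field_simps)
    finally show ?thesis using \<rho> by (simp add: field_simps)
  qed
  have p3: "9 \<le> 3 * pi" using pi_gt3 by simp
  show thesis
  proof (cases "\<sigma> = 0")
    case True
    have "\<rho> * L * L \<le> 3 * pi" using rL p3 by (simp add: power2_eq_square algebra_simps)
    then have "\<rho> * L \<le> 3 * (\<omega> \<rho> - \<omega> \<sigma>)" using L True by (simp add: om) (simp add: \<omega>_def field_simps)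
    then show thesis using that[of L] L by (simp add: L_def)
  next
    case False
    define l where "l = - ln \<sigma>"
    have s: "\<sigma> > 0" using \<sigma> False by simp
    have l: "L \<le> l" using s \<sigma> \<rho> by (simp add: L_def l_def)
    have l0: "l > 0" using l L by simp
    have os: "\<omega> \<sigma> = pi / l" using s by (simp add: \<omega>_def l_def)
    have D: "\<omega> \<rho> - \<omega> \<sigma> = pi * (l - L) / (L * l)" unfolding om os using L l0 by (simp add: field_simps)
    show thesis
    \<comment> \<open>For comparable logarithms \<open>ln \<rho> - ln \<sigma>\<close> is the right
      constant; otherwise \<open>\<omega> \<sigma>\<close> is at most half of
      \<open>\<omega> \<rho>\<close> and \<open>- ln \<rho>\<close> will do. The factor
      \<open>3\<close> comes from \<open>8 \<le> 3 * pi\<close>, which both cases need.\<close>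
    proof (cases "l \<le> 2 * L")
      case True
      have "\<rho> * L * l \<le> \<rho> * L * (2 * L)" using True \<rho> L by (intro mult_left_mono) auto
      also have "\<dots> \<le> 3 * pi" using rL p3 by (simp add: power2_eq_square algebra_simps)
      finally have "(\<rho> * L * l) * (l - L) \<le> 3 * pi * (l - L)" using l by (intro mult_right_mono) auto
      then have "\<rho> * (l - L) \<le> 3 * (\<omega> \<rho> - \<omega> \<sigma>)" unfolding D using L l0 by (simp add: field_simps)
      then show thesis using that[of "l - L"] l s by (simp add: L_def l_def)
    next
      case False
      have "pi / l \<le> pi / (2 * L)" using False L l0 by (intro divide_left_mono) auto
      then have "pi / (2 * L) \<le> \<omega> \<rho> - \<omega> \<sigma>" unfolding om os using L by (simp add: field_simps)
      moreover have "\<rho> * L \<le> 3 * (pi / (2 * L))"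
        using rL p3 L by (simp add: power2_eq_square field_simps)
      ultimately have "\<rho> * L \<le> 3 * (\<omega> \<rho> - \<omega> \<sigma>)"
        by (meson mult_left_mono order_trans zero_le_numeral)
      then show thesis using that[of L] L by (simp add: L_def)
    qed
  qed
qed

text \<open>On the segment from \<open>0\<close> to \<open>w\<close> the real part never exceeds
  \<open>max 0 (Re w)\<close>, which bounds the derivative of \<open>exp\<close> there.\<close>

lemma norm_exp_minus_one_le: "norm (exp w - 1) \<le> norm w * max 1 (exp (Re w))"
proof -
  have "norm (exp w - exp 0) \<le> max 1 (exp (Re w)) * norm (w - 0)"
  proof (rule field_differentiable_bound[of "closed_segment 0 w" exp exp])
    fix z assume "z \<in> closed_segment 0 w"
    then obtain u where u: "0 \<le> u" "u \<le> 1" "z = u *\<^sub>R w" by (auto simp: in_segment)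
    have "u * Re w \<le> max 0 (Re w)"
    proof (cases "0 \<le> Re w")
      case True then show ?thesis using u mult_left_le_one_le[of "Re w" u] by simp
    next
      case False then show ?thesis using u by (simp add: mult_nonneg_nonpos)
    qed
    then have "exp (u * Re w) \<le> exp (max 0 (Re w))" by simp
    also have "\<dots> = max 1 (exp (Re w))" by (simp add: max_def)
    finally show "norm (exp z) \<le> max 1 (exp (Re w))" using u by (simp add: norm_exp_eq_Re)
  qed (auto intro!: derivative_eq_intros)
  then show ?thesis by (simp add: mult.commute)
qed

text \<open>The two alternatives: either the annuli do not degenerate, and the mean of \<open>q\<close> is controlled by
  \<open>ln \<rho> - ln \<sigma>\<close>; or they are so thick that the value at one point close to the centre dominates
  the mean.\<close>

lemma near_identity_estimate:
  assumes ab: "0 \<le> \<rho>0" "\<rho>0 < a" "b < 1" and z0: "a \<le> norm z0" "norm z0 \<le> b"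
    and alt: "0 < \<sigma>0 \<or> (\<rho>0 \<le> 1/1024 \<and> norm z0 = 1/16)"
  obtains C where "0 \<le> C"
    "\<And>\<rho> \<sigma> f z. 0 \<le> \<sigma> \<Longrightarrow> \<sigma>0 \<le> \<sigma> \<Longrightarrow> \<sigma> \<le> \<rho> \<Longrightarrow> \<rho> \<le> \<rho>0 \<Longrightarrow> f holomorphic_on annulus \<rho> \<Longrightarrow>
      f ` annulus \<rho> \<subseteq> annulus \<sigma> \<Longrightarrow> (\<And>w. norm w = norm z0 \<Longrightarrow> norm (f w - w) < norm w / 2) \<Longrightarrow>
      a \<le> norm z \<Longrightarrow> norm z \<le> b \<Longrightarrow>
      norm (f z - z) \<le> C * (norm (f z0 - z0) + (\<omega> \<rho> - \<omega> \<sigma>))"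
proof -
  have a: "0 < a" "a \<le> b" "a < 1" "\<rho>0 < 1" using ab z0 by linarith+
  \<comment> \<open>\<open>oscillation_bound\<close> made uniform in
    \<open>\<rho> \<le> \<rho>0\<close>: the numerator
    \<open>4 * m * \<rho> + 2 * (\<rho> * \<kappa>)\<close> is at most
    \<open>4 * m + 6 * \<Delta>\<close>, with
    \<open>\<Delta> = \<omega> \<rho> - \<omega> \<sigma>\<close>.\<close>
  define B where "B = 2 * (b / (1 - b)) + 6 / (1 - \<rho>0\<^sup>2) * (b / (1 - b) + 1 / (a - \<rho>0))"
  \<comment> \<open>From \<open>ln \<rho> - ln \<sigma> = (\<omega> \<rho> - \<omega> \<sigma>) * ln
    \<rho> * ln \<sigma> / pi\<close>, where both logarithms are at most
    \<open>- ln \<sigma>0\<close> in modulus if \<open>\<sigma>0 > 0\<close>.\<close>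
  define C1 where "C1 = (ln \<sigma>0)\<^sup>2 / pi"
  \<comment> \<open>Covers both alternatives for the bound on \<open>m\<close>; \<open>802\<close>
    arises from \<open>2 * norm (q z0) + 800 * \<Delta>\<close>.\<close>
  define C2 where "C2 = C1 + 802"
  define C3 where "C3 = (2 * B + 1) * (C2 + 1) + 1"
  have r02: "\<rho>0\<^sup>2 < 1" using ab a by (simp add: abs_square_less_1)
  have B0: "0 \<le> B" unfolding B_def using ab a r02 by (intro add_nonneg_nonneg mult_nonneg_nonneg divide_nonneg_nonneg) auto
  have C10: "0 \<le> C1" by (simp add: C1_def)
  have C20: "0 \<le> C2" using C10 by (simp add: C2_def)
  have C30: "0 \<le> C3" using B0 C20 by (simp add: C3_def)
  have a2: "1 \<le> 2 / a" using a by simp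
  show thesis
  proof
    show "0 \<le> C3 * (2 / a)" using C30 a by simp
    fix \<rho> \<sigma> :: real and f and z :: complex
    assume \<sigma>: "0 \<le> \<sigma>" "\<sigma>0 \<le> \<sigma>" "\<sigma> \<le> \<rho>" and \<rho>le: "\<rho> \<le> \<rho>0" and f: "f holomorphic_on annulus \<rho>"
      and im: "f ` annulus \<rho> \<subseteq> annulus \<sigma>" and near: "\<And>w. norm w = norm z0 \<Longrightarrow> norm (f w - w) < norm w / 2"
      and z: "a \<le> norm z" "norm z \<le> b"
    have \<rho>': "0 \<le> \<rho>" "\<rho> < 1" "\<rho> < norm z0" using \<sigma> \<rho>le a ab z0 by linarith+
    have nz: "f w \<noteq> 0" if "w \<in> annulus \<rho>" for w using im that \<sigma> by (fastforce simp: mem_annulus)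
    obtain q where q: "q holomorphic_on annulus \<rho>" and fq: "\<And>w. w \<in> annulus \<rho> \<Longrightarrow> f w = w * exp (q w)"
      and qLn: "\<And>w. norm w = norm z0 \<Longrightarrow> q w = Ln (f w / w)"
    proof (rule annulus_logarithm[OF \<rho>'(1) f nz \<rho>'(3)])
      show "norm z0 < 1" using z0 ab by simp
      show "norm (f w - w) < norm w" if "norm w = norm z0" for w
        using near[OF that] by (smt (verit) field_sum_of_halves norm_ge_zero)
    qed auto
    have Req: "Re (q w) = ln (norm (f w)) - ln (norm w)" if "w \<in> annulus \<rho>" for w
    proof -
      have "w \<noteq> 0" using that \<rho>' by (auto simp: mem_annulus)
      then show ?thesis using fq[OF that] by (simp add: norm_mult ln_mult norm_exp_eq_Re)
    qed
    have fn: "\<sigma> < norm (f w)" "norm (f w) < 1" "0 < norm (f w)" if "w \<in> annulus \<rho>" for w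
    proof -
      have "f w \<in> annulus \<sigma>" using im that by blast
      then show "\<sigma> < norm (f w)" "norm (f w) < 1" "0 < norm (f w)" using nz[OF that] by (auto simp: mem_annulus)
    qed
    interpret annulus_function q \<rho>
      by unfold_locales (use q \<rho>' Req fn in \<open>auto intro: less_imp_le\<close>)
    define \<Delta> where "\<Delta> = \<omega> \<rho> - \<omega> \<sigma>"
    have low: "ln \<sigma> - ln (norm w) \<le> Re (q w)" if "w \<in> annulus \<rho>" "0 < \<sigma>" for w
      using Req[OF that(1)] fn[OF that(1)] that(2) by simp
    obtain \<kappa> where \<kappa>: "0 \<le> \<kappa>" "\<rho> * \<kappa> \<le> 3 * \<Delta>"
      and H: "\<And>n. n > 0 \<Longrightarrow> \<rho> > 0 \<Longrightarrow> norm (of_real (\<rho> ^ n) * cp n + cnj (cm n) / of_real (\<rho> ^ n)) \<le> 2 * m + 2 * \<kappa>"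
    proof (cases "\<rho> > 0")
      case True
      obtain \<kappa> where \<kappa>: "0 \<le> \<kappa>" "\<rho> * \<kappa> \<le> 3 * (\<omega> \<rho> - \<omega> \<sigma>)" "\<kappa> = - ln \<rho> \<or> (0 < \<sigma> \<and> \<kappa> = ln \<rho> - ln \<sigma>)"
        using inner_constant_exists[OF True \<rho>'(2) \<sigma>(1,3)] by blast
      have "norm (of_real (\<rho> ^ n) * cp n + cnj (cm n) / of_real (\<rho> ^ n)) \<le> 2 * m + 2 * \<kappa>" if "n > 0" for n
        using \<kappa>(3)
      proof
        assume "\<kappa> = - ln \<rho>" then show ?thesis using inner_upper[OF that True] by simp
      next
        assume "0 < \<sigma> \<and> \<kappa> = ln \<rho> - ln \<sigma>" then show ?thesis using inner_lower(1)[OF True low that] by simp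
      qed
      then show ?thesis using that[of \<kappa>] \<kappa>(1,2) by (simp add: \<Delta>_def)
    next
      case False
      then have "\<rho> = 0" "\<sigma> = 0" using \<rho>' \<sigma> by auto
      then show ?thesis using that[of 0] by (simp add: \<Delta>_def)
    qed
    have \<Delta>0: "0 \<le> \<Delta>" using \<kappa> \<rho>' mult_nonneg_nonneg[of \<rho> \<kappa>] by linarith
    have z0a: "z0 \<in> annulus \<rho>" using \<rho>' z0 ab by (simp add: mem_annulus)
    have osc: "norm (q w - cp 0) \<le> B * (m + \<Delta>)" if w: "a \<le> norm w" "norm w \<le> b" for w
    proof -
      have "norm (q w - cp 0) \<le> 2 * m * (b / (1 - b)) +
          (4 * m * \<rho> + 2 * (\<rho> * \<kappa>)) / (1 - \<rho>\<^sup>2) * (b / (1 - b) + 1 / (a - \<rho>))"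
        using oscillation_bound[OF \<kappa>(1) H w] \<rho>le ab by simp
      also have "\<dots> \<le> 2 * (m + \<Delta>) * (b / (1 - b)) + (6 * (m + \<Delta>)) / (1 - \<rho>0\<^sup>2) * (b / (1 - b) + 1 / (a - \<rho>0))"
      proof (intro add_mono mult_mono)
        have "m * \<rho> \<le> m * 1" using m_nonneg \<rho>' by (intro mult_left_mono) auto
        then have "4 * m * \<rho> + 2 * (\<rho> * \<kappa>) \<le> 6 * (m + \<Delta>)" using \<kappa>(2) m_nonneg by simp
        moreover have "1 - \<rho>0\<^sup>2 \<le> 1 - \<rho>\<^sup>2" using \<rho>le \<rho>' by (simp add: power_mono)
        moreover have "0 \<le> 4 * m * \<rho> + 2 * (\<rho> * \<kappa>)" using m_nonneg \<rho>' \<kappa>(1) by simp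
        ultimately show "(4 * m * \<rho> + 2 * (\<rho> * \<kappa>)) / (1 - \<rho>\<^sup>2) \<le> (6 * (m + \<Delta>)) / (1 - \<rho>0\<^sup>2)"
          using r02 by (intro frac_le) auto
        show "1 / (a - \<rho>) \<le> 1 / (a - \<rho>0)" using \<rho>le ab by (intro divide_left_mono) auto
        show "0 \<le> 6 * (m + \<Delta>) / (1 - \<rho>0\<^sup>2)" using m_nonneg \<Delta>0 r02 by (intro divide_nonneg_nonneg) auto
      qed (use a ab \<rho>le m_nonneg \<Delta>0 in auto)
      also have "\<dots> = B * (m + \<Delta>)" unfolding B_def by (simp add: algebra_simps add_divide_distrib)
      finally show ?thesis .
    qed
    have m_le: "m \<le> C2 * (norm (q z0) + \<Delta>)"
      using alt
    proof
      assume s0: "0 < \<sigma>0"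
      then have s: "0 < \<sigma>" "0 < \<rho>" using \<sigma> by linarith+
      have "m \<le> ln \<rho> - ln \<sigma>" using inner_lower(2)[OF s(2) low[OF _ s(1)], of 1] by simp
      also have "\<dots> = \<Delta> * (ln \<rho> * ln \<sigma>) / pi"
        using s \<rho>' \<sigma> by (simp add: \<Delta>_def \<omega>_def field_simps)
      also have "\<dots> \<le> \<Delta> * ((ln \<sigma>0)\<^sup>2) / pi"
      proof (intro divide_right_mono mult_left_mono)
        have "ln \<sigma>0 \<le> ln \<sigma>" "ln \<sigma> \<le> ln \<rho>" "ln \<rho> < 0" using s s0 \<sigma> \<rho>' by auto
        then have "(- ln \<rho>) * (- ln \<sigma>) \<le> (- ln \<sigma>0) * (- ln \<sigma>0)" by (intro mult_mono) auto
        then show "ln \<rho> * ln \<sigma> \<le> (ln \<sigma>0)\<^sup>2" by (simp add: power2_eq_square)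
      qed (use \<Delta>0 in auto)
      also have "\<dots> = C1 * \<Delta>" by (simp add: C1_def)
      also have "\<dots> \<le> C2 * (norm (q z0) + \<Delta>)" using C10 \<Delta>0 by (intro mult_mono) (auto simp: C2_def)
      finally show ?thesis .
    next
      \<comment> \<open>The radii \<open>1/16\<close> and \<open>1/1024\<close> make the coefficient
        of \<open>m\<close> in the oscillation bound at most \<open>1/2\<close>, so that
        \<open>m\<close> can be absorbed by the left side.\<close>
      assume H': "\<rho>0 \<le> 1/1024 \<and> norm z0 = 1/16"
      have small: "\<rho> \<le> 1/1024" using H' \<rho>le by simp
      have "norm (q z0 - cp 0) \<le> 2 * m * ((1/16) / (1 - 1/16)) +
          (4 * m * \<rho> + 2 * (\<rho> * \<kappa>)) / (1 - \<rho>\<^sup>2) * ((1/16) / (1 - 1/16) + 1 / (1/16 - \<rho>))"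
        by (rule oscillation_bound[OF \<kappa>(1) H]) (use H' small in auto)
      also have "\<dots> \<le> 2 * m * (1/15) + (4 * m * (1/1024) + 6 * \<Delta>) / (1/2) * (1/15 + 1 / (1/32))"
      proof (intro add_mono mult_mono)
        have "m * \<rho> \<le> m * (1/1024)" using m_nonneg small by (intro mult_left_mono) auto
        then have "4 * m * \<rho> + 2 * (\<rho> * \<kappa>) \<le> 4 * m * (1/1024) + 6 * \<Delta>" using \<kappa>(2) by simp
        moreover have "\<rho>\<^sup>2 \<le> (1/1024)\<^sup>2" using small \<rho>' by (intro power_mono)
        moreover have "0 \<le> 4 * m * \<rho> + 2 * (\<rho> * \<kappa>)" using m_nonneg \<rho>' \<kappa>(1) by simp
        ultimately show "(4 * m * \<rho> + 2 * (\<rho> * \<kappa>)) / (1 - \<rho>\<^sup>2) \<le> (4 * m * (1/1024) + 6 * \<Delta>) / (1/2)"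
          by (intro frac_le) (auto simp: power2_eq_square)
        show "1 / (1/16 - \<rho>) \<le> 1 / (1/32)" using small by (intro divide_left_mono) auto
      qed (use m_nonneg small \<Delta>0 in auto)
      also have "\<dots> \<le> m / 2 + 400 * \<Delta>"
      proof -
        have "2 * x * (1/15) + (4 * x * (1/1024) + 6 * y) / (1/2) * (1/15 + 1 / (1/32)) \<le> x / 2 + 400 * y"
          if "0 \<le> x" "0 \<le> y" for x y :: real
          using that by (simp add: field_simps)
        from this[OF m_nonneg \<Delta>0] show ?thesis .
      qed
      finally have 1: "norm (q z0 - cp 0) \<le> m / 2 + 400 * \<Delta>" .
      have "Re (q z0) + m \<le> norm (q z0 - cp 0)" using complex_Re_le_cmod[of "q z0 - cp 0"] by (simp add: m_def)
      moreover have "- Re (q z0) \<le> norm (q z0)" using abs_Re_le_cmod[of "q z0"] by linarith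
      ultimately have "m \<le> 2 * norm (q z0) + 800 * \<Delta>" using 1 by linarith
      also have "\<dots> \<le> 802 * (norm (q z0) + \<Delta>)" using \<Delta>0 by (simp add: algebra_simps)
      also have "\<dots> \<le> C2 * (norm (q z0) + \<Delta>)" using C10 \<Delta>0 by (intro mult_right_mono) (auto simp: C2_def)
      finally show ?thesis .
    qed
    have z0n: "norm z0 > 0" using z0 a by linarith
    have za: "z \<in> annulus \<rho>" using z \<rho>le ab by (simp add: mem_annulus)
    \<comment> \<open>The factor \<open>2\<close> is the Lipschitz constant of \<open>Ln\<close> at
      \<open>1\<close> on the disc of radius \<open>1/2\<close>; division by
      \<open>norm z0 \<ge> a\<close> accounts for the rest.\<close>
    have q0: "norm (q z0) \<le> (2 / a) * norm (f z0 - z0)"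
    proof -
      have z00: "z0 \<noteq> 0" using z0n by auto
      have e: "f z0 / z0 = 1 + (f z0 - z0) / z0" using z00 by (simp add: field_simps)
      have "norm ((f z0 - z0) / z0) < 1 / 2" using near[of z0] z0n by (simp add: norm_divide field_simps)
      then have "norm (Ln (1 + (f z0 - z0) / z0)) \<le> 2 * norm ((f z0 - z0) / z0)" by (rule norm_Ln_le)
      then have "norm (q z0) \<le> 2 * (norm (f z0 - z0) / norm z0)" using qLn[of z0] unfolding e by (simp add: norm_divide)
      also have "\<dots> \<le> 2 * (norm (f z0 - z0) / a)" using z0 a z0n by (intro mult_left_mono divide_left_mono) auto
      finally show ?thesis by simp
    qed
    define T where "T = norm (q z0) + \<Delta>"
    have T0: "0 \<le> T" using \<Delta>0 by (simp add: T_def)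
    have "\<Delta> \<le> T" by (simp add: T_def)
    then have mT: "m + \<Delta> \<le> (C2 + 1) * T" using m_le unfolding T_def[symmetric] by (simp add: distrib_right)
    \<comment> \<open>\<open>norm z * max 1 (exp (Re (q z)))\<close> is the larger of
      \<open>norm z\<close> and \<open>norm (f z)\<close>, both less than one.\<close>
    have "norm (f z - z) \<le> norm (q z)"
    proof -
      have "f z - z = z * (exp (q z) - 1)" using fq[OF za] by (simp add: algebra_simps)
      then have "norm (f z - z) = norm z * norm (exp (q z) - 1)" by (simp add: norm_mult)
      also have "\<dots> \<le> norm z * (norm (q z) * max 1 (exp (Re (q z))))"
        by (intro mult_left_mono norm_exp_minus_one_le) auto
      also have "\<dots> = norm (q z) * max (norm z) (norm (f z))"
        using fq[OF za] by (simp add: norm_mult norm_exp_eq_Re max_mult_distrib_left algebra_simps)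
      also have "\<dots> \<le> norm (q z) * 1" using fn(2)[OF za] z ab by (intro mult_left_mono) auto
      finally show ?thesis by simp
    qed
    also have "norm (q z) \<le> norm (q z - cp 0) + norm (cp 0)" using norm_triangle_ineq[of "q z - cp 0" "cp 0"] by simp
    also have "norm (cp 0) \<le> \<bar>Re (cp 0)\<bar> + \<bar>Im (cp 0)\<bar>" by (rule cmod_le)
    also have "\<bar>Re (cp 0)\<bar> = m" using m_nonneg by (simp add: m_def)
    \<comment> \<open>The rotational part of \<open>f\<close>, on which positivity is silent; it is
      read off at the reference point \<open>z0\<close>.\<close>
    also have "\<bar>Im (cp 0)\<bar> \<le> norm (q z0) + norm (q z0 - cp 0)"
      using abs_Im_le_cmod[of "q z0"] abs_Im_le_cmod[of "q z0 - cp 0"] by simp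
    finally have "norm (f z - z) \<le> norm (q z - cp 0) + m + norm (q z0) + norm (q z0 - cp 0)" by simp
    also have "\<dots> \<le> B * (m + \<Delta>) + (m + \<Delta>) + T + B * (m + \<Delta>)"
      using osc[OF z] osc[OF z0] \<Delta>0 by (simp add: T_def)
    also have "\<dots> = (2 * B + 1) * (m + \<Delta>) + T" by (simp add: algebra_simps)
    also have "\<dots> \<le> (2 * B + 1) * ((C2 + 1) * T) + T"
      using B0 mT by (intro add_mono mult_left_mono) auto
    also have "\<dots> = C3 * T" by (simp add: C3_def algebra_simps)
    also have "\<dots> \<le> C3 * ((2 / a) * (norm (f z0 - z0) + \<Delta>))"
    proof (rule mult_left_mono[OF _ C30])
      have "\<Delta> * 1 \<le> \<Delta> * (2 / a)" using \<Delta>0 a2 by (rule mult_left_mono[rotated])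
      then show "T \<le> 2 / a * (norm (f z0 - z0) + \<Delta>)" using q0 by (simp add: T_def algebra_simps)
    qed
    finally show "norm (f z - z) \<le> C3 * (2 / a) * (norm (f z0 - z0) + (\<omega> \<rho> - \<omega> \<sigma>))"
      unfolding \<Delta>_def by (simp only: mult.assoc)
  qed
qed

section \<open>Evolution families\<close>

text \<open>\<open>k\<omega>\<close> is a density for the decrease of \<open>\<omega> (r t)\<close>.
  The order \<open>d\<close> of the domain system enters only here; the treatment of vector fields
  relies on the monotone continuous radii alone.\<close>

locale evolution = annular_domains +
  fixes d :: ennreal and \<phi> :: "real \<Rightarrow> real \<Rightarrow> complex \<Rightarrow> complex" and k\<omega> :: "real \<Rightarrow> real"
  assumes d: "1 \<le> d" and ef: "evolution_family d D \<phi>"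
    and k\<omega>_nonneg: "\<And>t. 0 \<le> k\<omega> t" and k\<omega>_Ld: "\<And>T. Ld d {0..T} k\<omega>"
    and k\<omega>_bound: "\<And>u t. 0 \<le> u \<Longrightarrow> u \<le> t \<Longrightarrow> \<omega> (r u) - \<omega> (r t) \<le> integral {u..t} k\<omega>"
begin

lemma ef_holomorphic: "0 \<le> s \<Longrightarrow> s \<le> t \<Longrightarrow> \<phi> s t holomorphic_on D s"
  using ef by (simp add: evolution_family_def)

lemma ef_in: "0 \<le> s \<Longrightarrow> s \<le> t \<Longrightarrow> z \<in> D s \<Longrightarrow> \<phi> s t z \<in> D t"
  using ef[unfolded evolution_family_def, THEN conjunct1] by blast

lemma ef_id: "0 \<le> s \<Longrightarrow> z \<in> D s \<Longrightarrow> \<phi> s s z = z"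
  using ef by (simp add: evolution_family_def)

lemma ef_comp: "0 \<le> s \<Longrightarrow> s \<le> u \<Longrightarrow> u \<le> t \<Longrightarrow> z \<in> D s \<Longrightarrow> \<phi> s t z = \<phi> u t (\<phi> s u z)"
  using ef[unfolded evolution_family_def, THEN conjunct2, THEN conjunct2, THEN conjunct1] by blast

lemma ef_norm: "0 \<le> s \<Longrightarrow> s \<le> t \<Longrightarrow> z \<in> D s \<Longrightarrow> norm (\<phi> s t z) \<le> 1"
  using ef_in[of s t z] by (simp add: mem_D)

lemma ef_increment:
  assumes "0 \<le> S" "S \<le> T" "z \<in> D S"
  obtains k :: "real \<Rightarrow> real" where "\<And>x. x \<in> {S..T} \<Longrightarrow> 0 \<le> k x" "Ld d {S..T} k" "k absolutely_integrable_on {S..T}"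
    "\<And>s u t. S \<le> s \<Longrightarrow> s \<le> u \<Longrightarrow> u \<le> t \<Longrightarrow> t \<le> T \<Longrightarrow> norm (\<phi> s u z - \<phi> s t z) \<le> integral {u..t} k"
proof -
  obtain k :: "real \<Rightarrow> real" where k: "\<forall>\<xi>\<in>{S..T}. 0 \<le> k \<xi>" "Ld d {S..T} k"
    "\<forall>s u t. S \<le> s \<and> s \<le> u \<and> u \<le> t \<and> t \<le> T \<longrightarrow> norm (\<phi> s u z - \<phi> s t z) \<le> (LINT \<xi>:{u..t}|lebesgue. k \<xi>)"
    using ef assms unfolding evolution_family_def by meson
  have ai: "k absolutely_integrable_on {S..T}" by (rule Ld_imp_absolutely_integrable[OF k(2) _ d]) simp
  show thesis
  proof (rule that[of k])
    fix s u t assume st: "S \<le> s" "s \<le> u" "u \<le> t" "t \<le> T"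
    have "norm (\<phi> s u z - \<phi> s t z) \<le> (LINT \<xi>:{u..t}|lebesgue. k \<xi>)" using k(3) st by blast
    also have "\<dots> = integral {u..t} k" by (rule LINT_Icc_eq_integral[OF ai]) (use st in auto)
    finally show "norm (\<phi> s u z - \<phi> s t z) \<le> integral {u..t} k" .
  qed (use k ai in auto)
qed

lemma integral_uniformly_small:
  fixes k :: "real \<Rightarrow> real"
  assumes k: "k integrable_on {S..T}" and e: "e > 0"
  obtains \<eta> where "\<eta> > 0" "\<And>u t. S \<le> u \<Longrightarrow> u \<le> t \<Longrightarrow> t \<le> T \<Longrightarrow> t - u < \<eta> \<Longrightarrow> integral {u..t} k < e"
proof -
  have "uniformly_continuous_on {S..T} (\<lambda>x. integral {S..x} k)"
    by (intro compact_uniformly_continuous indefinite_integral_continuous_1 k) auto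
  then obtain \<eta> where \<eta>: "\<eta> > 0" "\<And>x y. x \<in> {S..T} \<Longrightarrow> y \<in> {S..T} \<Longrightarrow> dist y x < \<eta> \<Longrightarrow>
      dist (integral {S..y} k) (integral {S..x} k) < e"
    using e unfolding uniformly_continuous_on_def by metis
  show thesis
  proof (rule that[OF \<eta>(1)])
    fix u t assume ut: "S \<le> u" "u \<le> t" "t \<le> T" "t - u < \<eta>"
    have "dist (integral {S..t} k) (integral {S..u} k) < e" using ut by (intro \<eta>(2)) (auto simp: dist_real_def)
    then show "integral {u..t} k < e" using integral_diff_Icc[OF k ut(1-3)] by (simp add: dist_real_def)
  qed
qed

lemma compact_margin:
  assumes "0 \<le> s" "compact K" "K \<subseteq> D s"
  obtains \<delta> where "\<delta> > 0" "\<And>z. z \<in> K \<Longrightarrow> cball z \<delta> \<subseteq> D s"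
proof -
  obtain \<delta> where "\<delta> > 0" "(\<Union>z\<in>K. cball z \<delta>) \<subseteq> D s"
    using compact_subset_open_imp_cball_epsilon_subset[OF assms(2) open_D[OF assms(1)] assms(3)] by metis
  then show thesis by (intro that) auto
qed

text \<open>All maps of the family take values in the unit disc, so Cauchy's inequality gives a
  Lipschitz constant that is independent of \<open>s\<close> and \<open>t\<close>.\<close>

lemma ef_Lipschitz:
  assumes S: "0 \<le> S" "S \<le> s" "s \<le> t" and \<delta>: "\<delta> > 0" "cball z (2 * \<delta>) \<subseteq> D S" and xy: "x \<in> cball z \<delta>" "y \<in> cball z \<delta>"
  shows "norm (\<phi> s t x - \<phi> s t y) \<le> 1 / \<delta> * norm (x - y)"
proof (rule holomorphic_Lipschitz_cball[OF ef_holomorphic open_D _ \<delta>(1) ef_norm xy])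
  show "cball z (2 * \<delta>) \<subseteq> D s" using \<delta>(2) D_mono[OF S(1,2)] by blast
  show "w \<in> D s" if "w \<in> cball z (2 * \<delta>)" for w using that \<delta>(2) D_mono[OF S(1,2)] by blast
qed (use S in auto)

text \<open>(EF3) at the points of a finite net, spread to the compact set by the common Lipschitz
  constant. The statement is qualitative, but it supplies the closeness to the identity on a circle
  that the logarithm requires.\<close>

lemma ef_uniformly_close:
  assumes S: "0 \<le> S" "S \<le> T" and K: "compact K" "K \<subseteq> D S" and e: "e > 0"
  obtains \<eta> where "\<eta> > 0" "\<And>s u t z. S \<le> s \<Longrightarrow> s \<le> u \<Longrightarrow> u \<le> t \<Longrightarrow> t \<le> T \<Longrightarrow> t - u < \<eta> \<Longrightarrow> z \<in> K \<Longrightarrow>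
     norm (\<phi> s u z - \<phi> s t z) < e"
proof -
  obtain \<delta>0 where \<delta>0: "\<delta>0 > 0" "\<And>z. z \<in> K \<Longrightarrow> cball z \<delta>0 \<subseteq> D S" using compact_margin[OF S(1) K] by blast
  define \<delta> where "\<delta> = \<delta>0 / 2"
  have \<delta>: "\<delta> > 0" "\<And>z. z \<in> K \<Longrightarrow> cball z (2 * \<delta>) \<subseteq> D S" using \<delta>0 by (auto simp: \<delta>_def)
  define \<delta>' where "\<delta>' = min \<delta> (\<delta> * e / 3)"
  have \<delta>': "\<delta>' > 0" "\<delta>' \<le> \<delta>" "1 / \<delta> * \<delta>' \<le> e / 3" using \<delta>(1) e by (auto simp: \<delta>'_def min_def field_simps)
  obtain F where F': "F \<subseteq> K" "finite F" "K \<subseteq> (\<Union>z\<in>F. ball z \<delta>')"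
  proof (rule compactE_image[OF K(1), of K "\<lambda>z. ball z \<delta>'"])
    show "K \<subseteq> (\<Union>z\<in>K. ball z \<delta>')" using \<delta>'(1) by auto
  qed (auto intro: that)
  note F = F'(2,1,3)
  have "\<exists>\<eta>>0. \<forall>s u t. S \<le> s \<and> s \<le> u \<and> u \<le> t \<and> t \<le> T \<and> t - u < \<eta> \<longrightarrow> norm (\<phi> s u z - \<phi> s t z) < e / 3"
    if z: "z \<in> F" for z
  proof -
    have zD: "z \<in> D S" using z F K by blast
    obtain k where "\<And>x. x \<in> {S..T} \<Longrightarrow> 0 \<le> k x" "Ld d {S..T} k" and k: "k absolutely_integrable_on {S..T}"
      "\<And>s u t. S \<le> s \<Longrightarrow> s \<le> u \<Longrightarrow> u \<le> t \<Longrightarrow> t \<le> T \<Longrightarrow> norm (\<phi> s u z - \<phi> s t z) \<le> integral {u..t} k"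
      by (rule ef_increment[OF S zD]) (rule that)
    have "e / 3 > 0" using e by simp
    then obtain \<eta> where \<eta>: "\<eta> > 0" "\<And>u t. S \<le> u \<Longrightarrow> u \<le> t \<Longrightarrow> t \<le> T \<Longrightarrow> t - u < \<eta> \<Longrightarrow> integral {u..t} k < e / 3"
      using integral_uniformly_small[OF set_lebesgue_integral_eq_integral(1)[OF k(1)]] by blast
    show ?thesis
    proof (intro exI[of _ \<eta>] conjI allI impI \<eta>(1))
      fix s u t assume H: "S \<le> s \<and> s \<le> u \<and> u \<le> t \<and> t \<le> T \<and> t - u < \<eta>"
      then have "norm (\<phi> s u z - \<phi> s t z) \<le> integral {u..t} k" by (intro k(2)) auto
      also have "\<dots> < e / 3" using H by (intro \<eta>(2)) auto
      finally show "norm (\<phi> s u z - \<phi> s t z) < e / 3" .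
    qed
  qed
  then obtain \<eta> where \<eta>: "\<And>z. z \<in> F \<Longrightarrow> \<eta> z > 0" "\<And>z s u t. z \<in> F \<Longrightarrow> S \<le> s \<Longrightarrow> s \<le> u \<Longrightarrow> u \<le> t \<Longrightarrow> t \<le> T \<Longrightarrow> t - u < \<eta> z \<Longrightarrow>
      norm (\<phi> s u z - \<phi> s t z) < e / 3"
    by metis
  define \<eta>0 where "\<eta>0 = Min (insert 1 (\<eta> ` F))"
  have \<eta>0: "\<eta>0 > 0" "\<And>z. z \<in> F \<Longrightarrow> \<eta>0 \<le> \<eta> z" using F(1) \<eta>(1) by (auto simp: \<eta>0_def)
  show thesis
  proof (rule that[OF \<eta>0(1)])
    fix s u t z assume H: "S \<le> s" "s \<le> u" "u \<le> t" "t \<le> T" "t - u < \<eta>0" "z \<in> K"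
    then obtain y where y: "y \<in> F" "z \<in> ball y \<delta>'" using F(3) by blast
    have yK: "y \<in> K" using y F by blast
    have d1: "norm (\<phi> s v z - \<phi> s v y) < e / 3" if "s \<le> v" for v
    proof -
      have "norm (\<phi> s v z - \<phi> s v y) \<le> 1 / \<delta> * norm (z - y)"
        using y(2) \<delta>' \<delta>(1) that H by (intro ef_Lipschitz[OF S(1) H(1) that \<delta>(1) \<delta>(2)[OF yK]]) auto
      also have "\<dots> < 1 / \<delta> * \<delta>'" using y(2) \<delta>(1) by (intro mult_strict_left_mono) (auto simp: dist_norm norm_minus_commute)
      finally show ?thesis using \<delta>'(3) by linarith
    qed
    have d2: "norm (\<phi> s u y - \<phi> s t y) < e / 3" using H \<eta>0(2)[OF y(1)] by (intro \<eta>(2)[OF y(1)]) auto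
    have "\<phi> s u z - \<phi> s t z = (\<phi> s u z - \<phi> s u y) + (\<phi> s u y - \<phi> s t y) - (\<phi> s t z - \<phi> s t y)" by simp
    also have "norm \<dots> \<le> norm (\<phi> s u z - \<phi> s u y) + norm (\<phi> s u y - \<phi> s t y) + norm (\<phi> s t z - \<phi> s t y)"
      by (rule order_trans[OF norm_triangle_ineq4 add_right_mono[OF norm_triangle_ineq]])
    also have "\<dots> < e" using d1[of u] d1[of t] d2 H by linarith
    finally show "norm (\<phi> s u z - \<phi> s t z) < e" .
  qed
qed

lemma ef_jointly_continuous:
  assumes s: "0 \<le> s" and K: "compact K" "K \<subseteq> D s"
  shows "continuous_on (K \<times> {s..T}) (\<lambda>p. \<phi> s (snd p) (fst p))"
  unfolding continuous_on_iff
proof (intro ballI allI impI)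
  fix p and e :: real assume p: "p \<in> K \<times> {s..T}" and e: "0 < e"
  obtain z t where pz: "p = (z, t)" by fastforce
  have z: "z \<in> K" and t: "s \<le> t" "t \<le> T" using p by (auto simp: pz)
  have sT: "s \<le> T" using t by simp
  have e2: "e / 2 > 0" using e by simp
  obtain \<eta> where \<eta>: "\<eta> > 0" "\<And>s' u t z. s \<le> s' \<Longrightarrow> s' \<le> u \<Longrightarrow> u \<le> t \<Longrightarrow> t \<le> T \<Longrightarrow> t - u < \<eta> \<Longrightarrow> z \<in> K \<Longrightarrow>
     norm (\<phi> s' u z - \<phi> s' t z) < e / 2"
    using ef_uniformly_close[OF s sT K e2] by blast
  have "continuous_on K (\<phi> s t)"
    using holomorphic_on_imp_continuous_on[OF ef_holomorphic[OF s t(1)]] K(2) by (rule continuous_on_subset)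
  then obtain \<delta> where \<delta>: "\<delta> > 0" "\<And>x. x \<in> K \<Longrightarrow> dist x z < \<delta> \<Longrightarrow> dist (\<phi> s t x) (\<phi> s t z) < e / 2"
    using z e2 unfolding continuous_on_iff by metis
  have "dist (\<phi> s t' z') (\<phi> s t z) < e" if "z' \<in> K" "s \<le> t'" "t' \<le> T" "dist (z', t') (z, t) < min \<eta> \<delta>" for z' t'
  proof -
    have dd: "dist z' z < \<delta>" "dist t' t < \<eta>"
      using that(4) dist_fst_le[of "(z', t')" "(z, t)"] dist_snd_le[of "(z', t')" "(z, t)"] by auto
    have "dist (\<phi> s t' z') (\<phi> s t z') < e / 2"
      using \<eta>(2)[of s t t' z'] \<eta>(2)[of s t' t z'] that t dd(2)
      by (cases "t \<le> t'") (auto simp: dist_norm norm_minus_commute)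
    then show ?thesis using \<delta>(2)[OF that(1) dd(1)] dist_triangle_half_r[of "\<phi> s t z'" "\<phi> s t' z'" e "\<phi> s t z"]
      by (metis dist_commute dist_triangle_half_l)
  qed
  then show "\<exists>da>0. \<forall>p'\<in>K \<times> {s..T}. dist p' p < da \<longrightarrow> dist (\<phi> s (snd p') (fst p')) (\<phi> s (snd p) (fst p)) < e"
    using \<eta>(1) \<delta>(1) by (intro exI[of _ "min \<eta> \<delta>"]) (auto simp: pz)
qed

lemma ef_graph_compact:
  assumes s: "0 \<le> s" and K: "compact K" "K \<subseteq> D s"
  shows "compact ((\<lambda>p. (\<phi> s (snd p) (fst p), snd p)) ` (K \<times> {s..T}))"
    "(\<lambda>p. (\<phi> s (snd p) (fst p), snd p)) ` (K \<times> {s..T}) \<subseteq> total_domain D"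
proof -
  show "compact ((\<lambda>p. (\<phi> s (snd p) (fst p), snd p)) ` (K \<times> {s..T}))"
    by (intro compact_continuous_image continuous_intros ef_jointly_continuous[OF assms] compact_Times K) auto
  show "(\<lambda>p. (\<phi> s (snd p) (fst p), snd p)) ` (K \<times> {s..T}) \<subseteq> total_domain D"
    using s K ef_in by (auto simp: mem_total_domain)
qed

section \<open>One density for all points of a compact set\<close>

text \<open>The uniform version of (EF3) for maps close to the diagonal. The density is defined on
  the whole half-line and nonnegative, so that densities of finitely many sets can be added;
  \<open>\<eta>\<close> is the time span on which the logarithm is available.\<close>

definition controls :: "(complex \<times> real) set \<Rightarrow> (real \<Rightarrow> real) \<Rightarrow> real \<Rightarrow> bool" where
  "controls V k \<eta> \<longleftrightarrow> \<eta> > 0 \<and> (\<forall>t. 0 \<le> k t) \<and> (\<forall>T. Ld d {0..T} k) \<and>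
    (\<forall>z u t. (z, u) \<in> V \<and> (z, u) \<in> total_domain D \<and> u \<le> t \<and> t < u + \<eta> \<longrightarrow> norm (\<phi> u t z - z) \<le> integral {u..t} k)"

text \<open>The reference point is a point of the box if the inner radius stays positive up to
  \<open>T\<close>; otherwise it has modulus \<open>1/16\<close>, and the box is widened to contain
  it. Its increments under (EF3) and the density \<open>k\<omega>\<close> then dominate those of all
  points of the box.\<close>

lemma box_control:
  assumes S: "0 \<le> S" "S \<le> T" and ab: "r S < a" "a \<le> b" "b < 1" and alt: "0 < r T \<or> r S \<le> 1/1024"
  obtains k \<eta> where "\<eta> > 0" "\<And>t. t \<in> {S..T} \<Longrightarrow> 0 \<le> k t" "Ld d {S..T} k"
    "\<And>u t z. S \<le> u \<Longrightarrow> u \<le> t \<Longrightarrow> t \<le> T \<Longrightarrow> t - u < \<eta> \<Longrightarrow> a \<le> norm z \<Longrightarrow> norm z \<le> b \<Longrightarrow>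
      norm (\<phi> u t z - z) \<le> integral {u..t} k"
proof -
  define a' where "a' = (if 0 < r T then a else min a (1/16))"
  define b' where "b' = (if 0 < r T then b else max b (1/16))"
  define \<rho>1 where "\<rho>1 = (if 0 < r T then a else 1/16)"
  define z0 where "z0 = complex_of_real \<rho>1"
  have rS: "0 \<le> r S" "r S < 1" using r_nonneg r_less_1 S by auto
  have rT0: "0 \<le> r T" using r_nonneg S by auto
  have a': "r S < a'" "a' \<le> a" "b \<le> b'" "b' < 1" "a' \<le> \<rho>1" "\<rho>1 \<le> b'" "\<rho>1 > 0"
    using ab alt rS by (auto simp: a'_def b'_def \<rho>1_def)
  have nz0: "norm z0 = \<rho>1" using a' by (simp add: z0_def)
  have alt': "0 < r T \<or> (r S \<le> 1/1024 \<and> norm z0 = 1/16)" using alt rT0 by (auto simp: nz0 \<rho>1_def)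
  obtain C where C: "0 \<le> C"
    "\<And>\<rho> \<sigma> f z. 0 \<le> \<sigma> \<Longrightarrow> r T \<le> \<sigma> \<Longrightarrow> \<sigma> \<le> \<rho> \<Longrightarrow> \<rho> \<le> r S \<Longrightarrow> f holomorphic_on annulus \<rho> \<Longrightarrow>
      f ` annulus \<rho> \<subseteq> annulus \<sigma> \<Longrightarrow> (\<And>w. norm w = norm z0 \<Longrightarrow> norm (f w - w) < norm w / 2) \<Longrightarrow>
      a' \<le> norm z \<Longrightarrow> norm z \<le> b' \<Longrightarrow>
      norm (f z - z) \<le> C * (norm (f z0 - z0) + (\<omega> \<rho> - \<omega> \<sigma>))"
    using near_identity_estimate[OF rS(1) a'(1,4) _ _ alt'] a'(5,6) unfolding nz0 by metis
  have z0D: "z0 \<in> D S" using S a' by (simp add: mem_D nz0)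
  obtain k where k: "\<And>x. x \<in> {S..T} \<Longrightarrow> 0 \<le> k x" "Ld d {S..T} k" "k absolutely_integrable_on {S..T}"
    "\<And>s u t. S \<le> s \<Longrightarrow> s \<le> u \<Longrightarrow> u \<le> t \<Longrightarrow> t \<le> T \<Longrightarrow> norm (\<phi> s u z0 - \<phi> s t z0) \<le> integral {u..t} k"
    by (rule ef_increment[OF S z0D]) (rule that)
  have k\<omega>: "Ld d {S..T} k\<omega>" using k\<omega>_Ld[of T] by (rule Ld_subset) (use S d in auto)
  have k\<omega>i: "k\<omega> absolutely_integrable_on {S..T}" by (rule Ld_imp_absolutely_integrable[OF k\<omega> _ d]) simp
  have sph: "compact (sphere (0::complex) \<rho>1)" "sphere 0 \<rho>1 \<subseteq> D S" using S a' by (auto simp: mem_D)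
  have r12: "\<rho>1 / 2 > 0" using a' by simp
  obtain \<eta> where \<eta>: "\<eta> > 0" "\<And>s u t z. S \<le> s \<Longrightarrow> s \<le> u \<Longrightarrow> u \<le> t \<Longrightarrow> t \<le> T \<Longrightarrow> t - u < \<eta> \<Longrightarrow> z \<in> sphere 0 \<rho>1 \<Longrightarrow>
     norm (\<phi> s u z - \<phi> s t z) < \<rho>1 / 2"
    using ef_uniformly_close[OF S sph r12] by blast
  show thesis
  proof (rule that[of \<eta> "\<lambda>t. C * (k t + k\<omega> t)", OF \<eta>(1)])
    show "0 \<le> C * (k t + k\<omega> t)" if "t \<in> {S..T}" for t using C(1) k(1)[OF that] k\<omega>_nonneg by simp
    show "Ld d {S..T} (\<lambda>t. C * (k t + k\<omega> t))" by (intro Ld_scale Ld_add k k\<omega> d)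
 fix u t :: real and z :: complex assume H: "S \<le> u" "u \<le> t" "t \<le> T" "t - u < \<eta>" "a \<le> norm z" "norm z \<le> b"
    have u0: "0 \<le> u" "0 \<le> t" using H S by auto
    have Du: "D u = annulus (r u)" "D t = annulus (r t)" using D_eq u0 by auto
    have sub: "{u..t} \<subseteq> {S..T}" using H by auto
    have uS: "w \<in> D u" if "w \<in> D S" for w using D_mono[OF S(1) H(1)] that by blast
    have "norm (\<phi> u t z - z) \<le> C * (norm (\<phi> u t z0 - z0) + (\<omega> (r u) - \<omega> (r t)))"
    proof (rule C(2))
      show "0 \<le> r t" "r T \<le> r t" "r t \<le> r u" "r u \<le> r S"
        using r_nonneg r_antimono H S u0 by auto
      show "\<phi> u t holomorphic_on annulus (r u)" using ef_holomorphic[OF u0(1) H(2)] Du by simp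
      show "\<phi> u t ` annulus (r u) \<subseteq> annulus (r t)" using ef_in[OF u0(1) H(2)] Du by auto
      show "norm (\<phi> u t w - w) < norm w / 2" if "norm w = norm z0" for w
      proof -
        have w: "w \<in> sphere 0 \<rho>1" using that by (simp add: nz0)
        have "norm (\<phi> u u w - \<phi> u t w) < \<rho>1 / 2" using H w by (intro \<eta>(2)) auto
        then show ?thesis using ef_id[OF u0(1) uS] w sph(2) that by (auto simp: nz0 norm_minus_commute)
      qed
      show "a' \<le> norm z" "norm z \<le> b'" using H a' by auto
    qed
    also have "\<dots> \<le> C * (integral {u..t} k + integral {u..t} k\<omega>)"
    proof (intro mult_left_mono add_mono C(1))
      show "norm (\<phi> u t z0 - z0) \<le> integral {u..t} k"
        using k(4)[of u u t] H ef_id[OF u0(1) uS[OF z0D]] by (simp add: norm_minus_commute)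
      show "\<omega> (r u) - \<omega> (r t) \<le> integral {u..t} k\<omega>" by (rule k\<omega>_bound[OF u0(1) H(2)])
    qed
    also have "\<dots> = integral {u..t} (\<lambda>x. C * (k x + k\<omega> x))"
    proof -
      have "k integrable_on {u..t}" "k\<omega> integrable_on {u..t}"
        using set_lebesgue_integral_eq_integral(1)[OF k(3)] set_lebesgue_integral_eq_integral(1)[OF k\<omega>i] sub
        by (auto intro: integrable_on_subinterval)
      then show ?thesis by (simp add: integral_add)
    qed
    finally show "norm (\<phi> u t z - z) \<le> integral {u..t} (\<lambda>x. C * (k x + k\<omega> x))" .
  qed
qed

lemma local_control:
  assumes zu: "(z0, u0) \<in> total_domain D"
  obtains V k \<eta> where "open V" "(z0, u0) \<in> V" "controls V k \<eta>"
proof -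
  have u0: "0 \<le> u0" and z0: "r u0 < norm z0" "norm z0 < 1" using zu by (auto simp: mem_total_domain mem_D)
  define a where "a = (r u0 + norm z0) / 2"
  define b where "b = (norm z0 + 1) / 2"
  have ab: "r u0 < a" "a < norm z0" "norm z0 < b" "b < 1" using z0 by (auto simp: a_def b_def)
  have r0: "0 \<le> r u0" using r_nonneg u0 by auto
  \<comment> \<open>If \<open>r u0 = 0\<close>, the radii stay below \<open>1/1024\<close> near
    \<open>u0\<close>; if \<open>r u0 > 0\<close>, they stay positive. In both cases they stay below
    \<open>a\<close>.\<close>
  define e where "e = (if r u0 = 0 then min a (1/1024) else min (a - r u0) (r u0))"
  have e: "e > 0" using ab r0 by (auto simp: e_def)
  then obtain \<delta> where \<delta>: "\<delta> > 0" "\<And>t. 0 \<le> t \<Longrightarrow> dist t u0 < \<delta> \<Longrightarrow> dist (r t) (r u0) < e"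
    using r_cont u0 unfolding continuous_on_iff by (metis atLeast_iff)
  define S where "S = max 0 (u0 - \<delta> / 2)"
  define T where "T = u0 + \<delta> / 2"
  have ST: "0 \<le> S" "S \<le> u0" "u0 < T" "S \<le> T" using \<delta>(1) u0 by (auto simp: S_def T_def)
  have dS: "dist (r S) (r u0) < e" "dist (r T) (r u0) < e"
    using \<delta> u0 by (auto simp: S_def T_def dist_real_def intro!: \<delta>(2))
  have rS: "r S < a" using dS(1) ab r0 by (auto simp: e_def dist_real_def split: if_splits)
  have alt: "0 < r T \<or> r S \<le> 1/1024" using dS r0 by (auto simp: e_def dist_real_def split: if_splits)
  obtain k \<eta> where k: "\<eta> > 0" "\<And>t. t \<in> {S..T} \<Longrightarrow> 0 \<le> k t" "Ld d {S..T} k"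
    "\<And>u t z. S \<le> u \<Longrightarrow> u \<le> t \<Longrightarrow> t \<le> T \<Longrightarrow> t - u < \<eta> \<Longrightarrow> a \<le> norm z \<Longrightarrow> norm z \<le> b \<Longrightarrow>
      norm (\<phi> u t z - z) \<le> integral {u..t} k"
  proof (rule box_control[OF ST(1,4) rS _ ab(4) alt])
    show "a \<le> b" using ab by simp
  qed (rule that)
  \<comment> \<open>The time window ends at \<open>u0 + \<delta> / 4\<close>, so that a further step
    of length \<open>\<delta> / 4\<close> does not pass \<open>T\<close>.\<close>
  define V where "V = {z :: complex. a < norm z \<and> norm z < b} \<times> {u0 - \<delta> / 2<..<u0 + \<delta> / 4}"
  show thesis
  proof (rule that[of V "\<lambda>t. indicator {S..T} t * k t" "min \<eta> (\<delta> / 4)"])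
    show "open V" unfolding V_def
      by (intro open_Times open_Collect_conj open_Collect_less continuous_intros open_greaterThanLessThan)
    show "(z0, u0) \<in> V" using ab \<delta>(1) by (auto simp: V_def)
    show "controls V (\<lambda>t. indicator {S..T} t * k t) (min \<eta> (\<delta> / 4))"
      unfolding controls_def
    proof (intro conjI allI impI)
      show "0 < min \<eta> (\<delta> / 4)" using k(1) \<delta>(1) by simp
      show "0 \<le> indicator {S..T} t * k t" for t using k(2)[of t] by (auto simp: indicator_def)
      show "Ld d {0..M} (\<lambda>t. indicator {S..T} t * k t)" for M by (rule Ld_restrict[OF k(3) _ _ d]) auto
      fix z u t assume H: "(z, u) \<in> V \<and> (z, u) \<in> total_domain D \<and> u \<le> t \<and> t < u + min \<eta> (\<delta> / 4)"
      then have H': "a < norm z" "norm z < b" "u0 - \<delta> / 2 < u" "u < u0 + \<delta> / 4" "0 \<le> u" "u \<le> t" "t < u + \<eta>" "t < u + \<delta> / 4"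
        by (auto simp: V_def mem_total_domain)
      then have uS: "S \<le> u" "t \<le> T" by (auto simp: S_def T_def)
      have "norm (\<phi> u t z - z) \<le> integral {u..t} k" using H' uS by (intro k(4)) auto
      also have "\<dots> = integral {u..t} (\<lambda>t. indicator {S..T} t * k t)"
        using uS by (intro integral_cong) auto
      finally show "norm (\<phi> u t z - z) \<le> integral {u..t} (\<lambda>t. indicator {S..T} t * k t)" .
    qed
  qed
qed

lemma controls_mono:
  assumes "controls V k \<eta>" "0 < \<eta>'" "\<eta>' \<le> \<eta>" "\<And>t. k t \<le> k' t" "\<And>T. Ld d {0..T} k'"
  shows "controls V k' \<eta>'"
  unfolding controls_def
proof (intro conjI allI impI)
  show "0 < \<eta>'" by fact
  show "0 \<le> k' t" for t using assms(1,4) unfolding controls_def by (meson order_trans)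
  show "Ld d {0..T} k'" for T by fact
  fix z u t assume H: "(z, u) \<in> V \<and> (z, u) \<in> total_domain D \<and> u \<le> t \<and> t < u + \<eta>'"
  then have "norm (\<phi> u t z - z) \<le> integral {u..t} k" using assms(1,3) unfolding controls_def by auto
  also have "\<dots> \<le> integral {u..t} k'"
  proof (rule integral_le)
    have u: "{u..t} \<subseteq> {0..t}" using H by (simp add: mem_total_domain)
    have i: "h integrable_on {u..t}" if "Ld d {0..t} h" for h :: "real \<Rightarrow> real"
      using set_lebesgue_integral_eq_integral(1)[OF Ld_imp_absolutely_integrable[OF that _ d]] u
      by (auto intro: integrable_on_subinterval)
    show "k integrable_on {u..t}" using assms(1) unfolding controls_def by (intro i) blast
    show "k' integrable_on {u..t}" by (intro i assms(5))
  qed (use assms(4) in auto)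
  finally show "norm (\<phi> u t z - z) \<le> integral {u..t} k'" .
qed

text \<open>Finite subcover, with the sum of the densities and the smallest of the time
  spans.\<close>

lemma compact_control:
  assumes K: "compact K" "K \<subseteq> total_domain D"
  obtains k \<eta> where "controls K k \<eta>"
proof -
  have "\<exists>V k \<eta>. open V \<and> p \<in> V \<and> controls V k \<eta>" if "p \<in> K" for p
    using local_control[of "fst p" "snd p"] that K(2) by (metis prod.collapse subsetD)
  then obtain V k \<eta> where V: "\<And>p. p \<in> K \<Longrightarrow> open (V p)" "\<And>p. p \<in> K \<Longrightarrow> p \<in> V p" "\<And>p. p \<in> K \<Longrightarrow> controls (V p) (k p) (\<eta> p)"
    by metis
  obtain F where F: "F \<subseteq> K" "finite F" "K \<subseteq> (\<Union>p\<in>F. V p)"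
  proof (rule compactE_image[OF K(1), of K V])
    show "K \<subseteq> (\<Union>p\<in>K. V p)" using V(2) by blast
  qed (auto intro: that V(1))
  define k0 where "k0 t = (\<Sum>p\<in>F. k p t)" for t
  define \<eta>0 where "\<eta>0 = Min (insert 1 (\<eta> ` F))"
  have pos: "0 \<le> k p t" "0 < \<eta> p" if "p \<in> F" for p t using V(3)[of p] that F(1) unfolding controls_def by auto
  have \<eta>0: "\<eta>0 > 0" "\<And>z. z \<in> F \<Longrightarrow> \<eta>0 \<le> \<eta> z" using F(2) pos by (auto simp: \<eta>0_def)
  have Ld: "Ld d {0..T} k0" for T
  proof -
    have "Ld d {0..T} (\<lambda>t. \<Sum>p\<in>F'. k p t)" if "F' \<subseteq> F" for F'
      using finite_subset[OF that F(2)] that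
    proof (induction F' rule: finite_induct)
      case empty
      then show ?case by (simp add: Ld_zero)
    next
      case (insert p F')
      then have "Ld d {0..T} (k p)" using V(3)[of p] F(1) unfolding controls_def by blast
      then show ?case using insert by (simp add: Ld_add d)
    qed
    then show ?thesis unfolding k0_def by blast
  qed
  have c: "controls (V p) k0 \<eta>0" if "p \<in> F" for p
  proof (rule controls_mono[OF V(3) \<eta>0(1) \<eta>0(2)[OF that] _ Ld])
    show "p \<in> K" using that F by blast
    show "k p t \<le> k0 t" for t unfolding k0_def using F(2) that pos by (intro member_le_sum) auto
  qed
  have "controls K k0 \<eta>0"
    unfolding controls_def
  proof (intro conjI allI impI \<eta>0(1) Ld)
    show "0 \<le> k0 t" for t unfolding k0_def using pos by (intro sum_nonneg) auto
    fix z u t assume H: "(z, u) \<in> K \<and> (z, u) \<in> total_domain D \<and> u \<le> t \<and> t < u + \<eta>0"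
    then obtain p where "p \<in> F" "(z, u) \<in> V p" using F(3) by blast
    then show "norm (\<phi> u t z - z) \<le> integral {u..t} k0" using c H unfolding controls_def by blast
  qed
  then show thesis by (rule that)
qed

end

section \<open>Difference quotients of holomorphic families\<close>

lemma has_vector_derivative_iff_quotient:
  fixes f :: "real \<Rightarrow> complex"
  shows "(f has_vector_derivative L) (at t within I) \<longleftrightarrow>
    ((\<lambda>\<tau>. (f \<tau> - f t) / of_real (\<tau> - t)) \<longlongrightarrow> L) (at t within I)"
proof -
  have "((\<lambda>\<tau>. (1 / norm (\<tau> - t)) *\<^sub>R (f \<tau> - (f t + (\<tau> - t) *\<^sub>R L))) \<longlongrightarrow> 0) (at t within I) \<longleftrightarrow>
      ((\<lambda>\<tau>. norm ((1 / norm (\<tau> - t)) *\<^sub>R (f \<tau> - (f t + (\<tau> - t) *\<^sub>R L)))) \<longlongrightarrow> 0) (at t within I)"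
    by (rule tendsto_norm_zero_iff[symmetric])
  also have "\<dots> \<longleftrightarrow> ((\<lambda>\<tau>. norm ((f \<tau> - f t) / of_real (\<tau> - t) - L)) \<longlongrightarrow> 0) (at t within I)"
  proof (rule tendsto_cong)
    have "norm ((1 / norm (\<tau> - t)) *\<^sub>R (f \<tau> - (f t + (\<tau> - t) *\<^sub>R L))) = norm ((f \<tau> - f t) / of_real (\<tau> - t) - L)"
      if "\<tau> \<noteq> t" for \<tau>
    proof -
      have ne: "complex_of_real (\<tau> - t) \<noteq> 0" using that by (metis eq_iff_diff_eq_0 of_real_eq_0_iff)
      have "(f \<tau> - f t) / of_real (\<tau> - t) - L = (f \<tau> - (f t + (\<tau> - t) *\<^sub>R L)) / of_real (\<tau> - t)"
        using ne by (simp only: scaleR_conv_of_real diff_divide_distrib add_divide_distrib) simp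
      then show ?thesis by (simp add: norm_divide norm_mult del: of_real_diff)
    qed
    then show "\<forall>\<^sub>F \<tau> in at t within I. norm ((1 / norm (\<tau> - t)) *\<^sub>R (f \<tau> - (f t + (\<tau> - t) *\<^sub>R L))) =
        norm ((f \<tau> - f t) / of_real (\<tau> - t) - L)"
      by (auto simp: eventually_at_filter)
  qed
  also have "\<dots> \<longleftrightarrow> ((\<lambda>\<tau>. (f \<tau> - f t) / of_real (\<tau> - t)) \<longlongrightarrow> L) (at t within I)"
    by (subst tendsto_norm_zero_iff) (rule LIM_zero_iff)
  finally show ?thesis
    unfolding has_vector_derivative_def has_derivative_within
    by (simp add: bounded_linear_scaleR_left)
qed

lemma sup_norm_bounds:
  assumes "0 \<le> e" "\<And>z. z \<in> K \<Longrightarrow> norm (f z) \<le> e"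
  shows "0 \<le> sup_norm K f" "sup_norm K f \<le> e"
proof -
  have "0 \<le> sup_norm K f \<and> sup_norm K f \<le> e"
  proof (cases "K = {}")
    case False
    then obtain z where z: "z \<in> K" by blast
    have "bdd_above ((\<lambda>z. norm (f z)) ` K)" using assms(2) by (intro bdd_aboveI[of _ e]) auto
    then have "norm (f z) \<le> (SUP z\<in>K. norm (f z))" using z by (rule cSUP_upper2) simp
    then have "0 \<le> (SUP z\<in>K. norm (f z))" using norm_ge_zero order_trans by blast
    moreover have "(SUP z\<in>K. norm (f z)) \<le> e" using False assms(2) by (rule cSUP_least)
    ultimately show ?thesis using False by (simp add: sup_norm_def)
  qed (use assms(1) in \<open>simp add: sup_norm_def\<close>)
  then show "0 \<le> sup_norm K f" "sup_norm K f \<le> e" by auto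
qed

lemma sup_norm_singleton: "sup_norm {z} f = norm (f z)"
  by (simp add: sup_norm_def)

lemma has_hol_derivativeI:
  assumes "g holomorphic_on U"
    and "\<And>K e. compact K \<Longrightarrow> K \<subseteq> U \<Longrightarrow> e > 0 \<Longrightarrow> \<exists>\<eta>>0. \<forall>\<tau>\<in>I. \<tau> \<noteq> t \<and> \<bar>\<tau> - t\<bar> < \<eta> \<longrightarrow>
      (\<forall>z\<in>K. norm (g z - (F \<tau> z - F t z) / of_real (\<tau> - t)) \<le> e)"
  shows "has_hol_derivative U I F g t"
  unfolding has_hol_derivative_def tendsto_iff
proof (intro conjI allI impI assms(1))
  fix K and e :: real assume K: "compact K \<and> K \<subseteq> U" and e: "0 < e"
  obtain \<eta> where \<eta>: "\<eta> > 0" "\<And>\<tau> z. \<tau> \<in> I \<Longrightarrow> \<tau> \<noteq> t \<Longrightarrow> \<bar>\<tau> - t\<bar> < \<eta> \<Longrightarrow> z \<in> K \<Longrightarrow>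
      norm (g z - (F \<tau> z - F t z) / of_real (\<tau> - t)) \<le> e / 2"
    using assms(2)[of K "e / 2"] K e by auto
  have "dist (sup_norm K (\<lambda>z. g z - (F \<tau> z - F t z) / of_real (\<tau> - t))) 0 < e"
    if "\<tau> \<in> I" "\<tau> \<noteq> t" "dist \<tau> t < \<eta>" for \<tau>
    using sup_norm_bounds[of "e / 2" K "\<lambda>z. g z - (F \<tau> z - F t z) / of_real (\<tau> - t)"] \<eta>(2)[OF that(1,2)] that(3) e
    by (auto simp: dist_real_def)
  then show "\<forall>\<^sub>F \<tau> in at t within I. dist (sup_norm K (\<lambda>z. g z - (F \<tau> z - F t z) / of_real (\<tau> - t))) 0 < e"
    unfolding eventually_at using \<eta>(1) by blast
qed

lemma has_hol_derivative_pointwise: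
  assumes "has_hol_derivative U I F g t" "z \<in> U"
  shows "((\<lambda>\<tau>. (F \<tau> z - F t z) / of_real (\<tau> - t)) \<longlongrightarrow> g z) (at t within I)"
proof -
  have "((\<lambda>\<tau>. norm (g z - (F \<tau> z - F t z) / of_real (\<tau> - t))) \<longlongrightarrow> 0) (at t within I)"
    using assms unfolding has_hol_derivative_def by (auto dest!: spec[of _ "{z}"] simp: sup_norm_singleton)
  then have "((\<lambda>\<tau>. norm ((F \<tau> z - F t z) / of_real (\<tau> - t) - g z)) \<longlongrightarrow> 0) (at t within I)"
    by (simp only: norm_minus_commute)
  then show ?thesis by (simp only: tendsto_norm_zero_iff LIM_zero_iff)
qed

text \<open>A locally bounded family of holomorphic functions is locally equi-Lipschitz, so pointwise
  convergence of the difference quotients on a dense set implies locally uniform convergence.\<close>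

lemma has_hol_derivative_exists:
  assumes U: "open U" and t: "t \<in> I" and acc: "\<And>n. t + 1 / real (Suc n) \<in> I"
    and F: "\<And>\<tau>. \<tau> \<in> I \<Longrightarrow> F \<tau> holomorphic_on U"
    and bnd: "\<And>K. compact K \<Longrightarrow> K \<subseteq> U \<Longrightarrow> \<exists>C \<eta>. \<eta> > 0 \<and>
      (\<forall>\<tau>\<in>I. \<forall>z\<in>K. \<bar>\<tau> - t\<bar> < \<eta> \<longrightarrow> norm (F \<tau> z - F t z) \<le> C * \<bar>\<tau> - t\<bar>)"
    and dense: "\<And>V. open V \<Longrightarrow> V \<noteq> {} \<Longrightarrow> \<exists>z\<in>Z. z \<in> V"
    and diff: "\<And>z. z \<in> Z \<Longrightarrow> z \<in> U \<Longrightarrow> \<exists>L. ((\<lambda>\<tau>. (F \<tau> z - F t z) / of_real (\<tau> - t)) \<longlongrightarrow> L) (at t within I)"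
  shows "\<exists>g. has_hol_derivative U I F g t"
proof -
  define Q where "Q \<tau> z = (F \<tau> z - F t z) / of_real (\<tau> - t)" for \<tau> z
  have Qh: "Q \<tau> holomorphic_on U" if "\<tau> \<in> I" "\<tau> \<noteq> t" for \<tau>
    unfolding Q_def using that t by (intro holomorphic_intros F) (auto simp flip: of_real_diff)
  \<comment> \<open>The Cauchy condition for the quotients, uniform on \<open>K\<close>; it avoids
    naming the limit function before it is constructed.\<close>
  have cauchy: "\<exists>\<eta>>0. \<forall>\<tau>\<in>I. \<forall>\<tau>'\<in>I. \<forall>z\<in>K. \<tau> \<noteq> t \<and> \<tau>' \<noteq> t \<and> \<bar>\<tau> - t\<bar> < \<eta> \<and> \<bar>\<tau>' - t\<bar> < \<eta> \<longrightarrow> norm (Q \<tau> z - Q \<tau>' z) < e"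
    if K: "compact K" "K \<subseteq> U" and e: "e > 0" for K e
  proof -
    obtain \<delta>0 where \<delta>0: "\<delta>0 > 0" "(\<Union>z\<in>K. cball z \<delta>0) \<subseteq> U"
      using compact_subset_open_imp_cball_epsilon_subset[OF K(1) U K(2)] by metis
    define K1 where "K1 = {x + y | x y. x \<in> K \<and> y \<in> cball 0 \<delta>0}"
    have K1c: "compact K1" unfolding K1_def by (rule compact_sums[OF K(1) compact_cball])
    have inK1: "w \<in> K1" if "z \<in> K" "w \<in> cball z \<delta>0" for z w
      unfolding K1_def mem_Collect_eq using that
      by (intro exI[of _ z] exI[of _ "w - z"]) (auto simp: dist_norm norm_minus_commute)
    have K1U: "K1 \<subseteq> U"
    proof
      fix w assume "w \<in> K1"
      then obtain x y where "w = x + y" "x \<in> K" "norm y \<le> \<delta>0" by (auto simp: K1_def)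
      then have "w \<in> cball x \<delta>0" by (simp add: dist_norm)
      then show "w \<in> U" using \<delta>0(2) \<open>x \<in> K\<close> by blast
    qed
    obtain C \<eta>1 where C: "\<eta>1 > 0" "\<And>\<tau> z. \<tau> \<in> I \<Longrightarrow> z \<in> K1 \<Longrightarrow> \<bar>\<tau> - t\<bar> < \<eta>1 \<Longrightarrow> norm (F \<tau> z - F t z) \<le> C * \<bar>\<tau> - t\<bar>"
      using bnd[OF K1c K1U] by blast
    define C' where "C' = \<bar>C\<bar> + 1"
    have C': "C' > 0" by (simp add: C'_def add_nonneg_pos)
    have Qb: "norm (Q \<tau> z) \<le> C'" if "\<tau> \<in> I" "z \<in> K1" "\<bar>\<tau> - t\<bar> < \<eta>1" "\<tau> \<noteq> t" for \<tau> z
    proof -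
      have "norm (Q \<tau> z) = norm (F \<tau> z - F t z) / \<bar>\<tau> - t\<bar>" unfolding Q_def norm_divide norm_of_real ..
      also have "\<dots> \<le> C" using C(2)[OF that(1-3)] that(4) by (simp add: divide_le_eq)
      also have "\<dots> \<le> C'" by (simp add: C'_def)
      finally show ?thesis .
    qed
    define \<delta> where "\<delta> = \<delta>0 / 2"
    have \<delta>: "\<delta> > 0" "2 * \<delta> = \<delta>0" using \<delta>0 by (auto simp: \<delta>_def)
    have lip: "norm (Q \<tau> z - Q \<tau> w) \<le> C' / \<delta> * norm (z - w)"
      if "z \<in> K" "w \<in> cball z \<delta>" "\<tau> \<in> I" "\<bar>\<tau> - t\<bar> < \<eta>1" "\<tau> \<noteq> t" for z w \<tau>
    proof (rule holomorphic_Lipschitz_cball[OF Qh[OF that(3,5)] U _ \<delta>(1)])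
      show "cball z (2 * \<delta>) \<subseteq> U" using \<delta>0(2) that(1) \<delta> by auto
      show "norm (Q \<tau> x) \<le> C'" if "x \<in> cball z (2 * \<delta>)" for x
        using that \<open>z \<in> K\<close> \<delta>(2) by (intro Qb inK1 \<open>\<tau> \<in> I\<close> \<open>\<bar>\<tau> - t\<bar> < \<eta>1\<close> \<open>\<tau> \<noteq> t\<close>) auto
    qed (use that \<delta> in auto)
    \<comment> \<open>Passing from a point to the net costs at most \<open>e / 4\<close> for each of
      the two quotients, which leaves \<open>e / 2\<close> for the comparison at the net.\<close>
    define \<delta>' where "\<delta>' = min \<delta> (\<delta> * e / (4 * C'))"
    have \<delta>': "\<delta>' > 0" "\<delta>' \<le> \<delta>" "C' / \<delta> * \<delta>' \<le> e / 4" using \<delta>(1) e C' by (auto simp: \<delta>'_def min_def field_simps)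
    have "K \<subseteq> (\<Union>y\<in>Z \<inter> U. ball y \<delta>')"
    proof
      fix z assume z: "z \<in> K"
      obtain y where y: "y \<in> Z" "y \<in> ball z \<delta>'" using dense[of "ball z \<delta>'"] \<delta>'(1) by auto
      then have "y \<in> cball z \<delta>0" using \<delta>'(2) \<delta> by auto
      then have "y \<in> U" using z \<delta>0(2) by blast
      then show "z \<in> (\<Union>y\<in>Z \<inter> U. ball y \<delta>')" using y by (auto simp: dist_commute)
    qed
    then obtain E where E: "E \<subseteq> Z \<inter> U" "finite E" "K \<subseteq> (\<Union>y\<in>E. ball y \<delta>')"
      by (rule compactE_image[OF K(1) open_ball])
    have "\<exists>\<eta>>0. \<forall>\<tau>\<in>I. \<forall>\<tau>'\<in>I. \<tau> \<noteq> t \<and> \<tau>' \<noteq> t \<and> \<bar>\<tau> - t\<bar> < \<eta> \<and> \<bar>\<tau>' - t\<bar> < \<eta> \<longrightarrow> norm (Q \<tau> y - Q \<tau>' y) < e / 2"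
      if y: "y \<in> E" for y
    proof -
      obtain L where L: "((\<lambda>\<tau>. Q \<tau> y) \<longlongrightarrow> L) (at t within I)" using diff[of y] y E(1) unfolding Q_def by blast
      have "e / 4 > 0" using e by simp
      then obtain \<eta> where \<eta>: "\<eta> > 0" "\<And>\<tau>. \<tau> \<in> I \<Longrightarrow> \<tau> \<noteq> t \<Longrightarrow> dist \<tau> t < \<eta> \<Longrightarrow> dist (Q \<tau> y) L < e / 4"
        using L unfolding tendsto_iff eventually_at by metis
      have "norm (Q \<tau> y - Q \<tau>' y) < e / 2"
        if "\<tau> \<in> I" "\<tau>' \<in> I" "\<tau> \<noteq> t" "\<tau>' \<noteq> t" "\<bar>\<tau> - t\<bar> < \<eta>" "\<bar>\<tau>' - t\<bar> < \<eta>" for \<tau> \<tau>'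
        using \<eta>(2)[of \<tau>] \<eta>(2)[of \<tau>'] that dist_triangle2[of "Q \<tau> y" "Q \<tau>' y" L]
        unfolding dist_norm[of "Q \<tau> y" "Q \<tau>' y", symmetric] by (auto simp: dist_real_def)
      then show ?thesis using \<eta>(1) by blast
    qed
    then obtain \<eta> where \<eta>: "\<And>y. y \<in> E \<Longrightarrow> \<eta> y > 0"
      "\<And>y \<tau> \<tau>'. y \<in> E \<Longrightarrow> \<tau> \<in> I \<Longrightarrow> \<tau>' \<in> I \<Longrightarrow> \<tau> \<noteq> t \<Longrightarrow> \<tau>' \<noteq> t \<Longrightarrow> \<bar>\<tau> - t\<bar> < \<eta> y \<Longrightarrow> \<bar>\<tau>' - t\<bar> < \<eta> y \<Longrightarrow>
        norm (Q \<tau> y - Q \<tau>' y) < e / 2"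
      by metis
    define \<eta>0 where "\<eta>0 = Min (insert \<eta>1 (\<eta> ` E))"
    have \<eta>0: "\<eta>0 > 0" "\<eta>0 \<le> \<eta>1" "\<And>y. y \<in> E \<Longrightarrow> \<eta>0 \<le> \<eta> y" using E(2) \<eta>(1) C(1) by (auto simp: \<eta>0_def)
    have "norm (Q \<tau> z - Q \<tau>' z) < e"
      if H: "\<tau> \<in> I" "\<tau>' \<in> I" "z \<in> K" "\<tau> \<noteq> t" "\<tau>' \<noteq> t" "\<bar>\<tau> - t\<bar> < \<eta>0" "\<bar>\<tau>' - t\<bar> < \<eta>0" for \<tau> \<tau>' z
    proof -
      obtain y where y: "y \<in> E" "z \<in> ball y \<delta>'" using E(3) H(3) by blast
      have yz: "y \<in> cball z \<delta>" using y(2) \<delta>'(2) by (auto simp: dist_commute)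
      have small: "C' / \<delta> * norm (z - y) \<le> e / 4"
      proof -
        have "C' / \<delta> * norm (z - y) \<le> C' / \<delta> * \<delta>'"
          using y(2) C' \<delta>(1) by (intro mult_left_mono) (auto simp: dist_norm norm_minus_commute)
        then show ?thesis using \<delta>'(3) by linarith
      qed
      have 1: "norm (Q \<tau> z - Q \<tau> y) \<le> e / 4" using lip[OF H(3) yz H(1) _ H(4)] H(6) \<eta>0(2) small by linarith
      have 2: "norm (Q \<tau>' z - Q \<tau>' y) \<le> e / 4" using lip[OF H(3) yz H(2) _ H(5)] H(7) \<eta>0(2) small by linarith
      have 3: "norm (Q \<tau> y - Q \<tau>' y) < e / 2" using H \<eta>0(3)[OF y(1)] by (intro \<eta>(2)[OF y(1)]) auto
      have "Q \<tau> z - Q \<tau>' z = (Q \<tau> z - Q \<tau> y) + (Q \<tau> y - Q \<tau>' y) - (Q \<tau>' z - Q \<tau>' y)" by simp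
      also have "norm \<dots> \<le> norm (Q \<tau> z - Q \<tau> y) + norm (Q \<tau> y - Q \<tau>' y) + norm (Q \<tau>' z - Q \<tau>' y)"
        by (rule order_trans[OF norm_triangle_ineq4 add_right_mono[OF norm_triangle_ineq]])
      also have "\<dots> < e" using 1 2 3 by linarith
      finally show ?thesis .
    qed
    then show ?thesis using \<eta>0(1) by blast
  qed
  \<comment> \<open>The limit is taken along a sequence from the right, the only side guaranteed to
    lie in \<open>I\<close> when \<open>t\<close> is its left end point.\<close>
  define s where "s n = t + 1 / real (Suc n)" for n
  have s: "s n \<in> I" "s n \<noteq> t" for n using acc[of n] by (auto simp: s_def)
  have slim: "s \<longlonglongrightarrow> t"
    unfolding s_def using tendsto_add[OF tendsto_const[of t] LIMSEQ_Suc[OF lim_1_over_n]] by simp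
  have sev: "\<forall>\<^sub>F n in sequentially. \<bar>s n - t\<bar> < \<eta>" if "\<eta> > 0" for \<eta>
    using tendstoD[OF slim that] by (simp add: dist_real_def)
  define g where "g z = lim (\<lambda>n. Q (s n) z)" for z
  have g: "(\<lambda>n. Q (s n) z) \<longlonglongrightarrow> g z" if z: "z \<in> U" for z
  proof -
    have "Cauchy (\<lambda>n. Q (s n) z)"
    proof (rule metric_CauchyI)
      fix e :: real assume "e > 0"
      then obtain \<eta> where \<eta>: "\<eta> > 0" "\<And>\<tau> \<tau>'. \<tau> \<in> I \<Longrightarrow> \<tau>' \<in> I \<Longrightarrow> \<tau> \<noteq> t \<Longrightarrow> \<tau>' \<noteq> t \<Longrightarrow> \<bar>\<tau> - t\<bar> < \<eta> \<Longrightarrow> \<bar>\<tau>' - t\<bar> < \<eta> \<Longrightarrow>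
          norm (Q \<tau> z - Q \<tau>' z) < e"
        using cauchy[of "{z}" e] z by auto
      obtain M where "\<And>n. n \<ge> M \<Longrightarrow> \<bar>s n - t\<bar> < \<eta>" using sev[OF \<eta>(1)] unfolding eventually_sequentially by blast
      then show "\<exists>M. \<forall>m\<ge>M. \<forall>n\<ge>M. dist (Q (s m) z) (Q (s n) z) < e"
        using \<eta>(2) s unfolding dist_norm by blast
    qed
    then show ?thesis unfolding g_def using Cauchy_convergent convergent_LIMSEQ_iff by blast
  qed
  have unif: "\<exists>\<eta>>0. \<forall>\<tau>\<in>I. \<tau> \<noteq> t \<and> \<bar>\<tau> - t\<bar> < \<eta> \<longrightarrow> (\<forall>z\<in>K. norm (g z - Q \<tau> z) \<le> e)"
    if K: "compact K" "K \<subseteq> U" and e: "e > 0" for K e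
  proof -
    obtain \<eta> where \<eta>: "\<eta> > 0" "\<And>\<tau> \<tau>' z. \<tau> \<in> I \<Longrightarrow> \<tau>' \<in> I \<Longrightarrow> z \<in> K \<Longrightarrow> \<tau> \<noteq> t \<Longrightarrow> \<tau>' \<noteq> t \<Longrightarrow> \<bar>\<tau> - t\<bar> < \<eta> \<Longrightarrow> \<bar>\<tau>' - t\<bar> < \<eta> \<Longrightarrow>
        norm (Q \<tau> z - Q \<tau>' z) < e"
      using cauchy[OF K e] by blast
    have "norm (g z - Q \<tau> z) \<le> e" if H: "\<tau> \<in> I" "\<tau> \<noteq> t" "\<bar>\<tau> - t\<bar> < \<eta>" "z \<in> K" for \<tau> z
    proof (rule Lim_norm_ubound)
      show "(\<lambda>n. Q (s n) z - Q \<tau> z) \<longlonglongrightarrow> g z - Q \<tau> z" using g[of z] H(4) K(2) by (intro tendsto_intros) auto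
      show "\<forall>\<^sub>F n in sequentially. norm (Q (s n) z - Q \<tau> z) \<le> e"
        using sev[OF \<eta>(1)] by eventually_elim (use \<eta>(2)[OF s(1) H(1,4) s(2) H(2) _ H(3)] in \<open>auto intro: less_imp_le\<close>)
    qed simp
    then show ?thesis using \<eta>(1) by blast
  qed
  have "g holomorphic_on U"
  proof (rule holomorphic_uniform_sequence[OF U])
    show "Q (s n) holomorphic_on U" for n by (rule Qh[OF s])
    fix x assume x: "x \<in> U"
    obtain \<delta> where \<delta>: "\<delta> > 0" "cball x \<delta> \<subseteq> U" using U x open_contains_cball by blast
    have "uniform_limit (cball x \<delta>) (\<lambda>n. Q (s n)) g sequentially"
      unfolding uniform_limit_iff
    proof (intro allI impI)
      fix e :: real assume "e > 0"
      then have "e / 2 > 0" by simp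
      then obtain \<eta> where \<eta>: "\<eta> > 0" "\<And>\<tau> z. \<tau> \<in> I \<Longrightarrow> \<tau> \<noteq> t \<Longrightarrow> \<bar>\<tau> - t\<bar> < \<eta> \<Longrightarrow> z \<in> cball x \<delta> \<Longrightarrow> norm (g z - Q \<tau> z) \<le> e / 2"
        using unif[OF compact_cball \<delta>(2)] by blast
      show "\<forall>\<^sub>F n in sequentially. \<forall>z\<in>cball x \<delta>. dist (Q (s n) z) (g z) < e"
        using sev[OF \<eta>(1)]
      proof eventually_elim
        case (elim n)
        have "norm (g z - Q (s n) z) < e" if "z \<in> cball x \<delta>" for z
          using \<eta>(2)[OF s elim that] \<open>e > 0\<close> by linarith
        then show ?case by (auto simp: dist_norm norm_minus_commute)
      qed
    qed
    then show "\<exists>\<delta>. 0 < \<delta> \<and> cball x \<delta> \<subseteq> U \<and> uniform_limit (cball x \<delta>) (\<lambda>n. Q (s n)) g sequentially"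
      using \<delta> by blast
  qed
  then have "has_hol_derivative U I F g t"
    by (rule has_hol_derivativeI) (use unif in \<open>simp add: Q_def\<close>)
  then show ?thesis by blast
qed

section \<open>Differentiability of evolution families\<close>

context evolution
begin

text \<open>A compact exhaustion of the total domain. Every compact subset lies in one of its
  members, so countably many densities, and hence one null set of times, serve all compact
  sets.\<close>

definition exhaustion :: "nat \<Rightarrow> (complex \<times> real) set" where
  "exhaustion j = {p. 0 \<le> snd p \<and> snd p \<le> real j \<and> r (snd p) + 1 / real (Suc j) \<le> norm (fst p) \<and>
     norm (fst p) \<le> 1 - 1 / real (Suc j)}"

lemma exhaustion_subset: "exhaustion j \<subseteq> total_domain D"
proof
  fix p assume p: "p \<in> exhaustion j"
  obtain z t where zt: "p = (z, t)" by fastforce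
  define \<epsilon> where "\<epsilon> = 1 / real (Suc j)"
  have "\<epsilon> > 0" by (simp add: \<epsilon>_def)
  moreover have "0 \<le> t" "r t + \<epsilon> \<le> norm z" "norm z \<le> 1 - \<epsilon>"
    using p unfolding exhaustion_def \<epsilon>_def[symmetric] by (auto simp: zt)
  ultimately show "p \<in> total_domain D" by (simp add: zt mem_total_domain mem_D)
qed

lemma compact_exhaustion: "compact (exhaustion j)"
proof -
  let ?S = "cball (0::complex) 1 \<times> {0..real j}"
  have rc: "continuous_on ?S (\<lambda>p. r (snd p))"
    by (rule continuous_on_compose2[OF r_cont continuous_on_snd]) (auto intro: continuous_intros)
  have "closed {p \<in> ?S. r (snd p) + 1 / real (Suc j) \<le> norm (fst p)}"
    by (intro continuous_on_closed_Collect_le continuous_intros rc closed_Times closed_cball)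
  moreover have "closed {p \<in> ?S. norm (fst p) \<le> 1 - 1 / real (Suc j)}"
    by (intro continuous_on_closed_Collect_le continuous_intros closed_Times closed_cball)
  moreover have le1: "norm z \<le> 1" if "norm z \<le> 1 - 1 / real (Suc j)" for z :: complex
    by (rule order_trans[OF that]) simp
  then have "exhaustion j = {p \<in> ?S. r (snd p) + 1 / real (Suc j) \<le> norm (fst p)} \<inter> {p \<in> ?S. norm (fst p) \<le> 1 - 1 / real (Suc j)}"
    by (auto simp: exhaustion_def mem_Times_iff simp del: of_nat_Suc intro: le1)
  ultimately have "closed (exhaustion j)" by (simp add: closed_Int)
  moreover have "exhaustion j \<subseteq> ?S" using \<open>exhaustion j = _\<close> by blast
  moreover have "compact ?S" by (intro compact_Times compact_cball compact_Icc)
  ultimately show ?thesis by (metis closed_Int_compact inf.absorb_iff1)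
qed

lemma subset_exhaustion:
  assumes K: "compact K" "K \<subseteq> total_domain D"
  obtains j where "K \<subseteq> exhaustion j"
proof (cases "K = {}")
  case True
  then show thesis using that by blast
next
  case False
  define f where "f p = min (norm (fst p) - r (snd p)) (1 - norm (fst p))" for p :: "complex \<times> real"
  have sn: "snd p \<ge> 0" "fst p \<in> D (snd p)" if "p \<in> K" for p
    using that K(2) mem_total_domain[of "fst p" "snd p"] by auto
  have "continuous_on K (\<lambda>p. r (snd p))"
    by (rule continuous_on_compose2[OF r_cont continuous_on_snd]) (use sn in \<open>auto intro: continuous_intros\<close>)
  then have "continuous_on K f" unfolding f_def by (intro continuous_intros)
  then obtain p0 where p0: "p0 \<in> K" "\<And>p. p \<in> K \<Longrightarrow> f p0 \<le> f p"
    using continuous_attains_inf[OF K(1) False] by blast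
  have pos: "f p0 > 0" using sn[OF p0(1)] by (simp add: f_def mem_D)
  have "compact (snd ` K)" by (intro compact_continuous_image K continuous_intros)
  then obtain M where M: "\<And>p. p \<in> K \<Longrightarrow> snd p \<le> M"
    using compact_imp_bounded bounded_has_Sup(1) by (metis imageI False image_is_empty)
  obtain j1 where j1: "1 / real (Suc j1) < f p0" using pos reals_Archimedean by (auto simp: inverse_eq_divide)
  obtain j2 :: nat where j2: "M \<le> real j2" using real_arch_simple by blast
  define j where "j = max j1 j2"
  have j: "1 / real (Suc j) < f p0" "M \<le> real j"
  proof -
    have "1 / real (Suc j) \<le> 1 / real (Suc j1)" by (intro divide_left_mono) (auto simp: j_def)
    then show "1 / real (Suc j) < f p0" using j1 by linarith
    show "M \<le> real j" using j2 by (simp add: j_def)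
  qed
  show thesis
  proof (rule that[of j], rule subsetI)
    fix p assume p: "p \<in> K"
    have "1 / real (Suc j) \<le> norm (fst p) - r (snd p)" "1 / real (Suc j) \<le> 1 - norm (fst p)"
      using p0(2)[OF p] j(1) by (auto simp: f_def simp del: of_nat_Suc)
    then show "p \<in> exhaustion j"
      using sn(1)[OF p] M[OF p] j(2) by (simp add: exhaustion_def del: of_nat_Suc)
  qed
qed

definition control_density :: "nat \<Rightarrow> real \<Rightarrow> real" where
  "control_density j = (SOME k. \<exists>\<eta>. controls (exhaustion j) k \<eta>)"

lemma control_density: "\<exists>\<eta>. controls (exhaustion j) (control_density j) \<eta>"
proof -
  have "\<exists>k \<eta>. controls (exhaustion j) k \<eta>"
    by (rule compact_control[OF compact_exhaustion exhaustion_subset]) blast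
  then show ?thesis unfolding control_density_def by (rule someI_ex[of "\<lambda>k. \<exists>\<eta>. controls (exhaustion j) k \<eta>"])
qed

lemma control_density_nonneg: "0 \<le> control_density j t" and control_density_Ld: "Ld d {0..T} (control_density j)"
  using control_density[of j] unfolding controls_def by auto

lemma control_density_integrable: "control_density j integrable_on {0..T}"
  by (rule set_lebesgue_integral_eq_integral(1)[OF Ld_imp_absolutely_integrable[OF control_density_Ld _ d]]) simp

definition dense_points :: "complex set" where
  "dense_points = (SOME Z. countable Z \<and> (\<forall>V. open V \<longrightarrow> V \<noteq> {} \<longrightarrow> (\<exists>z\<in>Z. z \<in> V)))"

lemma dense_points: "countable dense_points" "\<And>V. open V \<Longrightarrow> V \<noteq> {} \<Longrightarrow> \<exists>z\<in>dense_points. z \<in> V"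
  unfolding dense_points_def
  using someI_ex[OF countable_dense_exists[where 'a = complex]] by auto

text \<open>Only countably many conditions, each of which holds almost everywhere: over the sets of
  the exhaustion, the rational initial times and a dense set of points. The strict inequality
  \<open>q < t\<close> makes all derivatives two-sided.\<close>

definition good_time :: "real \<Rightarrow> bool" where
  "good_time t \<longleftrightarrow> 0 < t \<and> (\<forall>j. ((\<lambda>x. integral {0..x} (control_density j)) has_vector_derivative control_density j t) (at t)) \<and>
    (\<forall>q z. q \<in> \<rat> \<and> 0 \<le> q \<and> q < t \<and> z \<in> dense_points \<and> z \<in> D q \<longrightarrow>
      (\<exists>L. ((\<lambda>\<tau>. \<phi> q \<tau> z) has_vector_derivative L) (at t)))"

lemma negligible_bad_times: "negligible {t. 0 \<le> t \<and> \<not> good_time t}"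
proof -
  define B1 where "B1 j M = {x \<in> {0<..<real M}. \<not> ((\<lambda>x. integral {0..x} (control_density j)) has_vector_derivative control_density j x) (at x)}"
    for j :: nat and M :: nat
  have B1: "negligible (B1 j M)" for j M
  proof -
    obtain N where "negligible N"
      "\<And>x. x \<in> {0<..<real M} - N \<Longrightarrow> ((\<lambda>x. integral {0..x} (control_density j)) has_vector_derivative control_density j x) (at x)"
      by (rule indefinite_integral_has_vector_derivative_ae[OF control_density_integrable[of j "real M"]]) blast
    then show ?thesis by (auto simp: B1_def intro: negligible_subset)
  qed
  define B2 where "B2 q z M = {x \<in> {q<..<real M}. \<not> (\<exists>L. ((\<lambda>\<tau>. \<phi> q \<tau> z) has_vector_derivative L) (at x))}"
    for q z and M :: nat
  have B2: "negligible (B2 q z M)" if q: "0 \<le> q" "z \<in> D q" for q z M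
  proof (cases "q \<le> real M")
    case True
    obtain k :: "real \<Rightarrow> real" where k: "\<And>x. x \<in> {q..real M} \<Longrightarrow> 0 \<le> k x" "Ld d {q..real M} k" "k absolutely_integrable_on {q..real M}"
      "\<And>s u t. q \<le> s \<Longrightarrow> s \<le> u \<Longrightarrow> u \<le> t \<Longrightarrow> t \<le> real M \<Longrightarrow> norm (\<phi> s u z - \<phi> s t z) \<le> integral {u..t} k"
      by (rule ef_increment[OF q(1) True q(2)]) (rule that)
    have dom: "norm (\<phi> q v z - \<phi> q u z) \<le> integral {u..v} k" if "q \<le> u" "u \<le> v" "v \<le> real M" for u v
      using k(4)[of q u v] that by (simp add: norm_minus_commute)
    obtain N g where N: "negligible N"
      "\<And>x. x \<in> {q<..<real M} - N \<Longrightarrow> ((\<lambda>\<tau>. \<phi> q \<tau> z) has_vector_derivative g x) (at x)"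
      by (rule dominated_complex_ae_differentiable[where f = "\<lambda>\<tau>. \<phi> q \<tau> z", OF True k(3,1) dom]) (assumption | rule that)+
    have "B2 q z M \<subseteq> N" using N(2) unfolding B2_def by blast
    then show ?thesis by (rule negligible_subset[OF N(1)])
  next
    case False
    then have "B2 q z M = {}" by (auto simp: B2_def)
    then show ?thesis by simp
  qed
  define P where "P = {(q, z). q \<in> \<rat> \<and> 0 \<le> q \<and> z \<in> dense_points \<and> z \<in> D q}"
  have cP: "countable P"
    by (rule countable_subset[of _ "\<rat> \<times> dense_points"]) (auto simp: P_def countable_rat dense_points)
  define N where "N = {0} \<union> (\<Union>p\<in>UNIV. B1 (fst p) (snd p)) \<union> (\<Union>p\<in>P \<times> UNIV. B2 (fst (fst p)) (snd (fst p)) (snd p))"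
  have "negligible (\<Union>p\<in>UNIV. B1 (fst p) (snd p))"
    by (rule negligible_countable_Union) (use B1 in auto)
  moreover have "negligible (\<Union>p\<in>P \<times> UNIV. B2 (fst (fst p)) (snd (fst p)) (snd p))"
    by (rule negligible_countable_Union) (use cP B2 in \<open>auto simp: P_def\<close>)
  ultimately have "negligible N" unfolding N_def by (simp add: negligible_Un)
  moreover have "{t. 0 \<le> t \<and> \<not> good_time t} \<subseteq> N"
  proof clarify
    fix t assume t: "0 \<le> t" "\<not> good_time t"
    show "t \<in> N"
    proof (rule ccontr)
      assume tN: "t \<notin> N"
      obtain M :: nat where M: "t < real M" using reals_Archimedean2 by blast
      have t0: "0 < t" using tN t by (auto simp: N_def)
      moreover have "((\<lambda>x. integral {0..x} (control_density j)) has_vector_derivative control_density j t) (at t)" for j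
      proof -
        have "t \<notin> B1 j M" using tN by (force simp: N_def)
        then show ?thesis using M t0 by (auto simp: B1_def)
      qed
      moreover have "\<exists>L. ((\<lambda>\<tau>. \<phi> q \<tau> z) has_vector_derivative L) (at t)"
        if H: "q \<in> \<rat> \<and> 0 \<le> q \<and> q < t \<and> z \<in> dense_points \<and> z \<in> D q" for q z
      proof -
        have "(q, z) \<in> P" using H by (auto simp: P_def)
        then have "t \<notin> B2 q z M" using tN by (force simp: N_def)
        then show ?thesis using H M by (auto simp: B2_def)
      qed
      ultimately have "good_time t" unfolding good_time_def by blast
      then show False using t by blast
    qed
  qed
  ultimately show ?thesis by (rule negligible_subset)
qed

text \<open>The trajectories through \<open>K\<close> stay in one set of the exhaustion, so their
  increments are bounded by those of the integral of its density, which is differentiable at a good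
  time; adding one to the derivative gives a Lipschitz constant at \<open>t\<close>.\<close>

lemma good_time_bound:
  assumes t: "good_time t" and s: "0 \<le> s" "s \<le> t" and K: "compact K" "K \<subseteq> D s"
  shows "\<exists>C \<eta>. \<eta> > 0 \<and> (\<forall>\<tau>\<in>{s..}. \<forall>z\<in>K. \<bar>\<tau> - t\<bar> < \<eta> \<longrightarrow> norm (\<phi> s \<tau> z - \<phi> s t z) \<le> C * \<bar>\<tau> - t\<bar>)"
proof -
  obtain j where j: "(\<lambda>p. (\<phi> s (snd p) (fst p), snd p)) ` (K \<times> {s..t + 1}) \<subseteq> exhaustion j"
    using subset_exhaustion[OF ef_graph_compact[OF s(1) K]] by blast
  obtain \<eta>1 where \<eta>1: "controls (exhaustion j) (control_density j) \<eta>1" using control_density by blast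
  define H where "H x = integral {0..x} (control_density j)" for x
  have "(H has_vector_derivative control_density j t) (at t)" using t by (simp add: good_time_def H_def[abs_def])
  then have "\<exists>\<delta>>0. \<forall>y. norm (y - t) < \<delta> \<longrightarrow> norm (H y - H t - (y - t) *\<^sub>R control_density j t) \<le> 1 * norm (y - t)"
    unfolding has_vector_derivative_def has_derivative_at_alt by (blast intro: zero_less_one)
  then obtain \<eta>2 where \<eta>2: "\<eta>2 > 0" "\<And>y. norm (y - t) < \<eta>2 \<Longrightarrow> norm (H y - H t - (y - t) *\<^sub>R control_density j t) \<le> norm (y - t)"
    by auto
  have Hb: "\<bar>H y - H t\<bar> \<le> (control_density j t + 1) * \<bar>y - t\<bar>" if "\<bar>y - t\<bar> < \<eta>2" for y
  proof -
    have "\<bar>H y - H t\<bar> \<le> \<bar>H y - H t - (y - t) * control_density j t\<bar> + \<bar>(y - t) * control_density j t\<bar>" by linarith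
    also have "\<dots> \<le> \<bar>y - t\<bar> + \<bar>y - t\<bar> * control_density j t"
      using \<eta>2(2)[of y] that control_density_nonneg[of j t] by (intro add_mono) (auto simp: abs_mult)
    finally show ?thesis by (simp add: algebra_simps)
  qed
  have Hd: "integral {u..v} (control_density j) = H v - H u" if "0 \<le> u" "u \<le> v" for u v
    unfolding H_def using integral_diff_Icc[OF control_density_integrable[of j v], of u v] that by simp
  have step: "norm (\<phi> s v z - \<phi> s u z) \<le> H v - H u"
    if "z \<in> K" "s \<le> u" "u \<le> v" "v < u + \<eta>1" "u \<le> t + 1" for z u v
  proof -
    have zs: "z \<in> D s" using that K by blast
    have "(\<lambda>p. (\<phi> s (snd p) (fst p), snd p)) (z, u) \<in> exhaustion j" using that by (intro subsetD[OF j] imageI) auto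
    then have w: "(\<phi> s u z, u) \<in> exhaustion j" by simp
    have "norm (\<phi> u v (\<phi> s u z) - \<phi> s u z) \<le> integral {u..v} (control_density j)"
      using \<eta>1 w that exhaustion_subset[of j] unfolding controls_def by blast
    moreover have "\<phi> s v z = \<phi> u v (\<phi> s u z)" using ef_comp[OF s(1) that(2,3) zs] .
    ultimately show ?thesis using Hd[of u v] that s by simp
  qed
  define \<eta> where "\<eta> = min (min \<eta>1 \<eta>2) 1"
  have "\<eta> > 0" using \<eta>1 \<eta>2 by (simp add: \<eta>_def controls_def)
  moreover have "norm (\<phi> s \<tau> z - \<phi> s t z) \<le> (control_density j t + 1) * \<bar>\<tau> - t\<bar>"
    if "\<tau> \<in> {s..}" "z \<in> K" "\<bar>\<tau> - t\<bar> < \<eta>" for \<tau> z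
  proof (cases "t \<le> \<tau>")
    case True
    then have "norm (\<phi> s \<tau> z - \<phi> s t z) \<le> H \<tau> - H t" using that s by (intro step) (auto simp: \<eta>_def)
    then show ?thesis using Hb[of \<tau>] that by (simp add: \<eta>_def)
  next
    case False
    then have "norm (\<phi> s t z - \<phi> s \<tau> z) \<le> H t - H \<tau>" using that s by (intro step) (auto simp: \<eta>_def)
    then show ?thesis using Hb[of \<tau>] that by (simp add: \<eta>_def norm_minus_commute)
  qed
  ultimately show ?thesis by blast
qed

text \<open>Near the diagonal the maps are close to the identity, so by Brouwer's theorem their images
  exhaust \<open>D t\<close>. This yields the one-sided derivative at \<open>s = t\<close> from countably many initial times.\<close>

lemma ef_surjective:
  assumes t: "0 < t" and z: "z \<in> D t"
  obtains q y where "q \<in> \<rat>" "0 \<le> q" "q < t" "y \<in> D q" "\<phi> q t y = z"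
proof -
  have zt: "r t < norm z" "norm z < 1" using z t by (auto simp: mem_D)
  define e where "e = min (norm z - r t) (1 - norm z) / 3"
  have e: "e > 0" using zt by (simp add: e_def)
  obtain \<delta> where \<delta>: "\<delta> > 0" "\<And>s. 0 \<le> s \<Longrightarrow> dist s t < \<delta> \<Longrightarrow> dist (r s) (r t) < e"
    using r_cont t e unfolding continuous_on_iff by (metis atLeast_iff less_imp_le)
  define S where "S = max 0 (t - \<delta> / 2)"
  have S: "0 \<le> S" "S < t" "S \<le> t" "dist (r S) (r t) < e" using \<delta> t by (auto simp: S_def dist_real_def intro!: \<delta>(2))
  have cb: "cball z e \<subseteq> D S"
  proof
    fix w assume "w \<in> cball z e"
    then have "norm (z - w) \<le> e" by (simp add: dist_norm)
    moreover have "3 * e \<le> norm z - r t" "3 * e \<le> 1 - norm z" by (auto simp: e_def)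
    ultimately show "w \<in> D S"
      using S norm_triangle_ineq2[of z w] norm_triangle_ineq2[of w z] e
      by (auto simp: mem_D dist_real_def norm_minus_commute)
  qed
  obtain \<eta> where \<eta>: "\<eta> > 0" "\<And>s u v w. S \<le> s \<Longrightarrow> s \<le> u \<Longrightarrow> u \<le> v \<Longrightarrow> v \<le> t \<Longrightarrow> v - u < \<eta> \<Longrightarrow> w \<in> cball z e \<Longrightarrow>
     norm (\<phi> s u w - \<phi> s v w) < e"
    using ef_uniformly_close[OF S(1,3) compact_cball cb e] by blast
  obtain q where q: "q \<in> \<rat>" "max S (t - \<eta>) < q" "q < t"
    using Rats_dense_in_real[of "max S (t - \<eta>)" t] S \<eta>(1) by auto
  have cbq: "cball z e \<subseteq> D q" using cb D_mono[of S q] S q by auto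
  have "\<exists>y\<in>cball z e. \<phi> q t y = z"
  \<comment> \<open>The map moves no point of the closed ball by as much as \<open>e\<close>, so
    \<open>z + (y - \<phi> q t y)\<close> defines a self-map of the ball; its fixed point is the
    preimage.\<close>
  proof (rule brouwer_surjective_cball[of z e "\<phi> q t" z "{z}"])
    show "continuous_on (cball z e) (\<phi> q t)"
      using holomorphic_on_imp_continuous_on[OF ef_holomorphic[of q t]] q S cbq continuous_on_subset by auto
    fix x y assume "x \<in> {z}" and y: "y \<in> cball z e"
    have "norm (\<phi> q q y - \<phi> q t y) < e" using q y by (intro \<eta>(2)) auto
    moreover have "\<phi> q q y = y" using q S y cbq by (intro ef_id) auto
    ultimately show "x + (y - \<phi> q t y) \<in> cball z e" using \<open>x \<in> {z}\<close> by (simp add: dist_norm norm_minus_commute)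
  qed (use e in auto)
  then obtain y where "y \<in> cball z e" "\<phi> q t y = z" by blast
  then show thesis using q S cbq by (intro that[of q y]) auto
qed

lemma ef_right_sequence: "0 \<le> s \<Longrightarrow> s \<le> t \<Longrightarrow> t + 1 / real (Suc n) \<in> {s..}"
  by (simp add: add_increasing2)

lemma ef_differentiable_rational:
  assumes t: "good_time t" and q: "q \<in> \<rat>" "0 \<le> q" "q < t"
  shows "\<exists>g. has_hol_derivative (D q) {q..} (\<phi> q) g t"
proof (rule has_hol_derivative_exists[where Z = dense_points])
  show "open (D q)" by (rule open_D[OF q(2)])
  show "t \<in> {q..}" using q by simp
  show "t + 1 / real (Suc n) \<in> {q..}" for n using q by (intro ef_right_sequence) auto
  show "\<phi> q \<tau> holomorphic_on D q" if "\<tau> \<in> {q..}" for \<tau> using that q by (intro ef_holomorphic) auto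
  show "\<exists>C \<eta>. 0 < \<eta> \<and> (\<forall>\<tau>\<in>{q..}. \<forall>z\<in>K. \<bar>\<tau> - t\<bar> < \<eta> \<longrightarrow> norm (\<phi> q \<tau> z - \<phi> q t z) \<le> C * \<bar>\<tau> - t\<bar>)"
    if "compact K" "K \<subseteq> D q" for K using good_time_bound[OF t q(2) _ that] q by simp
  show "\<exists>z\<in>dense_points. z \<in> V" if "open V" "V \<noteq> {}" for V using dense_points(2) that .
  fix z assume "z \<in> dense_points" "z \<in> D q"
  then obtain L where "((\<lambda>\<tau>. \<phi> q \<tau> z) has_vector_derivative L) (at t)" using t q unfolding good_time_def by blast
  then have "((\<lambda>\<tau>. \<phi> q \<tau> z) has_vector_derivative L) (at t within {q..})" by (rule has_vector_derivative_at_within)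
  then show "\<exists>L. ((\<lambda>\<tau>. (\<phi> q \<tau> z - \<phi> q t z) / of_real (\<tau> - t)) \<longlongrightarrow> L) (at t within {q..})"
    unfolding has_vector_derivative_iff_quotient by blast
qed

text \<open>Near \<open>t\<close> the orbit of \<open>z\<close> is the orbit of a point
  \<open>y\<close> with a rational initial time \<open>q < t\<close>:
  \<open>y = \<phi> s q z\<close> if \<open>s < t\<close>, and a preimage of \<open>z\<close> under
  \<open>\<phi> q t\<close> if \<open>s = t\<close>. At rational times every point of
  \<open>D q\<close> is available, not only the dense ones.\<close>

lemma ef_differentiable:
  assumes t: "good_time t" and s: "0 \<le> s" "s \<le> t"
  shows "\<exists>g. has_hol_derivative (D s) {s..} (\<phi> s) g t"
proof (rule has_hol_derivative_exists[where Z = UNIV])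
  show "open (D s)" by (rule open_D[OF s(1)])
  show "t \<in> {s..}" using s by simp
  show "t + 1 / real (Suc n) \<in> {s..}" for n by (rule ef_right_sequence[OF s])
  show "\<phi> s \<tau> holomorphic_on D s" if "\<tau> \<in> {s..}" for \<tau> using that s by (intro ef_holomorphic) auto
  show "\<exists>C \<eta>. 0 < \<eta> \<and> (\<forall>\<tau>\<in>{s..}. \<forall>z\<in>K. \<bar>\<tau> - t\<bar> < \<eta> \<longrightarrow> norm (\<phi> s \<tau> z - \<phi> s t z) \<le> C * \<bar>\<tau> - t\<bar>)"
    if "compact K" "K \<subseteq> D s" for K by (rule good_time_bound[OF t s that])
  show "\<exists>z\<in>UNIV. z \<in> V" if "open V" "V \<noteq> {}" for V :: "complex set" using that by blast
  fix z assume z: "z \<in> D s"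
  have t0: "0 < t" using t by (simp add: good_time_def)
  obtain q y c where q: "q \<in> \<rat>" "0 \<le> q" "q < t" "y \<in> D q" and c: "c < t"
    and eq: "\<And>\<tau>. \<tau> \<in> {s..} \<Longrightarrow> c < \<tau> \<Longrightarrow> \<phi> s \<tau> z = \<phi> q \<tau> y"
  proof (cases "s = t")
    case True
    obtain q y where q: "q \<in> \<rat>" "0 \<le> q" "q < t" "y \<in> D q" "\<phi> q t y = z"
      using ef_surjective[OF t0] z True by metis
    show thesis
    \<comment> \<open>For \<open>s = t\<close> all admissible times are at least
      \<open>t > 0\<close>, so the lower limit \<open>0\<close> imposes nothing.\<close>
    proof (rule that[of q y 0])
      show "\<phi> s \<tau> z = \<phi> q \<tau> y" if "\<tau> \<in> {s..}" for \<tau> using q True that ef_comp[of q t \<tau> y] by auto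
    qed (use q t0 in auto)
  next
    case False
    then obtain q where q: "q \<in> \<rat>" "s < q" "q < t" using Rats_dense_in_real[of s t] s by auto
    show thesis
    proof (rule that[of q "\<phi> s q z" q])
      show "\<phi> s q z \<in> D q" using q s z by (intro ef_in) auto
      show "\<phi> s \<tau> z = \<phi> q \<tau> (\<phi> s q z)" if "q < \<tau>" for \<tau> using q s z that by (intro ef_comp) auto
    qed (use q s in auto)
  qed
  obtain g where g: "has_hol_derivative (D q) {q..} (\<phi> q) g t" using ef_differentiable_rational[OF t q(1-3)] by blast
  have lim: "((\<lambda>\<tau>. (\<phi> q \<tau> y - \<phi> q t y) / of_real (\<tau> - t)) \<longlongrightarrow> g y) (at t within {q..})"
    by (rule has_hol_derivative_pointwise[OF g q(4)])
  have "at t within {q..} = at t" using q by (intro at_within_interior) (auto simp: interior_Ici)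
  then have "((\<lambda>\<tau>. (\<phi> q \<tau> y - \<phi> q t y) / of_real (\<tau> - t)) \<longlongrightarrow> g y) (at t within {s..})"
    using lim by (auto intro: tendsto_within_subset)
  moreover have "\<forall>\<^sub>F \<tau> in at t within {s..}. (\<phi> q \<tau> y - \<phi> q t y) / of_real (\<tau> - t) = (\<phi> s \<tau> z - \<phi> s t z) / of_real (\<tau> - t)"
    unfolding eventually_at using c s eq
    by (intro exI[of _ "t - c"]) (auto simp: dist_real_def)
  ultimately have "((\<lambda>\<tau>. (\<phi> s \<tau> z - \<phi> s t z) / of_real (\<tau> - t)) \<longlongrightarrow> g y) (at t within {s..})"
    by (rule Lim_transform_eventually)
  then show "\<exists>L. ((\<lambda>\<tau>. (\<phi> s \<tau> z - \<phi> s t z) / of_real (\<tau> - t)) \<longlongrightarrow> L) (at t within {s..})" by blast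
qed

end

section \<open>The vector field of an evolution family\<close>

context evolution
begin

text \<open>The right derivative of the family on the diagonal. It is taken along a sequence, so
  that it is a limit of countably many measurable functions, and set to zero at bad times, so that
  it is holomorphic at every time.\<close>

definition generator :: "complex \<Rightarrow> real \<Rightarrow> complex" where
  "generator z t = (if good_time t
     then lim (\<lambda>n. (\<phi> t (t + 1 / real (Suc n)) z - z) / of_real (1 / real (Suc n))) else 0)"

lemma good_time_pos: "good_time t \<Longrightarrow> 0 < t"
  by (simp add: good_time_def)

lemma right_sequence_limit: "filterlim (\<lambda>n. t + 1 / real (Suc n)) (at t within {t..}) sequentially"
  unfolding filterlim_at
proof
  show "(\<lambda>n. t + 1 / real (Suc n)) \<longlonglongrightarrow> t"
    using tendsto_add[OF tendsto_const[of t] LIMSEQ_Suc[OF lim_1_over_n]] by simp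
qed (auto intro!: always_eventually)

text \<open>By the composition law the quotients to the right of \<open>t\<close> depend on
  \<open>s\<close> and \<open>z\<close> only through the point \<open>\<phi> s t z\<close>.
  Therefore one function of this point and of \<open>t\<close> describes the derivatives for all
  \<open>s\<close>.\<close>

lemma derivative_sequence:
  assumes s: "0 \<le> s" "s \<le> t" and z: "z \<in> D s" and g: "has_hol_derivative (D s) {s..} (\<phi> s) g t"
  shows "(\<lambda>n. (\<phi> t (t + 1 / real (Suc n)) (\<phi> s t z) - \<phi> s t z) / of_real (1 / real (Suc n))) \<longlonglongrightarrow> g z"
proof -
  have "((\<lambda>\<tau>. (\<phi> s \<tau> z - \<phi> s t z) / of_real (\<tau> - t)) \<longlongrightarrow> g z) (at t within {t..})"
    using has_hol_derivative_pointwise[OF g z] by (rule tendsto_within_subset) (use s in auto)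
  from filterlim_compose[OF this right_sequence_limit]
  have "(\<lambda>n. (\<phi> s (t + 1 / real (Suc n)) z - \<phi> s t z) / of_real (t + 1 / real (Suc n) - t)) \<longlonglongrightarrow> g z" .
  moreover have "\<phi> s (t + 1 / real (Suc n)) z = \<phi> t (t + 1 / real (Suc n)) (\<phi> s t z)" for n
    using s z by (intro ef_comp) auto
  ultimately show ?thesis by simp
qed

lemma derivative_eq_generator:
  assumes "good_time t" "0 \<le> s" "s \<le> t" "z \<in> D s" "has_hol_derivative (D s) {s..} (\<phi> s) g t"
  shows "g z = generator (\<phi> s t z) t"
  using limI[OF derivative_sequence[OF assms(2-5)]] assms(1) by (simp add: generator_def)

lemma has_hol_derivative_cong:
  assumes "has_hol_derivative U I F g t" "\<And>z. z \<in> U \<Longrightarrow> g z = h z"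
  shows "has_hol_derivative U I F h t"
proof -
  have "sup_norm K (\<lambda>z. g z - f z) = sup_norm K (\<lambda>z. h z - f z)" if "K \<subseteq> U" for K and f
    using that assms(2) unfolding sup_norm_def by (auto intro!: SUP_cong simp: subset_iff)
  moreover have "h holomorphic_on U"
    using assms holomorphic_cong[of U U g h] by (auto simp: has_hol_derivative_def)
  ultimately show ?thesis using assms(1) by (auto simp: has_hol_derivative_def)
qed

lemma ef_has_hol_derivative:
  assumes t: "good_time t" and s: "0 \<le> s" "s \<le> t"
  shows "has_hol_derivative (D s) {s..} (\<phi> s) (\<lambda>z. generator (\<phi> s t z) t) t"
proof -
  obtain g where g: "has_hol_derivative (D s) {s..} (\<phi> s) g t" using ef_differentiable[OF assms] by blast
  show ?thesis by (rule has_hol_derivative_cong[OF g derivative_eq_generator[OF t s _ g]])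
qed

lemma generator_sequence:
  assumes t: "good_time t" and z: "z \<in> D t"
  shows "(\<lambda>n. (\<phi> t (t + 1 / real (Suc n)) z - z) / of_real (1 / real (Suc n))) \<longlonglongrightarrow> generator z t"
proof -
  have t0: "0 \<le> t" using good_time_pos[OF t] by simp
  show ?thesis
    using derivative_sequence[OF t0 order_refl z ef_has_hol_derivative[OF t t0 order_refl]] ef_id[OF t0 z] by simp
qed

lemma generator_holomorphic:
  assumes t: "0 \<le> t"
  shows "(\<lambda>z. generator z t) holomorphic_on D t"
proof (cases "good_time t")
  case True
  have "(\<lambda>z. generator (\<phi> t t z) t) holomorphic_on D t"
    using ef_has_hol_derivative[OF True t order_refl] by (simp add: has_hol_derivative_def)
  then show ?thesis by (rule holomorphic_transform) (simp add: ef_id[OF t])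
qed (simp add: generator_def)

text \<open>Divide the control of the increments by the step and let it shrink: at a good time the
  quotients of the integral tend to the value of the density itself.\<close>

lemma generator_bound:
  assumes zt: "(z, t) \<in> exhaustion j"
  shows "norm (generator z t) \<le> control_density j t"
proof (cases "good_time t")
  case True
  have z: "z \<in> D t" "0 \<le> t" using zt exhaustion_subset[of j] by (auto simp: mem_total_domain subset_iff)
  obtain \<eta> where \<eta>: "controls (exhaustion j) (control_density j) \<eta>" using control_density by blast
  then have \<eta>0: "\<eta> > 0" by (simp add: controls_def)
  define H where "H x = integral {0..x} (control_density j)" for x
  have "((\<lambda>y. (H y - H t) / (y - t)) \<longlongrightarrow> control_density j t) (at t)"
    using True unfolding good_time_def H_def[abs_def]
    by (simp add: has_real_derivative_iff_has_vector_derivative[symmetric] has_field_derivative_iff)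
  then have "((\<lambda>y. (H y - H t) / (y - t)) \<longlongrightarrow> control_density j t) (at t within {t..})" by (rule tendsto_within_subset) simp
  from filterlim_compose[OF this right_sequence_limit]
  have lim: "(\<lambda>n. (H (t + 1 / real (Suc n)) - H t) / (1 / real (Suc n))) \<longlonglongrightarrow> control_density j t" by simp
  have "\<forall>\<^sub>F n in sequentially. 1 / real (Suc n) < \<eta>"
    using order_tendstoD(2)[OF LIMSEQ_Suc[OF lim_1_over_n] \<eta>0] .
  then have ev: "\<forall>\<^sub>F n in sequentially. norm ((\<phi> t (t + 1 / real (Suc n)) z - z) / of_real (1 / real (Suc n)))
      \<le> (H (t + 1 / real (Suc n)) - H t) / (1 / real (Suc n))"
  proof eventually_elim
    case (elim n)
    define h where "h = 1 / real (Suc n)"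
    have h: "0 < h" "h < \<eta>" using elim by (auto simp: h_def)
    have "norm (\<phi> t (t + h) z - z) \<le> integral {t..t + h} (control_density j)"
      using \<eta> zt exhaustion_subset[of j] h unfolding controls_def by auto
    also have "\<dots> = H (t + h) - H t"
      unfolding H_def using integral_diff_Icc[OF control_density_integrable[of j "t + h"], of t "t + h"] z h by simp
    finally have "norm (\<phi> t (t + h) z - z) / h \<le> (H (t + h) - H t) / h" using h by (intro divide_right_mono) auto
    moreover have "norm ((\<phi> t (t + h) z - z) / of_real h) = norm (\<phi> t (t + h) z - z) / h"
      using h by (simp add: norm_divide)
    ultimately show ?case unfolding h_def[symmetric] by simp
  qed
  show ?thesis
    by (rule tendsto_le[OF sequentially_bot lim tendsto_norm[OF generator_sequence[OF True z(1)]] ev])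
next
  case False
  then show ?thesis by (simp add: generator_def control_density_nonneg)
qed

text \<open>For \<open>t \<le> t'\<close> the composition law gives
  \<open>\<phi> t (t' + h) z = \<phi> t' (t' + h) (\<phi> t t' z)\<close>. So the change of the
  initial time is a change of the initial point, handled by the Lipschitz bound, and the change of
  the final time is handled by (EF3).\<close>

lemma ef_shift_continuous:
  assumes h: "0 < h"
  shows "continuous_on {t. (z, t) \<in> total_domain D} (\<lambda>t. \<phi> t (t + h) z)"
  unfolding continuous_on_iff
proof (intro ballI allI impI)
  fix t1 and e :: real assume "t1 \<in> {t. (z, t) \<in> total_domain D}" and e: "0 < e"
  then have t1: "0 \<le> t1" "z \<in> D t1" by (auto simp: mem_total_domain)
  \<comment> \<open>A starting time before \<open>t1\<close> at which \<open>z\<close> is already in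
    the domain, so that (EF3) on \<open>{S..T}\<close> covers both sides of \<open>t1\<close>; at
    \<open>t1 = 0\<close> there is no left side.\<close>
  obtain S \<delta>S where S: "0 \<le> S" "S \<le> t1" "z \<in> D S" "\<delta>S > 0" "\<And>t. 0 \<le> t \<Longrightarrow> \<bar>t - t1\<bar> < \<delta>S \<Longrightarrow> S \<le> t"
  proof (cases "t1 = 0")
    case True
    then show thesis using that[of 0 1] t1 by auto
  next
    case False
    have zt: "r t1 < norm z" "norm z < 1" using t1 by (auto simp: mem_D)
    then obtain \<delta> where \<delta>: "\<delta> > 0" "\<And>s. 0 \<le> s \<Longrightarrow> dist s t1 < \<delta> \<Longrightarrow> dist (r s) (r t1) < norm z - r t1"
      using r_cont t1(1) unfolding continuous_on_iff by (metis atLeast_iff diff_gt_0_iff_gt)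
    define S where "S = max 0 (t1 - \<delta> / 2)"
    have S: "0 \<le> S" "S < t1" using \<delta>(1) t1(1) False by (auto simp: S_def)
    have "dist (r S) (r t1) < norm z - r t1" using \<delta> t1 by (intro \<delta>(2)) (auto simp: S_def dist_real_def)
    then have "z \<in> D S" using S zt by (auto simp: mem_D dist_real_def)
    then show thesis using S by (intro that[of S "t1 - S"]) auto
  qed
  define T where "T = t1 + h + 1"
  have ST: "S \<le> T" using S h by (simp add: T_def)
  obtain k :: "real \<Rightarrow> real" where k: "\<And>x. x \<in> {S..T} \<Longrightarrow> 0 \<le> k x" "Ld d {S..T} k" "k absolutely_integrable_on {S..T}"
    "\<And>s u t. S \<le> s \<Longrightarrow> s \<le> u \<Longrightarrow> u \<le> t \<Longrightarrow> t \<le> T \<Longrightarrow> norm (\<phi> s u z - \<phi> s t z) \<le> integral {u..t} k"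
    by (rule ef_increment[OF S(1) ST S(3)]) (rule that)
  obtain \<delta>0 where \<delta>0: "\<delta>0 > 0" "cball z \<delta>0 \<subseteq> D S" using open_D[OF S(1)] S(3) open_contains_cball by blast
  define \<delta> where "\<delta> = \<delta>0 / 2"
  have \<delta>: "\<delta> > 0" "cball z (2 * \<delta>) \<subseteq> D S" using \<delta>0 by (auto simp: \<delta>_def)
  define \<epsilon> where "\<epsilon> = min (e / 2) (min \<delta> (\<delta> * e / 2))"
  have \<epsilon>: "\<epsilon> > 0" "\<epsilon> \<le> e / 2" "\<epsilon> \<le> \<delta>" "1 / \<delta> * \<epsilon> \<le> e / 2" using \<delta>(1) e by (auto simp: \<epsilon>_def min_def field_simps)
  obtain \<eta> where \<eta>: "\<eta> > 0" "\<And>u t. S \<le> u \<Longrightarrow> u \<le> t \<Longrightarrow> t \<le> T \<Longrightarrow> t - u < \<eta> \<Longrightarrow> integral {u..t} k < \<epsilon>"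
    by (rule integral_uniformly_small[OF set_lebesgue_integral_eq_integral(1)[OF k(3)] \<epsilon>(1)]) (rule that)
  have main: "dist (\<phi> t (t + h) z) (\<phi> t' (t' + h) z) < e" if H: "S \<le> t" "t \<le> t'" "t' + h \<le> T" "t' - t < \<eta>" for t t'
  proof -
    have t0: "0 \<le> t" "0 \<le> t'" using H S by auto
    have zt: "z \<in> D t" using D_mono[OF S(1) H(1)] S(3) by blast
    define y where "y = \<phi> t t' z"
    have "norm (\<phi> t t z - \<phi> t t' z) \<le> integral {t..t'} k" using H h by (intro k(4)) auto
    also have "\<dots> < \<epsilon>" using H h by (intro \<eta>(2)) auto
    finally have y: "norm (y - z) < \<epsilon>" using ef_id[OF t0(1) zt] by (simp add: y_def norm_minus_commute)
    have "norm (\<phi> t (t + h) z - \<phi> t (t' + h) z) \<le> integral {t + h..t' + h} k" using H h by (intro k(4)) auto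
    also have "\<dots> < \<epsilon>" using H h by (intro \<eta>(2)) auto
    finally have 1: "norm (\<phi> t (t + h) z - \<phi> t (t' + h) z) < e / 2" using \<epsilon>(2) by linarith
    have "norm (\<phi> t' (t' + h) y - \<phi> t' (t' + h) z) \<le> 1 / \<delta> * norm (y - z)"
      using H h y \<epsilon>(3) \<delta>(1) by (intro ef_Lipschitz[OF S(1) _ _ \<delta>]) (auto simp: dist_norm norm_minus_commute)
    also have "\<dots> < 1 / \<delta> * \<epsilon>" using y \<delta>(1) by (intro mult_strict_left_mono) auto
    finally have 2: "norm (\<phi> t' (t' + h) y - \<phi> t' (t' + h) z) < e / 2" using \<epsilon>(4) by linarith
    have 3: "\<phi> t (t' + h) z = \<phi> t' (t' + h) y" unfolding y_def using H h t0 zt by (intro ef_comp) auto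
    show ?thesis
      using norm_triangle_ineq[of "\<phi> t (t + h) z - \<phi> t (t' + h) z" "\<phi> t' (t' + h) y - \<phi> t' (t' + h) z"] 1 2
      by (simp add: dist_norm 3)
  qed
  have "dist (\<phi> t (t + h) z) (\<phi> t1 (t1 + h) z) < e" if "0 \<le> t" "dist t t1 < min (min \<delta>S \<eta>) 1" for t
  proof -
    have "S \<le> t" using that by (intro S(5)) (auto simp: dist_real_def)
    then show ?thesis
      using main[of t t1] main[of t1 t] that S(2) by (cases "t \<le> t1") (auto simp: dist_real_def dist_commute T_def)
  qed
  then show "\<exists>d>0. \<forall>x'\<in>{t. (z, t) \<in> total_domain D}. dist x' t1 < d \<longrightarrow>
      dist (\<phi> x' (x' + h) z) (\<phi> t1 (t1 + h) z) < e"
    using S(4) \<eta>(1) by (intro exI[of _ "min (min \<delta>S \<eta>) 1"]) (auto simp: mem_total_domain)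
qed

text \<open>A pointwise limit of continuous functions of time, multiplied by the indicator of the
  complement of the bad times; the time set is relatively open in the half-line.\<close>

lemma generator_measurable:
  "generator z \<in> borel_measurable (lebesgue_on {t. (z, t) \<in> total_domain D})"
proof -
  define E where "E = {t. (z, t) \<in> total_domain D}"
  define B where "B = {t. 0 \<le> t \<and> \<not> good_time t}"
  have E: "E \<in> sets lebesgue"
  proof (cases "norm z < 1")
    case True
    then have "E = {0..} \<inter> r -` {..<norm z}" by (auto simp: E_def mem_total_domain mem_D)
    moreover have "openin (top_of_set {0..}) ({0..} \<inter> r -` {..<norm z})"
      by (rule continuous_openin_preimage_gen[OF r_cont open_lessThan])
    ultimately obtain T where "open T" "E = {0..} \<inter> T" by (auto simp: openin_open)
    then show ?thesis by auto
  next
    case False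
    then have "E = {}" by (auto simp: E_def mem_total_domain mem_D)
    then show ?thesis by simp
  qed
  have B: "- B \<in> sets lebesgue"
    using negligible_bad_times unfolding B_def by (metis Compl_in_sets_lebesgue negligible_imp_sets)
  define f where "f n t = indicator (- B) t *\<^sub>R ((\<phi> t (t + 1 / real (Suc n)) z - z) / of_real (1 / real (Suc n)))" for n t
  have "generator z \<in> borel_measurable (lebesgue_on E)"
  proof (rule borel_measurable_LIMSEQ_metric)
    show "f n \<in> borel_measurable (lebesgue_on E)" for n
    proof -
      have "continuous_on E (\<lambda>t. (\<phi> t (t + 1 / real (Suc n)) z - z) / of_real (1 / real (Suc n)))"
        unfolding E_def
      proof (intro continuous_on_divide continuous_on_diff continuous_on_const ef_shift_continuous ballI)
        show "complex_of_real (1 / real (Suc n)) \<noteq> 0" unfolding of_real_eq_0_iff by simp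
      qed simp
      then have "(\<lambda>t. (\<phi> t (t + 1 / real (Suc n)) z - z) / of_real (1 / real (Suc n))) \<in> borel_measurable (lebesgue_on E)"
        by (rule continuous_imp_measurable_on_sets_lebesgue[OF _ E])
      moreover have "indicat_real (- B) \<in> borel_measurable (lebesgue_on E)"
        by (intro measurable_restrict_space1 borel_measurable_indicator B)
      ultimately show ?thesis unfolding f_def by (intro borel_measurable_scaleR)
    qed
    fix t assume "t \<in> space (lebesgue_on E)"
    then have t: "0 \<le> t" "z \<in> D t" by (auto simp: E_def mem_total_domain)
    show "(\<lambda>n. f n t) \<longlonglongrightarrow> generator z t"
    proof (cases "good_time t")
      case True
      then show ?thesis using generator_sequence[OF True t(2)] by (simp add: f_def B_def)
    next
      case False
      then show ?thesis using t by (simp add: f_def B_def generator_def)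
    qed
  qed
  then show ?thesis by (simp add: E_def)
qed

lemma generator_weak_hol_vector_field: "weak_hol_vector_field d D generator"
  unfolding weak_hol_vector_field_def
proof (intro conjI allI impI)
  show "generator z \<in> borel_measurable (lebesgue_on {t. (z, t) \<in> total_domain D})" for z
    by (rule generator_measurable)
  show "(\<lambda>z. generator z t) holomorphic_on D t" if "0 \<le> t" for t by (rule generator_holomorphic[OF that])
  fix K assume K: "compact K \<and> K \<subseteq> total_domain D"
  then obtain j where j: "K \<subseteq> exhaustion j" using subset_exhaustion by blast
  have c: "compact (snd ` K)" by (intro compact_continuous_image continuous_intros) (use K in auto)
  have "snd ` K \<subseteq> {0..real j}" using j by (auto simp: exhaustion_def)
  then have "Ld d (snd ` K) (control_density j)"
    by (intro Ld_subset[OF control_density_Ld[of "real j" j] _ _ _ d]) (use lmeasurable_compact[OF c] in auto)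
  then show "\<exists>k. (\<forall>t\<in>snd ` K. 0 \<le> k t) \<and> Ld d (snd ` K) k \<and> (\<forall>(z, t)\<in>K. norm (generator z t) \<le> k t)"
    using j generator_bound control_density_nonneg by (intro exI[of _ "control_density j"]) blast
qed

text \<open>The orbits of the family are themselves solutions on \<open>{s..}\<close>, absolutely
  continuous by (EF3) and differentiable at all good times.\<close>

lemma generator_semicomplete: "semicomplete D generator"
proof -
  interpret vector_field D r generator d
    by unfold_locales (rule d generator_weak_hol_vector_field)+
  show ?thesis
    unfolding semicomplete_def
  proof clarify
    fix z s t assume zs: "(z, s) \<in> total_domain D" and t: "s \<le> t"
    have s: "0 \<le> s" "z \<in> D s" using zs by (auto simp: mem_total_domain)
    have "is_solution D generator s z {s..} (\<lambda>t. \<phi> s t z)"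
      unfolding is_solution_def
    proof (intro conjI)
      show "loc_abs_cont_on {s..} (\<lambda>t. \<phi> s t z)"
        unfolding loc_abs_cont_on_def
      proof (intro allI impI)
        fix a b assume ab: "{a..b} \<subseteq> {s..}"
        define b' where "b' = max s b"
        have sb: "s \<le> b'" by (simp add: b'_def)
        obtain k :: "real \<Rightarrow> real" where k: "\<And>x. x \<in> {s..b'} \<Longrightarrow> 0 \<le> k x" "Ld d {s..b'} k" "k absolutely_integrable_on {s..b'}"
          "\<And>s' u t. s \<le> s' \<Longrightarrow> s' \<le> u \<Longrightarrow> u \<le> t \<Longrightarrow> t \<le> b' \<Longrightarrow> norm (\<phi> s' u z - \<phi> s' t z) \<le> integral {u..t} k"
          by (rule ef_increment[OF s(1) sb s(2)]) (rule that)
        have "abs_cont_on {s..b'} (\<lambda>t. \<phi> s t z)"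
        proof (rule abs_cont_on_dominated[OF k(3,1)])
          show "norm (\<phi> s v z - \<phi> s u z) \<le> integral {u..v} k" if "s \<le> u" "u \<le> v" "v \<le> b'" for u v
            using k(4)[of s u v] that by (simp add: norm_minus_commute)
        qed
        then show "abs_cont_on {a..b} (\<lambda>t. \<phi> s t z)"
        proof (rule abs_cont_on_subset)
          show "{a..b} \<subseteq> {s..b'}" using ab by (fastforce simp: b'_def)
        qed
      qed
      show "\<forall>t\<in>{s..}. (\<phi> s t z, t) \<in> total_domain D" using s ef_in by (auto simp: mem_total_domain)
      show "\<phi> s s z = z" using ef_id s .
      show "AE t in lebesgue. t \<in> {s..} \<longrightarrow> ((\<lambda>t. \<phi> s t z) has_vector_derivative generator (\<phi> s t z) t) (at t within {s..})"
        unfolding AE_negligible_iff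
      proof (intro exI[of _ "{t. 0 \<le> t \<and> \<not> good_time t}"] conjI ballI negligible_bad_times)
        fix t assume "t \<in> {s..} - {t. 0 \<le> t \<and> \<not> good_time t}"
        then have t: "s \<le> t" "good_time t" using s by auto
        show "((\<lambda>t. \<phi> s t z) has_vector_derivative generator (\<phi> s t z) t) (at t within {s..})"
          unfolding has_vector_derivative_iff_quotient
          by (rule has_hol_derivative_pointwise[OF ef_has_hol_derivative[OF t(2) s(1) t(1)] s(2)])
      qed
    qed (use s in \<open>auto simp: is_interval_ci\<close>)
    then have "{s..} \<subseteq> max_interval D generator s z" by (rule solution_subset_max_interval)
    then show "t \<in> max_interval D generator s z" using t by auto
  qed
qed

text \<open>The graph of the orbits of \<open>K\<close> over a compact time interval is compact, so
  one density dominates the increments at all its points, and hence their supremum norms.\<close>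

lemma ef_hol_loc_abs_cont:
  assumes s: "0 \<le> s"
  shows "hol_loc_abs_cont_on (D s) {s..} (\<phi> s)"
  unfolding hol_loc_abs_cont_on_def hol_abs_cont_on_def
proof (intro allI impI)
  fix a b \<epsilon> :: real and K assume ab: "{a..b} \<subseteq> {s..}" and \<epsilon>: "0 < \<epsilon>" and K: "compact K \<and> K \<subseteq> D s"
  define b' where "b' = max s b"
  have sub: "{a..b} \<subseteq> {s..b'}" using ab by (fastforce simp: b'_def)
  obtain k \<eta> where k: "controls ((\<lambda>p. (\<phi> s (snd p) (fst p), snd p)) ` (K \<times> {s..b'})) k \<eta>"
    using compact_control[OF ef_graph_compact[OF s, of K b']] K by blast
  have \<eta>: "\<eta> > 0" "\<And>t. 0 \<le> k t" and Ld: "Ld d {0..b'} k" using k by (auto simp: controls_def)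
  have ki: "k absolutely_integrable_on {0..b'}" by (rule Ld_imp_absolutely_integrable[OF Ld _ d]) simp
  have ki: "k absolutely_integrable_on {s..b'}" by (rule set_integrable_subset[OF ki]) (use s in auto)
  obtain \<delta> where \<delta>: "\<delta> > 0" "\<And>P. disjoint_intervals {s..b'} P \<Longrightarrow> (\<Sum>(a, b)\<in>P. b - a) < \<delta> \<Longrightarrow>
      (\<Sum>(a, b)\<in>P. integral {a..b} k) < \<epsilon>"
    using disjoint_intervals_integral_small[OF ki \<eta>(2) \<epsilon>] by blast
  have inc: "sup_norm K (\<lambda>z. \<phi> s v z - \<phi> s u z) \<le> integral {u..v} k"
    if uv: "s \<le> u" "u \<le> v" "v \<le> b'" "v - u < \<eta>" for u v
  proof (rule sup_norm_bounds(2))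
    have "k integrable_on {u..v}"
      using set_lebesgue_integral_eq_integral(1)[OF ki] by (rule integrable_on_subinterval) (use uv in auto)
    then show "0 \<le> integral {u..v} k" using \<eta>(2) by (intro integral_nonneg) auto
    fix z assume z: "z \<in> K"
    then have zs: "z \<in> D s" using K by blast
    have "(\<lambda>p. (\<phi> s (snd p) (fst p), snd p)) (z, u) \<in> (\<lambda>p. (\<phi> s (snd p) (fst p), snd p)) ` (K \<times> {s..b'})"
      using z uv by (intro imageI) auto
    then have w: "(\<phi> s u z, u) \<in> (\<lambda>p. (\<phi> s (snd p) (fst p), snd p)) ` (K \<times> {s..b'})" by simp
    moreover have "(\<phi> s u z, u) \<in> total_domain D" using s uv zs ef_in by (auto simp: mem_total_domain)
    ultimately have "norm (\<phi> u v (\<phi> s u z) - \<phi> s u z) \<le> integral {u..v} k"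
      using k uv unfolding controls_def by auto
    then show "norm (\<phi> s v z - \<phi> s u z) \<le> integral {u..v} k" using ef_comp[OF s uv(1,2) zs] by simp
  qed
  have "(\<Sum>(a, b)\<in>P. sup_norm K (\<lambda>z. \<phi> s b z - \<phi> s a z)) < \<epsilon>"
    if P: "disjoint_intervals {a..b} P" "(\<Sum>(a, b)\<in>P. b - a) < min \<delta> \<eta>" for P
  proof -
    have P': "disjoint_intervals {s..b'} P" by (rule disjoint_intervals_mono[OF P(1) sub])
    have "(\<Sum>(a, b)\<in>P. sup_norm K (\<lambda>z. \<phi> s b z - \<phi> s a z)) \<le> (\<Sum>(a, b)\<in>P. integral {a..b} k)"
    proof (rule sum_mono, clarify)
      fix u v assume uv: "(u, v) \<in> P"
      have pos: "0 \<le> (\<lambda>(a, b). b - a) p" if "p \<in> P" for p using P' that by (auto simp: disjoint_intervals_def)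
      \<comment> \<open>No single interval is longer than the total length, so each is shorter than
        \<open>\<eta>\<close> and the control applies.\<close>
      have "(\<lambda>(a, b). b - a) (u, v) \<le> (\<Sum>(a, b)\<in>P. b - a)"
        using P' by (intro member_le_sum[OF uv pos]) (auto simp: disjoint_intervals_def)
      then have "v - u < \<eta>" using P(2) by simp
      moreover have "s \<le> u" "u \<le> v" "v \<le> b'" using P' uv by (auto simp: disjoint_intervals_def)
      ultimately show "sup_norm K (\<lambda>z. \<phi> s v z - \<phi> s u z) \<le> integral {u..v} k" by (intro inc)
    qed
    also have "\<dots> < \<epsilon>" using P(2) by (intro \<delta>(2)[OF P']) simp
    finally show ?thesis .
  qed
  then show "\<exists>\<delta>>0. \<forall>P. disjoint_intervals {a..b} P \<and> (\<Sum>(a, b)\<in>P. b - a) < \<delta> \<longrightarrow>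
      (\<Sum>(a, b)\<in>P. sup_norm K (\<lambda>z. \<phi> s b z - \<phi> s a z)) < \<epsilon>"
    using \<delta>(1) \<eta>(1) by (intro exI[of _ "min \<delta> \<eta>"]) auto
qed

lemma generator_corresponding:
  "corresponding_vector_field d D \<phi> generator {t. 0 \<le> t \<and> \<not> good_time t}"
  unfolding corresponding_vector_field_def
proof (intro conjI allI impI ballI)
  show "weak_hol_vector_field d D generator" by (rule generator_weak_hol_vector_field)
  show "semicomplete D generator" by (rule generator_semicomplete)
  show "{t. 0 \<le> t \<and> \<not> good_time t} \<in> null_sets lebesgue"
    using negligible_bad_times by (simp add: negligible_iff_null_sets)
  show "hol_loc_abs_cont_on (D s) {s..} (\<phi> s)" if "0 \<le> s" for s by (rule ef_hol_loc_abs_cont[OF that])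
  fix s t assume s: "0 \<le> s" and "t \<in> {s..} - {t. 0 \<le> t \<and> \<not> good_time t}"
  then have t: "s \<le> t" "good_time t" by auto
  show "has_hol_derivative (D s) {s..} (\<phi> s) (\<lambda>z. generator (\<phi> s t z) t) t"
    by (rule ef_has_hol_derivative[OF t(2) s t(1)])
  then show "hol_differentiable (D s) {s..} (\<phi> s) t" unfolding hol_differentiable_def by blast
qed auto

end

section \<open>Uniqueness of the vector field, and the radii of a canonical domain system\<close>

lemma corresponding_vector_field_unique:
  assumes ef: "evolution_family d D \<phi>"
    and 1: "corresponding_vector_field d D \<phi> G1 N1" and 2: "corresponding_vector_field d D \<phi> G2 N2"
  shows "AE t in lebesgue. 0 \<le> t \<longrightarrow> (\<forall>z\<in>D t. G1 z t = G2 z t)"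
proof -
  have "N1 \<union> N2 \<in> null_sets lebesgue" using 1 2 by (auto simp: corresponding_vector_field_def)
  moreover have "G1 z t = G2 z t" if t: "0 \<le> t" "t \<notin> N1 \<union> N2" and z: "z \<in> D t" for t z
  proof -
    \<comment> \<open>The differential equation is evaluated at \<open>s = t\<close>, where both
      fields appear as the same right derivative at \<open>z\<close> itself.\<close>
    have id: "\<phi> t t z = z" using ef t z by (simp add: evolution_family_def)
    have "((\<lambda>\<tau>. (\<phi> t \<tau> z - \<phi> t t z) / of_real (\<tau> - t)) \<longlongrightarrow> G1 (\<phi> t t z) t) (at t within {t..})"
      using 1 t by (intro has_hol_derivative_pointwise[OF _ z]) (auto simp: corresponding_vector_field_def)
    moreover have "((\<lambda>\<tau>. (\<phi> t \<tau> z - \<phi> t t z) / of_real (\<tau> - t)) \<longlongrightarrow> G2 (\<phi> t t z) t) (at t within {t..})"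
      using 2 t by (intro has_hol_derivative_pointwise[OF _ z]) (auto simp: corresponding_vector_field_def)
    moreover have "at t within {t..} \<noteq> bot" by (simp add: at_within_Ici_at_right)
    ultimately show ?thesis using tendsto_unique id by metis
  qed
  ultimately show ?thesis by (intro AE_I'[of "N1 \<union> N2"]) auto
qed

text \<open>The function \<open>R\<close> inverts \<open>\<omega>\<close> and is continuous and
  monotone on the whole line, so \<open>r\<close> inherits both properties from
  \<open>\<omega> (r t)\<close>. The density is the modulus of the derivative of
  \<open>\<omega> (r t)\<close>, by the fundamental theorem.\<close>

lemma canonical_domain_system_radius:
  assumes d: "1 \<le> d" and D: "canonical_domain_system d D"
  obtains r k\<omega> where "annular_domains D r" "\<And>t. 0 \<le> k\<omega> t" "\<And>T. Ld d {0..T} k\<omega>"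
    "\<And>u t. 0 \<le> u \<Longrightarrow> u \<le> t \<Longrightarrow> \<omega> (r u) - \<omega> (r t) \<le> integral {u..t} k\<omega>"
proof -
  obtain r where r: "\<And>t. 0 \<le> t \<Longrightarrow> 0 \<le> r t \<and> r t < 1 \<and> D t = annulus (r t)"
    and ac: "ACd d {0..} (\<lambda>t. \<omega> (r t))" and mono: "antimono_on {0..} (\<lambda>t. \<omega> (r t))"
    using D by (auto simp: canonical_domain_system_def)
  define w where "w t = \<omega> (r t)" for t
  define R :: "real \<Rightarrow> real" where "R x = (if x \<le> 0 then 0 else exp (- pi / x))" for x
  have rR: "r t = R (w t)" if t: "0 \<le> t" for t
  proof (cases "r t = 0")
    case False
    then have l: "ln (r t) < 0" using r[OF t] by simp
    have "w t = - pi / ln (r t)" using False by (simp add: w_def \<omega>_def)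
    moreover have "w t > 0"
      unfolding calculation using divide_pos_neg[OF pi_gt_zero l] by simp
    ultimately show ?thesis using False r[OF t] l by (simp add: R_def exp_ln)
  qed (simp add: w_def \<omega>_def R_def)
  have Rm: "R x \<le> R y" if "x \<le> y" for x y
    using that pi_gt_zero by (auto simp: R_def divide_left_mono)
  \<comment> \<open>Gives continuity of \<open>R\<close> at zero, the value that corresponds to a
    punctured disc; it rests on \<open>pi / x \<le> exp (pi / x)\<close>.\<close>
  have R0: "\<bar>R x\<bar> \<le> \<bar>x\<bar>" for x
  proof (cases "x \<le> 0")
    case False
    have "pi / x \<le> exp (pi / x)" using exp_ge_add_one_self[of "pi / x"] by linarith
    then have "1 / exp (pi / x) \<le> 1 / (pi / x)" using False by (intro divide_left_mono) auto
    also have "\<dots> \<le> x" using False pi_gt3 by (simp add: field_simps)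
    finally show ?thesis using False by (simp add: R_def exp_minus inverse_eq_divide)
  qed (simp add: R_def)
  have Rc: "isCont R x" for x
  proof (cases x "0 :: real" rule: linorder_cases)
    case less
    have "isCont R x \<longleftrightarrow> isCont (\<lambda>_. 0 :: real) x"
      by (rule isCont_cong) (use less in \<open>auto simp: R_def eventually_nhds intro!: exI[of _ "{..<0}"]\<close>)
    then show ?thesis by simp
  next
    case equal
    have "(R \<longlongrightarrow> 0) (at 0)"
    proof (rule Lim_null_comparison)
      show "\<forall>\<^sub>F x in at 0. norm (R x) \<le> \<bar>x\<bar>" using R0 by simp
      show "((\<lambda>x::real. \<bar>x\<bar>) \<longlongrightarrow> 0) (at 0)" by (intro tendsto_eq_intros) auto
    qed
    then show ?thesis using equal by (simp add: isCont_def R_def)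
  next
    case greater
    have "isCont R x \<longleftrightarrow> isCont (\<lambda>x. exp (- pi / x)) x"
      by (rule isCont_cong) (use greater in \<open>auto simp: R_def eventually_nhds intro!: exI[of _ "{0<..}"]\<close>)
    then show ?thesis using greater by (simp add: continuous_intros)
  qed
  have wm: "w t \<le> w s" if "0 \<le> s" "s \<le> t" for s t
    using mono that by (auto simp: monotone_on_def w_def)
  have acw: "abs_cont_on {u..t} w" if "0 \<le> u" for u t
  proof -
    have "{u..t} \<subseteq> {0..}" using that by auto
    then show ?thesis using ac unfolding ACd_def loc_abs_cont_on_def w_def[abs_def] by blast
  qed
  have wc: "continuous_on {0..} w"
    unfolding continuous_on_eq_continuous_within
  proof
    fix x :: real assume x: "x \<in> {0..}"
    have "continuous_on {0..x + 1} w" by (rule abs_cont_on_continuous[OF acw]) simp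
    then have "continuous (at x within {0..x + 1}) w" using x by (simp add: continuous_on_eq_continuous_within)
    moreover have "at x within {0..x + 1} = at x within {0..}"
    proof (rule at_within_nhd[of x "{x - 1<..<x + 1}"])
      show "{0..x + 1} \<inter> {x - 1<..<x + 1} - {x} = {0..} \<inter> {x - 1<..<x + 1} - {x}" by auto
    qed auto
    ultimately show "continuous (at x within {0..}) w" by (simp add: continuous_within)
  qed
  have "annular_domains D r"
  proof
    show "0 \<le> r t" "r t < 1" "D t = annulus (r t)" if "0 \<le> t" for t using r[OF that] by auto
    show "r t \<le> r s" if "0 \<le> s" "s \<le> t" for s t using rR[of s] rR[of t] Rm[OF wm[OF that]] that by simp
    have "continuous_on {0..} (\<lambda>t. R (w t))"
      by (rule continuous_on_compose2[OF continuous_at_imp_continuous_on[of UNIV R] wc]) (use Rc in auto)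
    then show "continuous_on {0..} r"
      using continuous_on_cong[of "{0..}" "{0..}" r "\<lambda>t. R (w t)"] rR by auto
  qed
  moreover obtain g where g: "AE t in lebesgue. t \<in> {0..} \<longrightarrow> (w has_vector_derivative g t) (at t within {0..})"
    "Ld_loc d {0..} g"
    using ac unfolding ACd_def w_def[abs_def] by blast
  obtain N where N: "negligible N" "\<And>t. t \<in> {0..} - N \<Longrightarrow> (w has_vector_derivative g t) (at t within {0..})"
    using g(1) unfolding AE_negligible_iff by blast
  have Lg: "Ld d {0..T} g" for T using g(2) by (simp add: Ld_loc_def)
  have "Ld d {0..T} (\<lambda>t. \<bar>g t\<bar>)" for T by (rule Ld_abs[OF Lg d])
  moreover have "\<omega> (r u) - \<omega> (r t) \<le> integral {u..t} (\<lambda>t. \<bar>g t\<bar>)" if ut: "0 \<le> u" "u \<le> t" for u t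
  proof -
    have sub: "{u..t} \<subseteq> {0..}" using ut by auto
    have hi: "(g has_integral (w t - w u)) {u..t}"
      by (rule abs_cont_fundamental[OF ut(2) acw[OF ut(1)] N(1)])
        (use sub in \<open>auto intro: has_vector_derivative_within_subset[OF N(2)]\<close>)
    have "(\<lambda>t. \<bar>g t\<bar>) absolutely_integrable_on {0..t}"
      by (rule Ld_imp_absolutely_integrable[OF Ld_abs[OF Lg d] _ d]) simp
    then have "(\<lambda>t. \<bar>g t\<bar>) integrable_on {u..t}"
      using ut by (auto intro: integrable_on_subinterval dest: set_lebesgue_integral_eq_integral(1))
    then have "norm (integral {u..t} g) \<le> integral {u..t} (\<lambda>t. \<bar>g t\<bar>)"
      by (intro integral_norm_bound_integral has_integral_integrable[OF hi]) auto
    then show ?thesis using integral_unique[OF hi] by (simp add: w_def)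
  qed
  ultimately show thesis by (intro that[of r "\<lambda>t. \<bar>g t\<bar>"]) auto
qed

theorem theorem5p1:
  fixes d :: ennreal and D :: "real \<Rightarrow> complex set"
  assumes "1 \<le> d" and "canonical_domain_system d D"
  shows "(\<forall>\<phi>. evolution_family d D \<phi> \<longrightarrow>
            (\<exists>G N. corresponding_vector_field d D \<phi> G N) \<and>
            (\<forall>G1 N1 G2 N2. corresponding_vector_field d D \<phi> G1 N1 \<and>
                 corresponding_vector_field d D \<phi> G2 N2 \<longrightarrow>
               (AE t in lebesgue. 0 \<le> t \<longrightarrow> (\<forall>z\<in>D t. G1 z t = G2 z t)))) \<and>
         (\<forall>G. weak_hol_vector_field d D G \<and> semicomplete D G \<longrightarrow>
            evolution_family d D (\<lambda>s t z. max_solution D G s z t))"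
proof -
  obtain r k\<omega> where r: "annular_domains D r" and k\<omega>: "\<And>t. 0 \<le> k\<omega> t" "\<And>T. Ld d {0..T} k\<omega>"
    "\<And>u t. 0 \<le> u \<Longrightarrow> u \<le> t \<Longrightarrow> \<omega> (r u) - \<omega> (r t) \<le> integral {u..t} k\<omega>"
    using canonical_domain_system_radius[OF assms] by metis
  interpret annular_domains D r by (rule r)
  show ?thesis
  proof (intro conjI allI impI)
    fix \<phi> assume ef: "evolution_family d D \<phi>"
    interpret evolution D r d \<phi> k\<omega> by unfold_locales (use assms ef k\<omega> in auto)
    show "\<exists>G N. corresponding_vector_field d D \<phi> G N" using generator_corresponding by blast
    fix G1 N1 G2 N2
    assume "corresponding_vector_field d D \<phi> G1 N1 \<and> corresponding_vector_field d D \<phi> G2 N2"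
    then show "AE t in lebesgue. 0 \<le> t \<longrightarrow> (\<forall>z\<in>D t. G1 z t = G2 z t)"
      using corresponding_vector_field_unique[OF ef] by blast
  next
    fix G assume H: "weak_hol_vector_field d D G \<and> semicomplete D G"
    interpret vector_field D r G d by unfold_locales (use assms H in auto)
    show "evolution_family d D (\<lambda>s t z. max_solution D G s z t)"
      by (rule semicomplete_evolution_family) (use H in blast)
  qed
qed

end
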